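(* Let $\alpha>\beta>0$ be constants with $\sqrt{\alpha}-\sqrt{\beta}>\sqrt{2}$. Let $A$ be the adjacency matrix of a random graph generated according to the binary symmetric stochastic block model with parameters $(n,p,q)$ and label $x^*$, where $p=\alpha\log n/n$ and $q=\beta\log n/n$. Then there is a number $N=\mathcal{O}(\log n/\log\log n)$ (depending only on $n,\alpha,\beta$) such that the following implementation of the vanilla spectral method exactly recovers the underlying communities with probability tending to one as $n\to\infty$: perform $N$ orthogonal iterations on $A$ to obtain the vector $\underline{q}^{(N)}$ defined in the context (an approximation of the eigenvector of $A$ associated with its second largest eigenvalue), and then apply a single projection onto $\mathcal{F}$; that is, $\mathcal{P}(\underline{q}^{(N)})$ is a singleton equal to $\{x^*\}$ or $\{-x^*\}$. Moreover, with probability tending to one this implementation runs in $\mathcal{O}(n\log^2 n/\log\log n)$ time.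
   Context: **Model.** $n\ge 2$ is an even integer, $\log$ is the natural logarithm, $p,q\in[0,1]$, $p>q$, and $x^*\in\{-1,+1\}^n$ is a label vector with $\mathbf{1}^Tx^*=0$, where $\mathbf{1}$ is the all-one vector. A random graph on vertex set $[n]=\{1,\dots,n\}$ is generated according to the binary symmetric stochastic block model with parameters $(n,p,q)$ and label $x^*$ if the entries $\{a_{ij}\}_{1\le i\le j\le n}$ of its (symmetric) adjacency matrix $A$ are independent with $a_{ij}\sim\mathrm{Bern}(p)$ if $x_i^*x_j^*=1$ and $a_{ij}\sim\mathrm{Bern}(q)$ if $x_i^*x_j^*=-1$ (self-loops allowed). **Projection.** $\mathcal{F}=\{x\in\mathbb{R}^n:\mathbf{1}^Tx=0,\ x_i\in\{\pm1\}\ \forall i\in[n]\}$, and for $c\in\mathbb{R}^n$, $\mathcal{P}(c)$ denotes the set of minimizers of $\|u-c\|_2^2$ over $u\in\mathcal{F}$. **Orthogonal iterations.** Let $Y\in\mathbb{R}^{n\times2}$ have i.i.d. standard normal entries, independent of $A$, and $Q^{(0)}=Y(Y^TY)^{-1/2}$. For $k\ge1$, let $AQ^{(k-1)}=Q^{(k)}R^{(k)}$ be a QR decomposition, where $Q^{(k)}\in\mathbb{R}^{n\times2}$ has orthonormal columns and $R^{(k)}\in\mathbb{R}^{2\times2}$ is upper triangular (one such step is one orthogonal iteration). Let $\underline{h}^{(k)}$ be a unit eigenvector of $Q^{(k)T}AQ^{(k)}$ associated with its smaller eigenvalue, and $\underline{q}^{(k)}:=Q^{(k)}\underline{h}^{(k)}$.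 **Conventions.** Probabilities are over $A$ and $Y$. Time counts elementary real arithmetic operations and comparisons; $A$ is stored sparsely, so that a product $Av$ costs time proportional to the number of non-zero entries of $A$ (plus $\mathcal{O}(n)$); a QR decomposition of an $n\times2$ matrix costs $\mathcal{O}(n)$, an eigendecomposition of a $2\times2$ symmetric matrix costs $\mathcal{O}(1)$, and the $(n/2)$-th largest entry of a vector in $\mathbb{R}^n$ can be found in $\mathcal{O}(n)$ time. Implied constants may depend on $\alpha,\beta$ only. *)

theory Defs
  imports
    "HOL-Probability.Probability"
    "HOL-Library.Landau_Symbols"
    "Jordan_Normal_Form.Char_Poly"
begin

(* The dimension n varies in the statement, so vectors and matrices are those of
   Jordan_Normal_Form (indices 0..n-1); the clashing syntax of HOL-Analysis is switched off. *)
unbundle no inner_syntax and no vec_syntax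
hide_const (open) Finite_Cartesian_Product.mat Finite_Cartesian_Product.vec

definition feasible :: "nat \<Rightarrow> real vec set" where
  "feasible n = {x \<in> carrier_vec n. vec n (\<lambda>_. 1) \<bullet> x = 0 \<and> (\<forall>i<n. x $ i \<in> {1, -1})}"

definition proj :: "nat \<Rightarrow> real vec \<Rightarrow> real vec set" where
  "proj n c = {u. is_arg_min (\<lambda>u. (u - c) \<bullet> (u - c)) (\<lambda>u. u \<in> feasible n) u}"

(* Law of the entries a_ij with i \<le> j.  bernoulli_pmf truncates its parameter to [0, 1], which
   is without effect for the parameters p, q in [0, 1] of the model. *)
definition sbm_pmf :: "nat \<Rightarrow> real \<Rightarrow> real \<Rightarrow> real vec \<Rightarrow> (nat \<times> nat \<Rightarrow> bool) pmf" where
  "sbm_pmf n p q x = Pi_pmf {(i, j). i \<le> j \<and> j < n} False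
     (\<lambda>(i, j). bernoulli_pmf (if x $ i * x $ j = 1 then p else q))"

definition adjacency :: "nat \<Rightarrow> (nat \<times> nat \<Rightarrow> bool) \<Rightarrow> real mat" where
  "adjacency n a = mat n n (\<lambda>(i, j). of_bool (a (min i j, max i j)))"

definition gaussian_entries :: "nat \<Rightarrow> (nat \<times> nat \<Rightarrow> real) measure" where
  "gaussian_entries n = Pi\<^sub>M ({..<n} \<times> {..<2}) (\<lambda>_. density lborel std_normal_density)"

definition gaussian_mat :: "nat \<Rightarrow> (nat \<times> nat \<Rightarrow> real) \<Rightarrow> real mat" where
  "gaussian_mat n y = mat n 2 y"

definition joint_law ::
  "nat \<Rightarrow> real \<Rightarrow> real \<Rightarrow> real vec \<Rightarrow> ((nat \<times> nat \<Rightarrow> bool) \<times> (nat \<times> nat \<Rightarrow> real)) measure" where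
  "joint_law n p q x = measure_pmf (sbm_pmf n p q x) \<Otimes>\<^sub>M gaussian_entries n"

(* "With probability tending to one as n tends to infinity through the even numbers".
   The property may quantify over all admissible runs of an algorithm, so it is not required
   to be measurable itself: it has to contain measurable events of probability tending to one. *)
definition whp_even :: "(nat \<Rightarrow> 'a measure) \<Rightarrow> (nat \<Rightarrow> 'a \<Rightarrow> bool) \<Rightarrow> bool" where
  "whp_even M P \<longleftrightarrow> (\<exists>E. (\<forall>n. even n \<longrightarrow> E n \<in> sets (M n) \<and> (\<forall>\<omega>\<in>E n. P n \<omega>)) \<and>
     ((\<lambda>n. measure (M n) (E n)) \<longlongrightarrow> 1) (inf sequentially (principal {n. even n})))"

definition is_qr :: "real mat \<Rightarrow> real mat \<Rightarrow> real mat \<Rightarrow> bool" where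
  "is_qr W Q R \<longleftrightarrow> Q \<in> carrier_mat (dim_row W) (dim_col W) \<and>
     R \<in> carrier_mat (dim_col W) (dim_col W) \<and>
     Q\<^sup>T * Q = 1\<^sub>m (dim_col W) \<and> upper_triangular R \<and> W = Q * R"

(* G^(-1/2): the symmetric positive definite S with S^2 = G^(-1).  It exists uniquely when G is
   symmetric positive definite, which holds almost surely for the Gram matrix it is applied to. *)
definition inv_sqrt :: "real mat \<Rightarrow> real mat" where
  "inv_sqrt G = (THE S. S \<in> carrier_mat (dim_row G) (dim_row G) \<and> S\<^sup>T = S \<and>
     (\<forall>v \<in> carrier_vec (dim_row G). v \<noteq> 0\<^sub>v (dim_row G) \<longrightarrow> v \<bullet> (S *\<^sub>v v) > 0) \<and>
     inverts_mat (S * S) G)"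

(* Q 0, ..., Q N; at every step any QR decomposition is admissible. *)
definition orthogonal_iterates :: "real mat \<Rightarrow> real mat \<Rightarrow> nat \<Rightarrow> (nat \<Rightarrow> real mat) \<Rightarrow> bool" where
  "orthogonal_iterates A Y N Q \<longleftrightarrow> Q 0 = Y * inv_sqrt (Y\<^sup>T * Y) \<and>
     (\<forall>k\<in>{1..N}. \<exists>R. is_qr (A * Q (k - 1)) (Q k) R)"

definition unit_min_eigenvector :: "real mat \<Rightarrow> real vec \<Rightarrow> bool" where
  "unit_min_eigenvector B h \<longleftrightarrow> eigenvector B h (Min {l. eigenvalue B l}) \<and> h \<bullet> h = 1"

(* q is a possible value of the vector obtained after N orthogonal iterations. *)
definition spectral_vector :: "real mat \<Rightarrow> real mat \<Rightarrow> nat \<Rightarrow> real vec \<Rightarrow> bool" where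
  "spectral_vector A Y N q \<longleftrightarrow> (\<exists>Q h. orthogonal_iterates A Y N Q \<and>
     unit_min_eigenvector ((Q N)\<^sup>T * A * Q N) h \<and> q = Q N *\<^sub>v h)"

(* A timed nondeterministic computation is the set of its possible (result, time) pairs.
   The operator charge k x yields x after k elementary operations.  The operator
   subroutine k P stands for a subroutine that returns some result satisfying P in time at most k. *)
type_synonym 'a timed = "('a \<times> nat) set"

definition charge :: "nat \<Rightarrow> 'a \<Rightarrow> 'a timed" where
  "charge k x = {(x, k)}"

definition subroutine :: "nat \<Rightarrow> ('a \<Rightarrow> bool) \<Rightarrow> 'a timed" where
  "subroutine k P = {(x, t). P x \<and> t \<le> k}"

definition andthen :: "'a timed \<Rightarrow> ('a \<Rightarrow> 'b timed) \<Rightarrow> 'b timed"  (infixl "\<rhd>" 54) where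
  "m \<rhd> f = {(y, s + t) |x s y t. (x, s) \<in> m \<and> (y, t) \<in> f x}"

definition nnz :: "real mat \<Rightarrow> nat" where
  "nnz A = card {(i, j). i < dim_row A \<and> j < dim_col A \<and> A $$ (i, j) \<noteq> 0}"

(* In what follows \<kappa> is the constant hidden in the costs of the subroutines: sparse product A v,
   QR decomposition of an n x 2 matrix, eigendecomposition of a symmetric 2 x 2 matrix,
   selection of the (n/2)-th largest entry. *)

(* Two sparse matrix-vector products, one per column. *)
definition sparse_mult :: "nat \<Rightarrow> nat \<Rightarrow> real mat \<Rightarrow> real mat \<Rightarrow> real mat timed" where
  "sparse_mult \<kappa> n A Q = subroutine (2 * (\<kappa> * (nnz A + n))) (\<lambda>W. W = A * Q)"

(* 8n: four inner products of length n.  6n: 2n entries with two products and a sum each.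
   The 2 x 2 inverse square root is read off an eigendecomposition. *)
definition initial_impl :: "nat \<Rightarrow> nat \<Rightarrow> real mat \<Rightarrow> real mat timed" where
  "initial_impl \<kappa> n Y =
     charge (8 * n) (Y\<^sup>T * Y) \<rhd> (\<lambda>G.
     subroutine \<kappa> (\<lambda>S. S = inv_sqrt G) \<rhd> (\<lambda>S.
     charge (6 * n) (Y * S)))"

definition iteration_impl :: "nat \<Rightarrow> nat \<Rightarrow> real mat \<Rightarrow> real mat \<Rightarrow> real mat timed" where
  "iteration_impl \<kappa> n A Q =
     sparse_mult \<kappa> n A Q \<rhd> (\<lambda>W.
     subroutine (\<kappa> * n) (\<lambda>(Q', R). is_qr W Q' R) \<rhd> (\<lambda>(Q', R).
     charge 0 Q'))"

primrec iterations_impl :: "nat \<Rightarrow> nat \<Rightarrow> real mat \<Rightarrow> nat \<Rightarrow> real mat \<Rightarrow> real mat timed" where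
  "iterations_impl \<kappa> n A 0 Q = charge 0 Q"
| "iterations_impl \<kappa> n A (Suc k) Q = iterations_impl \<kappa> n A k Q \<rhd> iteration_impl \<kappa> n A"

definition extraction_impl :: "nat \<Rightarrow> nat \<Rightarrow> real mat \<Rightarrow> real mat \<Rightarrow> real vec timed" where
  "extraction_impl \<kappa> n A Q =
     sparse_mult \<kappa> n A Q \<rhd> (\<lambda>W.
     charge (8 * n) (Q\<^sup>T * W) \<rhd> (\<lambda>B.
     subroutine \<kappa> (unit_min_eigenvector B) \<rhd> (\<lambda>h.
     charge (3 * n) (Q *\<^sub>v h))))"

definition kth_largest :: "nat \<Rightarrow> real vec \<Rightarrow> real" where
  "kth_largest k v = rev (sort (list_of_vec v)) ! (k - 1)"

(* Thresholding at the (n/2)-th largest entry; entries equal to the threshold are assigned +1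
   in index order until n/2 entries are positive.  Charges: n comparisons and n increments for
   the first pass; three comparisons and one increment per entry, and one subtraction,
   for the second. *)
definition projection_impl :: "nat \<Rightarrow> nat \<Rightarrow> real vec \<Rightarrow> real vec timed" where
  "projection_impl \<kappa> n v =
     subroutine (\<kappa> * n) (\<lambda>\<tau>. \<tau> = kth_largest (n div 2) v) \<rhd> (\<lambda>\<tau>.
     charge (2 * n) (card {i. i < n \<and> v $ i > \<tau>}) \<rhd> (\<lambda>m.
     charge (4 * n + 1) (vec n (\<lambda>i.
       if v $ i > \<tau> \<or> v $ i = \<tau> \<and> card {j. j < i \<and> v $ j = \<tau>} < n div 2 - m then 1 else -1))))"

definition spectral_impl :: "nat \<Rightarrow> nat \<Rightarrow> real mat \<Rightarrow> real mat \<Rightarrow> nat \<Rightarrow> real vec timed" where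
  "spectral_impl \<kappa> n A Y N =
     initial_impl \<kappa> n Y \<rhd> iterations_impl \<kappa> n A N \<rhd> extraction_impl \<kappa> n A \<rhd> projection_impl \<kappa> n"

end

theory Submission
  imports Defs "HOL-Real_Asymp.Real_Asymp"
begin

text \<open>
Write \<open>A = W + (a/n) 1 1\<^sup>T + (b/n) x x\<^sup>T\<close> with \<open>W\<close> centred, \<open>a = n (p + q) / 2\<close> and
\<open>b = n (p - q) / 2\<close>, both of order \<open>L = log n\<close>. A discrepancy argument in the style of Bilu and Linial
bounds the norm of \<open>W\<close> by \<open>w\<close> of order \<open>L\<close> to the power \<open>9/10\<close>, so \<open>A\<close> has two eigenvalues
\<open>l\<^sub>1 > l\<^sub>2\<close> of order \<open>L\<close>, and on the complement of their eigenvectors its norm is at most \<open>w\<close>.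
Expanding \<open>l\<^sub>2 u\<^sub>2 = A u\<^sub>2\<close> in powers of \<open>W / l\<^sub>2\<close>, the main term of \<open>x\<^sub>i (u\<^sub>2)\<^sub>i\<close> is
proportional to \<open>x\<^sub>i (A x)\<^sub>i\<close>, which above the threshold is at least a constant times \<open>L\<close> for all \<open>i\<close>; the
higher powers of \<open>W\<close> are controlled entrywise by leave-one-out. Hence \<open>\<bar>(u\<^sub>2)\<^sub>i\<bar>\<close> is at least a
constant over \<open>sqrt n\<close>, with the signs of \<open>x\<close> or of \<open>-x\<close>.

The overlap determinant of the Gaussian start with \<open>u\<^sub>1, u\<^sub>2\<close> is polynomially small at worst, and each
iteration contracts the component orthogonal to \<open>u\<^sub>1, u\<^sub>2\<close> by a negative power of \<open>L\<close> relative to the rest. So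
a constant multiple of \<open>L / log L\<close> iterations makes it smaller than any fixed power of \<open>n\<close>, the lower
Ritz vector agrees with \<open>u\<^sub>2\<close> up to sign and an error below \<open>min \<bar>(u\<^sub>2)\<^sub>i\<bar>\<close>, and rounding is exact.
\<close>

section \<open>Linear algebra in coordinates\<close>

text \<open>N iterations shrink the unwanted component by (w / l2)^N, and N may be of order ln n /
  ln ln n. So it is enough that w / l2 is a negative power of ln n, however small the exponent, and
  a crude norm bound for \<open>W\<close> is affordable. No norm estimate can decide all signs: its
  error w / l2 is far larger than the entries of the eigenvector, which have size 1 / sqrt n. This
  is why the expansion has to be controlled entry by entry. The condition sqrt \<alpha> - sqrt
  \<beta> > sqrt 2 enters in one place only. It is what lets the optimised Chernoff bound for the
  signed degree of a vertex survive a union over n vertices. Neither QR factors nor eigenvector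
  signs are unique, and the claim concerns every run. The analysis therefore sees a run only through
  the range of A^N Y, and the lower Ritz vector only as a unit minimiser of the Rayleigh quotient on
  it. The good set of Gaussian starts is built from eigenvectors that are merely chosen for each
  graph; the finite support of the law of the graph makes the resulting event measurable.\<close>

definition ip :: "nat \<Rightarrow> (nat \<Rightarrow> real) \<Rightarrow> (nat \<Rightarrow> real) \<Rightarrow> real" where
  "ip n f g = (\<Sum>i<n. f i * g i)"

definition mv :: "nat \<Rightarrow> (nat \<Rightarrow> nat \<Rightarrow> real) \<Rightarrow> (nat \<Rightarrow> real) \<Rightarrow> nat \<Rightarrow> real" where
  "mv n M f = (\<lambda>i. \<Sum>j<n. M i j * f j)"

definition nrm :: "nat \<Rightarrow> (nat \<Rightarrow> real) \<Rightarrow> real" where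
  "nrm n f = sqrt (ip n f f)"

definition sym :: "nat \<Rightarrow> (nat \<Rightarrow> nat \<Rightarrow> real) \<Rightarrow> bool" where
  "sym n M \<longleftrightarrow> (\<forall>i<n. \<forall>j<n. M i j = M j i)"

lemma ip_commute: "ip n f g = ip n g f"
  by (simp add: ip_def mult.commute)

lemma ip_cong: "(\<And>i. i < n \<Longrightarrow> f i = f' i) \<Longrightarrow> (\<And>i. i < n \<Longrightarrow> g i = g' i) \<Longrightarrow> ip n f g = ip n f' g'"
  by (auto simp: ip_def intro!: sum.cong)

lemma mv_cong: "(\<And>i. i < n \<Longrightarrow> f i = g i) \<Longrightarrow> mv n M f = mv n M g"
  by (auto simp: mv_def intro!: sum.cong ext)

lemma ip_linear:
  "ip n (\<lambda>i. f i + g i) h = ip n f h + ip n g h"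
  "ip n (\<lambda>i. f i - g i) h = ip n f h - ip n g h"
  "ip n (\<lambda>i. c * f i) h = c * ip n f h"
  "ip n h (\<lambda>i. f i + g i) = ip n h f + ip n h g"
  "ip n h (\<lambda>i. f i - g i) = ip n h f - ip n h g"
  "ip n h (\<lambda>i. c * f i) = c * ip n h f"
  by (simp_all add: ip_def sum.distrib sum_subtractf sum_distrib_left algebra_simps)

lemma mv_linear:
  "mv n M (\<lambda>i. f i + g i) = (\<lambda>i. mv n M f i + mv n M g i)"
  "mv n M (\<lambda>i. f i - g i) = (\<lambda>i. mv n M f i - mv n M g i)"
  "mv n M (\<lambda>i. c * f i) = (\<lambda>i. c * mv n M f i)"
  by (simp_all add: mv_def sum.distrib sum_subtractf sum_distrib_left algebra_simps)

lemma ip_mv_sym: "sym n M \<Longrightarrow> ip n f (mv n M g) = ip n (mv n M f) g"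
proof -
  assume "sym n M"
  have "ip n f (mv n M g) = (\<Sum>i<n. \<Sum>j<n. f i * M i j * g j)"
    by (simp add: ip_def mv_def sum_distrib_left mult.assoc)
  also have "\<dots> = (\<Sum>j<n. \<Sum>i<n. f i * M i j * g j)" by (rule sum.swap)
  also have "\<dots> = ip n (mv n M f) g"
    unfolding ip_def mv_def sum_distrib_right
    using \<open>sym n M\<close> by (intro sum.cong refl) (auto simp: sym_def)
  finally show ?thesis .
qed

lemma ip_self_nonneg [simp]: "ip n f f \<ge> 0"
  by (simp add: ip_def sum_nonneg)

lemma ip_self_eq_0: "ip n f f = 0 \<longleftrightarrow> (\<forall>i<n. f i = 0)"
  by (auto simp: ip_def sum_nonneg_eq_0_iff)

lemma nrm_L2_set: "nrm n f = L2_set f {..<n}"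
  by (simp add: nrm_def ip_def L2_set_def power2_eq_square)

lemma nrm_nonneg [simp]: "nrm n f \<ge> 0"
  by (simp add: nrm_def)

lemma nrm_power2: "(nrm n f)\<^sup>2 = ip n f f"
  by (simp add: nrm_def)

lemma ip_le_nrm: "\<bar>ip n f g\<bar> \<le> nrm n f * nrm n g"
proof -
  have "\<bar>ip n f g\<bar> \<le> (\<Sum>i<n. \<bar>f i\<bar> * \<bar>g i\<bar>)"
    unfolding ip_def by (rule order.trans[OF sum_abs]) (simp add: abs_mult)
  also have "\<dots> \<le> nrm n f * nrm n g"
    unfolding nrm_L2_set by (rule L2_set_mult_ineq)
  finally show ?thesis .
qed

lemma nrm_triangle: "nrm n (\<lambda>i. f i + g i) \<le> nrm n f + nrm n g"
  unfolding nrm_L2_set by (rule L2_set_triangle_ineq)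

lemma nrm_scale: "nrm n (\<lambda>i. c * f i) = \<bar>c\<bar> * nrm n f"
  by (simp add: nrm_def ip_linear real_sqrt_mult mult.assoc[symmetric])

lemma abs_le_nrm: "i < n \<Longrightarrow> \<bar>f i\<bar> \<le> nrm n f"
  using member_le_L2_set[of "{..<n}" i "\<lambda>i. \<bar>f i\<bar>"] by (simp add: nrm_L2_set L2_set_def)

text \<open>For small \<open>t\<close> with the sign of \<open>c\<close> the linear term dominates.
  This gives stationarity at the maximum of a Rayleigh quotient without differentiation.\<close>

lemma linear_coeff_zero:
  fixes c d :: real
  assumes "\<And>t. c * t + d * t\<^sup>2 \<le> 0"
  shows "c = 0"
proof (rule ccontr)
  assume "c \<noteq> 0"
  define K where "K = \<bar>d\<bar> + 1"
  have K: "K > 0" "d > - K" by (auto simp: K_def)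
  \<comment> \<open>With \<open>K\<close> larger than \<open>\<bar>d\<bar>\<close>, the quadratic
    term takes away less than half of the linear one.\<close>
  define t where "t = c / (2 * K)"
  have "c * t + d * t\<^sup>2 = c\<^sup>2 / (2 * K) * (1 + d / (2 * K))"
    using K by (simp add: t_def field_simps power2_eq_square)
  moreover have "d / (2 * K) > -1" using K by (simp add: field_simps)
  moreover have "c\<^sup>2 / (2 * K) > 0" using K \<open>c \<noteq> 0\<close> by simp
  ultimately have "c * t + d * t\<^sup>2 > 0"
    by (smt (verit) mult_pos_pos)
  with assms[of t] show False by simp
qed

text \<open>The maximiser over unit vectors orthogonal to \<open>u\<close> is stationary in every
  direction orthogonal to \<open>u\<close>. Its residual is such a direction, because
  \<open>M\<close> is symmetric and \<open>u\<close> an eigenvector. For \<open>u = 0\<close> the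
  constraint is void and the top eigenpair results, so the lemma serves both eigenpairs.\<close>

lemma rayleigh_eigenvector:
  assumes sy: "sym n M" and u: "\<And>i. i < n \<Longrightarrow> mv n M u i = c * u i"
    and ex: "ip n u v0 = 0" "ip n v0 v0 \<noteq> 0"
  obtains e l where "ip n e e = 1" "ip n u e = 0" "\<And>i. i < n \<Longrightarrow> mv n M e i = l * e i"
    "\<And>v. ip n u v = 0 \<Longrightarrow> ip n v (mv n M v) \<le> l * ip n v v"
proof -
  \<comment> \<open>Vectors are functions on all of \<open>nat\<close>; pinning the coordinates from
    \<open>n\<close> on to 0 makes the cube a product of compact sets, so that Tychonoff
    applies.\<close>
  define K where "K = (PiE UNIV (\<lambda>i. if i < n then {-1..1::real} else {0}))"
  define S where "S = K \<inter> {f. ip n f f = 1} \<inter> {f. ip n u f = 0}"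
  have K: "compact K"
    unfolding K_def compactin_euclidean_iff[symmetric] euclidean_product_topology[symmetric]
    by (subst compactin_PiE) (auto simp: compactin_euclidean_iff)
  have [continuous_intros]: "continuous_on UNIV (\<lambda>f::nat\<Rightarrow>real. f i)" for i
    by (rule continuous_on_product_coordinates)
  have c1: "continuous_on UNIV (\<lambda>f. ip n f f)" "continuous_on UNIV (\<lambda>f. ip n u f)"
    "continuous_on UNIV (\<lambda>f. ip n f (mv n M f))"
    unfolding ip_def mv_def by (intro continuous_intros)+
  have cl: "closed {f. ip n f f = 1}" "closed {f. ip n u f = 0}"
    using c1 by (auto intro!: closed_Collect_eq continuous_intros)
  have S: "compact S" unfolding S_def using K cl by (intro compact_Int_closed)
  define r where "r v = (\<lambda>i. if i < n then v i / nrm n v else 0)" for v :: "nat \<Rightarrow> real"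
  have rS: "r v \<in> S" if "ip n u v = 0" "ip n v v \<noteq> 0" for v
  proof -
    have p: "nrm n v > 0" using that by (simp add: nrm_def less_le)
    have "v i \<le> nrm n v" "- nrm n v \<le> v i" if "i < n" for i
      using abs_le_nrm[OF that, of v] by auto
    then have "r v \<in> K" unfolding K_def r_def using p
      by (auto simp: PiE_iff field_simps split: if_splits)
    moreover have "ip n (r v) (r v) = ip n (\<lambda>i. (1/nrm n v) * v i) (\<lambda>i. (1/nrm n v) * v i)"
      by (rule ip_cong) (auto simp: r_def)
    then have "ip n (r v) (r v) = (1/nrm n v) * ((1/nrm n v) * (nrm n v)\<^sup>2)"
      by (simp only: ip_linear nrm_power2)
    then have "ip n (r v) (r v) = 1" using p by (simp add: power2_eq_square)
    moreover have "ip n u (r v) = ip n u (\<lambda>i. (1/nrm n v) * v i)"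
      by (rule ip_cong) (auto simp: r_def)
    then have "ip n u (r v) = 0" unfolding ip_linear using that by simp
    ultimately show ?thesis by (simp add: S_def)
  qed
  have "S \<noteq> {}" using rS[OF ex] by auto
  from continuous_attains_sup[OF S this continuous_on_subset[OF c1(3)]]
  obtain e where e: "e \<in> S" "\<And>f. f \<in> S \<Longrightarrow> ip n f (mv n M f) \<le> ip n e (mv n M e)" by auto
  define l where "l = ip n e (mv n M e)"
  have ee: "ip n e e = 1" "ip n u e = 0" using e(1) by (auto simp: S_def)
  have max: "ip n v (mv n M v) \<le> l * ip n v v" if "ip n u v = 0" for v
  proof (cases "ip n v v = 0")
    case True
    then have "\<forall>i<n. v i = 0" by (simp add: ip_self_eq_0)
    then have "ip n v (mv n M v) = 0" by (simp add: ip_def)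
    then show ?thesis using True by simp
  next
    case False
    have p: "nrm n v > 0" using False by (simp add: nrm_def less_le)
    have "mv n M (r v) = mv n M (\<lambda>i. (1/nrm n v) * v i)" by (rule mv_cong) (auto simp: r_def)
    then have "ip n (r v) (mv n M (r v)) = ip n (\<lambda>i. (1/nrm n v) * v i) (mv n M (\<lambda>i. (1/nrm n v) * v i))"
      by (intro ip_cong) (auto simp: r_def)
    also have "\<dots> = ip n v (mv n M v) / ip n v v"
      using p by (simp only: mv_linear ip_linear) (simp add: nrm_power2[symmetric] power2_eq_square)
    finally have "ip n v (mv n M v) / ip n v v \<le> l" using e(2)[OF rS[OF that False]] by (simp add: l_def)
    moreover have "ip n v v > 0" using False by (simp add: less_le)
    ultimately show ?thesis by (simp add: field_simps)
  qed
  have stat: "ip n h (mv n M e) - l * ip n h e = 0" if h: "ip n u h = 0" for h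
  proof -
    have "2 * (ip n h (mv n M e) - l * ip n h e) * t + (ip n h (mv n M h) - l * ip n h h) * t\<^sup>2 \<le> 0" for t
    proof -
      have "ip n u (\<lambda>i. e i + t * h i) = 0" using h ee by (simp add: ip_linear)
      from max[OF this] have "ip n e (mv n M e) + t * ip n h (mv n M e) + t * ip n e (mv n M h) + t\<^sup>2 * ip n h (mv n M h)
         \<le> l * (ip n e e + 2 * t * ip n h e + t\<^sup>2 * ip n h h)"
        by (simp add: ip_linear mv_linear ip_commute[of n e h] power2_eq_square algebra_simps)
      moreover have "ip n e (mv n M h) = ip n h (mv n M e)"
        using ip_mv_sym[OF sy] by (simp add: ip_commute)
      ultimately show ?thesis using ee by (simp add: l_def algebra_simps)
    qed
    from linear_coeff_zero[OF this] show ?thesis by simp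
  qed
  \<comment> \<open>Stationarity against the residual itself says that its norm is zero.\<close>
  define h where "h = (\<lambda>i. mv n M e i - l * e i)"
  have "ip n u (mv n M e) = ip n (mv n M u) e" by (rule ip_mv_sym[OF sy])
  also have "\<dots> = ip n (\<lambda>i. c * u i) e" using u by (intro ip_cong) auto
  finally have "ip n u h = 0" unfolding h_def using ee by (simp add: ip_linear)
  from stat[OF this] have "ip n h (\<lambda>i. mv n M e i - l * e i) = 0" by (simp only: ip_linear)
  then have "ip n h h = 0" by (simp only: h_def)
  then have "\<And>i. i < n \<Longrightarrow> mv n M e i = l * e i" by (simp add: ip_self_eq_0 h_def)
  with ee max show ?thesis using that by blast
qed

section \<open>The planted spectrum\<close>

text \<open>The cross product of the two rows is a solution. If it vanishes, the rows are parallel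
  and a solution of one of them solves both. The lemma provides a combination of three vectors that
  is orthogonal to both planted directions.\<close>

lemma three_unknowns:
  fixes p1 p2 p3 q1 q2 q3 :: real
  obtains c s t where "c \<noteq> 0 \<or> s \<noteq> 0 \<or> t \<noteq> 0"
    "c * p1 + s * p2 + t * p3 = 0" "c * q1 + s * q2 + t * q3 = 0"
proof -
  let ?c1 = "p2*q3 - p3*q2" and ?c2 = "p3*q1 - p1*q3" and ?c3 = "p1*q2 - p2*q1"
  consider "?c1 \<noteq> 0 \<or> ?c2 \<noteq> 0 \<or> ?c3 \<noteq> 0" | "?c1 = 0" "?c2 = 0" "?c3 = 0" by blast
  then show ?thesis
  proof cases
    case 1
    then show ?thesis by (rule that) (simp_all add: algebra_simps)
  next
    case cross: 2
    consider "p1 \<noteq> 0 \<or> p2 \<noteq> 0" | "p1 = 0" "p2 = 0" "p3 \<noteq> 0" | "p1 = 0" "p2 = 0" "p3 = 0" "q1 = 0" "q2 = 0"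
      | "p1 = 0" "p2 = 0" "p3 = 0" "q1 \<noteq> 0 \<or> q2 \<noteq> 0" by blast
    then show ?thesis
    proof cases
      case 1 then show ?thesis using cross by (intro that[of p2 "-p1" 0]) (auto simp: algebra_simps)
    next
      case 2 then show ?thesis using cross by (intro that[of 1 0 0]) auto
    next
      case 3 then show ?thesis by (intro that[of 1 0 0]) auto
    next
      case 4 then show ?thesis by (intro that[of q2 "-q1" 0]) auto
    qed
  qed
qed

lemma mv_pow_cong:
  assumes "\<And>i. i < n \<Longrightarrow> f i = g i" "i < n"
  shows "(mv n M ^^ k) f i = (mv n M ^^ k) g i"
proof (cases k)
  case (Suc m)
  have "(mv n M ^^ Suc m) f = (mv n M ^^ Suc m) g"
    unfolding funpow_Suc_right comp_def using mv_cong[OF assms(1)] by simp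
  then show ?thesis using Suc by simp
qed (use assms in simp)

lemma mv_pow_linear:
  "(mv n M ^^ k) (\<lambda>i. f i + g i) = (\<lambda>i. (mv n M ^^ k) f i + (mv n M ^^ k) g i)"
  "(mv n M ^^ k) (\<lambda>i. c * f i) = (\<lambda>i. c * (mv n M ^^ k) f i)"
  by (induction k) (simp_all add: mv_linear)

lemma mv_pow_eigenvector:
  assumes "\<And>i. i < n \<Longrightarrow> mv n M e i = l * e i" "i < n"
  shows "(mv n M ^^ k) e i = l ^ k * e i"
  using assms(2)
proof (induction k arbitrary: i)
  case (Suc k)
  have "mv n M ((mv n M ^^ k) e) = mv n M (\<lambda>i. l ^ k * e i)" using Suc.IH by (intro mv_cong)
  then show ?case using assms(1)[OF Suc.prems] by (simp add: mv_linear)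
qed simp

locale planted =
  fixes n :: nat and x :: "nat \<Rightarrow> real" and W :: "nat \<Rightarrow> nat \<Rightarrow> real" and a b w :: real
  assumes n_pos: "n > 0"
    and x_pm: "\<And>i. i < n \<Longrightarrow> x i = 1 \<or> x i = -1"
    and x_sum: "(\<Sum>i<n. x i) = 0"
    and W_sym: "sym n W"
    and W_norm: "\<And>v. nrm n (mv n W v) \<le> w * nrm n v"
    and w_pos: "w > 0" and b_gt: "b > 4 * w" and ab_gap: "a - b > 4 * w"
begin

definition A :: "nat \<Rightarrow> nat \<Rightarrow> real" where
  "A i j = W i j + a / n + b / n * x i * x j"

abbreviation one :: "nat \<Rightarrow> real" where "one \<equiv> (\<lambda>_. 1)"

lemma A_sym: "sym n A"
  using W_sym by (simp add: sym_def A_def mult_ac)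

lemma x_square: "i < n \<Longrightarrow> x i * x i = 1"
  using x_pm by fastforce

lemma ip_x_x: "ip n x x = n" and ip_one_one: "ip n one one = n" and ip_one_x: "ip n one x = 0" "ip n x one = 0"
  using x_sum by (simp_all add: ip_def x_square)

lemma mv_A: "mv n A v = (\<lambda>i. mv n W v i + a / n * ip n one v + b / n * ip n x v * x i)"
proof
  fix i
  have "mv n A v i = (\<Sum>j<n. W i j * v j + a / n * (1 * v j) + b / n * (x j * v j) * x i)"
    unfolding mv_def A_def by (intro sum.cong refl) (simp add: algebra_simps)
  also have "\<dots> = mv n W v i + a / n * ip n one v + b / n * ip n x v * x i"
    unfolding mv_def ip_def sum.distrib sum_distrib_left sum_distrib_right by simp
  finally show "mv n A v i = mv n W v i + a / n * ip n one v + b / n * ip n x v * x i" .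
qed

lemma W_quadratic: "\<bar>ip n f (mv n W g)\<bar> \<le> w * nrm n f * nrm n g"
proof -
  have "\<bar>ip n f (mv n W g)\<bar> \<le> nrm n f * nrm n (mv n W g)" by (rule ip_le_nrm)
  also have "\<dots> \<le> nrm n f * (w * nrm n g)" by (intro mult_left_mono W_norm) simp
  finally show ?thesis by (simp add: mult_ac)
qed

lemma W_quadratic_self: "\<bar>ip n f (mv n W f)\<bar> \<le> w * ip n f f"
  using W_quadratic[of f f] by (simp add: nrm_power2[symmetric] power2_eq_square mult_ac)

lemma ip_A: "ip n v (mv n A v) = ip n v (mv n W v) + a / n * (ip n one v)\<^sup>2 + b / n * (ip n x v)\<^sup>2"
proof -
  have "ip n v (mv n A v) = ip n v (\<lambda>i. mv n W v i + (a / n * ip n one v) * one i + (b / n * ip n x v) * x i)"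
    by (simp add: mv_A)
  also have "\<dots> = ip n v (mv n W v) + a / n * ip n one v * ip n v one + b / n * ip n x v * ip n v x"
    by (simp only: ip_linear)
  finally show ?thesis by (simp add: power2_eq_square ip_commute[of n v])
qed

lemma ip_x_le: "(ip n x v)\<^sup>2 \<le> n * ip n v v"
proof -
  have "\<bar>ip n x v\<bar>\<^sup>2 \<le> (nrm n x * nrm n v)\<^sup>2" by (intro power_mono ip_le_nrm) simp
  then show ?thesis by (simp add: power_mult_distrib nrm_power2 ip_x_x)
qed

end

section \<open>Eigenpairs of the planted matrix and the complement of their span\<close>

locale planted_eigen = planted +
  fixes u1 u2 :: "nat \<Rightarrow> real" and l1 l2 :: real
  assumes u_unit: "ip n u1 u1 = 1" "ip n u2 u2 = 1" and u_orth: "ip n u1 u2 = 0"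
    and u1_eigen: "\<And>i. i < n \<Longrightarrow> mv n A u1 i = l1 * u1 i"
    and u2_eigen: "\<And>i. i < n \<Longrightarrow> mv n A u2 i = l2 * u2 i"
    and l1_ge: "l1 \<ge> a - w" and l2_bounds: "l2 \<ge> b - w" "l2 \<le> b + w"

context planted
begin

text \<open>Min-max with explicit test vectors. The vector \<open>one\<close> bounds
  \<open>l1\<close> from below. The span of \<open>one\<close> and \<open>x\<close> contains a
  vector orthogonal to \<open>u1\<close>, which bounds \<open>l2\<close> from below; the span of
  \<open>u1\<close> and \<open>u2\<close> contains one orthogonal to \<open>one\<close>, where only
  \<open>W\<close> and the \<open>x\<close> part act, and it bounds \<open>l2\<close> from
  above.\<close>

lemma eigen_exists: "\<exists>u1 u2 l1 l2. planted_eigen n x W a b w u1 u2 l1 l2"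
proof -
  have "ip n one one \<noteq> 0" using n_pos by (simp add: ip_one_one)
  have zero: "ip n (\<lambda>_. 0) v = 0" "mv n A (\<lambda>_. 0) i = 0 * 0" for v i by (simp_all add: ip_def mv_def)
  obtain u1 l1 where u1: "ip n u1 u1 = 1" "ip n (\<lambda>_. 0) u1 = 0" "\<And>i. i < n \<Longrightarrow> mv n A u1 i = l1 * u1 i"
    and max1': "\<And>v. ip n (\<lambda>_. 0) v = 0 \<Longrightarrow> ip n v (mv n A v) \<le> l1 * ip n v v"
    by (rule rayleigh_eigenvector[OF A_sym zero(2) zero(1) \<open>ip n one one \<noteq> 0\<close>]) (rule that)
  have max1: "ip n v (mv n A v) \<le> l1 * ip n v v" for v using max1' zero by blast
  \<comment> \<open>Coefficients of a vector orthogonal to \<open>u1\<close>; if \<open>u1\<close>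
    is orthogonal to both \<open>one\<close> and \<open>x\<close>, the vector \<open>x\<close> is
    taken.\<close>
  define s t where "s = (if ip n u1 one = 0 \<and> ip n u1 x = 0 then 0 else ip n u1 x)"
    and "t = (if ip n u1 one = 0 \<and> ip n u1 x = 0 then 1 else - ip n u1 one)"
  define v where "v = (\<lambda>i. s * one i + t * x i)"
  have st: "s\<^sup>2 + t\<^sup>2 > 0" unfolding s_def t_def
    by (auto simp: sum_power2_gt_zero_iff)
  have uv: "ip n u1 v = 0" unfolding v_def ip_linear by (simp add: s_def t_def)
  have vv: "ip n v v = n * (s\<^sup>2 + t\<^sup>2)" unfolding v_def ip_linear ip_one_x ip_x_x ip_one_one
    by (simp add: power2_eq_square algebra_simps)
  have vo: "ip n one v = n * s" "ip n x v = n * t" unfolding v_def ip_linear ip_one_x ip_x_x ip_one_one by simp_all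
  have vv0: "ip n v v \<noteq> 0"
    unfolding vv using st n_pos by (metis less_irrefl mult_pos_pos of_nat_0_less_iff)
  obtain u2 l2 where u2: "ip n u2 u2 = 1" "ip n u1 u2 = 0" "\<And>i. i < n \<Longrightarrow> mv n A u2 i = l2 * u2 i"
    and max2: "\<And>v. ip n u1 v = 0 \<Longrightarrow> ip n v (mv n A v) \<le> l2 * ip n v v"
    by (rule rayleigh_eigenvector[OF A_sym u1(3) uv vv0]) (assumption, rule that)
  have e2: "ip n f (mv n A u2) = l2 * ip n f u2" for f
    using u2(3) by (subst ip_linear(6)[symmetric], intro ip_cong) auto
  have e1: "ip n f (mv n A u1) = l1 * ip n f u1" for f
    using u1(3) by (subst ip_linear(6)[symmetric], intro ip_cong) auto
  have l12: "l2 \<le> l1" using max1[of u2] u2 by (simp add: e2)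
  have "a * n - w * n \<le> l1 * n"
    using max1[of one] W_quadratic_self[of one] n_pos
    unfolding ip_A ip_one_one ip_one_x by (simp add: power2_eq_square)
  then have l1: "l1 \<ge> a - w" using n_pos by (simp add: left_diff_distrib[symmetric])
  have "ip n v (mv n A v) \<ge> (b - w) * ip n v v"
  proof -
    have "ip n v (mv n A v) \<ge> - w * ip n v v + a * (n * s\<^sup>2) + b * (n * t\<^sup>2)"
      using W_quadratic_self[of v] n_pos by (simp add: ip_A vo power2_eq_square)
    moreover have "a * (n * s\<^sup>2) \<ge> b * (n * s\<^sup>2)" using ab_gap w_pos by (intro mult_right_mono) auto
    ultimately show ?thesis unfolding vv by (simp add: algebra_simps)
  qed
  with max2[OF uv] have "(b - w) * ip n v v \<le> l2 * ip n v v" by simp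
  moreover have "ip n v v > 0" using st n_pos by (simp add: vv)
  ultimately have l2: "l2 \<ge> b - w" by simp
  define s' t' where "s' = (if ip n one u1 = 0 \<and> ip n one u2 = 0 then 0 else ip n one u2)"
    and "t' = (if ip n one u1 = 0 \<and> ip n one u2 = 0 then 1 else - ip n one u1)"
  define z where "z = (\<lambda>i. s' * u1 i + t' * u2 i)"
  have st': "s'\<^sup>2 + t'\<^sup>2 > 0" unfolding s'_def t'_def by (auto simp: sum_power2_gt_zero_iff)
  have z1: "ip n one z = 0" unfolding z_def ip_linear by (simp add: s'_def t'_def)
  have zz: "ip n z z = s'\<^sup>2 + t'\<^sup>2" unfolding z_def ip_linear using u1 u2 ip_commute[of n u2 u1]
    by (simp add: power2_eq_square algebra_simps)
  have "ip n z (mv n A z) = l1 * s'\<^sup>2 + l2 * t'\<^sup>2" unfolding z_def mv_linear ip_linear e1 e2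
    using u1 u2 ip_commute[of n u2 u1] by (simp add: power2_eq_square algebra_simps)
  also have "\<dots> \<ge> l2 * ip n z z" using l12 mult_right_mono[OF l12, of "s'\<^sup>2"] by (simp add: zz algebra_simps)
  finally have "l2 * ip n z z \<le> ip n z (mv n W z) + b / n * (ip n x z)\<^sup>2"
    by (simp add: ip_A z1)
  also have "\<dots> \<le> w * ip n z z + b / n * (n * ip n z z)"
    using W_quadratic_self[of z] mult_left_mono[OF ip_x_le[of z], of "b / n"] b_gt w_pos by simp
  also have "\<dots> = (b + w) * ip n z z" using n_pos by (simp add: algebra_simps)
  finally have l2': "l2 \<le> b + w" using st' by (simp add: zz)
  have "planted_eigen n x W a b w u1 u2 l1 l2"
    by (intro planted_eigen.intro planted_eigen_axioms.intro planted_axioms) (fact u1 u2 l1 l2 l2' | assumption)+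
  then show ?thesis by blast
qed

end

context planted_eigen
begin

lemma u_simps: "ip n u1 u1 = 1" "ip n u2 u2 = 1" "ip n u1 u2 = 0" "ip n u2 u1 = 0"
  using u_unit u_orth ip_commute[of n u2 u1] by simp_all

lemma l2_pos: "l2 > 0" "l2 > w" "l2 \<le> l1" "l1 > w" "l1 > 0"
  using l1_ge l2_bounds b_gt ab_gap w_pos by linarith+

lemma ip_A_u: "ip n f (mv n A u1) = l1 * ip n f u1" "ip n f (mv n A u2) = l2 * ip n f u2"
  by (subst ip_linear(6)[symmetric], rule ip_cong, use u1_eigen u2_eigen in simp_all)+

lemma ip_u_A: "ip n u1 (mv n A v) = l1 * ip n u1 v" "ip n u2 (mv n A v) = l2 * ip n u2 v"
  using ip_A_u[of v] ip_mv_sym[OF A_sym] ip_commute by metis+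

lemma complement_norm:
  assumes v: "ip n u1 v = 0" "ip n u2 v = 0"
  shows "nrm n (mv n A v) \<le> w * nrm n v"
proof -
  obtain c s t where cst: "c \<noteq> 0 \<or> s \<noteq> 0 \<or> t \<noteq> 0"
    "c * ip n one v + s * ip n one u1 + t * ip n one u2 = 0"
    "c * ip n x v + s * ip n x u1 + t * ip n x u2 = 0"
    using three_unknowns by blast
  define z where "z = (\<lambda>i. c * v i + s * u1 i + t * u2 i)"
  have o: "ip n one z = 0" "ip n x z = 0" using cst by (simp_all add: z_def ip_linear)
  have "mv n A z = mv n W z" by (simp add: mv_A o)
  then have "(nrm n (mv n A z))\<^sup>2 \<le> (w * nrm n z)\<^sup>2" using W_norm[of z] by (intro power_mono) auto
  then have zW: "ip n (mv n A z) (mv n A z) \<le> w\<^sup>2 * ip n z z" by (simp add: nrm_power2 power_mult_distrib)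
  have l: "ip n (mv n A u1) f = l1 * ip n u1 f" "ip n (mv n A u2) f = l2 * ip n u2 f" for f
    using ip_u_A ip_mv_sym[OF A_sym] by metis+
  have l': "ip n (mv n A v) u1 = 0" "ip n (mv n A v) u2 = 0"
    by (simp_all add: ip_commute[of n "mv n A v"] ip_u_A v)
  have zA: "ip n (mv n A z) (mv n A z) = c\<^sup>2 * ip n (mv n A v) (mv n A v) + s\<^sup>2 * l1\<^sup>2 + t\<^sup>2 * l2\<^sup>2"
    apply (simp only: z_def mv_linear ip_linear l ip_A_u ip_u_A l' v u_simps)
    apply (simp add: power2_eq_square algebra_simps)
    done
  have zz: "ip n z z = c\<^sup>2 * ip n v v + s\<^sup>2 + t\<^sup>2"
    apply (simp only: z_def ip_linear u_simps v ip_commute[of n v u1] ip_commute[of n v u2])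
    apply (simp add: power2_eq_square algebra_simps)
    done
  from zW have ineq: "c\<^sup>2 * ip n (mv n A v) (mv n A v) + s\<^sup>2 * (l1\<^sup>2 - w\<^sup>2) + t\<^sup>2 * (l2\<^sup>2 - w\<^sup>2) \<le> c\<^sup>2 * (w\<^sup>2 * ip n v v)"
    unfolding zA zz by (simp add: algebra_simps)
  have d: "l1\<^sup>2 - w\<^sup>2 > 0" "l2\<^sup>2 - w\<^sup>2 > 0" using l2_pos w_pos by (simp_all add: power_strict_mono)
  \<comment> \<open>Otherwise \<open>z\<close> would lie in the span of \<open>u1\<close> and
    \<open>u2\<close>, where \<open>A\<close> stretches by more than \<open>w\<close>.\<close>
  have c: "c \<noteq> 0"
  proof
    assume "c = 0"
    then have "s\<^sup>2 * (l1\<^sup>2 - w\<^sup>2) + t\<^sup>2 * (l2\<^sup>2 - w\<^sup>2) \<le> 0" using ineq by simp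
    moreover have "s\<^sup>2 * (l1\<^sup>2 - w\<^sup>2) \<ge> 0" "t\<^sup>2 * (l2\<^sup>2 - w\<^sup>2) \<ge> 0" using d by (meson less_imp_le mult_nonneg_nonneg zero_le_power2)+
    ultimately have "s\<^sup>2 * (l1\<^sup>2 - w\<^sup>2) = 0" "t\<^sup>2 * (l2\<^sup>2 - w\<^sup>2) = 0" by linarith+
    then show False using d cst(1) \<open>c = 0\<close> by auto
  qed
  have "s\<^sup>2 * (l1\<^sup>2 - w\<^sup>2) \<ge> 0" "t\<^sup>2 * (l2\<^sup>2 - w\<^sup>2) \<ge> 0" using d by (meson less_imp_le mult_nonneg_nonneg zero_le_power2)+
  with ineq have "c\<^sup>2 * ip n (mv n A v) (mv n A v) \<le> c\<^sup>2 * (w\<^sup>2 * ip n v v)" by linarith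
  then have "ip n (mv n A v) (mv n A v) \<le> w\<^sup>2 * ip n v v" using c by simp
  then have "(nrm n (mv n A v))\<^sup>2 \<le> (w * nrm n v)\<^sup>2" by (simp add: nrm_power2 power_mult_distrib)
  then show ?thesis by (rule power2_le_imp_le) (use w_pos in simp)
qed

lemma complement_power:
  assumes v: "ip n u1 v = 0" "ip n u2 v = 0"
  shows "ip n u1 ((mv n A ^^ k) v) = 0 \<and> ip n u2 ((mv n A ^^ k) v) = 0 \<and>
    nrm n ((mv n A ^^ k) v) \<le> w ^ k * nrm n v"
proof (induction k)
  case (Suc k)
  have "nrm n ((mv n A ^^ Suc k) v) \<le> w * nrm n ((mv n A ^^ k) v)"
    using Suc complement_norm by simp
  also have "\<dots> \<le> w * (w ^ k * nrm n v)" using Suc w_pos by (intro mult_left_mono) auto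
  finally show ?case using Suc by (simp add: ip_u_A mult_ac)
qed (use v in auto)

definition perp :: "(nat \<Rightarrow> real) \<Rightarrow> nat \<Rightarrow> real" where
  "perp v = (\<lambda>i. v i - ip n u1 v * u1 i - ip n u2 v * u2 i)"

lemma perp_orth: "ip n u1 (perp v) = 0" "ip n u2 (perp v) = 0"
  unfolding perp_def ip_linear by (simp_all add: u_simps)

lemma decomp: "v = (\<lambda>i. perp v i + ip n u1 v * u1 i + ip n u2 v * u2 i)"
  by (simp add: perp_def)

lemma pythagoras: "ip n v v = ip n (perp v) (perp v) + (ip n u1 v)\<^sup>2 + (ip n u2 v)\<^sup>2"
  apply (simp only: perp_def ip_linear u_simps ip_commute[of n v u1] ip_commute[of n v u2])
  apply (simp add: power2_eq_square algebra_simps)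
  done

lemma ip_A_decomp: "ip n v (mv n A v) = ip n (perp v) (mv n A (perp v)) + l1 * (ip n u1 v)\<^sup>2 + l2 * (ip n u2 v)\<^sup>2"
  apply (simp only: perp_def mv_linear ip_linear ip_A_u ip_u_A u_simps ip_commute[of n v u1] ip_commute[of n v u2])
  apply (simp add: power2_eq_square algebra_simps)
  done

lemma perp_nrm_le: "nrm n (perp v) \<le> nrm n v"
  unfolding nrm_def using pythagoras[of v] by (simp add: )

lemma perp_quadratic: "\<bar>ip n (perp v) (mv n A (perp v))\<bar> \<le> w * ip n (perp v) (perp v)"
proof -
  have "\<bar>ip n (perp v) (mv n A (perp v))\<bar> \<le> nrm n (perp v) * nrm n (mv n A (perp v))" by (rule ip_le_nrm)
  also have "\<dots> \<le> nrm n (perp v) * (w * nrm n (perp v))"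
    by (intro mult_left_mono complement_norm perp_orth) simp
  finally show ?thesis by (simp add: nrm_power2[symmetric] power2_eq_square mult_ac)
qed

end

section \<open>Entries of the second eigenvector and subspace iteration\<close>

lemma geometric_sum_le_2:
  fixes r :: real assumes "0 \<le> r" "r \<le> 1/2" shows "(\<Sum>j<m. r ^ j) \<le> 2"
proof -
  have "(\<Sum>j<m. r ^ j) = (1 - r ^ m) / (1 - r)" using assms by (subst sum_gp_strict) auto
  also have "\<dots> \<le> 2"
  proof -
    have "1 - r ^ m \<le> 1" "1 \<le> 2 * (1 - r)" using assms by auto
    then have "1 - r ^ m \<le> 2 * (1 - r)" by linarith
    then show ?thesis using assms by (simp add: divide_le_eq)
  qed
  finally show ?thesis .
qed

context planted_eigen
begin

lemma nrm_u2: "nrm n u2 = 1" "nrm n one = sqrt n" "nrm n x = sqrt n"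
  by (simp_all add: nrm_def u_simps ip_one_one ip_x_x)

text \<open>Paired with \<open>one\<close>, the eigenvector equation loses its \<open>x\<close> part
  because the labels are balanced. What remains is \<open>a - l2\<close> times the overlap, against
  a term of size at most \<open>w * sqrt n\<close>.\<close>

lemma u2_one: "\<bar>ip n one u2\<bar> \<le> sqrt n * w / (a - b - w)"
proof -
  have "l2 * ip n one u2 = ip n one (\<lambda>i. mv n W u2 i + a / n * ip n one u2 * one i + b / n * ip n x u2 * x i)"
    unfolding ip_A_u[symmetric] mv_A by simp
  also have "\<dots> = ip n one (mv n W u2) + a * ip n one u2"
    unfolding ip_linear ip_one_one ip_one_x using n_pos by simp
  finally have "(a - l2) * ip n one u2 = - ip n one (mv n W u2)" by (simp add: algebra_simps)
  then have "\<bar>a - l2\<bar> * \<bar>ip n one u2\<bar> \<le> w * sqrt n"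
    using W_quadratic[of one u2] by (simp add: nrm_u2 abs_mult[symmetric])
  moreover have "(a - b - w) * \<bar>ip n one u2\<bar> \<le> \<bar>a - l2\<bar> * \<bar>ip n one u2\<bar>"
    using l2_bounds ab_gap w_pos by (intro mult_right_mono) auto
  ultimately show ?thesis using ab_gap w_pos by (simp add: pos_le_divide_eq mult_ac)
qed

text \<open>The Rayleigh quotient of \<open>u2\<close> is at least \<open>b - w\<close>. The matrix
  \<open>W\<close> contributes at most \<open>w\<close> and the \<open>one\<close> part at most
  \<open>b / 8\<close>, so the \<open>x\<close> part must supply the rest.\<close>

lemma u2_x:
  assumes "8 * a * w\<^sup>2 \<le> b * (a - b - w)\<^sup>2" "16 * w \<le> b"
  shows "(ip n x u2)\<^sup>2 \<ge> n / 4"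
proof -
  have g: "a - b - w > 0" "b > 0" "a > 0" using ab_gap w_pos b_gt by auto
  have "(ip n one u2)\<^sup>2 \<le> (sqrt n * w / (a - b - w))\<^sup>2" using power_mono[OF u2_one, of 2] by simp
  also have "\<dots> = n * (w\<^sup>2 / (a - b - w)\<^sup>2)" by (simp add: power_divide power_mult_distrib)
  finally have "a / n * (ip n one u2)\<^sup>2 \<le> a / n * (n * (w\<^sup>2 / (a - b - w)\<^sup>2))"
    using g by (intro mult_left_mono) auto
  also have "\<dots> = a * w\<^sup>2 / (a - b - w)\<^sup>2" using n_pos by simp
  also have "\<dots> \<le> b / 8" using assms(1) g by (simp add: divide_le_eq mult_ac)
  finally have 1: "a / n * (ip n one u2)\<^sup>2 \<le> b / 8" .
  have 2: "l2 = ip n u2 (mv n W u2) + a / n * (ip n one u2)\<^sup>2 + b / n * (ip n x u2)\<^sup>2"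
    using ip_A[of u2] by (simp add: ip_A_u u_simps)
  have "b / n * (ip n x u2)\<^sup>2 \<ge> b / 4"
    using 1 2 abs_le_D1[OF W_quadratic_self[of u2]] l2_bounds(1) assms(2) w_pos unfolding u_simps by linarith
  then have "b * (n / 4) \<le> b * (ip n x u2)\<^sup>2" using n_pos g by (simp add: field_simps)
  then show ?thesis using g by simp
qed

text \<open>Unrolling of the eigenvector equation, in which \<open>u2\<close> is \<open>W u2\<close>
  plus a rank-two part, divided by \<open>l2\<close>. The remainder is kept exactly, so that no
  convergence question arises.\<close>

lemma u2_expansion:
  assumes "i < n"
  shows "u2 i = (\<Sum>j<J. (a * ip n one u2 / n * (mv n W ^^ j) one i + b * ip n x u2 / n * (mv n W ^^ j) x i) / l2 ^ Suc j)
    + (mv n W ^^ J) u2 i / l2 ^ J"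
proof (induction J)
  case (Suc J)
  let ?g = "a * ip n one u2 / n" and ?t = "b * ip n x u2 / n"
  have "u2 k = 1 / l2 * (mv n W u2 k) + (?g / l2 * one k + ?t / l2 * x k)" if "k < n" for k
    using u2_eigen[OF that] l2_pos by (simp add: mv_A field_simps)
  then have "(mv n W ^^ J) u2 i = (mv n W ^^ J) (\<lambda>k. 1 / l2 * (mv n W u2 k) + (?g / l2 * one k + ?t / l2 * x k)) i"
    using assms by (intro mv_pow_cong)
  also have "\<dots> = 1 / l2 * (mv n W ^^ J) (mv n W u2) i + (?g / l2 * (mv n W ^^ J) one i + ?t / l2 * (mv n W ^^ J) x i)"
    by (simp only: mv_pow_linear)
  also have "(mv n W ^^ J) (mv n W u2) = (mv n W ^^ Suc J) u2" by (simp add: funpow_swap1)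
  finally have "(mv n W ^^ J) u2 i / l2 ^ J = (?g * (mv n W ^^ J) one i + ?t * (mv n W ^^ J) x i) / l2 ^ Suc J + (mv n W ^^ Suc J) u2 i / l2 ^ Suc J"
    using l2_pos by (simp add: field_simps)
  with Suc.IH show ?case by simp
qed simp

lemma W_pow_norm: "nrm n ((mv n W ^^ k) v) \<le> w ^ k * nrm n v"
proof (induction k)
  case (Suc k)
  have "nrm n ((mv n W ^^ Suc k) v) \<le> w * nrm n ((mv n W ^^ k) v)" using W_norm by simp
  also have "\<dots> \<le> w * (w ^ k * nrm n v)" using Suc w_pos by (intro mult_left_mono) auto
  finally show ?case by (simp add: mult_ac)
qed simp

text \<open>The factor \<open>\<rho>\<close> normalises the coefficient of \<open>x\<close> in the
  expansion to 1, and \<open>\<gamma>\<close> is the relative weight of the \<open>one\<close>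
  series. The zeroth and first term of the \<open>x\<close> series contribute at least
  \<open>1 + (e - b) / l2\<close>, hence \<open>(e - w) / l2\<close>; all else is error. Entry
  bounds are available for the powers 1 to \<open>m + 1\<close>, whence the cut at
  \<open>m + 2\<close>.\<close>

lemma u2_entry:
  assumes i: "i < n" and K: "0 \<le> K1" "0 \<le> K2" "2 * K2 \<le> l2" and t: "ip n x u2 \<noteq> 0"
    and one_le: "\<And>j. j \<le> m \<Longrightarrow> \<bar>(mv n W ^^ Suc j) one i\<bar> \<le> K1 * K2 ^ j"
    and x_le: "\<And>j. j \<le> m \<Longrightarrow> \<bar>(mv n W ^^ Suc j) x i\<bar> \<le> K1 * K2 ^ j"
    and e: "x i * mv n W x i \<ge> e - b"
  defines "\<rho> \<equiv> n * l2 / (b * ip n x u2)" and "\<gamma> \<equiv> a * ip n one u2 / (b * ip n x u2)"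
  shows "\<rho> * (x i * u2 i) \<ge> (e - w) / l2 - 2 * K1 * K2 / l2\<^sup>2 - \<bar>\<gamma>\<bar> * (1 + 2 * K1 / l2) - \<bar>\<rho>\<bar> * (w / l2) ^ (m + 2)"
proof -
  have b: "b > 0" using b_gt w_pos by simp
  define r where "r = K2 / l2"
  have r: "0 \<le> r" "r \<le> 1/2" using K l2_pos by (auto simp: r_def field_simps)
  define X where "X j = (mv n W ^^ j) x i / l2 ^ j" for j
  define O1 where "O1 j = (mv n W ^^ j) one i / l2 ^ j" for j
  have pw: "K1 * K2 ^ j / l2 ^ Suc j = K1 / l2 * r ^ j" for j by (simp add: r_def power_divide)
  have XO: "\<bar>X (Suc j)\<bar> \<le> K1 / l2 * r ^ j" "\<bar>O1 (Suc j)\<bar> \<le> K1 / l2 * r ^ j" if "j \<le> m" for j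
    unfolding pw[symmetric] X_def O1_def abs_divide
    using x_le[OF that] one_le[OF that] l2_pos by (auto intro!: divide_right_mono)
  have "\<rho> * u2 i = (\<Sum>j<m+2. \<gamma> * O1 j + X j) + \<rho> * ((mv n W ^^ (m + 2)) u2 i / l2 ^ (m + 2))"
  proof -
    have "\<rho> * ((a * ip n one u2 / n * (mv n W ^^ j) one i + b * ip n x u2 / n * (mv n W ^^ j) x i) / l2 ^ Suc j) = \<gamma> * O1 j + X j" for j
      using t b n_pos l2_pos by (simp add: \<rho>_def \<gamma>_def O1_def X_def field_simps)
    then show ?thesis unfolding u2_expansion[OF i, of "m+2"] distrib_left[of \<rho>] sum_distrib_left by simp
  qed
  also have "(\<Sum>j<m+2. \<gamma> * O1 j + X j) = \<gamma> * (O1 0 + (\<Sum>j<m+1. O1 (Suc j))) + (X 0 + X 1 + (\<Sum>j<m. X (Suc (Suc j))))"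
  proof -
    have "(\<Sum>j<m+2. f j) = f 0 + (\<Sum>j<m+1. f (Suc j))" for f :: "nat \<Rightarrow> real"
      using sum.lessThan_Suc_shift[of f "m+1"] by simp
    moreover have "(\<Sum>j<m+1. f (Suc j)) = f 1 + (\<Sum>j<m. f (Suc (Suc j)))" for f :: "nat \<Rightarrow> real"
      using sum.lessThan_Suc_shift[of "\<lambda>j. f (Suc j)" m] by simp
    ultimately show ?thesis unfolding sum.distrib sum_distrib_left[symmetric] by (metis add.assoc)
  qed
  finally have eq: "\<rho> * u2 i = \<gamma> * (O1 0 + (\<Sum>j<m+1. O1 (Suc j))) + (X 0 + X 1 + (\<Sum>j<m. X (Suc (Suc j))))
     + \<rho> * ((mv n W ^^ (m + 2)) u2 i / l2 ^ (m + 2))" .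
  have s1: "\<bar>\<Sum>j<m+1. O1 (Suc j)\<bar> \<le> 2 * K1 / l2"
  proof -
    have "\<bar>\<Sum>j<m+1. O1 (Suc j)\<bar> \<le> (\<Sum>j<m+1. K1 / l2 * r ^ j)"
      by (rule order.trans[OF sum_abs sum_mono]) (use XO in auto)
    also have "\<dots> \<le> K1 / l2 * 2"
      unfolding sum_distrib_left[symmetric] using K l2_pos by (intro mult_left_mono geometric_sum_le_2 r) auto
    also have "\<dots> = 2 * K1 / l2" by simp
    finally show ?thesis .
  qed
  have s2: "\<bar>\<Sum>j<m. X (Suc (Suc j))\<bar> \<le> 2 * K1 * K2 / l2\<^sup>2"
  proof -
    have "\<bar>\<Sum>j<m. X (Suc (Suc j))\<bar> \<le> (\<Sum>j<m. K1 / l2 * r * r ^ j)"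
    proof (rule order.trans[OF sum_abs sum_mono])
      fix j assume "j \<in> {..<m}"
      then show "\<bar>X (Suc (Suc j))\<bar> \<le> K1 / l2 * r * r ^ j" using XO(1)[of "Suc j"] by (simp add: mult_ac)
    qed
    also have "\<dots> \<le> K1 / l2 * r * 2"
      unfolding sum_distrib_left[symmetric] using K l2_pos r by (intro mult_left_mono geometric_sum_le_2 r) auto
    also have "\<dots> = 2 * K1 * K2 / l2\<^sup>2" by (simp add: r_def power2_eq_square)
    finally show ?thesis .
  qed
  have s3: "\<bar>(mv n W ^^ (m + 2)) u2 i / l2 ^ (m + 2)\<bar> \<le> (w / l2) ^ (m + 2)"
    using abs_le_nrm[OF i, of "(mv n W ^^ (m + 2)) u2"] W_pow_norm[of "m+2" u2] l2_pos
    unfolding abs_divide power_divide by (simp add: nrm_u2 divide_right_mono)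
  have xi: "\<bar>x i\<bar> = 1" using x_pm[OF i] by auto
  have xX: "x i * (X 0 + X 1) \<ge> 1 + (e - b) / l2"
    using e l2_pos x_square[OF i] by (simp add: X_def distrib_left divide_right_mono)
  \<comment> \<open>Here \<open>l2 >= b - w\<close> lets the 1 cancel \<open>b\<close> up to
    \<open>w\<close>.\<close>
  have "1 + (e - b) / l2 \<ge> (e - w) / l2"
  proof -
    have "1 + (e - b) / l2 = (l2 + e - b) / l2" using l2_pos by (simp add: field_simps)
    then show ?thesis using l2_bounds l2_pos by (simp add: divide_right_mono)
  qed
  moreover have "\<rho> * (x i * u2 i) = x i * (\<rho> * u2 i)" by simp
  moreover have "x i * (\<rho> * u2 i) = x i * (\<gamma> * (O1 0 + (\<Sum>j<m+1. O1 (Suc j)))) + x i * (X 0 + X 1) + x i * (\<Sum>j<m. X (Suc (Suc j)))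
     + x i * (\<rho> * ((mv n W ^^ (m + 2)) u2 i / l2 ^ (m + 2)))" unfolding eq by (simp add: algebra_simps)
  moreover have "\<bar>x i * (\<gamma> * (O1 0 + (\<Sum>j<m+1. O1 (Suc j))))\<bar> \<le> \<bar>\<gamma>\<bar> * (1 + 2 * K1 / l2)"
    unfolding abs_mult xi using s1 abs_triangle_ineq[of "O1 0" "\<Sum>j<m+1. O1 (Suc j)"]
    by (simp add: mult_left_mono O1_def)
  moreover have "\<bar>x i * (\<Sum>j<m. X (Suc (Suc j)))\<bar> \<le> 2 * K1 * K2 / l2\<^sup>2" unfolding abs_mult xi using s2 by simp
  moreover have "\<bar>x i * (\<rho> * ((mv n W ^^ (m + 2)) u2 i / l2 ^ (m + 2)))\<bar> \<le> \<bar>\<rho>\<bar> * (w / l2) ^ (m + 2)"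
    unfolding abs_mult[of "x i"] abs_mult[of \<rho>] xi using mult_left_mono[OF s3, of "\<bar>\<rho>\<bar>"] by simp
  ultimately show ?thesis using xX unfolding abs_le_iff by linarith
qed

section \<open>Subspace iteration and the lower Ritz vector\<close>

lemma ip_u_power: "ip n u1 ((mv n A ^^ k) v) = l1 ^ k * ip n u1 v" "ip n u2 ((mv n A ^^ k) v) = l2 ^ k * ip n u2 v"
  by (induction k) (simp_all add: ip_u_A)

lemma perp_power:
  assumes "i < n" shows "perp ((mv n A ^^ k) v) i = (mv n A ^^ k) (perp v) i"
proof -
  have "(mv n A ^^ k) v = (mv n A ^^ k) (\<lambda>i. perp v i + ip n u1 v * u1 i + ip n u2 v * u2 i)"
    using decomp[of v] by simp
  also have "\<dots> = (\<lambda>i. (mv n A ^^ k) (perp v) i + ip n u1 v * (mv n A ^^ k) u1 i + ip n u2 v * (mv n A ^^ k) u2 i)"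
    by (simp only: mv_pow_linear)
  finally show ?thesis
    unfolding perp_def[of "(mv n A ^^ k) v"] ip_u_power
    using mv_pow_eigenvector[OF u1_eigen assms] mv_pow_eigenvector[OF u2_eigen assms] by simp
qed

lemma nrm_perp_power: "nrm n (perp ((mv n A ^^ k) v)) \<le> w ^ k * nrm n (perp v)"
proof -
  have "nrm n (perp ((mv n A ^^ k) v)) = nrm n ((mv n A ^^ k) (perp v))"
    unfolding nrm_def using perp_power by (intro arg_cong[of _ _ sqrt] ip_cong)
  then show ?thesis using complement_power[OF perp_orth] by simp
qed

end

text \<open>The determinant of the overlaps with \<open>u1\<close> and \<open>u2\<close> measures
  how far the projections of \<open>y1\<close> and \<open>y2\<close> to the span of the eigenvectors
  are from being dependent.\<close>

locale iterated_subspace = planted_eigen +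
  fixes y1 y2 :: "nat \<Rightarrow> real" and M \<delta> :: real and N :: nat
  assumes y_nrm: "nrm n y1 \<le> M" "nrm n y2 \<le> M" and \<delta>_pos: "\<delta> > 0"
    and det_ge: "\<bar>ip n u1 y1 * ip n u2 y2 - ip n u2 y1 * ip n u1 y2\<bar> \<ge> \<delta>"
begin

definition V :: "real \<Rightarrow> real \<Rightarrow> nat \<Rightarrow> real" where
  "V c1 c2 = (mv n A ^^ N) (\<lambda>i. c1 * y1 i + c2 * y2 i)"

definition \<epsilon> :: real where "\<epsilon> = 4 * M\<^sup>2 / \<delta> * (w / l2) ^ N"

lemma M_nonneg: "M \<ge> 0"
  using y_nrm nrm_nonneg order.trans by blast

lemma eps_nonneg: "\<epsilon> \<ge> 0"
  using \<delta>_pos w_pos l2_pos by (simp add: \<epsilon>_def)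

text \<open>By Cramer's rule the coefficients, and so the norm of the start vector, are at most
  \<open>2 * M^2 / \<delta>\<close> times the sum of its overlaps \<open>g1\<close>,
  \<open>g2\<close>. The iteration multiplies overlaps by at least \<open>l2 ^ N\<close> and the
  rest by at most \<open>w ^ N\<close>. Bounding each of the two final overlaps by the full norm
  doubles the constant.\<close>

lemma perp_V: "nrm n (perp (V c1 c2)) \<le> \<epsilon> * nrm n (V c1 c2)"
proof -
  define y where "y = (\<lambda>i. c1 * y1 i + c2 * y2 i)"
  define g1 g2 D where "g1 = ip n u1 y" "g2 = ip n u2 y" "D = ip n u1 y1 * ip n u2 y2 - ip n u2 y1 * ip n u1 y2"
  have ipM: "\<bar>ip n u1 y1\<bar> \<le> M" "\<bar>ip n u1 y2\<bar> \<le> M" "\<bar>ip n u2 y1\<bar> \<le> M" "\<bar>ip n u2 y2\<bar> \<le> M"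
    using ip_le_nrm[of n u1 y1] ip_le_nrm[of n u1 y2] ip_le_nrm[of n u2 y1] ip_le_nrm[of n u2 y2] y_nrm
    by (auto simp: nrm_def u_simps)
  have cramer: "c1 * D = g1 * ip n u2 y2 - g2 * ip n u1 y2" "c2 * D = g2 * ip n u1 y1 - g1 * ip n u2 y1"
    by (simp_all add: g1_g2_D_def y_def ip_linear algebra_simps)
  have b: "\<bar>p * q - p' * q'\<bar> \<le> (\<bar>p\<bar> + \<bar>p'\<bar>) * M" if "\<bar>q\<bar> \<le> M" "\<bar>q'\<bar> \<le> M" for p q p' q' :: real
  proof -
    have "\<bar>p * q - p' * q'\<bar> \<le> \<bar>p\<bar> * \<bar>q\<bar> + \<bar>p'\<bar> * \<bar>q'\<bar>" by (simp add: abs_mult[symmetric])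
    also have "\<dots> \<le> \<bar>p\<bar> * M + \<bar>p'\<bar> * M" using that by (intro add_mono mult_left_mono) auto
    finally show ?thesis by (simp add: algebra_simps)
  qed
  have c: "\<bar>c1\<bar> * \<delta> \<le> (\<bar>g1\<bar> + \<bar>g2\<bar>) * M" "\<bar>c2\<bar> * \<delta> \<le> (\<bar>g1\<bar> + \<bar>g2\<bar>) * M"
  proof -
    have "\<bar>c1\<bar> * \<delta> \<le> \<bar>c1 * D\<bar>" "\<bar>c2\<bar> * \<delta> \<le> \<bar>c2 * D\<bar>" using det_ge by (simp_all add: g1_g2_D_def abs_mult mult_left_mono)
    then show "\<bar>c1\<bar> * \<delta> \<le> (\<bar>g1\<bar> + \<bar>g2\<bar>) * M" "\<bar>c2\<bar> * \<delta> \<le> (\<bar>g1\<bar> + \<bar>g2\<bar>) * M"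
      using b[OF ipM(4) ipM(2), of g1 g2] b[OF ipM(1) ipM(3), of g2 g1] unfolding cramer by (simp_all add: add.commute)
  qed
  have "nrm n y \<le> \<bar>c1\<bar> * M + \<bar>c2\<bar> * M"
    unfolding y_def by (rule order.trans[OF nrm_triangle]) (auto simp: nrm_scale intro!: add_mono mult_left_mono y_nrm)
  moreover have "\<bar>c1\<bar> \<le> (\<bar>g1\<bar> + \<bar>g2\<bar>) * M / \<delta>" "\<bar>c2\<bar> \<le> (\<bar>g1\<bar> + \<bar>g2\<bar>) * M / \<delta>"
    using c \<delta>_pos by (simp_all add: pos_le_divide_eq)
  ultimately have "nrm n y \<le> (\<bar>g1\<bar> + \<bar>g2\<bar>) * M / \<delta> * M + (\<bar>g1\<bar> + \<bar>g2\<bar>) * M / \<delta> * M"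
    using M_nonneg by (meson add_mono mult_right_mono order.trans)
  then have ny: "nrm n (perp y) \<le> 2 * M\<^sup>2 / \<delta> * (\<bar>g1\<bar> + \<bar>g2\<bar>)"
    using perp_nrm_le[of y] by (simp add: power2_eq_square algebra_simps)
  have l: "l2 ^ N * (\<bar>g1\<bar> + \<bar>g2\<bar>) \<le> \<bar>ip n u1 (V c1 c2)\<bar> + \<bar>ip n u2 (V c1 c2)\<bar>"
  proof -
    have "l2 ^ N \<le> l1 ^ N" using l2_pos by (intro power_mono) auto
    then have "l2 ^ N * \<bar>g1\<bar> \<le> l1 ^ N * \<bar>g1\<bar>" by (intro mult_right_mono) auto
    then show ?thesis using l2_pos
      by (simp add: V_def y_def[symmetric] ip_u_power g1_g2_D_def(1,2)[symmetric] abs_mult algebra_simps)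
  qed
  have u: "\<bar>ip n u1 (V c1 c2)\<bar> \<le> nrm n (V c1 c2)" "\<bar>ip n u2 (V c1 c2)\<bar> \<le> nrm n (V c1 c2)"
    using ip_le_nrm[of n u1 "V c1 c2"] ip_le_nrm[of n u2 "V c1 c2"] by (simp_all add: nrm_def u_simps)
  have "nrm n (perp (V c1 c2)) \<le> w ^ N * nrm n (perp y)" unfolding V_def y_def[symmetric] by (rule nrm_perp_power)
  also have "\<dots> \<le> w ^ N * (2 * M\<^sup>2 / \<delta> * (\<bar>g1\<bar> + \<bar>g2\<bar>))" using ny w_pos by (intro mult_left_mono) auto
  also have "\<dots> = 2 * M\<^sup>2 / \<delta> * (w / l2) ^ N * (l2 ^ N * (\<bar>g1\<bar> + \<bar>g2\<bar>))" using l2_pos by (simp add: power_divide)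
  also have "\<dots> \<le> 2 * M\<^sup>2 / \<delta> * (w / l2) ^ N * (nrm n (V c1 c2) + nrm n (V c1 c2))"
    using l u \<delta>_pos w_pos l2_pos by (intro mult_left_mono) auto
  finally show ?thesis by (simp add: \<epsilon>_def)
qed

text \<open>Overlaps are only scaled by non-zero factors, so a vanishing image would need vanishing
  start overlaps, against the determinant. This excludes a loss of rank at any number of
  iterations.\<close>

lemma V_nonzero:
  assumes "c1 \<noteq> 0 \<or> c2 \<noteq> 0" shows "ip n (V c1 c2) (V c1 c2) > 0"
proof (rule ccontr)
  assume "\<not> ?thesis"
  then have "ip n (V c1 c2) (V c1 c2) = 0" using ip_self_nonneg[of n "V c1 c2"] by linarith
  then have "ip n u1 (V c1 c2) = 0 \<and> ip n u2 (V c1 c2) = 0"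
    using pythagoras[of "V c1 c2"] ip_self_nonneg[of n "perp (V c1 c2)"] zero_le_power2[of "ip n u1 (V c1 c2)"] zero_le_power2[of "ip n u2 (V c1 c2)"]
    by (smt (verit) zero_eq_power2)
  then have g: "c1 * ip n u1 y1 + c2 * ip n u1 y2 = 0" "c1 * ip n u2 y1 + c2 * ip n u2 y2 = 0"
    using l2_pos unfolding V_def ip_u_power ip_linear by auto
  let ?D = "ip n u1 y1 * ip n u2 y2 - ip n u2 y1 * ip n u1 y2"
  have "c1 * ?D = ip n u2 y2 * (c1 * ip n u1 y1 + c2 * ip n u1 y2) - ip n u1 y2 * (c1 * ip n u2 y1 + c2 * ip n u2 y2)"
       "c2 * ?D = ip n u1 y1 * (c1 * ip n u2 y1 + c2 * ip n u2 y2) - ip n u2 y1 * (c1 * ip n u1 y1 + c2 * ip n u1 y2)"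
    by (simp_all add: algebra_simps)
  then have "c1 * ?D = 0" "c2 * ?D = 0" unfolding g by simp_all
  then show False using det_ge \<delta>_pos assms by auto
qed

text \<open>The minimiser is compared with a vector of the subspace orthogonal to \<open>u1\<close>,
  whose quotient is at most \<open>l2 + w * \<epsilon>^2\<close>. A component \<open>s\<close> along
  \<open>u1\<close> raises the quotient by about \<open>(l1 - l2) * s^2\<close>, so \<open>s\<close>
  is of order \<open>\<epsilon>\<close>, and the unit norm forces the rest onto
  \<open>u2\<close>.\<close>

lemma ritz_vector:
  assumes unit: "ip n (V c1 c2) (V c1 c2) = 1" and eps: "\<epsilon> \<le> 1"
    and min: "\<And>d1 d2. ip n (V c1 c2) (mv n A (V c1 c2)) * ip n (V d1 d2) (V d1 d2) \<le> ip n (V d1 d2) (mv n A (V d1 d2))"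
  obtains \<sigma> :: real where "\<sigma> = 1 \<or> \<sigma> = -1" "\<And>i. i < n \<Longrightarrow> \<bar>V c1 c2 i - \<sigma> * u2 i\<bar> \<le> \<epsilon> * (3 + 2 * ((2 * w + l2) / (l1 - l2)))"
proof -
  define v where "v = V c1 c2"
  \<comment> \<open>These coefficients cancel the overlap with \<open>u1\<close>; the determinant
    shows that they are not both zero.\<close>
  define v' where "v' = V (ip n u1 y2) (- ip n u1 y1)"
  have gap: "l1 - l2 > 0" using l1_ge l2_bounds ab_gap w_pos by linarith
  have pp: "ip n (perp (V d1 d2)) (perp (V d1 d2)) \<le> \<epsilon>\<^sup>2 * ip n (V d1 d2) (V d1 d2)" for d1 d2
    using power_mono[OF perp_V[of d1 d2], of 2] by (simp add: nrm_power2 power_mult_distrib)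
  have "ip n u1 y1 \<noteq> 0 \<or> ip n u1 y2 \<noteq> 0" using det_ge \<delta>_pos by auto
  then have v'0: "ip n v' v' > 0" unfolding v'_def by (intro V_nonzero) auto
  have "ip n u1 v' = 0" by (simp add: v'_def V_def ip_u_power ip_linear)
  then have "ip n v' v' = ip n (perp v') (perp v') + (ip n u2 v')\<^sup>2"
    "ip n v' (mv n A v') = ip n (perp v') (mv n A (perp v')) + l2 * (ip n u2 v')\<^sup>2"
    using pythagoras[of v'] ip_A_decomp[of v'] by simp_all
  then have "ip n v' (mv n A v') \<le> w * ip n (perp v') (perp v') + l2 * ip n v' v'"
    using abs_le_D1[OF perp_quadratic[of v']] mult_nonneg_nonneg[OF less_imp_le[OF l2_pos(1)] ip_self_nonneg[of n "perp v'"]]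
    by (simp add: distrib_left)
  also have "\<dots> \<le> w * (\<epsilon>\<^sup>2 * ip n v' v') + l2 * ip n v' v'"
    using w_pos pp unfolding v'_def by (intro add_right_mono mult_left_mono) auto
  finally have "ip n v' (mv n A v') \<le> (w * \<epsilon>\<^sup>2 + l2) * ip n v' v'" by (simp add: algebra_simps)
  with min[of "ip n u1 y2" "- ip n u1 y1"] have "ip n v (mv n A v) * ip n v' v' \<le> (w * \<epsilon>\<^sup>2 + l2) * ip n v' v'"
    unfolding v_def v'_def by linarith
  then have up: "ip n v (mv n A v) \<le> w * \<epsilon>\<^sup>2 + l2" using v'0 by simp
  define s t where "s = ip n u1 v" and "t = ip n u2 v"
  have ppv: "ip n (perp v) (perp v) \<le> \<epsilon>\<^sup>2" using pp[of c1 c2] unit by (simp add: v_def)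
  have st: "ip n (perp v) (perp v) + s\<^sup>2 + t\<^sup>2 = 1" using pythagoras[of v] unit by (simp add: v_def s_def t_def)
  have "ip n v (mv n A v) \<ge> - w * \<epsilon>\<^sup>2 + l1 * s\<^sup>2 + l2 * t\<^sup>2"
    using ip_A_decomp[of v] abs_le_D2[OF perp_quadratic[of v]] mult_left_mono[OF ppv less_imp_le[OF w_pos]]
    unfolding s_def t_def by linarith
  with up have "l1 * s\<^sup>2 + l2 * t\<^sup>2 \<le> 2 * w * \<epsilon>\<^sup>2 + l2" by simp
  moreover have "l2 * t\<^sup>2 \<ge> l2 * (1 - s\<^sup>2 - \<epsilon>\<^sup>2)" using st ppv l2_pos by (intro mult_left_mono) auto
  ultimately have "(l1 - l2) * s\<^sup>2 \<le> (2 * w + l2) * \<epsilon>\<^sup>2" by (simp add: algebra_simps)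
  define K where "K = (2 * w + l2) / (l1 - l2)"
  have K0: "K \<ge> 0" using w_pos l2_pos gap by (simp add: K_def)
  have s2: "s\<^sup>2 \<le> K * \<epsilon>\<^sup>2" using \<open>(l1 - l2) * s\<^sup>2 \<le> _\<close> gap by (simp add: K_def field_simps)
  \<comment> \<open>The square root of \<open>K\<close> is replaced by the larger
    \<open>1 + K\<close>.\<close>
  have sa: "\<bar>s\<bar> \<le> (1 + K) * \<epsilon>"
  proof (rule power2_le_imp_le)
    have "K * \<epsilon>\<^sup>2 \<le> (1 + K)\<^sup>2 * \<epsilon>\<^sup>2" using K0 by (intro mult_right_mono) (auto simp: power2_eq_square algebra_simps)
    then show "\<bar>s\<bar>\<^sup>2 \<le> ((1 + K) * \<epsilon>)\<^sup>2" using s2 by (simp add: power_mult_distrib)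
  qed (use K0 eps_nonneg in auto)
  have e2: "\<epsilon>\<^sup>2 \<le> \<epsilon>" using eps eps_nonneg by (simp add: power2_eq_square mult_left_le_one_le)
  define \<sigma> where "\<sigma> = (if t \<ge> 0 then 1 else -1 :: real)"
  have t1: "\<bar>t\<bar> \<le> 1" 
  proof -
    have "t\<^sup>2 \<le> 1" using st ip_self_nonneg[of n "perp v"] zero_le_power2[of s] by linarith
    then show ?thesis by (simp add: abs_square_le_1)
  qed
  have "t\<^sup>2 \<ge> 1 - \<epsilon> - K * \<epsilon>" using st ppv s2 e2 mult_left_mono[OF e2 K0] by linarith
  moreover have "t\<^sup>2 \<le> \<bar>t\<bar>" using mult_right_mono[OF t1, of "\<bar>t\<bar>"] by (simp add: power2_eq_square)
  \<comment> \<open>As \<open>\<bar>t\<bar> <= 1\<close>, the distance of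
    \<open>\<bar>t\<bar>\<close> from 1 is at most \<open>1 - t^2\<close>.\<close>
  ultimately have ta: "\<bar>t - \<sigma>\<bar> \<le> \<epsilon> + K * \<epsilon>" using t1 by (auto simp: \<sigma>_def abs_if split: if_splits)
  show thesis
  proof (rule that[of \<sigma>])
    show "\<sigma> = 1 \<or> \<sigma> = -1" by (simp add: \<sigma>_def)
    fix i assume i: "i < n"
    have u1i: "\<bar>u1 i\<bar> \<le> 1" "\<bar>u2 i\<bar> \<le> 1" using abs_le_nrm[OF i, of u1] abs_le_nrm[OF i, of u2] by (simp_all add: nrm_def u_simps)
    have "nrm n (perp v) \<le> \<epsilon>" using perp_V[of c1 c2] unit by (simp add: v_def nrm_def)
    then have p: "\<bar>perp v i\<bar> \<le> \<epsilon>" using abs_le_nrm[OF i, of "perp v"] by simp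
    have "v i - \<sigma> * u2 i = perp v i + s * u1 i + (t - \<sigma>) * u2 i"
      using fun_cong[OF decomp[of v], of i] by (simp add: s_def t_def algebra_simps)
    also have "\<bar>\<dots>\<bar> \<le> \<bar>perp v i\<bar> + \<bar>s\<bar> * \<bar>u1 i\<bar> + \<bar>t - \<sigma>\<bar> * \<bar>u2 i\<bar>"
      by (simp add: abs_mult[symmetric])
    also have "\<dots> \<le> \<bar>perp v i\<bar> + \<bar>s\<bar> * 1 + \<bar>t - \<sigma>\<bar> * 1"
      using u1i by (intro add_mono mult_left_mono) auto
    also have "\<dots> \<le> \<epsilon> + (1 + K) * \<epsilon> + (\<epsilon> + K * \<epsilon>)" using p sa ta by simp
    also have "\<dots> = \<epsilon> * (3 + 2 * K)" by (simp add: algebra_simps)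
    finally show "\<bar>V c1 c2 i - \<sigma> * u2 i\<bar> \<le> \<epsilon> * (3 + 2 * ((2 * w + l2) / (l1 - l2)))" by (simp add: v_def K_def)
  qed
qed

end

section \<open>Operator norm from discrepancy\<close>

definition iv :: "bool \<Rightarrow> real" where
  "iv P = (if P then 1 else 0)"

lemma iv_simps [simp]: "iv True = 1" "iv False = 0" "iv P \<ge> 0" "iv P * iv P = iv P" "\<bar>iv P\<bar> = iv P"
  by (auto simp: iv_def)

lemma sum_iv:
  "finite A \<Longrightarrow> (\<Sum>s\<in>A. iv (P s)) = real (card {s \<in> A. P s})"
  "finite A \<Longrightarrow> (\<Sum>s\<in>A. iv (P s) * f s) = sum f {s \<in> A. P s}"
  by (simp_all add: iv_def sum.If_cases Int_def if_distrib[of "\<lambda>z. z * _"] cong: if_cong)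

lemma sum_fst_snd:
  "(\<Sum>i\<in>X. \<Sum>j\<in>Y. h i j) = (\<Sum>p\<in>X\<times>Y. h (fst p) (snd p))"
  by (simp add: sum.cartesian_product case_prod_unfold)

lemma sum_swap_four:
  "(\<Sum>i\<in>A. \<Sum>j\<in>B. \<Sum>s\<in>C. \<Sum>t\<in>D. f i j s t) = (\<Sum>s\<in>C. \<Sum>t\<in>D. \<Sum>i\<in>A. \<Sum>j\<in>B. f i j s t)"
  unfolding sum_fst_snd[where X=C and Y=D] sum_fst_snd[where X=A and Y=B] by (rule sum.swap)

lemma card_le_real:
  fixes z :: real assumes "z \<ge> 0" shows "real (card {t \<in> {1..m::nat}. real t \<le> z}) \<le> z"
proof -
  have "{t \<in> {1..m}. real t \<le> z} \<subseteq> {1..nat \<lfloor>z\<rfloor>}" by (auto simp: le_nat_iff le_floor_iff)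
  then have "card {t \<in> {1..m}. real t \<le> z} \<le> card {1..nat \<lfloor>z\<rfloor>}" by (intro card_mono) auto
  then have "real (card {t \<in> {1..m}. real t \<le> z}) \<le> real (nat \<lfloor>z\<rfloor>)" by simp
  also have "\<dots> \<le> z" using assms by simp
  finally show ?thesis .
qed

lemma layer_sum:
  assumes "k \<le> m" shows "real k = (\<Sum>s\<in>{1..m}. iv (s \<le> k))"
proof -
  have "{s \<in> {1..m}. s \<le> k} = {1..k}" using assms by auto
  then show ?thesis by (simp add: sum_iv)
qed

lemma layer_sum_weighted:
  assumes "k \<le> m" shows "(\<Sum>s\<in>{1..m}. real s * iv (s \<le> k)) \<le> (real k)\<^sup>2"
proof -
  have "(\<Sum>s\<in>{1..m}. real s * iv (s \<le> k)) \<le> (\<Sum>s\<in>{1..m}. real k * iv (s \<le> k))"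
    by (intro sum_mono) (auto simp: iv_def)
  also have "\<dots> = (real k)\<^sup>2" using layer_sum[OF assms] by (simp add: sum_distrib_left[symmetric] power2_eq_square)
  finally show ?thesis .
qed

text \<open>Weighted arithmetic-geometric mean. With \<open>r\<close> the ratio of two levels it
  distributes a discrepancy bound over the two level sets.\<close>

lemma sqrt_mult_le:
  fixes a b r :: real assumes "a \<ge> 0" "b \<ge> 0" "r > 0"
  shows "sqrt (a * b) \<le> (a * r + b / r) / 2"
proof -
  have "sqrt (a * b) = sqrt ((a * r) * (b / r))" using assms by simp
  also have "\<dots> \<le> (a * r + b / r) / 2" using assms by (intro arith_geo_mean_sqrt) auto
  finally show ?thesis .
qed

text \<open>Setting of a converse to the expander mixing lemma: sums over rectangles and row sums
  together bound the norm. \<open>R\<close> is the free ratio at which pairs of levels are cut; one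
  single cut costs powers of \<open>R\<close>, which is affordable here.\<close>

locale discrepancy =
  fixes n :: nat and W :: "nat \<Rightarrow> nat \<Rightarrow> real" and D l R :: real
  assumes W_sym: "sym n W" and D_nonneg: "D \<ge> 0" and R_ge: "R \<ge> 1"
    and row: "\<And>i. i < n \<Longrightarrow> (\<Sum>j<n. \<bar>W i j\<bar>) \<le> l"
    and disc: "\<And>S T. S \<subseteq> {..<n} \<Longrightarrow> T \<subseteq> {..<n} \<Longrightarrow>
      \<bar>\<Sum>i\<in>S. \<Sum>j\<in>T. W i j\<bar> \<le> D * sqrt (real (card S) * real (card T))"
begin

lemma col: "j < n \<Longrightarrow> (\<Sum>i<n. \<bar>W i j\<bar>) \<le> l"
  using row[of j] W_sym by (simp add: sym_def)

definition bil :: "(nat \<Rightarrow> real) \<Rightarrow> (nat \<Rightarrow> real) \<Rightarrow> real" where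
  "bil f g = (\<Sum>i<n. \<Sum>j<n. f i * W i j * g j)"

definition sq :: "(nat \<Rightarrow> real) \<Rightarrow> real" where
  "sq f = (\<Sum>i<n. (f i)\<^sup>2)"

text \<open>Below a level \<open>t\<close> at most \<open>t / R\<close> levels \<open>s\<close>
  satisfy \<open>R * s <= t\<close>. The sum over levels at \<open>j\<close> is thus at most
  \<open>y j ^ 2 / R\<close>, and the absolute column sums contribute \<open>l\<close>.\<close>

lemma far_bound:
  fixes y :: "nat \<Rightarrow> nat"
  assumes "\<And>i. i < n \<Longrightarrow> y i \<le> m"
  shows "(\<Sum>i<n. \<Sum>j<n. \<bar>W i j\<bar> * (\<Sum>t\<in>{1..m}. \<Sum>s\<in>{1..m}. iv (R * real s \<le> real t) * iv (t \<le> y j))) \<le> l / R * sq (\<lambda>j. y j)"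
proof -
  have inner: "(\<Sum>t\<in>{1..m}. \<Sum>s\<in>{1..m}. iv (R * real s \<le> real t) * iv (t \<le> y j)) \<le> (real (y j))\<^sup>2 / R" if "j < n" for j
  proof -
    have "(\<Sum>s\<in>{1..m}. iv (R * real s \<le> real t)) \<le> real t / R" for t
    proof -
      have "(\<Sum>s\<in>{1..m}. iv (R * real s \<le> real t)) = real (card {s \<in> {1..m}. real s \<le> real t / R})"
        using R_ge by (simp add: sum_iv pos_le_divide_eq mult.commute)
      also have "\<dots> \<le> real t / R" using R_ge by (intro card_le_real) simp
      finally show ?thesis .
    qed
    then have "(\<Sum>t\<in>{1..m}. \<Sum>s\<in>{1..m}. iv (R * real s \<le> real t) * iv (t \<le> y j)) \<le> (\<Sum>t\<in>{1..m}. real t / R * iv (t \<le> y j))"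
      unfolding sum_distrib_right[symmetric] by (intro sum_mono mult_right_mono) auto
    also have "\<dots> = (\<Sum>t\<in>{1..m}. real t * iv (t \<le> y j)) / R" by (simp add: sum_divide_distrib)
    also have "\<dots> \<le> (real (y j))\<^sup>2 / R" using R_ge assms[OF that] by (intro divide_right_mono layer_sum_weighted) auto
    finally show ?thesis .
  qed
  have "(\<Sum>i<n. \<Sum>j<n. \<bar>W i j\<bar> * (\<Sum>t\<in>{1..m}. \<Sum>s\<in>{1..m}. iv (R * real s \<le> real t) * iv (t \<le> y j)))
    \<le> (\<Sum>i<n. \<Sum>j<n. \<bar>W i j\<bar> * ((real (y j))\<^sup>2 / R))"
    by (intro sum_mono mult_left_mono inner) auto
  also have "\<dots> = (\<Sum>j<n. (\<Sum>i<n. \<bar>W i j\<bar>) * ((real (y j))\<^sup>2 / R))"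
    unfolding sum_distrib_right by (rule sum.swap)
  also have "\<dots> \<le> (\<Sum>j<n. l * ((real (y j))\<^sup>2 / R))"
    using R_ge by (intro sum_mono mult_right_mono col) auto
  also have "\<dots> = l / R * sq (\<lambda>j. y j)" by (simp add: sq_def sum_distrib_left)
  finally show ?thesis .
qed

text \<open>For each \<open>s\<close> at most \<open>R * s\<close> levels \<open>t\<close> are near,
  each with \<open>s / t <= R\<close>. Summed over the level sets, the remaining factor
  \<open>s\<close> gives back at most the squares.\<close>

lemma near_bound:
  fixes x :: "nat \<Rightarrow> nat"
  assumes "\<And>i. i < n \<Longrightarrow> x i \<le> m"
  shows "(\<Sum>s\<in>{1..m}. \<Sum>t\<in>{1..m}. iv (real t \<le> R * s \<and> real s \<le> R * t) * (real (card {i. i < n \<and> s \<le> x i}) * (real s / real t))) \<le> R\<^sup>2 * sq (\<lambda>i. x i)"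
proof -
  have "(\<Sum>t\<in>{1..m}. iv (real t \<le> R * s \<and> real s \<le> R * t) * (c * (real s / real t))) \<le> c * (R\<^sup>2 * s)" if "c \<ge> 0" for c s
  proof -
    have "(\<Sum>t\<in>{1..m}. iv (real t \<le> R * s \<and> real s \<le> R * t) * (c * (real s / real t))) \<le> (\<Sum>t\<in>{1..m}. iv (real t \<le> R * s) * (c * R))"
    proof (intro sum_mono)
      fix t assume "t \<in> {1..m}"
      then have "real s / real t \<le> R" if "real s \<le> R * t" using that by (simp add: divide_le_eq)
      then show "iv (real t \<le> R * s \<and> real s \<le> R * t) * (c * (real s / real t)) \<le> iv (real t \<le> R * s) * (c * R)"
        using that R_ge by (auto simp: iv_def intro!: mult_left_mono simp del: times_divide_eq_right)
    qed
    also have "\<dots> = c * R * real (card {t \<in> {1..m}. real t \<le> R * s})"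
      unfolding sum_distrib_right[symmetric] by (simp add: sum_iv)
    also have "\<dots> \<le> c * R * (R * s)" using that R_ge by (intro mult_left_mono card_le_real) auto
    finally show ?thesis by (simp add: power2_eq_square mult_ac)
  qed
  then have "(\<Sum>s\<in>{1..m}. \<Sum>t\<in>{1..m}. iv (real t \<le> R * s \<and> real s \<le> R * t) * (real (card {i. i < n \<and> s \<le> x i}) * (real s / real t)))
     \<le> (\<Sum>s\<in>{1..m}. real (card {i. i < n \<and> s \<le> x i}) * (R\<^sup>2 * s))" by (intro sum_mono) auto
  also have "\<dots> = (\<Sum>s\<in>{1..m}. \<Sum>i<n. R\<^sup>2 * (real s * iv (s \<le> x i)))"
    by (intro sum.cong refl) (simp add: sum_iv sum_distrib_left[symmetric] mult_ac lessThan_def)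
  also have "\<dots> = R\<^sup>2 * (\<Sum>i<n. \<Sum>s\<in>{1..m}. real s * iv (s \<le> x i))"
    unfolding sum_distrib_left by (rule sum.swap)
  also have "\<dots> \<le> R\<^sup>2 * sq (\<lambda>i. x i)"
    unfolding sq_def using assms by (intro mult_left_mono sum_mono layer_sum_weighted) auto
  finally show ?thesis .
qed

text \<open>Layer-cake decomposition: level sets of \<open>x\<close> and \<open>y\<close> whose levels differ by a factor of at most \<open>R\<close> are
handled by the discrepancy bound, all others by the row sums.\<close>

lemma nat_bound:
  fixes x y :: "nat \<Rightarrow> nat"
  shows "\<bar>bil (\<lambda>i. x i) (\<lambda>i. y i)\<bar> \<le> (D * R\<^sup>2 / 2 + l / R) * (sq (\<lambda>i. x i) + sq (\<lambda>i. y i))"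
proof -
  define m where "m = Max (insert 0 (x ` {..<n} \<union> y ` {..<n}))"
  have m: "x i \<le> m" "y i \<le> m" if "i < n" for i using that by (auto simp: m_def intro!: Max_ge)
  define B where "B s t i j = iv (s \<le> x i) * iv (t \<le> y j) * W i j" for s t i j
  define F where "F s t = (\<Sum>i<n. \<Sum>j<n. B s t i j)" for s t
  define near where "near s t \<longleftrightarrow> real t \<le> R * real s \<and> real s \<le> R * real t" for s t
  have "bil (\<lambda>i. x i) (\<lambda>i. y i) = (\<Sum>i<n. \<Sum>j<n. \<Sum>s\<in>{1..m}. \<Sum>t\<in>{1..m}. B s t i j)"
    unfolding bil_def
  proof (intro sum.cong refl)
    fix i j assume "i \<in> {..<n}" "j \<in> {..<n}"
    then have "real (x i) * W i j * real (y j) = (\<Sum>s\<in>{1..m}. iv (s \<le> x i)) * W i j * (\<Sum>t\<in>{1..m}. iv (t \<le> y j))"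
      using m layer_sum by (metis lessThan_iff)
    then show "real (x i) * W i j * real (y j) = (\<Sum>s\<in>{1..m}. \<Sum>t\<in>{1..m}. B s t i j)"
      unfolding sum_distrib_left sum_distrib_right B_def by (subst sum.swap) (simp add: mult_ac)
  qed
  also have "\<dots> = (\<Sum>s\<in>{1..m}. \<Sum>t\<in>{1..m}. F s t)"
    unfolding F_def by (rule sum_swap_four)
  also have "\<dots> = (\<Sum>s\<in>{1..m}. \<Sum>t\<in>{1..m}. iv (near s t) * F s t) + (\<Sum>s\<in>{1..m}. \<Sum>t\<in>{1..m}. iv (\<not> near s t) * F s t)"
    unfolding sum.distrib[symmetric] by (intro sum.cong refl) (simp add: iv_def)
  finally have bil_eq: "bil (\<lambda>i. x i) (\<lambda>i. y i) = (\<Sum>s\<in>{1..m}. \<Sum>t\<in>{1..m}. iv (near s t) * F s t) + (\<Sum>s\<in>{1..m}. \<Sum>t\<in>{1..m}. iv (\<not> near s t) * F s t)" .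
  have "\<bar>bil (\<lambda>i. x i) (\<lambda>i. y i)\<bar> \<le> (\<Sum>s\<in>{1..m}. \<Sum>t\<in>{1..m}. iv (near s t) * \<bar>F s t\<bar>) + (\<Sum>s\<in>{1..m}. \<Sum>t\<in>{1..m}. iv (\<not> near s t) * \<bar>F s t\<bar>)"
  proof -
    have "\<bar>\<Sum>s\<in>{1..m}. \<Sum>t\<in>{1..m}. iv (P s t) * F s t\<bar> \<le> (\<Sum>s\<in>{1..m}. \<Sum>t\<in>{1..m}. iv (P s t) * \<bar>F s t\<bar>)" for P
      by (rule order.trans[OF sum_abs sum_mono], rule order.trans[OF sum_abs sum_mono]) (simp add: abs_mult)
    from this[of near] this[of "\<lambda>s t. \<not> near s t"] show ?thesis
      unfolding bil_eq by linarith
  qed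
  moreover have "(\<Sum>s\<in>{1..m}. \<Sum>t\<in>{1..m}. iv (near s t) * \<bar>F s t\<bar>) \<le> D * R\<^sup>2 / 2 * (sq (\<lambda>i. x i) + sq (\<lambda>i. y i))"
  proof -
    define a b where "a s = real (card {i. i < n \<and> s \<le> x i})" and "b s = real (card {i. i < n \<and> s \<le> y i})" for s
    have F: "\<bar>F s t\<bar> \<le> D / 2 * (a s * (real s / real t) + b t * (real t / real s))" if "s \<ge> 1" "t \<ge> 1" for s t
    proof -
      have "F s t = (\<Sum>i<n. iv (s \<le> x i) * (\<Sum>j<n. iv (t \<le> y j) * W i j))"
        by (simp add: F_def B_def sum_distrib_left mult.assoc)
      also have "\<dots> = (\<Sum>i\<in>{i. i < n \<and> s \<le> x i}. \<Sum>j\<in>{j. j < n \<and> t \<le> y j}. W i j)"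
        by (simp add: sum_iv lessThan_def)
      finally have "\<bar>F s t\<bar> \<le> D * sqrt (a s * b t)" unfolding a_def b_def using disc by (simp add: subset_iff)
      \<comment> \<open>The ratio \<open>s / t\<close> is the weight for which
        \<open>near_bound\<close> sums both resulting terms.\<close>
      also have "\<dots> \<le> D * ((a s * (real s / real t) + b t / (real s / real t)) / 2)"
        using that D_nonneg by (intro mult_left_mono sqrt_mult_le) (auto simp: a_def b_def)
      finally show ?thesis by (simp add: field_simps)
    qed
    have "(\<Sum>s\<in>{1..m}. \<Sum>t\<in>{1..m}. iv (near s t) * \<bar>F s t\<bar>) \<le> (\<Sum>s\<in>{1..m}. \<Sum>t\<in>{1..m}. iv (near s t) * (D / 2 * (a s * (real s / real t) + b t * (real t / real s))))"
      using F by (intro sum_mono mult_left_mono) auto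
    also have "\<dots> = D / 2 * ((\<Sum>s\<in>{1..m}. \<Sum>t\<in>{1..m}. iv (near s t) * (a s * (real s / real t))) + (\<Sum>s\<in>{1..m}. \<Sum>t\<in>{1..m}. iv (near s t) * (b t * (real t / real s))))"
      unfolding sum.distrib[symmetric] sum_distrib_left by (intro sum.cong refl) (simp add: distrib_left mult_ac)
    also have "(\<Sum>s\<in>{1..m}. \<Sum>t\<in>{1..m}. iv (near s t) * (b t * (real t / real s))) = (\<Sum>t\<in>{1..m}. \<Sum>s\<in>{1..m}. iv (near t s) * (b t * (real t / real s)))"
      by (subst sum.swap) (simp add: near_def conj_commute)
    also have "D / 2 * ((\<Sum>s\<in>{1..m}. \<Sum>t\<in>{1..m}. iv (near s t) * (a s * (real s / real t))) + \<dots>) \<le> D / 2 * (R\<^sup>2 * sq (\<lambda>i. x i) + R\<^sup>2 * sq (\<lambda>i. y i))"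
      unfolding near_def a_def b_def using m D_nonneg by (intro mult_left_mono add_mono near_bound) auto
    finally show ?thesis by (simp add: algebra_simps)
  qed
  moreover have "(\<Sum>s\<in>{1..m}. \<Sum>t\<in>{1..m}. iv (\<not> near s t) * \<bar>F s t\<bar>) \<le> l / R * sq (\<lambda>i. x i) + l / R * sq (\<lambda>i. y i)"
  proof -
    define G where "G i j s t = \<bar>W i j\<bar> * (iv (R * real s \<le> real t) * iv (t \<le> y j)) + \<bar>W i j\<bar> * (iv (R * real t \<le> real s) * iv (s \<le> x i))" for i j s t
    have "iv (\<not> near s t) * \<bar>F s t\<bar> \<le> (\<Sum>i<n. \<Sum>j<n. G i j s t)" for s t
    proof -
      have "iv (\<not> near s t) * \<bar>F s t\<bar> \<le> iv (\<not> near s t) * (\<Sum>i<n. \<Sum>j<n. \<bar>B s t i j\<bar>)"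
        unfolding F_def by (intro mult_left_mono order.trans[OF sum_abs sum_mono[OF sum_abs]]) auto
      also have "\<dots> \<le> (\<Sum>i<n. \<Sum>j<n. G i j s t)"
        unfolding sum_distrib_left by (intro sum_mono) (auto simp: B_def G_def near_def iv_def abs_mult)
      finally show ?thesis .
    qed
    then have "(\<Sum>s\<in>{1..m}. \<Sum>t\<in>{1..m}. iv (\<not> near s t) * \<bar>F s t\<bar>) \<le> (\<Sum>s\<in>{1..m}. \<Sum>t\<in>{1..m}. \<Sum>i<n. \<Sum>j<n. G i j s t)"
      by (intro sum_mono)
    also have "\<dots> = (\<Sum>i<n. \<Sum>j<n. \<Sum>s\<in>{1..m}. \<Sum>t\<in>{1..m}. G i j s t)"
      by (rule sum_swap_four)
    also have "\<dots> = (\<Sum>i<n. \<Sum>j<n. \<bar>W i j\<bar> * (\<Sum>t\<in>{1..m}. \<Sum>s\<in>{1..m}. iv (R * real s \<le> real t) * iv (t \<le> y j)))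
       + (\<Sum>i<n. \<Sum>j<n. \<bar>W i j\<bar> * (\<Sum>s\<in>{1..m}. \<Sum>t\<in>{1..m}. iv (R * real t \<le> real s) * iv (s \<le> x i)))"
      unfolding G_def sum.distrib sum_distrib_left[symmetric] by (subst sum.swap[of _ "{1..m}" "{1..m}"]) simp
    also have "(\<Sum>i<n. \<Sum>j<n. \<bar>W i j\<bar> * (\<Sum>s\<in>{1..m}. \<Sum>t\<in>{1..m}. iv (R * real t \<le> real s) * iv (s \<le> x i)))
       = (\<Sum>j<n. \<Sum>i<n. \<bar>W j i\<bar> * (\<Sum>s\<in>{1..m}. \<Sum>t\<in>{1..m}. iv (R * real t \<le> real s) * iv (s \<le> x i)))"
      using W_sym by (subst sum.swap) (auto simp: sym_def intro!: sum.cong)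
    also have "(\<Sum>i<n. \<Sum>j<n. \<bar>W i j\<bar> * (\<Sum>t\<in>{1..m}. \<Sum>s\<in>{1..m}. iv (R * real s \<le> real t) * iv (t \<le> y j))) + \<dots>
      \<le> l / R * sq (\<lambda>i. y i) + l / R * sq (\<lambda>i. x i)"
      using m by (intro add_mono far_bound) auto
    finally show ?thesis by simp
  qed
  ultimately show ?thesis by (simp add: algebra_simps)
qed

lemma bil_diff:
  "bil (\<lambda>i. f i - f' i) (\<lambda>i. g i - g' i) = bil f g - bil f g' - bil f' g + bil f' g'"
  unfolding bil_def sum.distrib[symmetric] sum_subtractf[symmetric]
  by (intro sum.cong refl) (simp add: algebra_simps)

text \<open>Positive and negative parts give four non-negative forms, while the sums of squares
  simply add up because the parts have disjoint supports. The price is a factor 2.\<close>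

lemma int_bound:
  fixes x y :: "nat \<Rightarrow> int"
  shows "\<bar>bil (\<lambda>i. x i) (\<lambda>i. y i)\<bar> \<le> 2 * (D * R\<^sup>2 / 2 + l / R) * (sq (\<lambda>i. x i) + sq (\<lambda>i. y i))"
proof -
  let ?c = "D * R\<^sup>2 / 2 + l / R"
  define p q p' q' where "p i = nat (x i)" and "q i = nat (- x i)" and "p' i = nat (y i)" and "q' i = nat (- y i)" for i
  have "real_of_int (x i) = real (p i) - real (q i)" "real_of_int (y i) = real (p' i) - real (q' i)" for i
    by (auto simp: p_def q_def p'_def q'_def)
  then have "bil (\<lambda>i. x i) (\<lambda>i. y i) = bil p p' - bil p q' - bil q p' + bil q q'"
    by (simp add: bil_diff)
  moreover have sq_eq: "sq (\<lambda>i. x i) = sq p + sq q" "sq (\<lambda>i. y i) = sq p' + sq q'"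
  proof -
    have "(real_of_int z)\<^sup>2 = (real (nat z))\<^sup>2 + (real (nat (- z)))\<^sup>2" for z by (cases "z \<ge> 0") auto
    then show "sq (\<lambda>i. x i) = sq p + sq q" "sq (\<lambda>i. y i) = sq p' + sq q'"
      by (simp_all add: sq_def sum.distrib[symmetric] p_def q_def p'_def q'_def)
  qed
  moreover have "2 * ?c * (sq p + sq q + (sq p' + sq q')) = ?c * (sq p + sq p') + ?c * (sq p + sq q') + ?c * (sq q + sq p') + ?c * (sq q + sq q')"
    by (simp only: ring_distribs) simp
  ultimately show ?thesis
    using nat_bound[of p p'] nat_bound[of p q'] nat_bound[of q p'] nat_bound[of q q'] unfolding sq_eq by linarith
qed

text \<open>Both sides are homogeneous of degree two, so the integer bound holds with the same
  constant on every grid of mesh \<open>1 / K\<close> and passes to the limit.\<close>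

lemma real_bound: "\<bar>bil x y\<bar> \<le> 2 * (D * R\<^sup>2 / 2 + l / R) * (sq x + sq y)"
proof -
  have fl: "(\<lambda>k. real_of_int \<lfloor>real (Suc k) * z\<rfloor> / real (Suc k)) \<longlonglongrightarrow> z" for z :: real
  proof (rule tendsto_sandwich)
    have "z - 1 / K \<le> real_of_int \<lfloor>K * z\<rfloor> / K" if "K > 0" for K :: real
    proof -
      have "K * z - 1 \<le> real_of_int \<lfloor>K * z\<rfloor>" by linarith
      then have "(K * z - 1) / K \<le> real_of_int \<lfloor>K * z\<rfloor> / K" using that by (simp add: divide_right_mono)
      then show ?thesis using that by (simp add: diff_divide_distrib)
    qed
    then show "\<forall>\<^sub>F k in sequentially. z - 1 / real (Suc k) \<le> real_of_int \<lfloor>real (Suc k) * z\<rfloor> / real (Suc k)"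
      by (intro always_eventually allI) simp
    show "\<forall>\<^sub>F k in sequentially. real_of_int \<lfloor>real (Suc k) * z\<rfloor> / real (Suc k) \<le> z"
      by (intro always_eventually allI) (simp add: field_simps)
    show "(\<lambda>k. z - 1 / real (Suc k)) \<longlonglongrightarrow> z"
      using tendsto_diff[OF tendsto_const LIMSEQ_inverse_real_of_nat, of z] by (simp add: inverse_eq_divide)
  qed simp
  define X Y where "X k i = real_of_int \<lfloor>real (Suc k) * x i\<rfloor> / real (Suc k)" and "Y k i = real_of_int \<lfloor>real (Suc k) * y i\<rfloor> / real (Suc k)" for k i
  have XY: "(\<lambda>k. X k i) \<longlonglongrightarrow> x i" "(\<lambda>k. Y k i) \<longlonglongrightarrow> y i" for i
    unfolding X_def Y_def by (rule fl)+
  have "(\<lambda>k. \<bar>bil (X k) (Y k)\<bar>) \<longlonglongrightarrow> \<bar>bil x y\<bar>"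
    unfolding bil_def by (intro tendsto_intros XY)
  moreover have "(\<lambda>k. 2 * (D * R\<^sup>2 / 2 + l / R) * (sq (X k) + sq (Y k))) \<longlonglongrightarrow> 2 * (D * R\<^sup>2 / 2 + l / R) * (sq x + sq y)"
    unfolding sq_def by (intro tendsto_intros XY)
  moreover have "\<bar>bil (X k) (Y k)\<bar> \<le> 2 * (D * R\<^sup>2 / 2 + l / R) * (sq (X k) + sq (Y k))" for k
  proof -
    define K where "K = real (Suc k)"
    have K: "K > 0" by (simp add: K_def)
    have b: "bil (X k) (Y k) = bil (\<lambda>i. \<lfloor>K * x i\<rfloor>) (\<lambda>i. \<lfloor>K * y i\<rfloor>) / K\<^sup>2"
      unfolding bil_def X_def Y_def K_def[symmetric] sum_divide_distrib by (simp add: power2_eq_square mult_ac)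
    have s: "sq (X k) = sq (\<lambda>i. \<lfloor>K * x i\<rfloor>) / K\<^sup>2" "sq (Y k) = sq (\<lambda>i. \<lfloor>K * y i\<rfloor>) / K\<^sup>2"
      unfolding sq_def X_def Y_def K_def[symmetric] sum_divide_distrib by (simp_all add: power_divide)
    have "\<bar>bil (X k) (Y k)\<bar> = \<bar>bil (\<lambda>i. \<lfloor>K * x i\<rfloor>) (\<lambda>i. \<lfloor>K * y i\<rfloor>)\<bar> / K\<^sup>2" unfolding b by simp
    also have "\<dots> \<le> 2 * (D * R\<^sup>2 / 2 + l / R) * (sq (\<lambda>i. \<lfloor>K * x i\<rfloor>) + sq (\<lambda>i. \<lfloor>K * y i\<rfloor>)) / K\<^sup>2"
      by (intro divide_right_mono int_bound) simp
    finally show ?thesis unfolding s by (simp add: add_divide_distrib distrib_left)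
  qed
  ultimately show ?thesis by (intro LIMSEQ_le) auto
qed

text \<open>The bilinear bound at the unit vectors along \<open>W v\<close> and \<open>v\<close>:
  there the form is the ratio of the two norms and both sums of squares are 1.\<close>

lemma operator_norm: "nrm n (mv n W v) \<le> (2 * D * R\<^sup>2 + 4 * l / R) * nrm n v"
proof (cases "nrm n v = 0 \<or> nrm n (mv n W v) = 0")
  case True
  have "nrm n (mv n W v) = 0" if "nrm n v = 0"
  proof -
    have "mv n W v = mv n W (\<lambda>_. 0)" using that by (intro mv_cong) (simp add: nrm_def ip_self_eq_0)
    then show ?thesis by (simp add: nrm_def ip_self_eq_0) (simp add: mv_def)
  qed
  then have "nrm n (mv n W v) = 0" using True by blast
  moreover have "n > 0 \<Longrightarrow> l \<ge> 0" using row[of 0] by (meson abs_ge_zero order.trans sum_nonneg)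
  moreover have "n = 0 \<Longrightarrow> nrm n v = 0" by (simp add: nrm_def ip_def)
  ultimately show ?thesis using D_nonneg R_ge by (cases "n = 0") auto
next
  case False
  define a b where "a = nrm n (mv n W v)" and "b = nrm n v"
  have ab: "a > 0" "b > 0" using False by (auto simp: a_def b_def less_le)
  have sq: "sq f = (nrm n f)\<^sup>2" for f unfolding nrm_power2 sq_def ip_def by (simp add: power2_eq_square)
  have bil: "bil f g = ip n f (mv n W g)" for f g
    by (simp add: bil_def ip_def mv_def sum_distrib_left mult.assoc)
  have "\<bar>bil (\<lambda>i. 1 / a * mv n W v i) (\<lambda>i. 1 / b * v i)\<bar> \<le> 2 * (D * R\<^sup>2 / 2 + l / R) * (1 + 1)"
    using real_bound[of "\<lambda>i. 1 / a * mv n W v i" "\<lambda>i. 1 / b * v i"] ab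
    unfolding sq nrm_scale a_def[symmetric] b_def[symmetric] by simp
  also have "bil (\<lambda>i. 1 / a * mv n W v i) (\<lambda>i. 1 / b * v i) = a / b"
    unfolding bil ip_linear mv_linear nrm_power2[symmetric] a_def[symmetric] using ab by (simp add: power2_eq_square)
  finally have "a \<le> (2 * D * R\<^sup>2 + 4 * l / R) * b" using ab by (simp add: divide_le_eq algebra_simps)
  then show ?thesis by (simp add: a_def b_def)
qed

end

section \<open>Leave-one-out bounds\<close>

text \<open>Row and column are zeroed rather than deleted, so that iterates of the minor and of the
  full matrix live in the same space and can be subtracted.\<close>

definition minor :: "nat \<Rightarrow> (nat \<Rightarrow> nat \<Rightarrow> real) \<Rightarrow> nat \<Rightarrow> nat \<Rightarrow> real" where
  "minor i W j k = (if j = i \<or> k = i then 0 else W j k)"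

lemma nrm_mono: "(\<And>i. i < n \<Longrightarrow> \<bar>f i\<bar> \<le> \<bar>g i\<bar>) \<Longrightarrow> nrm n f \<le> nrm n g"
  unfolding nrm_def ip_def
  by (intro real_sqrt_le_mono sum_mono) (metis abs_mult_self_eq abs_mult abs_ge_zero lessThan_iff mult_mono)

lemma minor_norm:
  assumes "\<And>v. nrm n (mv n W v) \<le> w * nrm n v" "w \<ge> 0"
  shows "nrm n (mv n (minor i W) v) \<le> w * nrm n v"
proof -
  let ?v = "\<lambda>k. if k = i then 0 else v k"
  have "nrm n (mv n (minor i W) v) \<le> nrm n (mv n W ?v)"
  proof (rule nrm_mono)
    fix j
    have "mv n (minor i W) v j = (if j = i then 0 else mv n W ?v j)"
      by (auto simp: mv_def minor_def intro!: sum.cong)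
    then show "\<bar>mv n (minor i W) v j\<bar> \<le> \<bar>mv n W ?v j\<bar>" by simp
  qed
  also have "\<dots> \<le> w * nrm n ?v" by (rule assms)
  also have "\<dots> \<le> w * nrm n v" using assms(2) by (intro mult_left_mono nrm_mono) auto
  finally show ?thesis .
qed

lemma mv_pow_norm:
  assumes "\<And>v. nrm n (mv n W v) \<le> w * nrm n v" "w \<ge> 0"
  shows "nrm n ((mv n W ^^ k) v) \<le> w ^ k * nrm n v"
proof (induction k)
  case (Suc k)
  have "nrm n ((mv n W ^^ Suc k) v) \<le> w * nrm n ((mv n W ^^ k) v)" using assms by simp
  also have "\<dots> \<le> w * (w ^ k * nrm n v)" using Suc assms by (intro mult_left_mono) auto
  finally show ?case by (simp add: mult_ac)
qed simp

text \<open>The last assumption expresses that row \<open>i\<close> of \<open>W\<close> is independent of the powers of \<open>minor i W\<close>. It is required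
only under the bounds that the induction provides for these powers.\<close>

locale leave_one_out =
  fixes n :: nat and W :: "nat \<Rightarrow> nat \<Rightarrow> real" and \<xi> :: "nat \<Rightarrow> real" and w K1 K2 :: real and m :: nat
  assumes W_sym: "sym n W" and W_norm: "\<And>v. nrm n (mv n W v) \<le> w * nrm n v" and w_nonneg: "w \<ge> 0"
    and W_le_1: "\<And>i j. i < n \<Longrightarrow> j < n \<Longrightarrow> \<bar>W i j\<bar> \<le> 1"
    and row: "\<And>i. i < n \<Longrightarrow> (\<Sum>j<n. \<bar>W i j\<bar>) \<le> K1"
    and xi: "\<And>i. i < n \<Longrightarrow> \<bar>\<xi> i\<bar> \<le> 1" "nrm n \<xi> \<le> sqrt n"
    and K: "K1 \<ge> 1" "4 * sqrt K1 \<le> K2" "2 * w + sqrt K1 \<le> K2"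
    and row_indep: "\<And>i k. i < n \<Longrightarrow> k \<le> m \<Longrightarrow>
      (\<And>j. j < n \<Longrightarrow> \<bar>(mv n (minor i W) ^^ Suc k) \<xi> j\<bar> \<le> 3 * (K1 * K2 ^ k)) \<Longrightarrow>
      nrm n ((mv n (minor i W) ^^ Suc k) \<xi>) \<le> w ^ Suc k * sqrt n \<Longrightarrow>
      \<bar>mv n W ((mv n (minor i W) ^^ Suc k) \<xi>) i\<bar> \<le> K1 * K2 ^ Suc k / 2"
begin

definition z :: "nat \<Rightarrow> nat \<Rightarrow> real" where "z k = (mv n W ^^ k) \<xi>"
definition zi :: "nat \<Rightarrow> nat \<Rightarrow> nat \<Rightarrow> real" where "zi i k = (mv n (minor i W) ^^ k) \<xi>"
definition d :: "nat \<Rightarrow> nat \<Rightarrow> nat \<Rightarrow> real" where "d i k = (\<lambda>j. z k j - zi i k j)"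

lemma K2_nonneg: "K2 \<ge> 0"
  using K(2) K(1) real_sqrt_ge_zero[of K1] by linarith

lemma row_nrm: "i < n \<Longrightarrow> nrm n (\<lambda>j. W i j) \<le> sqrt K1"
proof -
  assume i: "i < n"
  have "ip n (\<lambda>j. W i j) (\<lambda>j. W i j) \<le> (\<Sum>j<n. \<bar>W i j\<bar>)"
    unfolding ip_def
  proof (rule sum_mono)
    fix j assume "j \<in> {..<n}"
    then have "\<bar>W i j\<bar> * \<bar>W i j\<bar> \<le> \<bar>W i j\<bar> * 1" using W_le_1[OF i] by (intro mult_left_mono) auto
    then show "W i j * W i j \<le> \<bar>W i j\<bar>" by simp
  qed
  then show ?thesis unfolding nrm_def using row[OF i] by simp
qed

text \<open>Away from \<open>i\<close> the two recursions differ by column \<open>i\<close> times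
  \<open>z k i\<close>. At \<open>i\<close> the minor yields 0, so the full entry
  \<open>z (Suc k) i\<close> remains.\<close>

lemma d_step:
  assumes i: "i < n"
  shows "nrm n (d i (Suc k)) \<le> w * nrm n (d i k) + \<bar>z k i\<bar> * sqrt K1 + \<bar>z (Suc k) i\<bar>"
proof -
  define e where "e j = (if j = i then z (Suc k) i else 0)" for j
  define c where "c j = (if j = i then 0 else W j i)" for j
  have "d i (Suc k) j = mv n (minor i W) (d i k) j + z k i * c j + e j" if j: "j < n" for j
  proof (cases "j = i")
    case True
    then show ?thesis by (simp add: d_def zi_def c_def e_def mv_def minor_def)
  next
    case False
    have "z (Suc k) j = (\<Sum>m<n. W j m * z k m)" by (simp add: z_def mv_def)
    also have "\<dots> = (\<Sum>m<n. minor i W j m * z k m + (if m = i then W j i * z k i else 0))"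
      using False by (intro sum.cong refl) (simp add: minor_def)
    also have "\<dots> = mv n (minor i W) (z k) j + W j i * z k i"
      using i by (simp add: sum.distrib mv_def)
    finally have "z (Suc k) j = mv n (minor i W) (z k) j + W j i * z k i" .
    moreover have "zi i (Suc k) j = mv n (minor i W) (zi i k) j" by (simp add: zi_def)
    ultimately show ?thesis using False by (simp add: d_def mv_linear c_def e_def)
  qed
  then have "nrm n (d i (Suc k)) = nrm n (\<lambda>j. (mv n (minor i W) (d i k) j + z k i * c j) + e j)"
    unfolding nrm_def by (intro arg_cong[of _ _ sqrt] ip_cong) auto
  also have "\<dots> \<le> nrm n (\<lambda>j. mv n (minor i W) (d i k) j + z k i * c j) + nrm n e" by (rule nrm_triangle)
  also have "\<dots> \<le> nrm n (mv n (minor i W) (d i k)) + nrm n (\<lambda>j. z k i * c j) + nrm n e"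
    using nrm_triangle[of n "mv n (minor i W) (d i k)"] by simp
  also have "nrm n (mv n (minor i W) (d i k)) \<le> w * nrm n (d i k)" by (rule minor_norm[OF W_norm w_nonneg])
  also have "nrm n (\<lambda>j. z k i * c j) \<le> \<bar>z k i\<bar> * sqrt K1"
  proof -
    have "nrm n c \<le> nrm n (\<lambda>j. W i j)"
      using W_sym i by (intro nrm_mono) (auto simp: c_def sym_def)
    then show ?thesis unfolding nrm_scale using row_nrm[OF i] by (intro mult_left_mono) auto
  qed
  also have "nrm n e = \<bar>z (Suc k) i\<bar>"
  proof -
    have "ip n e e = (\<Sum>j<n. if j = i then z (Suc k) i * z (Suc k) i else 0)"
      unfolding ip_def by (intro sum.cong) (auto simp: e_def)
    then show ?thesis using i by (simp add: nrm_def)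
  qed
  finally show ?thesis by simp
qed

lemma zi_nrm: "nrm n (zi i k) \<le> w ^ k * sqrt n"
proof -
  have "nrm n (zi i k) \<le> w ^ k * nrm n \<xi>"
    unfolding zi_def by (intro mv_pow_norm minor_norm W_norm w_nonneg)
  also have "\<dots> \<le> w ^ k * sqrt n" using xi w_nonneg by (intro mult_left_mono) auto
  finally show ?thesis .
qed

text \<open>Entry bound and distance bound feed each other. Row \<open>i\<close> times the true
  iterate is row \<open>i\<close> times the leave-one-out iterate, controlled by
  \<open>row_indep\<close>, plus row \<open>i\<close> times the difference, controlled by
  Cauchy-Schwarz; each is at most half of the target. The two bounds \<open>B\<close> and
  \<open>2 * B\<close> add up to the \<open>3 * B\<close> in the premise of
  \<open>row_indep\<close>.\<close>

lemma bounds: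
  assumes "k \<le> Suc m"
  shows "\<forall>i<n. \<bar>z (Suc k) i\<bar> \<le> K1 * K2 ^ k \<and> nrm n (d i (Suc k)) \<le> 2 * (K1 * K2 ^ k)"
  using assms
proof (induction k)
  case 0
  show ?case
  proof (intro allI impI conjI)
    fix i assume i: "i < n"
    have "\<bar>z (Suc 0) i\<bar> \<le> (\<Sum>j<n. \<bar>W i j\<bar> * \<bar>\<xi> j\<bar>)"
      by (simp add: z_def mv_def) (rule order.trans[OF sum_abs], simp add: abs_mult)
    also have "\<dots> \<le> (\<Sum>j<n. \<bar>W i j\<bar> * 1)" using xi by (intro sum_mono mult_left_mono) auto
    finally have z1: "\<bar>z (Suc 0) i\<bar> \<le> K1" using row[OF i] by simp
    then show "\<bar>z (Suc 0) i\<bar> \<le> K1 * K2 ^ 0" by simp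
    have "nrm n (d i 0) = 0" by (simp add: d_def z_def zi_def nrm_def ip_def)
    moreover have "\<bar>z 0 i\<bar> * sqrt K1 \<le> 1 * sqrt K1" using xi(1)[OF i] K(1) by (intro mult_right_mono) (auto simp: z_def)
    moreover have "sqrt K1 \<le> K1" using K(1) by (intro real_le_lsqrt) (auto simp: power2_eq_square)
    ultimately show "nrm n (d i (Suc 0)) \<le> 2 * (K1 * K2 ^ 0)" using d_step[OF i, of 0] z1 by simp
  qed
next
  case (Suc k)
  then have IH: "\<And>i. i < n \<Longrightarrow> \<bar>z (Suc k) i\<bar> \<le> K1 * K2 ^ k" "\<And>i. i < n \<Longrightarrow> nrm n (d i (Suc k)) \<le> 2 * (K1 * K2 ^ k)" by auto
  define B where "B = K1 * K2 ^ k"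
  have B: "B \<ge> 0" using K K2_nonneg by (simp add: B_def)
  have BS: "K1 * K2 ^ Suc k = K2 * B" by (simp add: B_def)
  show ?case
  proof (intro allI impI conjI)
    fix i assume i: "i < n"
    have "\<bar>zi i (Suc k) j\<bar> \<le> 3 * B" if j: "j < n" for j
      using IH(1)[OF j] IH(2)[OF i] abs_le_nrm[OF j, of "d i (Suc k)"] by (simp add: d_def B_def)
    then have 1: "\<bar>mv n W (zi i (Suc k)) i\<bar> \<le> K2 * B / 2"
      using row_indep[OF i, of k] zi_nrm[of i "Suc k"] Suc.prems unfolding BS zi_def[symmetric] B_def[symmetric] by simp
    have "\<bar>mv n W (d i (Suc k)) i\<bar> \<le> nrm n (\<lambda>j. W i j) * nrm n (d i (Suc k))"
      using ip_le_nrm[of n "\<lambda>j. W i j" "d i (Suc k)"] by (simp add: ip_def mv_def)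
    also have "\<dots> \<le> sqrt K1 * (2 * B)"
      using row_nrm[OF i] IH(2)[OF i] K(1) by (intro mult_mono) (auto simp: B_def)
    also have "\<dots> \<le> K2 * B / 2" using mult_right_mono[OF K(2) B] by simp
    finally have 2: "\<bar>mv n W (d i (Suc k)) i\<bar> \<le> K2 * B / 2" .
    have "z (Suc (Suc k)) i = mv n W (\<lambda>j. zi i (Suc k) j + d i (Suc k) j) i" by (simp add: z_def d_def)
    also have "\<dots> = mv n W (zi i (Suc k)) i + mv n W (d i (Suc k)) i" by (simp only: mv_linear)
    finally have z2: "\<bar>z (Suc (Suc k)) i\<bar> \<le> K2 * B" using 1 2 by linarith
    then show "\<bar>z (Suc (Suc k)) i\<bar> \<le> K1 * K2 ^ Suc k" unfolding BS .
    have "nrm n (d i (Suc (Suc k))) \<le> w * nrm n (d i (Suc k)) + \<bar>z (Suc k) i\<bar> * sqrt K1 + \<bar>z (Suc (Suc k)) i\<bar>"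
      by (rule d_step[OF i])
    also have "\<dots> \<le> w * (2 * B) + B * sqrt K1 + K2 * B"
      using IH[OF i] z2 w_nonneg K(1) by (intro add_mono mult_left_mono mult_right_mono) (auto simp: B_def)
    also have "\<dots> = (2 * w + sqrt K1) * B + K2 * B" by (simp add: algebra_simps)
    also have "\<dots> \<le> K2 * B + K2 * B" using K(3) B by (intro add_right_mono mult_right_mono)
    finally show "nrm n (d i (Suc (Suc k))) \<le> 2 * (K1 * K2 ^ Suc k)" unfolding BS by (simp only: mult_2)
  qed
qed

lemma power_entry_bound: "k \<le> Suc m \<Longrightarrow> i < n \<Longrightarrow> \<bar>(mv n W ^^ Suc k) \<xi> i\<bar> \<le> K1 * K2 ^ k"
  using bounds[of k] by (simp add: z_def)

end

section \<open>Tail bounds for Bernoulli products\<close>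

lemma exp_quadratic_bound: "exp u - 1 - u \<le> u\<^sup>2 * exp \<bar>u\<bar>" for u :: real
proof -
  obtain t where t: "\<bar>t\<bar> \<le> \<bar>u\<bar>" "exp u = (\<Sum>m<2. u ^ m / fact m) + exp t / fact 2 * u ^ 2"
    using Maclaurin_exp_le[of u 2] by auto
  then have "exp u - 1 - u = exp t / 2 * u\<^sup>2" by (simp add: numeral_2_eq_2)
  also have "\<dots> \<le> exp \<bar>u\<bar> * u\<^sup>2"
    
  proof (intro mult_right_mono)
    have "exp t \<le> exp \<bar>u\<bar>" using t(1) by simp
    then show "exp t / 2 \<le> exp \<bar>u\<bar>" using exp_gt_zero[of t] by linarith
  qed simp
  finally show ?thesis by (simp add: mult.commute)
qed

text \<open>Chernoff bound, with the exponential parameter absorbed in the coefficients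
  \<open>u\<close>.\<close>

lemma bernoulli_product_tail:
  fixes u :: "'e \<Rightarrow> real"
  assumes "finite I" "\<And>e. e \<in> I \<Longrightarrow> 0 \<le> pr e \<and> pr e \<le> 1"
  shows "measure_pmf.prob (Pi_pmf I False (\<lambda>e. bernoulli_pmf (pr e))) {a. (\<Sum>e\<in>I. u e * of_bool (a e)) \<ge> t}
    \<le> exp (- t + (\<Sum>e\<in>I. pr e * (exp (u e) - 1)))"
proof -
  define M where "M = Pi_pmf I False (\<lambda>e. bernoulli_pmf (pr e))"
  define f where "f e b = exp (u e * of_bool b)" for e and b :: bool
  have int: "integrable (bernoulli_pmf r) g" for r and g :: "bool \<Rightarrow> real"
    by (rule integrable_measure_pmf_finite) simp
  have ig: "integrable M (\<lambda>a. \<Prod>e\<in>I. f e (a e))"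
    unfolding M_def using assms int by (intro integrable_prod_Pi_pmf) auto
  have prod_f: "(\<Prod>e\<in>I. f e (a e)) = exp (\<Sum>e\<in>I. u e * of_bool (a e))" for a
    unfolding f_def by (rule exp_sum[OF assms(1), symmetric])
  have "measure_pmf.prob M {a. (\<Sum>e\<in>I. u e * of_bool (a e)) \<ge> t} = measure_pmf.expectation M (indicator {a. (\<Sum>e\<in>I. u e * of_bool (a e)) \<ge> t})"
    by simp
  also have "\<dots> \<le> measure_pmf.expectation M (\<lambda>a. exp (- t) * (\<Prod>e\<in>I. f e (a e)))"
  proof (rule integral_mono)
    show "integrable M (indicator {a. (\<Sum>e\<in>I. u e * of_bool (a e)) \<ge> t} :: _ \<Rightarrow> real)"
      by (rule measure_pmf.integrable_const_bound[where B=1]) auto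
    show "indicator {a. (\<Sum>e\<in>I. u e * of_bool (a e)) \<ge> t} a \<le> exp (- t) * (\<Prod>e\<in>I. f e (a e))" for a
      unfolding prod_f by (auto simp: indicator_def exp_add[symmetric])
  qed (use ig in auto)
  also have "\<dots> = exp (- t) * (\<Prod>e\<in>I. measure_pmf.expectation (bernoulli_pmf (pr e)) (f e))"
    unfolding M_def using assms(1) int by (subst integral_mult_right_zero, subst expectation_prod_Pi_pmf) (auto simp: f_def)
  finally have 1: "measure_pmf.prob M {a. (\<Sum>e\<in>I. u e * of_bool (a e)) \<ge> t} \<le> exp (- t) * (\<Prod>e\<in>I. measure_pmf.expectation (bernoulli_pmf (pr e)) (f e))" .
  have "(\<Prod>e\<in>I. measure_pmf.expectation (bernoulli_pmf (pr e)) (f e)) \<le> (\<Prod>e\<in>I. exp (pr e * (exp (u e) - 1)))"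
  proof (rule prod_mono)
    fix e assume "e \<in> I"
    then have "measure_pmf.expectation (bernoulli_pmf (pr e)) (f e) = 1 + pr e * (exp (u e) - 1)"
      using assms(2) by (simp add: f_def algebra_simps)
    moreover have "measure_pmf.expectation (bernoulli_pmf (pr e)) (f e) \<ge> 0"
      by (simp add: f_def Bochner_Integration.integral_nonneg)
    ultimately show "0 \<le> measure_pmf.expectation (bernoulli_pmf (pr e)) (f e) \<and> measure_pmf.expectation (bernoulli_pmf (pr e)) (f e) \<le> exp (pr e * (exp (u e) - 1))"
      by (simp add: exp_ge_add_one_self)
  qed
  then have "exp (- t) * (\<Prod>e\<in>I. measure_pmf.expectation (bernoulli_pmf (pr e)) (f e)) \<le> exp (- t) * (\<Prod>e\<in>I. exp (pr e * (exp (u e) - 1)))"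
    by (intro mult_left_mono) auto
  also have "exp (- t) * (\<Prod>e\<in>I. exp (pr e * (exp (u e) - 1))) = exp (- t + (\<Sum>e\<in>I. pr e * (exp (u e) - 1)))"
    unfolding exp_add exp_sum[OF assms(1)] ..
  finally show ?thesis using 1 unfolding M_def by linarith
qed

text \<open>Centring removes the linear term of the exponential; the rest is quadratic, with
  constant \<open>exp b\<close> for coefficients of size at most \<open>b\<close>.\<close>

lemma bernoulli_product_centred_tail:
  fixes u :: "'e \<Rightarrow> real"
  assumes "finite I" "\<And>e. e \<in> I \<Longrightarrow> 0 \<le> pr e \<and> pr e \<le> 1" "\<And>e. e \<in> I \<Longrightarrow> \<bar>u e\<bar> \<le> b"
  shows "measure_pmf.prob (Pi_pmf I False (\<lambda>e. bernoulli_pmf (pr e))) {a. (\<Sum>e\<in>I. u e * (of_bool (a e) - pr e)) \<ge> t}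
    \<le> exp (- t + exp b * (\<Sum>e\<in>I. (u e)\<^sup>2 * pr e))"
proof -
  have "{a. (\<Sum>e\<in>I. u e * (of_bool (a e) - pr e)) \<ge> t} = {a. (\<Sum>e\<in>I. u e * of_bool (a e)) \<ge> t + (\<Sum>e\<in>I. u e * pr e)}"
    unfolding right_diff_distrib sum_subtractf le_diff_eq ..
  then have "measure_pmf.prob (Pi_pmf I False (\<lambda>e. bernoulli_pmf (pr e))) {a. (\<Sum>e\<in>I. u e * (of_bool (a e) - pr e)) \<ge> t}
    \<le> exp (- (t + (\<Sum>e\<in>I. u e * pr e)) + (\<Sum>e\<in>I. pr e * (exp (u e) - 1)))"
    using bernoulli_product_tail[OF assms(1,2), where t="t + (\<Sum>e\<in>I. u e * pr e)" and u=u] by (simp only:)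
  also have "- (t + (\<Sum>e\<in>I. u e * pr e)) + (\<Sum>e\<in>I. pr e * (exp (u e) - 1)) = - t + (\<Sum>e\<in>I. pr e * (exp (u e) - 1 - u e))"
    by (simp add: algebra_simps sum.distrib sum_subtractf)
  also have "\<dots> \<le> - t + exp b * (\<Sum>e\<in>I. (u e)\<^sup>2 * pr e)"
    unfolding sum_distrib_left
  proof (intro add_left_mono sum_mono)
    fix e assume e: "e \<in> I"
    have "exp (u e) - 1 - u e \<le> (u e)\<^sup>2 * exp b"
      using assms(3)[OF e] by (intro order.trans[OF exp_quadratic_bound] mult_left_mono) auto
    then have "pr e * (exp (u e) - 1 - u e) \<le> pr e * ((u e)\<^sup>2 * exp b)"
      using assms(2)[OF e] by (intro mult_left_mono) auto
    then show "pr e * (exp (u e) - 1 - u e) \<le> exp b * ((u e)\<^sup>2 * pr e)" by (simp add: mult_ac)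
  qed
  finally show ?thesis by simp
qed

lemma prob_pair_pmf_le:
  assumes "\<And>x. measure_pmf.prob B {y. (x, y) \<in> S} \<le> c" "c \<ge> 0"
  shows "measure_pmf.prob (pair_pmf A B) S \<le> c"
proof -
  have "emeasure (pair_pmf A B) S = (\<integral>\<^sup>+x. \<integral>\<^sup>+y. indicator S (x, y) \<partial>B \<partial>A)"
    by (simp add: nn_integral_pair_pmf'[symmetric])
  also have "\<dots> \<le> (\<integral>\<^sup>+x. ennreal c \<partial>A)"
  proof (rule nn_integral_mono)
    fix x
    have "(\<integral>\<^sup>+y. indicator S (x, y) \<partial>B) = (\<integral>\<^sup>+y. indicator {y. (x, y) \<in> S} y \<partial>B)"
      by (intro nn_integral_cong) (simp add: indicator_def)
    also have "\<dots> = ennreal (measure_pmf.prob B {y. (x, y) \<in> S})"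
      by (simp add: measure_pmf.emeasure_eq_measure)
    also have "\<dots> \<le> ennreal c" using assms by (intro ennreal_leI)
    finally show "(\<integral>\<^sup>+y. indicator S (x, y) \<partial>B) \<le> ennreal c" .
  qed
  also have "\<dots> = ennreal c" by simp
  finally show ?thesis using assms(2) by (simp add: measure_pmf.emeasure_eq_measure)
qed

text \<open>The coefficients may depend on the coordinates outside \<open>R\<close>: conditionally on those, they are constants.\<close>

lemma conditional_centred_tail:
  fixes u :: "('e \<Rightarrow> bool) \<Rightarrow> 'e \<Rightarrow> real"
  assumes "finite I" "R \<subseteq> I" and pr: "\<And>e. e \<in> I \<Longrightarrow> 0 \<le> pr e \<and> pr e \<le> 1"
    and dep: "\<And>a a'. (\<And>e. e \<notin> R \<Longrightarrow> a e = a' e) \<Longrightarrow> u a = u a' \<and> good a = good a'"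
    and good: "\<And>a. good a \<Longrightarrow> (\<forall>e\<in>R. \<bar>u a e\<bar> \<le> b) \<and> exp b * (\<Sum>e\<in>R. (u a e)\<^sup>2 * pr e) \<le> v"
  shows "measure_pmf.prob (Pi_pmf I False (\<lambda>e. bernoulli_pmf (pr e)))
    {a. good a \<and> (\<Sum>e\<in>R. u a e * (of_bool (a e) - pr e)) \<ge> t} \<le> exp (- t + v)"
proof -
  define O' where "O' = I - R"
  have fin: "finite O'" "finite R" using assms(1,2) finite_subset by (auto simp: O'_def)
  have I: "I = O' \<union> R" "O' \<inter> R = {}" using assms(2) by (auto simp: O'_def)
  let ?b = "\<lambda>e. bernoulli_pmf (pr e)"
  let ?S = "{a. good a \<and> (\<Sum>e\<in>R. u a e * (of_bool (a e) - pr e)) \<ge> t}"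
  let ?h = "\<lambda>(f, g) x. if x \<in> O' then f x else g x"
  have "measure_pmf.prob (Pi_pmf I False ?b) ?S = measure_pmf.prob (pair_pmf (Pi_pmf O' False ?b) (Pi_pmf R False ?b)) (?h -` ?S)"
    unfolding I(1) by (subst Pi_pmf_union[OF fin I(2)]) simp
  also have "\<dots> \<le> exp (- t + v)"
  proof (rule prob_pair_pmf_le)
    fix f :: "'e \<Rightarrow> bool"
    \<comment> \<open>The coordinates in \<open>R\<close> get a default value; by
      \<open>dep\<close>, neither \<open>u\<close> nor \<open>good\<close> depends on it.\<close>
    define a0 where "a0 = (\<lambda>x. if x \<in> O' then f x else False)"
    define T where "T = {g. (\<Sum>e\<in>R. u a0 e * (of_bool (g e) - pr e)) \<ge> t}"
    have set: "set_pmf (Pi_pmf R False ?b) \<subseteq> {g. \<forall>x. x \<notin> R \<longrightarrow> g x = False}" by (rule set_Pi_pmf_subset[OF fin(2)])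
    have "measure_pmf.prob (Pi_pmf R False ?b) {g. (f, g) \<in> ?h -` ?S} \<le> measure_pmf.prob (Pi_pmf R False ?b) (if good a0 then T else {})"
    proof (rule measure_pmf.finite_measure_mono_AE)
      show "AE g in Pi_pmf R False ?b. g \<in> {g. (f, g) \<in> ?h -` ?S} \<longrightarrow> g \<in> (if good a0 then T else {})"
      proof (rule AE_pmfI, rule impI)
        fix g assume g: "g \<in> set_pmf (Pi_pmf R False ?b)" and in': "g \<in> {g. (f, g) \<in> ?h -` ?S}"
        have eq: "u (?h (f, g)) = u a0 \<and> good (?h (f, g)) = good a0"
          using g set by (intro dep) (auto simp: a0_def)
        have "(\<Sum>e\<in>R. u a0 e * (of_bool (?h (f, g) e) - pr e)) = (\<Sum>e\<in>R. u a0 e * (of_bool (g e) - pr e))"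
          using I(2) by (intro sum.cong) auto
        then show "g \<in> (if good a0 then T else {})" using in' eq by (auto simp: T_def)
      qed
    qed auto
    also have "\<dots> \<le> exp (- t + v)"
    proof (cases "good a0")
      case True
      have "measure_pmf.prob (Pi_pmf R False ?b) T \<le> exp (- t + exp b * (\<Sum>e\<in>R. (u a0 e)\<^sup>2 * pr e))"
        unfolding T_def using fin(2) pr assms(2) good[OF True] by (intro bernoulli_product_centred_tail) auto
      also have "\<dots> \<le> exp (- t + v)" using good[OF True] by simp
      finally show ?thesis using True by simp
    qed simp
    finally show "measure_pmf.prob (Pi_pmf R False ?b) {g. (f, g) \<in> ?h -` ?S} \<le> exp (- t + v)" .
  qed simp
  finally show ?thesis .
qed

section \<open>The stochastic block model\<close>

definition mm :: "nat \<Rightarrow> nat \<Rightarrow> nat \<times> nat" where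
  "mm i j = (min i j, max i j)"

lemma mm_commute: "mm i j = mm j i"
  by (simp add: mm_def min.commute max.commute)

lemma mm_eq_iff: "mm i j = mm i k \<longleftrightarrow> j = k"
  by (auto simp: mm_def min_def max_def)

text \<open>Each set is weighted by \<open>r ^ card S\<close> with \<open>r = t / n\<close>. The
  total weight \<open>(1 + r) ^ n\<close> is at most \<open>exp t\<close>, and every counted set
  weighs at least \<open>r ^ t\<close>.\<close>

lemma subset_count_le:
  fixes n t :: nat assumes "1 \<le> t" "t \<le> n"
  shows "real (card {S. S \<subseteq> {..<n} \<and> card S \<le> t}) \<le> (exp 1 * n / t) ^ t"
proof -
  define r where "r = real t / real n"
  have r: "0 < r" "r \<le> 1" using assms by (auto simp: r_def)
  have "(\<Sum>S\<in>Pow {..<n}. r ^ card S) = (1 + r) ^ n"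
  proof -
    have "(\<Sum>S\<in>Pow {..<n}. (\<Prod>i\<in>S. r) * (\<Prod>i\<in>{..<n} - S. 1)) = (\<Prod>i<n. r + 1)"
      by (rule prod_add[symmetric]) simp
    then show ?thesis by (simp add: add.commute)
  qed
  moreover have "(1 + r) ^ n \<le> exp (real t)"
  proof -
    have "(1 + r) ^ n \<le> exp r ^ n" using r by (intro power_mono) auto
    also have "\<dots> = exp (real t)" using assms by (simp add: exp_of_nat_mult[symmetric] r_def)
    finally show ?thesis .
  qed
  moreover have "real (card {S. S \<subseteq> {..<n} \<and> card S \<le> t}) * r ^ t \<le> (\<Sum>S\<in>Pow {..<n}. r ^ card S)"
  proof -
    have "real (card {S. S \<subseteq> {..<n} \<and> card S \<le> t}) * r ^ t = (\<Sum>S\<in>{S. S \<subseteq> {..<n} \<and> card S \<le> t}. r ^ t)" by simp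
    also have "\<dots> \<le> (\<Sum>S\<in>{S. S \<subseteq> {..<n} \<and> card S \<le> t}. r ^ card S)"
      using r by (intro sum_mono power_decreasing) auto
    also have "\<dots> \<le> (\<Sum>S\<in>Pow {..<n}. r ^ card S)" using r by (intro sum_mono2) auto
    finally show ?thesis .
  qed
  ultimately have "real (card {S. S \<subseteq> {..<n} \<and> card S \<le> t}) * r ^ t \<le> exp (real t)" by linarith
  then have "real (card {S. S \<subseteq> {..<n} \<and> card S \<le> t}) \<le> exp (real t) / r ^ t" using r by (simp add: pos_le_divide_eq)
  also have "\<dots> = (exp 1 * n / t) ^ t" using assms by (simp add: r_def power_divide power_mult_distrib exp_of_nat_mult[symmetric])
  finally show ?thesis .
qed

text \<open>The left-hand side increases with \<open>t\<close> on this range and equals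
  \<open>1 + ln n\<close> at \<open>t = 1\<close>. It turns exponents of the union bound over sets
  into powers of \<open>n\<close>.\<close>

lemma entropy_ge:
  fixes n t :: nat assumes "1 \<le> t" "t \<le> n"
  shows "real t * ln (exp 1 * n / t) \<ge> 1 + ln n"
proof -
  have t: "real t \<ge> 1" "real n \<ge> real t" using assms by auto
  have 1: "ln (exp 1 * n / t) = 1 + ln n - ln t" using t by (simp add: ln_div ln_mult)
  have 2: "ln (real t) \<le> real t - 1" using t by (intro ln_le_minus_one) simp
  have "(real t - 1) * (1 + ln n) \<ge> (real t - 1) * (1 + ln t)" using t by (intro mult_left_mono) auto
  then show ?thesis unfolding 1 using 2 by (simp add: algebra_simps)
qed

section \<open>The centred adjacency matrix and its linear statistics\<close>

locale sbm =
  fixes n :: nat and x :: "nat \<Rightarrow> real" and p q :: real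
  assumes n_ge: "n \<ge> 2" and x_pm: "\<And>i. i < n \<Longrightarrow> x i = 1 \<or> x i = -1" and x_sum: "(\<Sum>i<n. x i) = 0"
    and pq: "0 < q" "q \<le> p" "p \<le> 1"
begin

definition E :: "(nat \<times> nat) set" where "E = {(i, j). i \<le> j \<and> j < n}"

definition pr :: "nat \<times> nat \<Rightarrow> real" where "pr e = (if x (fst e) * x (snd e) = 1 then p else q)"

definition mu :: "(nat \<times> nat \<Rightarrow> bool) pmf" where "mu = Pi_pmf E False (\<lambda>e. bernoulli_pmf (pr e))"

text \<open>Self-loops have probability \<open>p\<close>, as \<open>x i * x i = 1\<close>. The
  expectation is therefore exactly of rank two, and no diagonal correction enters the planted
  model.\<close>

definition W :: "(nat \<times> nat \<Rightarrow> bool) \<Rightarrow> nat \<Rightarrow> nat \<Rightarrow> real" where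
  "W a i j = of_bool (a (mm i j)) - pr (mm i j)"

lemma finite_E: "finite E"
  by (rule finite_subset[of _ "{..<n} \<times> {..<n}"]) (auto simp: E_def)

lemma pr_bounds: "0 \<le> pr e" "pr e \<le> 1" "pr e \<le> p"
  using pq by (auto simp: pr_def)

lemma pr_mm: "pr (mm i j) = pr (i, j)"
  by (auto simp: pr_def mm_def min_def max_def mult.commute)

lemma mm_in_E: "i < n \<Longrightarrow> j < n \<Longrightarrow> mm i j \<in> E"
  by (auto simp: mm_def E_def)

lemma W_sym: "sym n (W a)"
  by (simp add: sym_def W_def mm_commute)

lemma W_le_1: "\<bar>W a i j\<bar> \<le> 1"
  using pr_bounds[of "mm i j"] by (auto simp: W_def abs_le_iff of_bool_def)

lemma W_eq: "i < n \<Longrightarrow> j < n \<Longrightarrow> W a i j = of_bool (a (mm i j)) - (p + q) / 2 - (p - q) / 2 * x i * x j"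
  using x_pm[of i] x_pm[of j] by (simp add: W_def pr_mm) (auto simp: pr_def field_simps)

text \<open>An edge bit may occur in \<open>F\<close> both as \<open>(i, j)\<close> and as
  \<open>(j, i)\<close>. Grouping by bit gives fibres of at most two elements, whence
  \<open>2 * \<theta> * B\<close> for the size of a coefficient and a doubled variance. The
  coefficients may depend on all bits that \<open>F\<close> does not read, as the leave-one-out
  argument requires.\<close>

lemma entry_sum_tail:
  fixes g :: "(nat \<times> nat \<Rightarrow> bool) \<Rightarrow> nat \<times> nat \<Rightarrow> real"
  assumes F: "F \<subseteq> {..<n} \<times> {..<n}"
    and dep: "\<And>a a'. (\<And>i j. (i, j) \<notin> F \<Longrightarrow> (j, i) \<notin> F \<Longrightarrow> a (i, j) = a' (i, j)) \<Longrightarrow> g a = g a' \<and> good a = good a'"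
    and good: "\<And>a. good a \<Longrightarrow> (\<forall>f\<in>F. \<bar>g a f\<bar> \<le> B) \<and> (\<Sum>f\<in>F. (g a f)\<^sup>2 * pr f) \<le> V"
    and \<theta>: "\<theta> \<ge> 0" and B: "B \<ge> 0"
  shows "measure_pmf.prob mu {a. good a \<and> (\<Sum>f\<in>F. g a f * W a (fst f) (snd f)) \<ge> t}
    \<le> exp (- (\<theta> * t) + 2 * \<theta>\<^sup>2 * exp (2 * \<theta> * B) * V)"
proof (cases "\<theta> = 0")
  case False
  define h where "h f = mm (fst f) (snd f)" for f
  define R where "R = h ` F"
  define fib where "fib e = {f \<in> F. h f = e}" for e
  have finF: "finite F" using F finite_subset by blast
  have fin: "finite R" "finite (fib e)" for e using finF by (auto simp: R_def fib_def)
  have R: "R \<subseteq> E" using F mm_in_E by (auto simp: R_def h_def)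
  have group: "(\<Sum>e\<in>R. \<Sum>f\<in>fib e. k f) = (\<Sum>f\<in>F. k f)" for k :: "_ \<Rightarrow> real"
    unfolding fib_def by (rule sum.group) (auto simp: finF fin R_def)
  have fib_card: "card (fib e) \<le> 2" for e
  proof -
    have "fib e \<subseteq> {e, (snd e, fst e)}" by (auto simp: fib_def h_def mm_def min_def max_def split: if_splits)
    then have "card (fib e) \<le> card {e, (snd e, fst e)}" by (intro card_mono) auto
    also have "\<dots> \<le> 2" by (simp add: card_insert_if)
    finally show ?thesis .
  qed
  define u where "u a e = \<theta> * (\<Sum>f\<in>fib e. g a f)" for a e
  have pr_fib: "pr e = pr f" if "f \<in> fib e" for e f
    using that by (auto simp: fib_def h_def pr_mm)
  have "measure_pmf.prob mu {a. good a \<and> (\<Sum>e\<in>R. u a e * (of_bool (a e) - pr e)) \<ge> \<theta> * t}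
    \<le> exp (- (\<theta> * t) + 2 * \<theta>\<^sup>2 * exp (2 * \<theta> * B) * V)"
    unfolding mu_def
  proof (rule conditional_centred_tail[where b = "2 * \<theta> * B", OF finite_E R])
    show "0 \<le> pr e \<and> pr e \<le> 1" for e using pr_bounds by simp
    show "u a = u a' \<and> good a = good a'" if "\<And>e. e \<notin> R \<Longrightarrow> a e = a' e" for a a'
    proof -
      have "g a = g a' \<and> good a = good a'"
      proof (rule dep)
        fix i j assume "(i, j) \<notin> F" "(j, i) \<notin> F"
        then have "(i, j) \<notin> R" by (auto simp: R_def h_def mm_def min_def max_def split: if_splits)
        then show "a (i, j) = a' (i, j)" by (rule that)
      qed
      then show ?thesis unfolding u_def by metis
    qed
    fix a assume a: "good a"
    have "\<bar>u a e\<bar> \<le> 2 * \<theta> * B" for e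
    proof -
      have "\<bar>\<Sum>f\<in>fib e. g a f\<bar> \<le> (\<Sum>f\<in>fib e. B)"
        using good[OF a] by (intro order.trans[OF sum_abs sum_mono]) (auto simp: fib_def)
      also have "\<dots> \<le> 2 * B" using fib_card[of e] B by (simp add: mult_right_mono)
      finally have "\<theta> * \<bar>\<Sum>f\<in>fib e. g a f\<bar> \<le> \<theta> * (2 * B)" using \<theta> by (rule mult_left_mono)
      then show ?thesis using \<theta> by (simp add: u_def abs_mult mult_ac)
    qed
    moreover have "(\<Sum>e\<in>R. (u a e)\<^sup>2 * pr e) \<le> 2 * \<theta>\<^sup>2 * V"
    proof -
      have "(u a e)\<^sup>2 * pr e \<le> 2 * \<theta>\<^sup>2 * (\<Sum>f\<in>fib e. (g a f)\<^sup>2 * pr f)" for e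
      proof -
        have "(\<Sum>f\<in>fib e. g a f * 1)\<^sup>2 \<le> (\<Sum>f\<in>fib e. (g a f)\<^sup>2) * (\<Sum>f\<in>fib e. 1\<^sup>2)"
          by (rule Cauchy_Schwarz_ineq_sum)
        also have "\<dots> \<le> (\<Sum>f\<in>fib e. (g a f)\<^sup>2) * 2"
          using fib_card[of e] by (intro mult_left_mono) (auto simp: sum_nonneg)
        finally have "(\<Sum>f\<in>fib e. g a f)\<^sup>2 \<le> 2 * (\<Sum>f\<in>fib e. (g a f)\<^sup>2)" by simp
        then have "\<theta>\<^sup>2 * (\<Sum>f\<in>fib e. g a f)\<^sup>2 * pr e \<le> \<theta>\<^sup>2 * (2 * (\<Sum>f\<in>fib e. (g a f)\<^sup>2)) * pr e"
          using pr_bounds[of e] by (intro mult_right_mono mult_left_mono) auto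
        also have "\<dots> = 2 * \<theta>\<^sup>2 * (\<Sum>f\<in>fib e. (g a f)\<^sup>2 * pr e)" unfolding sum_distrib_right[symmetric] by simp
        also have "(\<Sum>f\<in>fib e. (g a f)\<^sup>2 * pr e) = (\<Sum>f\<in>fib e. (g a f)\<^sup>2 * pr f)" using pr_fib by simp
        finally show ?thesis by (simp add: u_def power_mult_distrib)
      qed
      then have "(\<Sum>e\<in>R. (u a e)\<^sup>2 * pr e) \<le> (\<Sum>e\<in>R. 2 * \<theta>\<^sup>2 * (\<Sum>f\<in>fib e. (g a f)\<^sup>2 * pr f))" by (intro sum_mono)
      also have "\<dots> = 2 * \<theta>\<^sup>2 * (\<Sum>f\<in>F. (g a f)\<^sup>2 * pr f)" unfolding sum_distrib_left[symmetric] group ..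
      also have "\<dots> \<le> 2 * \<theta>\<^sup>2 * V" using good[OF a] by (intro mult_left_mono) auto
      finally show ?thesis .
    qed
    ultimately show "(\<forall>e\<in>R. \<bar>u a e\<bar> \<le> 2 * \<theta> * B) \<and> exp (2 * \<theta> * B) * (\<Sum>e\<in>R. (u a e)\<^sup>2 * pr e) \<le> 2 * \<theta>\<^sup>2 * exp (2 * \<theta> * B) * V"
      using mult_left_mono[of "\<Sum>e\<in>R. (u a e)\<^sup>2 * pr e" "2 * \<theta>\<^sup>2 * V" "exp (2 * \<theta> * B)"] by (simp add: mult_ac)
  qed
  moreover have "(\<Sum>e\<in>R. u a e * (of_bool (a e) - pr e)) = \<theta> * (\<Sum>f\<in>F. g a f * W a (fst f) (snd f))" for a
  proof -
    have "(\<Sum>e\<in>R. u a e * (of_bool (a e) - pr e)) = (\<Sum>e\<in>R. \<Sum>f\<in>fib e. \<theta> * (g a f * W a (fst f) (snd f)))"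
      unfolding u_def sum_distrib_left sum_distrib_right
      by (intro sum.cong refl) (auto simp: fib_def h_def W_def mult_ac)
    then show ?thesis unfolding group by (simp add: sum_distrib_left)
  qed
  ultimately show ?thesis using \<theta> False by (simp add: mult_le_cancel_left)
qed (simp add: measure_pmf.prob_le_1)

lemma entry_sum_tail_abs:
  fixes g :: "(nat \<times> nat \<Rightarrow> bool) \<Rightarrow> nat \<times> nat \<Rightarrow> real"
  assumes F: "F \<subseteq> {..<n} \<times> {..<n}"
    and dep: "\<And>a a'. (\<And>i j. (i, j) \<notin> F \<Longrightarrow> (j, i) \<notin> F \<Longrightarrow> a (i, j) = a' (i, j)) \<Longrightarrow> g a = g a' \<and> good a = good a'"
    and good: "\<And>a. good a \<Longrightarrow> (\<forall>f\<in>F. \<bar>g a f\<bar> \<le> B) \<and> (\<Sum>f\<in>F. (g a f)\<^sup>2 * pr f) \<le> V"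
    and \<theta>: "\<theta> \<ge> 0" and B: "B \<ge> 0"
  shows "measure_pmf.prob mu {a. good a \<and> \<bar>\<Sum>f\<in>F. g a f * W a (fst f) (snd f)\<bar> \<ge> t}
    \<le> 2 * exp (- (\<theta> * t) + 2 * \<theta>\<^sup>2 * exp (2 * \<theta> * B) * V)"
proof -
  let ?S = "\<lambda>a. \<Sum>f\<in>F. g a f * W a (fst f) (snd f)"
  have "{a. good a \<and> \<bar>?S a\<bar> \<ge> t} \<subseteq> {a. good a \<and> ?S a \<ge> t} \<union> {a. good a \<and> (\<Sum>f\<in>F. - g a f * W a (fst f) (snd f)) \<ge> t}"
    by (auto simp: sum_negf abs_if split: if_splits)
  then have "measure_pmf.prob mu {a. good a \<and> \<bar>?S a\<bar> \<ge> t}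
    \<le> measure_pmf.prob mu ({a. good a \<and> ?S a \<ge> t} \<union> {a. good a \<and> (\<Sum>f\<in>F. - g a f * W a (fst f) (snd f)) \<ge> t})"
    by (intro measure_pmf.finite_measure_mono) auto
  also have "\<dots> \<le> measure_pmf.prob mu {a. good a \<and> ?S a \<ge> t} + measure_pmf.prob mu {a. good a \<and> (\<Sum>f\<in>F. - g a f * W a (fst f) (snd f)) \<ge> t}"
    by (rule measure_Un_le) auto
  also have "\<dots> \<le> exp (- (\<theta> * t) + 2 * \<theta>\<^sup>2 * exp (2 * \<theta> * B) * V) + exp (- (\<theta> * t) + 2 * \<theta>\<^sup>2 * exp (2 * \<theta> * B) * V)"
  proof (intro add_mono entry_sum_tail assms)
    show "(\<lambda>f. - g a f) = (\<lambda>f. - g a' f) \<and> good a = good a'"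
      if "\<And>i j. (i, j) \<notin> F \<Longrightarrow> (j, i) \<notin> F \<Longrightarrow> a (i, j) = a' (i, j)" for a a'
      using dep[of a a'] that by metis
    show "(\<forall>f\<in>F. \<bar>- g a f\<bar> \<le> B) \<and> (\<Sum>f\<in>F. (- g a f)\<^sup>2 * pr f) \<le> V" if "good a" for a using good[OF that] by simp
  qed
  finally show ?thesis by simp
qed

text \<open>Entrywise \<open>\<bar>W\<bar> <= W + 2 * pr\<close>, so the absolute row sum is a
  linear statistic up to \<open>2 * (n * p)\<close>.\<close>

lemma row_tail:
  assumes i: "i < n"
  shows "measure_pmf.prob mu {a. (\<Sum>j<n. \<bar>W a i j\<bar>) > t + 2 * (n * p)} \<le> exp (- t + 2 * exp 2 * (n * p))"
proof -
  let ?F = "{i} \<times> {..<n}"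
  have sumF: "(\<Sum>f\<in>?F. k f) = (\<Sum>j<n. k (i, j))" for k :: "_ \<Rightarrow> real"
    by (subst sum_fst_snd[of "\<lambda>i j. k (i, j)" "{..<n}" "{i}", simplified, symmetric]) simp
  have "(\<Sum>f\<in>?F. pr f) \<le> (\<Sum>f\<in>?F. p)" using pr_bounds by (intro sum_mono) auto
  then have V: "(\<Sum>f\<in>?F. pr f) \<le> n * p" by (simp add: card_cartesian_product)
  have "measure_pmf.prob mu {a. True \<and> (\<Sum>f\<in>?F. 1 * W a (fst f) (snd f)) \<ge> t} \<le> exp (- (1 * t) + 2 * 1\<^sup>2 * exp (2 * 1 * 1) * (n * p))"
    by (rule entry_sum_tail) (use i V in auto)
  moreover have "{a. (\<Sum>j<n. \<bar>W a i j\<bar>) > t + 2 * (n * p)} \<subseteq> {a. True \<and> (\<Sum>f\<in>?F. 1 * W a (fst f) (snd f)) \<ge> t}"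
  proof (safe; simp only: mult_1 sumF fst_conv snd_conv)
    fix a assume a: "(\<Sum>j<n. \<bar>W a i j\<bar>) > t + 2 * (n * p)"
    have "\<bar>W a i j\<bar> \<le> W a i j + 2 * pr (i, j)" for j
      using pr_bounds[of "(i, j)"] by (auto simp: W_def pr_mm abs_if)
    then have "(\<Sum>j<n. \<bar>W a i j\<bar>) \<le> (\<Sum>j<n. W a i j + 2 * pr (i, j))" by (intro sum_mono)
    also have "\<dots> = (\<Sum>j<n. W a i j) + 2 * (\<Sum>j<n. pr (i, j))" by (simp add: sum.distrib sum_distrib_left)
    finally show "t \<le> (\<Sum>j<n. W a i j)" using a V unfolding sumF by linarith
  qed
  ultimately show ?thesis
    using measure_pmf.finite_measure_mono[of "{a. (\<Sum>j<n. \<bar>W a i j\<bar>) > t + 2 * (n * p)}" "{a. True \<and> (\<Sum>f\<in>?F. 1 * W a (fst f) (snd f)) \<ge> t}" mu]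
    by simp
qed

text \<open>Chernoff bound for the signed degree, the quantity governed by the recovery threshold.
  Balance gives exactly \<open>n / 2\<close> bits of each kind, the self-loop counting among those
  of probability \<open>p\<close>.\<close>

lemma community_tail:
  assumes i: "i < n" and \<theta>: "\<theta> \<ge> 0"
  shows "measure_pmf.prob mu {a. (\<Sum>j<n. x i * x j * of_bool (a (mm i j))) \<le> s}
    \<le> exp (\<theta> * s + n / 2 * (p * (exp (- \<theta>) - 1) + q * (exp \<theta> - 1)))"
proof -
  \<comment> \<open>Bits not incident to \<open>i\<close> get coefficient 0; the others are indexed
    by the second endpoint through \<open>mm i\<close>.\<close>
  define u where "u e = (if fst e = i \<or> snd e = i then - \<theta> * (x (fst e) * x (snd e)) else 0)" for e :: "nat \<times> nat"
  have rowE: "(\<Sum>e\<in>E. k e) = (\<Sum>j<n. k (mm i j))" if "\<And>e. e \<in> E \<Longrightarrow> fst e \<noteq> i \<Longrightarrow> snd e \<noteq> i \<Longrightarrow> k e = 0" for k :: "_ \<Rightarrow> real"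
  proof -
    have "(\<Sum>e\<in>E. k e) = (\<Sum>e\<in>mm i ` {..<n}. k e)"
    proof (rule sum.mono_neutral_right[OF finite_E])
      show "mm i ` {..<n} \<subseteq> E" using mm_in_E i by auto
      show "\<forall>e\<in>E - mm i ` {..<n}. k e = 0"
      proof
        fix e assume e: "e \<in> E - mm i ` {..<n}"
        have "e = mm i (snd e)" if "fst e = i" using that e by (cases e) (auto simp: E_def mm_def)
        moreover have "e = mm i (fst e)" if "snd e = i" using that e by (cases e) (auto simp: E_def mm_def)
        moreover have "fst e < n" "snd e < n" using e by (auto simp: E_def)
        ultimately have "fst e \<noteq> i" "snd e \<noteq> i" using e by (metis Diff_iff imageI lessThan_iff)+
        then show "k e = 0" using that e by auto
      qed
    qed
    also have "\<dots> = (\<Sum>j<n. k (mm i j))" by (subst sum.reindex) (auto simp: inj_on_def mm_eq_iff)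
    finally show ?thesis .
  qed
  have u_mm: "u (mm i j) = - \<theta> * (x i * x j)" for j by (auto simp: u_def mm_def min_def max_def)
  have eq: "(\<Sum>e\<in>E. u e * of_bool (a e)) = - \<theta> * (\<Sum>j<n. x i * x j * of_bool (a (mm i j)))" for a
    by (subst rowE) (simp add: u_def, simp add: u_mm sum_distrib_left mult_ac)
  have "{a. (\<Sum>j<n. x i * x j * of_bool (a (mm i j))) \<le> s} \<subseteq> {a. (\<Sum>e\<in>E. u e * of_bool (a e)) \<ge> - (\<theta> * s)}"
    unfolding eq using \<theta> by (auto simp: mult_left_mono)
  then have "measure_pmf.prob mu {a. (\<Sum>j<n. x i * x j * of_bool (a (mm i j))) \<le> s}
    \<le> measure_pmf.prob mu {a. (\<Sum>e\<in>E. u e * of_bool (a e)) \<ge> - (\<theta> * s)}"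
    by (intro measure_pmf.finite_measure_mono) auto
  also have "\<dots> \<le> exp (- (- (\<theta> * s)) + (\<Sum>e\<in>E. pr e * (exp (u e) - 1)))"
    unfolding mu_def by (rule bernoulli_product_tail[OF finite_E]) (simp add: pr_bounds)
  also have "(\<Sum>e\<in>E. pr e * (exp (u e) - 1)) = (\<Sum>j<n. pr (i, j) * (exp (- \<theta> * (x i * x j)) - 1))"
    by (subst rowE) (simp_all add: u_mm pr_mm, simp add: u_def)
  also have "\<dots> = (\<Sum>j<n. (1 + x i * x j) / 2 * (p * (exp (- \<theta>) - 1)) + (1 - x i * x j) / 2 * (q * (exp \<theta> - 1)))"
  proof (intro sum.cong refl)
    fix j assume "j \<in> {..<n}"
    then have "x i * x j = 1 \<or> x i * x j = -1" using x_pm[OF i] x_pm[of j] by auto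
    then show "pr (i, j) * (exp (- \<theta> * (x i * x j)) - 1) = (1 + x i * x j) / 2 * (p * (exp (- \<theta>) - 1)) + (1 - x i * x j) / 2 * (q * (exp \<theta> - 1))"
      by (auto simp: pr_def)
  qed
  also have "\<dots> = n / 2 * (p * (exp (- \<theta>) - 1) + q * (exp \<theta> - 1))"
  proof -
    have "(\<Sum>j<n. (1 + x i * x j) / 2 * c) = n / 2 * c" "(\<Sum>j<n. (1 - x i * x j) / 2 * c) = n / 2 * c" for c
      unfolding sum_distrib_right[symmetric] sum_divide_distrib[symmetric] sum.distrib sum_subtractf
        sum_distrib_left[symmetric] x_sum by simp_all
    then show ?thesis unfolding sum.distrib distrib_left by (simp only:)
  qed
  finally show ?thesis by simp
qed

end

section \<open>Discrepancy and row independence of the random graph\<close>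

lemma prob_pmf_mono: "A \<subseteq> B \<Longrightarrow> measure_pmf.prob M A \<le> measure_pmf.prob M B"
  by (intro measure_pmf.finite_measure_mono) auto

lemma prob_pmf_union_bound: "finite I \<Longrightarrow> measure_pmf.prob M (\<Union>i\<in>I. A i) \<le> (\<Sum>i\<in>I. measure_pmf.prob M (A i))"
  by (rule measure_pmf.finite_measure_subadditive_finite) auto

context sbm
begin

text \<open>The exponent has to beat the \<open>exp (2 * t * y)\<close> choices of a pair, where
  \<open>y = ln (e n / t)\<close> and \<open>t = card T\<close>. So \<open>\<theta> = k * y\<close>
  grows as the sets shrink; \<open>k <= 1/4\<close> keeps \<open>exp (2 * \<theta>)\<close> below
  \<open>exp (y / 2)\<close>, which the factor \<open>exp (1 - y) = t / n\<close> absorbs. With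
  \<open>k = 24 * l / D^2\<close>, half of the linear term is at least \<open>12 * t * y\<close> by
  \<open>dense\<close>.\<close>

lemma pair_tail:
  assumes ST: "S \<subseteq> {..<n}" "T \<subseteq> {..<n}" "card S \<le> card T" "1 \<le> card T"
    and D: "D > 0" "l > 0" and \<kappa>: "24 * l / D\<^sup>2 \<le> 1/4" "12 * (24 * l / D\<^sup>2) * (n * p) \<le> D"
    and dense: "D / l * card T \<le> sqrt (card S * card T)"
  shows "measure_pmf.prob mu {a. \<bar>\<Sum>i\<in>S. \<Sum>j\<in>T. W a i j\<bar> \<ge> D * sqrt (card S * card T)}
    \<le> 2 * exp (- (12 * (card T * ln (exp 1 * n / card T))))"
proof -
  define s t where "s = real (card S)" and "t = real (card T)"
  define y where "y = ln (exp 1 * n / t)"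
  define k where "k = 24 * l / D\<^sup>2"
  define \<theta> where "\<theta> = k * y"
  have fin: "finite S" "finite T" using ST finite_subset by blast+
  have t: "t \<ge> 1" "t \<le> n" "s \<le> t" "0 \<le> s"
    using ST card_mono[OF _ ST(2)] by (auto simp: s_def t_def)
  have y: "y \<ge> 1" "t = n * exp (1 - y)"
  proof -
    have "y = 1 + ln (n / t)" using t n_ge unfolding y_def by (subst times_divide_eq_right[symmetric], subst ln_mult) auto
    moreover have "ln (n / t) \<ge> 0" using t by simp
    ultimately show "y \<ge> 1" by simp
    have "exp (1 - y) = exp 1 / exp y" by (rule exp_diff)
    also have "exp y = exp 1 * n / t" unfolding y_def using t n_ge by (intro exp_ln) auto
    finally show "t = n * exp (1 - y)" using t by simp
  qed
  have k: "k > 0" "k \<le> 1/4" "12 * k * (n * p) \<le> D" using D \<kappa> by (auto simp: k_def)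
  define r where "r = sqrt (s * t)"
  have r: "0 \<le> r" "r \<le> t" "r * r = s * t" "D / l * t \<le> r"
    using t dense real_sqrt_le_mono[OF mult_right_mono[OF t(3), of t]] by (auto simp: r_def s_def t_def)
  have small: "\<theta> * exp (2 * \<theta>) * p * r \<le> D / 4"
  proof -
    have "\<theta> * exp (2 * \<theta>) * p * r \<le> \<theta> * exp (2 * \<theta>) * p * t"
      using r k y pq by (intro mult_left_mono) (auto simp: \<theta>_def)
    also have "\<dots> = k * (n * p) * (y * exp (2 * k * y + 1 - y))"
      unfolding y(2) \<theta>_def by (simp add: exp_add exp_diff mult_ac)
    also have "y * exp (2 * k * y + 1 - y) \<le> 3"
    proof -
      have "2 * k * y \<le> y / 2" using mult_right_mono[OF k(2), of y] y by simp
      then have "exp (2 * k * y + 1 - y) \<le> exp (1 - y / 2)" by simp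
      then have "y * exp (2 * k * y + 1 - y) \<le> y * exp (1 - y / 2)" using y by (intro mult_left_mono) auto
      also have "\<dots> = exp 1 * (y / exp (y / 2))" by (simp add: exp_diff)
      \<comment> \<open>From \<open>exp z >= 1 + z + z^2 / 2\<close> at
        \<open>z = y / 2\<close>.\<close>
      also have "y \<le> exp (y / 2)"
        using exp_lower_Taylor_quadratic[of "y / 2"] y zero_le_power2[of "y / 2 - 1"]
        by (simp add: power2_eq_square algebra_simps)
      then have "exp 1 * (y / exp (y / 2)) \<le> exp 1 * 1" by (intro mult_left_mono) auto
      also have "\<dots> \<le> 3" using exp_le by simp
      finally show ?thesis by simp
    qed
    then have "k * (n * p) * (y * exp (2 * k * y + 1 - y)) \<le> k * (n * p) * 3"
      using k pq by (intro mult_left_mono) auto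
    also have "\<dots> \<le> D / 4" using k(3) by simp
    finally show ?thesis .
  qed
  have \<theta>0: "\<theta> \<ge> 0" using k y by (simp add: \<theta>_def)
  have "(\<Sum>f\<in>S \<times> T. pr f) \<le> (\<Sum>f\<in>S \<times> T. p)" using pr_bounds by (intro sum_mono) auto
  then have V: "(\<Sum>f\<in>S \<times> T. pr f) \<le> p * (s * t)" by (simp add: card_cartesian_product s_def t_def mult.commute)
  have "measure_pmf.prob mu {a. True \<and> \<bar>\<Sum>f\<in>S\<times>T. 1 * W a (fst f) (snd f)\<bar> \<ge> D * r}
    \<le> 2 * exp (- (\<theta> * (D * r)) + 2 * \<theta>\<^sup>2 * exp (2 * \<theta> * 1) * (p * (s * t)))"
    by (rule entry_sum_tail_abs) (use ST V \<theta>0 in auto)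
  also have "\<dots> \<le> 2 * exp (- (12 * (t * y)))"
  proof -
    have "2 * \<theta>\<^sup>2 * exp (2 * \<theta> * 1) * (p * (s * t)) = 2 * \<theta> * r * (\<theta> * exp (2 * \<theta>) * p * r)"
      unfolding r(3)[symmetric] by (simp add: power2_eq_square)
    also have "\<dots> \<le> 2 * \<theta> * r * (D / 4)" using small \<theta>0 r by (intro mult_left_mono) auto
    finally have "2 * \<theta>\<^sup>2 * exp (2 * \<theta> * 1) * (p * (s * t)) \<le> \<theta> * (D * r) - \<theta> * D / 2 * r"
      by (simp only: times_divide_eq_right times_divide_eq_left) (simp add: field_simps)
    then have "- (\<theta> * (D * r)) + 2 * \<theta>\<^sup>2 * exp (2 * \<theta> * 1) * (p * (s * t)) \<le> - (\<theta> * D / 2 * r)" by linarith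
    also have "\<theta> * D / 2 * (D / l * t) \<le> \<theta> * D / 2 * r" using r \<theta>0 D by (intro mult_left_mono) auto
    then have "- (\<theta> * D / 2 * r) \<le> - (\<theta> * D / 2 * (D / l * t))" by simp
    also have "\<theta> * D / 2 * (D / l * t) = 12 * (t * y)" using D by (simp add: \<theta>_def k_def power2_eq_square)
    finally show ?thesis by simp
  qed
  finally show ?thesis
    by (simp add: sum.cartesian_product case_prod_unfold r_def s_def t_def y_def)
qed

text \<open>For a pair of very different sizes the row sums alone imply the bound, so a violation
  forces the hypothesis \<open>dense\<close> of \<open>pair_tail\<close>. With larger set of size
  \<open>t\<close> there are at most \<open>exp (2 * t * y)\<close> pairs, each failing with
  probability at most \<open>2 * exp (- 12 * t * y)\<close>. The surplus
  \<open>10 * t * y >= 2 * ln n\<close> bounds the sum over \<open>t\<close> by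
  \<open>2 / n\<close>.\<close>

lemma discrepancy_prob:
  assumes D: "D > 0" "l > 0" and \<kappa>: "24 * l / D\<^sup>2 \<le> 1/4" "12 * (24 * l / D\<^sup>2) * (n * p) \<le> D"
  shows "measure_pmf.prob mu {a. (\<forall>i<n. (\<Sum>j<n. \<bar>W a i j\<bar>) \<le> l) \<and>
      \<not> (\<forall>S T. S \<subseteq> {..<n} \<longrightarrow> T \<subseteq> {..<n} \<longrightarrow> \<bar>\<Sum>i\<in>S. \<Sum>j\<in>T. W a i j\<bar> \<le> D * sqrt (real (card S) * real (card T)))}
    \<le> 2 / n"
proof -
  define X where "X S T = {a. \<bar>\<Sum>i\<in>S. \<Sum>j\<in>T. W a i j\<bar> \<ge> D * sqrt (real (card S) * real (card T))}" for S T
  define C where "C t = {S. S \<subseteq> {..<n} \<and> card S \<le> t}" for t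
  define P where "P t = {z \<in> C t \<times> C t. card (snd z) = t \<and> D / l * t \<le> sqrt (real (card (fst z)) * t)}" for t
  define U where "U t = (\<Union>z\<in>P t. X (fst z) (snd z))" for t
  define Z where "Z = {a. (\<forall>i<n. (\<Sum>j<n. \<bar>W a i j\<bar>) \<le> l) \<and>
      \<not> (\<forall>S T. S \<subseteq> {..<n} \<longrightarrow> T \<subseteq> {..<n} \<longrightarrow> \<bar>\<Sum>i\<in>S. \<Sum>j\<in>T. W a i j\<bar> \<le> D * sqrt (real (card S) * real (card T)))}"
  have finC: "finite (C t)" for t unfolding C_def by (rule finite_subset[of _ "Pow {..<n}"]) auto
  have finP: "finite (P t)" for t unfolding P_def using finC by auto
  have case1: "\<exists>t\<in>{1..n}. \<exists>z\<in>P t. a \<in> X (fst z) (snd z)"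
    if rows: "\<forall>i<n. (\<Sum>j<n. \<bar>W a i j\<bar>) \<le> l" and ST: "S \<subseteq> {..<n}" "T \<subseteq> {..<n}" "card S \<le> card T"
      and big: "\<bar>\<Sum>i\<in>S. \<Sum>j\<in>T. W a i j\<bar> > D * sqrt (real (card S) * real (card T))" for a S T
  proof -
    define s t where "s = real (card S)" and "t = real (card T)"
    have fin: "finite S" "finite T" using ST finite_subset by blast+
    have "\<bar>\<Sum>i\<in>S. \<Sum>j\<in>T. W a i j\<bar> \<le> (\<Sum>i\<in>S. \<Sum>j<n. \<bar>W a i j\<bar>)"
    proof (rule order.trans[OF sum_abs sum_mono])
      fix i
      have "\<bar>\<Sum>j\<in>T. W a i j\<bar> \<le> (\<Sum>j\<in>T. \<bar>W a i j\<bar>)" by (rule sum_abs)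
      also have "\<dots> \<le> (\<Sum>j<n. \<bar>W a i j\<bar>)" using ST by (intro sum_mono2) auto
      finally show "\<bar>\<Sum>j\<in>T. W a i j\<bar> \<le> (\<Sum>j<n. \<bar>W a i j\<bar>)" .
    qed
    also have "\<dots> \<le> (\<Sum>i\<in>S. l)" using rows ST by (intro sum_mono) auto
    \<comment> \<open>The violated bound lies below the bound from the row sums, which excludes an
      \<open>S\<close> much smaller than \<open>T\<close>.\<close>
    finally have sl: "D * sqrt (s * t) < s * l" using big by (simp add: s_def t_def)
    have s0: "s > 0" using sl D by (cases "s = 0") (auto simp: s_def)
    have dense: "D / l * t \<le> sqrt (s * t)"
    proof -
      have "sqrt s * (D * sqrt t) = D * sqrt (s * t)" by (simp add: real_sqrt_mult)
      also have "\<dots> \<le> s * l" using sl by simp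
      also have "\<dots> = sqrt s * (sqrt s * l)" using s0 by simp
      finally have "D * sqrt t \<le> sqrt s * l" using s0 by (simp only: mult_le_cancel_left_pos real_sqrt_gt_0_iff)
      then have "D * sqrt t * sqrt t \<le> sqrt s * l * sqrt t" by (rule mult_right_mono) (simp add: t_def)
      then show ?thesis using D by (simp add: pos_divide_le_eq real_sqrt_mult mult_ac t_def)
    qed
    have m1: "card T \<le> n" using card_mono[OF _ ST(2)] by simp
    have m2: "1 \<le> card T" using s0 ST(3) by (simp add: s_def)
    have m3: "(S, T) \<in> P (card T)" using ST dense by (simp add: P_def C_def s_def t_def)
    have m4: "a \<in> X S T" unfolding X_def mem_Collect_eq using big by (rule less_imp_le)
    show ?thesis
      by (rule bexI[of _ "card T"], rule bexI[of _ "(S, T)"]) (simp_all only: fst_conv snd_conv m1 m2 m3 m4 atLeastAtMost_iff)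
  qed
  have "{a. (\<forall>i<n. (\<Sum>j<n. \<bar>W a i j\<bar>) \<le> l) \<and>
      \<not> (\<forall>S T. S \<subseteq> {..<n} \<longrightarrow> T \<subseteq> {..<n} \<longrightarrow> \<bar>\<Sum>i\<in>S. \<Sum>j\<in>T. W a i j\<bar> \<le> D * sqrt (real (card S) * real (card T)))}
    \<subseteq> (\<Union>t\<in>{1..n}. \<Union>z\<in>P t. X (fst z) (snd z))"
  proof
    fix a assume "a \<in> {a. (\<forall>i<n. (\<Sum>j<n. \<bar>W a i j\<bar>) \<le> l) \<and>
      \<not> (\<forall>S T. S \<subseteq> {..<n} \<longrightarrow> T \<subseteq> {..<n} \<longrightarrow> \<bar>\<Sum>i\<in>S. \<Sum>j\<in>T. W a i j\<bar> \<le> D * sqrt (real (card S) * real (card T)))}"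
    then obtain S T where rows: "\<forall>i<n. (\<Sum>j<n. \<bar>W a i j\<bar>) \<le> l" and ST: "S \<subseteq> {..<n}" "T \<subseteq> {..<n}"
      and big: "\<not> \<bar>\<Sum>i\<in>S. \<Sum>j\<in>T. W a i j\<bar> \<le> D * sqrt (real (card S) * real (card T))" by blast
    have W_swap: "W a i j = W a j i" for i j unfolding W_def mm_commute[of i j] ..
    have swap: "(\<Sum>i\<in>T. \<Sum>j\<in>S. W a i j) = (\<Sum>i\<in>S. \<Sum>j\<in>T. W a i j)"
      by (subst sum.swap, rule sum.cong[OF refl], rule sum.cong[OF refl], rule W_swap)
    have "\<exists>t\<in>{1..n}. \<exists>z\<in>P t. a \<in> X (fst z) (snd z)"
    proof (cases "card S \<le> card T")
      case True
      have big': "\<bar>\<Sum>i\<in>S. \<Sum>j\<in>T. W a i j\<bar> > D * sqrt (real (card S) * real (card T))"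
        using big by (rule not_le_imp_less)
      have c: "\<exists>t\<in>{1..n}. \<exists>z\<in>P t. a \<in> X (fst z) (snd z)"
        by (rule case1[of a S T, OF rows ST(1) ST(2) True big'])
      show ?thesis by (rule c)
    next
      case False
      then have le: "card T \<le> card S" by simp
      show ?thesis
      proof (rule case1[of a T S, OF rows ST(2) ST(1) le])
        show "\<bar>\<Sum>i\<in>T. \<Sum>j\<in>S. W a i j\<bar> > D * sqrt (real (card T) * real (card S))"
        using big unfolding swap not_le mult.commute[of "real (card T)"] .
      qed
    qed
    then show "a \<in> (\<Union>t\<in>{1..n}. \<Union>z\<in>P t. X (fst z) (snd z))" unfolding UN_iff .
  qed
  then have d1: "measure_pmf.prob mu Z \<le> measure_pmf.prob mu (\<Union>t\<in>{1..n}. U t)"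
    unfolding Z_def U_def by (rule prob_pmf_mono)
  have d2: "measure_pmf.prob mu (\<Union>t\<in>{1..n}. U t) \<le> (\<Sum>t\<in>{1..n}. measure_pmf.prob mu (U t))"
    by (rule prob_pmf_union_bound) simp
  have d3: "(\<Sum>t\<in>{1..n}. measure_pmf.prob mu (U t)) \<le> (\<Sum>t\<in>{1..n}. 2 * exp (- (2 * ln n)))"
  proof (rule sum_mono)
    fix t assume "t \<in> {1..n}"
    then have t: "1 \<le> t" "t \<le> n" by auto
    define y where "y = ln (exp 1 * n / t)"
    have ey: "exp y = exp 1 * n / t" unfolding y_def using t by (intro exp_ln) auto
    have cC: "real (card (C t)) \<le> exp (t * y)"
      using subset_count_le[OF t] unfolding C_def ey[symmetric] exp_of_nat_mult .
    have "card (P t) \<le> card (C t \<times> C t)" unfolding P_def using finC by (intro card_mono) auto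
    then have "real (card (P t)) \<le> real (card (C t)) * real (card (C t))" unfolding card_cartesian_product of_nat_mult[symmetric] of_nat_le_iff .
    also have "\<dots> \<le> exp (t * y) * exp (t * y)" using cC by (intro mult_mono) auto
    also have "\<dots> = exp (2 * (t * y))" by (simp only: exp_add mult_2)
    finally have cP: "real (card (P t)) \<le> exp (2 * (t * y))" .
    have c1: "measure_pmf.prob mu (\<Union>z\<in>P t. X (fst z) (snd z)) \<le> (\<Sum>z\<in>P t. measure_pmf.prob mu (X (fst z) (snd z)))"
      by (rule prob_pmf_union_bound[OF finP])
    have c2: "(\<Sum>z\<in>P t. measure_pmf.prob mu (X (fst z) (snd z))) \<le> (\<Sum>z\<in>P t. 2 * exp (- (12 * (t * y))))"
    proof (rule sum_mono)
      fix z assume z: "z \<in> P t"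
      obtain S T where ST: "z = (S, T)" by (cases z)
      show "measure_pmf.prob mu (X (fst z) (snd z)) \<le> 2 * exp (- (12 * (t * y)))"
        using pair_tail[of S T D l] z t D \<kappa> unfolding ST X_def y_def unfolding P_def C_def by auto
    qed
    have c3: "(\<Sum>z\<in>P t. 2 * exp (- (12 * (t * y)))) \<le> exp (2 * (t * y)) * (2 * exp (- (12 * (t * y))))" using cP by (simp add: mult_right_mono)
    have c4: "exp (2 * (t * y)) * (2 * exp (- (12 * (t * y)))) = 2 * exp (- (10 * (t * y)))"
    proof -
      have "exp (2 * z) * exp (- (12 * z)) = exp (- (10 * z))" for z :: real
        using exp_add[of "2 * z" "- (12 * z)"] by simp
      then show ?thesis by simp
    qed
    have c5: "2 * exp (- (10 * (t * y))) \<le> 2 * exp (- (2 * ln n))"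
    proof -
      have "ln (real n) \<ge> 0" using n_ge by simp
      moreover have "real t * y \<ge> 1 + ln n" using entropy_ge[OF t] by (simp add: y_def)
      ultimately have "10 * (t * y) \<ge> 2 * ln n" by linarith
      then show ?thesis by simp
    qed
    show "measure_pmf.prob mu (U t) \<le> 2 * exp (- (2 * ln n))"
      using c1 c2 c3 c4 c5 unfolding U_def by linarith
  qed
  have d4: "(\<Sum>t\<in>{1..n}. 2 * exp (- (2 * ln n))) = n * (2 * exp (- (2 * ln n)))"
  proof -
    have "(\<Sum>t\<in>{1..n}. c) = n * c" for c :: real by simp
    then show ?thesis by blast
  qed
  have d5: "n * (2 * exp (- (2 * ln n))) = 2 / n"
  proof -
    have "exp (- ln (real n)) = 1 / n" using n_ge by (simp add: exp_minus inverse_eq_divide)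
    then have "exp (- (2 * ln (real n))) = 1 / n * (1 / n)"
      using exp_add[of "- ln (real n)" "- ln (real n)"] by simp
    then show ?thesis using n_ge by simp
  qed
  show ?thesis using d1 d2 d3 d4 d5 unfolding Z_def by linarith
qed

text \<open>The minor reads no bit of row or column \<open>i\<close>, so given the other bits
  \<open>zi\<close> is constant. The choice \<open>\<theta> = s / (3 * B)\<close> scales the
  coefficients to size at most \<open>s\<close>, and \<open>w ^ Suc k / B <= w / K2\<close> makes
  the exponent independent of \<open>k\<close>.\<close>

lemma row_indep_prob:
  fixes \<xi> :: "nat \<Rightarrow> real" and k :: nat
  assumes i: "i < n" and K: "K1 \<ge> K2" "K2 > 0" "0 \<le> w" "w \<le> K2" and s: "s \<ge> 0"
  defines "zi \<equiv> \<lambda>a. (mv n (minor i (W a)) ^^ Suc k) \<xi>"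
  shows "measure_pmf.prob mu {a. (\<forall>j<n. \<bar>zi a j\<bar> \<le> 3 * (K1 * K2 ^ k)) \<and> nrm n (zi a) \<le> w ^ Suc k * sqrt n \<and>
      \<not> \<bar>mv n (W a) (zi a) i\<bar> \<le> K1 * K2 ^ Suc k / 2}
    \<le> 2 * exp (- (s * K2 / 6) + s\<^sup>2 * exp (2 * s) * (n * p) * (w / K2)\<^sup>2)"
proof -
  define B where "B = K1 * K2 ^ k"
  have B: "B > 0" using K by (auto simp: B_def)
  define \<theta> where "\<theta> = s / (3 * B)"
  define good where "good a \<longleftrightarrow> (\<forall>j<n. \<bar>zi a j\<bar> \<le> 3 * B) \<and> nrm n (zi a) \<le> w ^ Suc k * sqrt n" for a
  let ?F = "{i} \<times> {..<n}"
  have sumF: "(\<Sum>f\<in>?F. h f) = (\<Sum>j<n. h (i, j))" for h :: "_ \<Rightarrow> real"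
    by (subst sum_fst_snd[of "\<lambda>i j. h (i, j)" "{..<n}" "{i}", simplified, symmetric]) simp
  have "measure_pmf.prob mu {a. good a \<and> \<bar>\<Sum>f\<in>?F. zi a (snd f) * W a (fst f) (snd f)\<bar> \<ge> K2 * B / 2}
    \<le> 2 * exp (- (\<theta> * (K2 * B / 2)) + 2 * \<theta>\<^sup>2 * exp (2 * \<theta> * (3 * B)) * (p * ((w ^ Suc k)\<^sup>2 * n)))"
  proof (rule entry_sum_tail_abs)
    show "?F \<subseteq> {..<n} \<times> {..<n}" using i by auto
    show "\<theta> \<ge> 0" "3 * B \<ge> 0" using s B by (auto simp: \<theta>_def)
  next
    fix a a' assume eq: "\<And>j k. (j, k) \<notin> ?F \<Longrightarrow> (k, j) \<notin> ?F \<Longrightarrow> a (j, k) = (a' (j, k) :: bool)"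
    have "minor i (W a) = minor i (W a')"
    proof (intro ext)
      fix j k show "minor i (W a) j k = minor i (W a') j k"
        using eq[of "min j k" "max j k"] by (auto simp: minor_def W_def mm_def min_def max_def)
    qed
    then have "zi a = zi a'" by (simp add: zi_def)
    then show "(\<lambda>f. zi a (snd f)) = (\<lambda>f. zi a' (snd f)) \<and> good a = good a'" by (simp add: good_def)
  next
    fix a assume a: "good a"
    have "(\<Sum>j<n. (zi a j)\<^sup>2 * pr (i, j)) \<le> (\<Sum>j<n. (zi a j)\<^sup>2 * p)"
      using pr_bounds by (intro sum_mono mult_left_mono) auto
    also have "\<dots> = p * (nrm n (zi a))\<^sup>2" unfolding nrm_power2 ip_def sum_distrib_left by (simp add: power2_eq_square mult_ac)
    also have "(nrm n (zi a))\<^sup>2 \<le> (w ^ Suc k * sqrt n)\<^sup>2" using a by (intro power_mono) (auto simp: good_def)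
    also have "(w ^ Suc k * sqrt n)\<^sup>2 = (w ^ Suc k)\<^sup>2 * n" unfolding power_mult_distrib by simp
    finally have "(\<Sum>j<n. (zi a j)\<^sup>2 * pr (i, j)) \<le> p * ((w ^ Suc k)\<^sup>2 * n)" using pq by (simp add: mult_left_mono)
    then show "(\<forall>f\<in>?F. \<bar>zi a (snd f)\<bar> \<le> 3 * B) \<and> (\<Sum>f\<in>?F. (zi a (snd f))\<^sup>2 * pr f) \<le> p * ((w ^ Suc k)\<^sup>2 * n)"
      using a unfolding sumF by (auto simp: good_def)
  qed
  also have "\<dots> \<le> 2 * exp (- (s * K2 / 6) + s\<^sup>2 * exp (2 * s) * (n * p) * (w / K2)\<^sup>2)"
  proof -
    have 1: "\<theta> * (K2 * B / 2) = s * K2 / 6" "2 * \<theta> * (3 * B) = 2 * s" using B by (auto simp: \<theta>_def)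
    have "K2 ^ Suc k \<le> B" using K by (simp add: B_def mult_right_mono)
    then have "w ^ Suc k / B \<le> w ^ Suc k / K2 ^ Suc k" using K B by (intro divide_left_mono) auto
    also have "\<dots> = (w / K2) ^ Suc k" by (simp add: power_divide)
    also have "\<dots> \<le> (w / K2) ^ 1" using K by (intro power_decreasing) auto
    finally have "(w ^ Suc k / B)\<^sup>2 \<le> (w / K2)\<^sup>2" using K B by (intro power_mono) auto
    then have "s\<^sup>2 * exp (2 * s) * (n * p) * ((w ^ Suc k / B)\<^sup>2 * (2 / 9)) \<le> s\<^sup>2 * exp (2 * s) * (n * p) * ((w / K2)\<^sup>2 * 1)"
      using pq by (intro mult_left_mono mult_mono) auto
    moreover have "2 * \<theta>\<^sup>2 * exp (2 * s) * (p * ((w ^ Suc k)\<^sup>2 * n)) = s\<^sup>2 * exp (2 * s) * (n * p) * ((w ^ Suc k / B)\<^sup>2 * (2 / 9))"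
      using B unfolding \<theta>_def power_divide power_mult_distrib by (simp add: mult_ac)
    ultimately have "2 * \<theta>\<^sup>2 * exp (2 * s) * (p * ((w ^ Suc k)\<^sup>2 * n)) \<le> s\<^sup>2 * exp (2 * s) * (n * p) * (w / K2)\<^sup>2"
      by (simp only: mult_1_right)
    then show ?thesis unfolding 1 by (simp only: mult_le_cancel_left_pos exp_le_cancel_iff add_le_cancel_left zero_less_numeral)
  qed
  finally have "measure_pmf.prob mu {a. good a \<and> \<bar>\<Sum>j<n. zi a j * W a i j\<bar> \<ge> K2 * B / 2}
    \<le> 2 * exp (- (s * K2 / 6) + s\<^sup>2 * exp (2 * s) * (n * p) * (w / K2)\<^sup>2)" unfolding sumF by simp
  moreover have "measure_pmf.prob mu {a. (\<forall>j<n. \<bar>zi a j\<bar> \<le> 3 * (K1 * K2 ^ k)) \<and> nrm n (zi a) \<le> w ^ Suc k * sqrt n \<and>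
      \<not> \<bar>mv n (W a) (zi a) i\<bar> \<le> K1 * K2 ^ Suc k / 2} \<le> measure_pmf.prob mu {a. good a \<and> \<bar>\<Sum>j<n. zi a j * W a i j\<bar> \<ge> K2 * B / 2}"
  proof (intro prob_pmf_mono subsetI)
    fix a assume a: "a \<in> {a. (\<forall>j<n. \<bar>zi a j\<bar> \<le> 3 * (K1 * K2 ^ k)) \<and> nrm n (zi a) \<le> w ^ Suc k * sqrt n \<and>
      \<not> \<bar>mv n (W a) (zi a) i\<bar> \<le> K1 * K2 ^ Suc k / 2}"
    have "mv n (W a) (zi a) i = (\<Sum>j<n. zi a j * W a i j)" by (simp add: mv_def mult.commute)
    moreover have "K1 * K2 ^ Suc k = K2 * B" by (simp add: B_def)
    ultimately show "a \<in> {a. good a \<and> \<bar>\<Sum>j<n. zi a j * W a i j\<bar> \<ge> K2 * B / 2}"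
      using a unfolding mem_Collect_eq good_def B_def[symmetric] not_le by (metis less_imp_le)
  qed
  ultimately show ?thesis by linarith
qed

section \<open>The typical event and its consequences for a fixed graph\<close>

definition typical :: "real \<Rightarrow> real \<Rightarrow> real \<Rightarrow> real \<Rightarrow> real \<Rightarrow> nat \<Rightarrow> (nat \<times> nat \<Rightarrow> bool) \<Rightarrow> bool" where
  "typical K1 K2 w D s m a \<longleftrightarrow>
     (\<forall>i<n. (\<Sum>j<n. \<bar>W a i j\<bar>) \<le> K1) \<and>
     (\<forall>S T. S \<subseteq> {..<n} \<longrightarrow> T \<subseteq> {..<n} \<longrightarrow> \<bar>\<Sum>i\<in>S. \<Sum>j\<in>T. W a i j\<bar> \<le> D * sqrt (real (card S) * real (card T))) \<and>
     (\<forall>\<xi>\<in>{\<lambda>_. 1, x}. \<forall>i<n. \<forall>k\<le>m.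
        (\<forall>j<n. \<bar>(mv n (minor i (W a)) ^^ Suc k) \<xi> j\<bar> \<le> 3 * (K1 * K2 ^ k)) \<longrightarrow>
        nrm n ((mv n (minor i (W a)) ^^ Suc k) \<xi>) \<le> w ^ Suc k * sqrt n \<longrightarrow>
        \<bar>mv n (W a) ((mv n (minor i (W a)) ^^ Suc k) \<xi>) i\<bar> \<le> K1 * K2 ^ Suc k / 2) \<and>
     (\<forall>i<n. s < (\<Sum>j<n. x i * x j * of_bool (a (mm i j))))"

text \<open>The third clause of \<open>typical\<close> is an implication, and only its failure under
  true premises is charged; this is the event of \<open>row_indep_prob\<close>. Two start vectors,
  two tails, \<open>n\<close> vertices and \<open>m + 1\<close> powers make up the factor
  \<open>4 * n * (m + 1)\<close>.\<close>

lemma typical_prob: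
  assumes D: "D > 0" "24 * K1 / D\<^sup>2 \<le> 1/4" "12 * (24 * K1 / D\<^sup>2) * (n * p) \<le> D"
    and K: "K1 \<ge> K2" "K2 > 0" "0 \<le> w" "w \<le> K2" and \<theta>: "\<theta> \<ge> 0" and r: "r \<ge> 0"
  shows "measure_pmf.prob mu {a. \<not> typical K1 K2 w D s m a} \<le>
     n * exp (- (K1 - 2 * (n * p)) + 2 * exp 2 * (n * p)) + 2 / n
     + 4 * real n * (real m + 1) * exp (- (r * K2 / 6) + r\<^sup>2 * exp (2 * r) * (n * p) * (w / K2)\<^sup>2)
     + n * exp (\<theta> * s + n / 2 * (p * (exp (- \<theta>) - 1) + q * (exp \<theta> - 1)))"
proof -
  define E1 where "E1 i = {a. (\<Sum>j<n. \<bar>W a i j\<bar>) > (K1 - 2 * (n * p)) + 2 * (n * p)}" for i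
  define E2 where "E2 = {a. (\<forall>i<n. (\<Sum>j<n. \<bar>W a i j\<bar>) \<le> K1) \<and>
      \<not> (\<forall>S T. S \<subseteq> {..<n} \<longrightarrow> T \<subseteq> {..<n} \<longrightarrow> \<bar>\<Sum>i\<in>S. \<Sum>j\<in>T. W a i j\<bar> \<le> D * sqrt (real (card S) * real (card T)))}"
  define E3 where "E3 \<xi> i k = {a. (\<forall>j<n. \<bar>(mv n (minor i (W a)) ^^ Suc k) \<xi> j\<bar> \<le> 3 * (K1 * K2 ^ k)) \<and>
        nrm n ((mv n (minor i (W a)) ^^ Suc k) \<xi>) \<le> w ^ Suc k * sqrt n \<and>
        \<not> \<bar>mv n (W a) ((mv n (minor i (W a)) ^^ Suc k) \<xi>) i\<bar> \<le> K1 * K2 ^ Suc k / 2}" for \<xi> i k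
  define E4 where "E4 i = {a. (\<Sum>j<n. x i * x j * of_bool (a (mm i j))) \<le> s}" for i
  let ?e3 = "2 * exp (- (r * K2 / 6) + r\<^sup>2 * exp (2 * r) * (n * p) * (w / K2)\<^sup>2)"
  define E3' where "E3' \<xi> = (\<Union>z\<in>{..<n}\<times>{..m}. E3 \<xi> (fst z) (snd z))" for \<xi>
  have "{a. \<not> typical K1 K2 w D s m a} \<subseteq> (\<Union>i\<in>{..<n}. E1 i) \<union> E2 \<union> (E3' (\<lambda>_. 1) \<union> E3' x) \<union> (\<Union>i\<in>{..<n}. E4 i)"
  proof (rule subsetI, rule ccontr)
    fix a assume nt: "a \<in> {a. \<not> typical K1 K2 w D s m a}"
      and out: "a \<notin> (\<Union>i\<in>{..<n}. E1 i) \<union> E2 \<union> (E3' (\<lambda>_. 1) \<union> E3' x) \<union> (\<Union>i\<in>{..<n}. E4 i)"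
    have rows: "\<forall>i<n. (\<Sum>j<n. \<bar>W a i j\<bar>) \<le> K1" using out by (auto simp: E1_def not_less)
    moreover have "\<forall>S T. S \<subseteq> {..<n} \<longrightarrow> T \<subseteq> {..<n} \<longrightarrow> \<bar>\<Sum>i\<in>S. \<Sum>j\<in>T. W a i j\<bar> \<le> D * sqrt (real (card S) * real (card T))"
    proof -
      have "a \<notin> E2" using out by blast
      with rows show ?thesis unfolding E2_def mem_Collect_eq by blast
    qed
    moreover have "a \<notin> E3 \<xi> i k" if "\<xi> \<in> {\<lambda>_. 1, x}" "i < n" "k \<le> m" for \<xi> i k
    proof
      assume "a \<in> E3 \<xi> i k"
      then have "a \<in> E3' \<xi>" using that unfolding E3'_def by (intro UN_I[of "(i, k)"]) auto
      then show False using out that by blast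
    qed
    moreover have "\<forall>i<n. s < (\<Sum>j<n. x i * x j * of_bool (a (mm i j)))"
    proof (intro allI impI)
      fix i assume "i < n"
      then have "a \<notin> E4 i" using out by blast
      then show "s < (\<Sum>j<n. x i * x j * of_bool (a (mm i j)))" unfolding E4_def mem_Collect_eq not_le .
    qed
    ultimately have "typical K1 K2 w D s m a" unfolding typical_def E3_def mem_Collect_eq by blast
    then show False using nt by blast
  qed
  then have "measure_pmf.prob mu {a. \<not> typical K1 K2 w D s m a} \<le> measure_pmf.prob mu ((\<Union>i\<in>{..<n}. E1 i) \<union> E2 \<union> (E3' (\<lambda>_. 1) \<union> E3' x) \<union> (\<Union>i\<in>{..<n}. E4 i))"
    by (rule prob_pmf_mono)
  also have "\<dots> \<le> measure_pmf.prob mu (\<Union>i\<in>{..<n}. E1 i) + measure_pmf.prob mu E2 + (measure_pmf.prob mu (E3' (\<lambda>_. 1)) + measure_pmf.prob mu (E3' x)) + measure_pmf.prob mu (\<Union>i\<in>{..<n}. E4 i)"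
    using measure_Un_le[of "(\<Union>i\<in>{..<n}. E1 i) \<union> E2 \<union> (E3' (\<lambda>_. 1) \<union> E3' x)" mu "\<Union>i\<in>{..<n}. E4 i"]
      measure_Un_le[of "(\<Union>i\<in>{..<n}. E1 i) \<union> E2" mu "E3' (\<lambda>_. 1) \<union> E3' x"]
      measure_Un_le[of "\<Union>i\<in>{..<n}. E1 i" mu E2] measure_Un_le[of "E3' (\<lambda>_. 1)" mu "E3' x"] by simp
  finally have 0: "measure_pmf.prob mu {a. \<not> typical K1 K2 w D s m a} \<le> measure_pmf.prob mu (\<Union>i\<in>{..<n}. E1 i) + measure_pmf.prob mu E2 + (measure_pmf.prob mu (E3' (\<lambda>_. 1)) + measure_pmf.prob mu (E3' x)) + measure_pmf.prob mu (\<Union>i\<in>{..<n}. E4 i)" .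
  have 1: "measure_pmf.prob mu (\<Union>i\<in>{..<n}. E1 i) \<le> n * exp (- (K1 - 2 * (n * p)) + 2 * exp 2 * (n * p))"
  proof -
    have "measure_pmf.prob mu (\<Union>i\<in>{..<n}. E1 i) \<le> (\<Sum>i<n. measure_pmf.prob mu (E1 i))"
      by (rule prob_pmf_union_bound) simp
    also have "\<dots> \<le> (\<Sum>i<n. exp (- (K1 - 2 * (n * p)) + 2 * exp 2 * (n * p)))"
      unfolding E1_def by (intro sum_mono row_tail) auto
    finally show ?thesis by simp
  qed
  have 2: "measure_pmf.prob mu E2 \<le> 2 / n"
    unfolding E2_def using D K by (intro discrepancy_prob) auto
  have E3: "measure_pmf.prob mu (E3' \<xi>) \<le> n * (m + 1) * ?e3" for \<xi>
  proof -
    have "measure_pmf.prob mu (E3' \<xi>) \<le> (\<Sum>z\<in>{..<n}\<times>{..m}. measure_pmf.prob mu (E3 \<xi> (fst z) (snd z)))"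
      unfolding E3'_def by (rule prob_pmf_union_bound) simp
    also have "\<dots> \<le> (\<Sum>z\<in>{..<n}\<times>{..m}. ?e3)"
      unfolding E3_def using K r by (intro sum_mono row_indep_prob) auto
    also have "\<dots> = n * (m + 1) * ?e3" by (simp add: card_cartesian_product)
    finally show ?thesis .
  qed
  have 4: "measure_pmf.prob mu (\<Union>i\<in>{..<n}. E4 i) \<le> n * exp (\<theta> * s + n / 2 * (p * (exp (- \<theta>) - 1) + q * (exp \<theta> - 1)))"
  proof -
    have "measure_pmf.prob mu (\<Union>i\<in>{..<n}. E4 i) \<le> (\<Sum>i<n. measure_pmf.prob mu (E4 i))"
      by (rule prob_pmf_union_bound) simp
    also have "\<dots> \<le> (\<Sum>i<n. exp (\<theta> * s + n / 2 * (p * (exp (- \<theta>) - 1) + q * (exp \<theta> - 1))))"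
      unfolding E4_def by (intro sum_mono community_tail \<theta>) auto
    finally show ?thesis by simp
  qed
  have "4 * real n * (real m + 1) * exp (- (r * K2 / 6) + r\<^sup>2 * exp (2 * r) * (n * p) * (w / K2)\<^sup>2) = n * (m + 1) * ?e3 + n * (m + 1) * ?e3"
    by (simp add: algebra_simps)
  then show ?thesis using 0 1 2 E3[of "\<lambda>_. 1"] E3[of x] 4 by linarith
qed

end

section \<open>The logarithmic regime\<close>

text \<open>The first two claims are the hypotheses on the discrepancy \<open>D\<close>; the second
  needs \<open>D^3\<close> well above \<open>(ln n)^2\<close>, and the exponent 7/10 achieves this.
  Balancing \<open>D * R^2\<close> against \<open>ln n / R\<close> gives \<open>R\<close> the
  exponent 1/10 and both terms 9/10, the exponent of \<open>w\<close>. In the last claim half of the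
  gain 1/10 is given up to absorb constants.\<close>

lemma scale_conditions:
  fixes \<alpha> \<beta> C \<eta> \<epsilon> r :: real
  assumes pos: "\<alpha> > \<beta>" "\<beta> > 0" "C > 0" "\<eta> > 0" "\<epsilon> > 0" "r > 0"
  shows
    "eventually (\<lambda>n. (24 * (C * ln n) / (ln n powr (7/10))\<^sup>2) \<le> 1/4) (at_top :: nat filter)"
    "eventually (\<lambda>n. 12 * (24 * (C * ln n) / (ln n powr (7/10))\<^sup>2) * (\<alpha> * ln n) \<le> ln n powr (7/10)) (at_top :: nat filter)"
    "eventually (\<lambda>n. 4 * sqrt (C * ln n) \<le> \<eta> * ln n) (at_top :: nat filter)"
    "eventually (\<lambda>n. 2 * ((2 + 4 * C) * ln n powr (9/10)) + sqrt (C * ln n) \<le> \<eta> * ln n) (at_top :: nat filter)"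
    "eventually (\<lambda>n. (2 + 4 * C) * ln n powr (9/10) / ln n \<le> r) (at_top :: nat filter)"
    "eventually (\<lambda>n. (2 * ((2 + 4 * C) * ln n powr (9/10))) / ((\<alpha> - \<beta>) / 2 * ln n) \<le> ln n powr (- 1/20)) (at_top :: nat filter)"
  using assms by (real_asymp)+

context sbm
begin

lemma typical_imp_planted:
  assumes ty: "typical K1 K2 w D s m a" and w: "w = 2 * D * R\<^sup>2 + 4 * K1 / R" "w > 0" and DR: "D \<ge> 0" "R \<ge> 1"
    and gaps: "n * (p - q) / 2 > 4 * w" "n * q > 4 * w"
  shows "planted n x (W a) (n * (p + q) / 2) (n * (p - q) / 2) w"
proof
  interpret discrepancy n "W a" D K1 R
    using ty DR W_sym by unfold_locales (auto simp: typical_def)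
  show "nrm n (mv n (W a) v) \<le> w * nrm n v" for v using operator_norm w by simp
  show "n > 0" using n_ge by simp
  show "n * (p + q) / 2 - n * (p - q) / 2 > 4 * w" using gaps by (simp add: field_simps)
qed (use x_pm x_sum W_sym w gaps in auto)

text \<open>The mean part along \<open>one\<close> cancels because the labels are balanced, and the
  part along \<open>x\<close> contributes the constant \<open>n * (p - q) / 2\<close>.\<close>

lemma community_degree:
  assumes i: "i < n"
  shows "x i * mv n (W a) x i = (\<Sum>j<n. x i * x j * of_bool (a (mm i j))) - n * (p - q) / 2"
proof -
  have "x i * mv n (W a) x i = (\<Sum>j<n. x i * x j * of_bool (a (mm i j)) - (p + q) / 2 * x i * x j - (p - q) / 2)"
    unfolding mv_def sum_distrib_left
  proof (intro sum.cong refl)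
    fix j assume "j \<in> {..<n}"
    then have j: "j < n" by simp
    have "x i * x i = 1" "x j * x j = 1" using x_pm[OF i] x_pm[OF j] by auto
    then have "x i * x j * (x i * x j) = 1" by (metis mult.assoc mult.commute mult.right_neutral)
    then show "x i * (W a i j * x j) = x i * x j * of_bool (a (mm i j)) - (p + q) / 2 * x i * x j - (p - q) / 2"
      
      unfolding W_eq[OF i j] using x_pm[OF i] x_pm[OF j] by (auto simp: algebra_simps)
  qed
  also have "\<dots> = (\<Sum>j<n. x i * x j * of_bool (a (mm i j))) - (p + q) / 2 * x i * (\<Sum>j<n. x j) - n * ((p - q) / 2)"
    by (simp add: sum_subtractf sum_distrib_left)
  finally show ?thesis by (simp add: x_sum)
qed

text \<open>As \<open>u2\<close> has overlap at least \<open>sqrt n / 2\<close> with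
  \<open>x\<close> in absolute value and \<open>l2 <= 2 * b\<close>, the normalisation
  \<open>\<rho>\<close> is at most \<open>4 * sqrt n\<close> in absolute value. Dividing the
  normalised bound \<open>k\<close> by it gives entries of order \<open>1 / sqrt n\<close>, with the
  labels as signs up to the sign of \<open>\<rho>\<close>.\<close>

lemma typical_entry:
  assumes ty: "typical K1 K2 w D s m a"
    and pe: "planted_eigen n x (W a) (n * (p + q) / 2) (n * (p - q) / 2) w u1 u2 l1 l2"
  defines "A0 \<equiv> n * (p + q) / 2" and "b \<equiv> n * (p - q) / 2"
  assumes K: "K1 \<ge> 1" "4 * sqrt K1 \<le> K2" "2 * w + sqrt K1 \<le> K2" "K2 \<le> b / 4"
    and w: "8 * A0 * w\<^sup>2 \<le> b * (n * q - w)\<^sup>2" "16 * w \<le> b" "w \<le> s"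
    and k: "k > 0" "(s - w) / (2 * b) - 8 * K1 * K2 / b\<^sup>2 - 2 * A0 * w / (b * (n * q - w)) * (1 + 4 * K1 / b) - 4 * sqrt n * (1 / 2) ^ (m + 2) \<ge> k"
  shows "\<exists>\<sigma>. (\<sigma> = 1 \<or> \<sigma> = -1) \<and> (\<forall>i<n. \<sigma> * (x i * u2 i) \<ge> k / 4 / sqrt n)"
proof -
  interpret P: planted_eigen n x "W a" A0 b w u1 u2 l1 l2 using pe by (simp add: A0_def b_def)
  have ab: "A0 - b = n * q" by (simp add: A0_def b_def field_simps)
  have b0: "b > 0" "w > 0" "n * q - w > 0" using P.b_gt P.w_pos P.ab_gap ab by auto
  have l2: "b / 2 \<le> l2" "l2 \<le> 2 * b" "15 * w \<le> l2" using P.l2_bounds w b0 by auto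
  have A0: "A0 > 0" using ab b0 by linarith
  have K2: "K2 \<ge> 0" using K real_sqrt_ge_zero[of K1] by linarith
  \<comment> \<open>The third clause of \<open>typical\<close> supplies \<open>row_indep\<close> for
    both starts, \<open>one\<close> and \<open>x\<close>.\<close>
  have loo: "leave_one_out n (W a) \<xi> w K1 K2 m" if xi: "\<xi> \<in> {\<lambda>_. 1, x}" for \<xi>
  proof
    show "\<bar>\<xi> i\<bar> \<le> 1" if "i < n" for i using xi x_pm[OF that] by auto
    show "nrm n \<xi> \<le> sqrt n" using xi P.nrm_u2 by auto
    show "nrm n (mv n (W a) v) \<le> w * nrm n v" for v by (rule P.W_norm)
    show "(\<Sum>j<n. \<bar>W a i j\<bar>) \<le> K1" if "i < n" for i using ty that by (auto simp: typical_def)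
    show "\<bar>mv n (W a) ((mv n (minor i (W a)) ^^ Suc k) \<xi>) i\<bar> \<le> K1 * K2 ^ Suc k / 2"
      if "i < n" "k \<le> m" "\<And>j. j < n \<Longrightarrow> \<bar>(mv n (minor i (W a)) ^^ Suc k) \<xi> j\<bar> \<le> 3 * (K1 * K2 ^ k)"
        "nrm n ((mv n (minor i (W a)) ^^ Suc k) \<xi>) \<le> w ^ Suc k * sqrt n" for i k
      using ty xi that unfolding typical_def by blast
  qed (use W_sym W_le_1 b0 K in auto)
  define \<tau> where "\<tau> = ip n x u2"
  have "\<tau>\<^sup>2 \<ge> n / 4" unfolding \<tau>_def by (rule P.u2_x) (use w ab in auto)
  then have "sqrt (n / 4) \<le> sqrt (\<tau>\<^sup>2)" by (rule real_sqrt_le_mono)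
  then have \<tau>: "\<bar>\<tau>\<bar> \<ge> sqrt n / 2" by (simp add: real_sqrt_divide)
  have n0: "sqrt n > 0" using n_ge by simp
  have \<tau>0: "\<tau> \<noteq> 0" "\<bar>\<tau>\<bar> > 0" using \<tau> n0 by auto
  define \<rho> \<gamma> where "\<rho> = n * l2 / (b * \<tau>)" and "\<gamma> = A0 * ip n (\<lambda>_. 1) u2 / (b * \<tau>)"
  have \<rho>: "\<bar>\<rho>\<bar> \<le> 4 * sqrt n" "\<bar>\<rho>\<bar> > 0"
  proof -
    have "\<bar>\<rho>\<bar> = n * l2 / (b * \<bar>\<tau>\<bar>)" using b0 l2 by (simp add: \<rho>_def abs_mult)
    also have "\<dots> \<le> n * (2 * b) / (b * (sqrt n / 2))"
      using b0 l2 \<tau> n0 by (intro frac_le mult_left_mono) auto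
    also have "\<dots> = 4 * (real n / sqrt n)" using b0 by simp
    also have "\<dots> = 4 * sqrt n" by (simp add: real_div_sqrt)
    finally show "\<bar>\<rho>\<bar> \<le> 4 * sqrt n" .
    show "\<bar>\<rho>\<bar> > 0" using b0 l2 \<tau>0 n_ge by (simp add: \<rho>_def)
  qed
  have \<gamma>: "\<bar>\<gamma>\<bar> \<le> 2 * A0 * w / (b * (n * q - w))"
  proof -
    have "\<bar>\<gamma>\<bar> = A0 * \<bar>ip n (\<lambda>_. 1) u2\<bar> / (b * \<bar>\<tau>\<bar>)" using b0 A0 by (simp add: \<gamma>_def abs_mult)
    also have "\<dots> \<le> A0 * (sqrt n * w / (n * q - w)) / (b * (sqrt n / 2))"
      using b0 A0 \<tau> n0 P.u2_one ab by (intro frac_le mult_left_mono) auto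
    also have "\<dots> = 2 * A0 * w / (b * (n * q - w))" using n0 by (simp add: mult_ac)
    finally show ?thesis .
  qed
  have main: "\<rho> * (x i * u2 i) \<ge> k" if i: "i < n" for i
  proof -
    have "\<rho> * (x i * u2 i) \<ge> (s - w) / l2 - 2 * K1 * K2 / l2\<^sup>2 - \<bar>\<gamma>\<bar> * (1 + 2 * K1 / l2) - \<bar>\<rho>\<bar> * (w / l2) ^ (m + 2)"
      unfolding \<rho>_def \<gamma>_def \<tau>_def
    proof (rule P.u2_entry[OF i])
      show "\<bar>(mv n (W a) ^^ Suc j) (\<lambda>_. 1) i\<bar> \<le> K1 * K2 ^ j" if "j \<le> m" for j
        using leave_one_out.power_entry_bound[OF loo, of "\<lambda>_. 1" j i] that i by simp
      show "\<bar>(mv n (W a) ^^ Suc j) x i\<bar> \<le> K1 * K2 ^ j" if "j \<le> m" for j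
        using leave_one_out.power_entry_bound[OF loo, of x j i] that i by simp
      have "s < (\<Sum>j<n. x i * x j * of_bool (a (mm i j)))" using ty i by (auto simp: typical_def)
      then show "s - b \<le> x i * mv n (W a) x i" unfolding community_degree[OF i] b_def by simp
    qed (use K K2 l2 \<tau>0 in \<open>auto simp: \<tau>_def\<close>)
    moreover have "(s - w) / (2 * b) \<le> (s - w) / l2" using l2 b0 w by (intro divide_left_mono) auto
    moreover have "2 * K1 * K2 / l2\<^sup>2 \<le> 8 * K1 * K2 / b\<^sup>2"
    proof -
      have "2 * K1 * K2 / l2\<^sup>2 \<le> 2 * K1 * K2 / (b / 2)\<^sup>2"
        using K K2 l2 b0 by (intro divide_left_mono power_mono mult_nonneg_nonneg) auto
      also have "\<dots> = 8 * K1 * K2 / b\<^sup>2" by (simp add: power_divide)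
      finally show ?thesis .
    qed
    moreover have "\<bar>\<gamma>\<bar> * (1 + 2 * K1 / l2) \<le> 2 * A0 * w / (b * (n * q - w)) * (1 + 4 * K1 / b)"
    proof (rule mult_mono[OF \<gamma>])
      have "2 * K1 / l2 \<le> 2 * K1 / (b / 2)" using K l2 b0 by (intro divide_left_mono) auto
      then show "1 + 2 * K1 / l2 \<le> 1 + 4 * K1 / b" by simp
      show "0 \<le> 1 + 2 * K1 / l2" using K l2 b0 by simp
    qed (use A0 b0 in auto)
    moreover have "\<bar>\<rho>\<bar> * (w / l2) ^ (m + 2) \<le> 4 * sqrt n * (1 / 2) ^ (m + 2)"
      using \<rho> l2 b0 n0 by (intro mult_mono power_mono) (auto simp: divide_le_eq)
    ultimately show ?thesis using k(2) by linarith
  qed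
  define \<sigma> where "\<sigma> = (if \<rho> > 0 then 1 else -1 :: real)"
  have "\<sigma> * (x i * u2 i) \<ge> k / 4 / sqrt n" if i: "i < n" for i
  proof -
    have "\<bar>\<rho>\<bar> * (\<sigma> * (x i * u2 i)) \<ge> k" using main[OF i] by (auto simp: \<sigma>_def abs_if)
    then have "\<sigma> * (x i * u2 i) \<ge> k / \<bar>\<rho>\<bar>" using \<rho>(2) by (simp add: pos_divide_le_eq mult.commute)
    moreover have "k / \<bar>\<rho>\<bar> \<ge> k / (4 * sqrt n)" using \<rho> k n0 by (intro divide_left_mono) auto
    ultimately show ?thesis by simp
  qed
  then show ?thesis by (intro exI[of _ \<sigma>]) (auto simp: \<sigma>_def)
qed

end

text \<open>All that the later parts use about the graph, with constants \<open>k\<close> and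
  \<open>C\<close> free of \<open>n\<close>. The Gaussian start does not occur, so its randomness
  can be treated for each fixed graph.\<close>

definition recoverable :: "nat \<Rightarrow> (nat \<Rightarrow> real) \<Rightarrow> real \<Rightarrow> real \<Rightarrow> real \<Rightarrow> real \<Rightarrow> (nat \<times> nat \<Rightarrow> bool) \<Rightarrow> bool" where
  "recoverable n x p q k C a \<longleftrightarrow> (\<exists>u1 u2 l1 l2 w.
     planted_eigen n x (sbm.W x p q a) (n * (p + q) / 2) (n * (p - q) / 2) w u1 u2 l1 l2 \<and>
     w / l2 \<le> ln n powr (- 1/20) \<and> 3 + 2 * ((2 * w + l2) / (l1 - l2)) \<le> C \<and>
     (\<exists>\<sigma>. (\<sigma> = 1 \<or> \<sigma> = -1) \<and> (\<forall>i<n. \<sigma> * (x i * u2 i) \<ge> k / sqrt n)) \<and>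
     (\<forall>i<n. (\<Sum>j<n. of_bool (a (mm i j))) \<le> C * ln n))"

lemma sbm_recoverable:
  fixes \<alpha> \<beta> :: real
  assumes ab: "\<alpha> > \<beta>" "\<beta> > 0" and thr: "sqrt \<alpha> - sqrt \<beta> > sqrt 2"
  obtains k C err where "k > 0" "C > 0" "err \<longlonglongrightarrow> 0"
    "\<forall>\<^sub>F n in sequentially. \<forall>x. sbm n x (\<alpha> * ln (real n) / real n) (\<beta> * ln (real n) / real n) \<longrightarrow>
      measure_pmf.prob (sbm.mu n x (\<alpha> * ln (real n) / real n) (\<beta> * ln (real n) / real n))
        {a. \<not> recoverable n x (\<alpha> * ln (real n) / real n) (\<beta> * ln (real n) / real n) k C a} \<le> err n"
proof -
  define b1 a1 where "b1 = (\<alpha> - \<beta>) / 2" and "a1 = (\<alpha> + \<beta>) / 2"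
  \<comment> \<open>With \<open>exp 2 <= 9\<close> the row tail exponent
    \<open>- (C1 - 2 * \<alpha>) + 2 * exp 2 * \<alpha>\<close> is at most -3.\<close>
  define C1 where "C1 = 3 + 20 * \<alpha>"
  \<comment> \<open>\<open>\<Delta>\<close> is the excess over the threshold and
    \<open>\<theta>\<close> minimises
    \<open>\<alpha> * exp (- \<theta>) + \<beta> * exp \<theta>\<close>. Asking for a signed degree
    of \<open>\<epsilon> * ln n\<close> instead of 0 spends
    \<open>\<theta> * \<epsilon> = \<Delta> / 2\<close> of the excess.\<close>
  define \<Delta> where "\<Delta> = (sqrt \<alpha> - sqrt \<beta>)\<^sup>2 / 2 - 1"
  define \<theta> where "\<theta> = ln (\<alpha> / \<beta>) / 2"
  define \<epsilon> where "\<epsilon> = \<Delta> / (2 * \<theta>)"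
  \<comment> \<open>For \<open>K2 = \<eta> * ln n\<close> the three entries give
    \<open>K2 <= K1\<close>, then \<open>2 * K2 <= l2\<close>, and finally a second-order term of at
    most \<open>\<epsilon> / (16 * b1)\<close>. The next line makes
    \<open>r * K2 / 6 = 3 * ln n\<close>.\<close>
  define \<eta> where "\<eta> = min C1 (min (b1 / 4) (\<epsilon> * b1 / (128 * C1)))"
  define r where "r = 18 / \<eta>"
  \<comment> \<open>One bound on \<open>w / ln n\<close> for all remaining smallness conditions: the
    spectral margins, the overlaps of \<open>u2\<close> with \<open>one\<close> and
    \<open>x\<close>, and, last, the variance term of row independence.\<close>
  define r0 where "r0 = Min {1, \<epsilon> / 8, \<beta> / 16, b1 / 16, \<epsilon> * \<beta> / (64 * a1 * (1 + 4 * C1 / b1)), b1 * \<beta>\<^sup>2 / (32 * a1), \<eta>\<^sup>2 / (2 * r\<^sup>2 * exp (2 * r) * \<alpha>)}"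
  \<comment> \<open>What is left of \<open>\<epsilon> / (2 * b1)\<close> after four losses of at
    most \<open>\<epsilon> / (16 * b1)\<close> each.\<close>
  define k where "k = \<epsilon> / (4 * b1)"
  define C where "C = max (3 + 4 * (\<alpha> - \<beta>) / \<beta>) (C1 + \<alpha>)"
  define err where "err n = real n * exp (- (3 * ln (real n))) + 2 / real n + 4 * real n * (real n + 1) * exp (- (5/2 * ln (real n))) + exp (- (\<Delta> / 2 * ln (real n)))" for n :: nat
  have pos: "b1 > 0" "a1 > 0" "C1 > 3" "\<alpha> > 0" using ab by (auto simp: b1_def a1_def C1_def)
  have \<Delta>: "\<Delta> > 0"
  proof -
    have "(sqrt 2)\<^sup>2 < (sqrt \<alpha> - sqrt \<beta>)\<^sup>2" using thr by (intro power_strict_mono) auto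
    then show ?thesis by (simp add: \<Delta>_def)
  qed
  have \<theta>: "\<theta> > 0" using ab by (simp add: \<theta>_def)
  have \<epsilon>: "\<epsilon> > 0" using \<Delta> \<theta> by (simp add: \<epsilon>_def)
  have \<eta>: "\<eta> > 0" "\<eta> \<le> C1" "\<eta> \<le> b1 / 4" "\<eta> \<le> \<epsilon> * b1 / (128 * C1)" using pos \<epsilon> by (auto simp: \<eta>_def)
  have r: "r > 0" using \<eta> by (simp add: r_def)
  have Zp: "1 + 4 * C1 / b1 > 0" using pos by (intro add_pos_pos divide_pos_pos mult_pos_pos) auto
  have r0: "r0 > 0" unfolding r0_def
    by (subst Min_gr_iff) (use pos \<epsilon> ab \<eta> r Zp in \<open>auto intro!: divide_pos_pos mult_pos_pos\<close>)
  have r0_le: "r0 \<le> 1" "r0 \<le> \<epsilon> / 8" "r0 \<le> \<beta> / 16" "r0 \<le> b1 / 16" "r0 \<le> \<epsilon> * \<beta> / (64 * a1 * (1 + 4 * C1 / b1))"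
    "r0 \<le> b1 * \<beta>\<^sup>2 / (32 * a1)" "r0 \<le> \<eta>\<^sup>2 / (2 * r\<^sup>2 * exp (2 * r) * \<alpha>)"
    unfolding r0_def by (rule Min_le, (simp only: finite.intros), (simp only: insert_iff simp_thms))+
  have k: "k > 0" using \<epsilon> pos by (simp add: k_def)
  have C: "C > 0" "C \<ge> 3 + 4 * (\<alpha> - \<beta>) / \<beta>" "C \<ge> C1 + \<alpha>" using pos ab by (simp_all add: C_def less_max_iff_disj)
  have "err \<longlonglongrightarrow> 0"
  proof -
    have "(\<lambda>n. real n * exp (- (3 * ln (real n))) + 2 / real n + 4 * real n * (real n + 1) * exp (- (5/2 * ln (real n)))) \<longlonglongrightarrow> 0"
      by real_asymp
    moreover have "(\<lambda>n::nat. exp (- (\<Delta> / 2 * ln (real n)))) \<longlonglongrightarrow> 0" using \<Delta> by real_asymp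
    ultimately show ?thesis unfolding err_def using tendsto_add by fastforce
  qed
  moreover have "\<forall>\<^sub>F n in sequentially. \<forall>x. sbm n x (\<alpha> * ln (real n) / real n) (\<beta> * ln (real n) / real n) \<longrightarrow>
      measure_pmf.prob (sbm.mu n x (\<alpha> * ln (real n) / real n) (\<beta> * ln (real n) / real n))
        {a. \<not> recoverable n x (\<alpha> * ln (real n) / real n) (\<beta> * ln (real n) / real n) (k / 4) C a} \<le> err n"
  proof -
    have C10: "C1 > 0" using pos by simp
    have big: "eventually (\<lambda>n::nat. ln n \<ge> 1) sequentially" by real_asymp
    \<comment> \<open>The expansion is cut near \<open>n\<close>, so its remainder is exponentially
      small; the union bound over the powers costs only a factor \<open>n + 1\<close>.\<close>
    have sm: "eventually (\<lambda>n::nat. 4 * sqrt n * (1 / 2) ^ (n + 2) \<le> \<epsilon> / (16 * b1)) sequentially"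
    proof -
      have "\<epsilon> / (16 * b1) > 0" using \<epsilon> pos by simp
      then show ?thesis by real_asymp
    qed
    show ?thesis
      using scale_conditions[OF ab C10 \<eta>(1) \<epsilon> r0] big sm
    proof eventually_elim
      case (elim n)
      define L where "L = ln (real n)"
      define w where "w = (2 + 4 * C1) * L powr (9/10)"
      define K1 K2 D R where "K1 = C1 * L" and "K2 = \<eta> * L" and "D = L powr (7/10)" and "R = L powr (1/10)"
      define y where "y = w / L"
      define p q where "p = \<alpha> * L / n" and "q = \<beta> * L / n"
      have L: "L \<ge> 1" using elim by (simp add: L_def)
      have y: "y > 0" "y \<le> r0" using elim(5) L C10 by (auto simp: y_def w_def L_def)
      have wy: "w = y * L" using L by (simp add: y_def)
      have n0: "real n > 0" using L by (cases "n = 0") (auto simp: L_def)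
      have np: "n * p = \<alpha> * L" "n * q = \<beta> * L" "n * (p + q) / 2 = a1 * L" "n * (p - q) / 2 = b1 * L"
        using n0 by (auto simp: p_def q_def a1_def b1_def field_simps)
      have w_eq: "w = 2 * D * R\<^sup>2 + 4 * K1 / R"
      proof -
        have "R\<^sup>2 = L powr (2/10)" using L by (simp add: R_def powr_power)
        then have "D * R\<^sup>2 = L powr (9/10)" using L by (simp add: D_def powr_add[symmetric])
        moreover have "L / R = L powr (9/10)" using L powr_diff[of L 1 "1/10"] by (simp add: R_def)
        then have "K1 / R = C1 * L powr (9/10)" by (metis K1_def times_divide_eq_right)
        moreover have "w = 2 * L powr (9/10) + 4 * (C1 * L powr (9/10))" by (simp add: w_def algebra_simps)
        moreover have "2 * D * R\<^sup>2 + 4 * K1 / R = 2 * (D * R\<^sup>2) + 4 * (K1 / R)" by simp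
        ultimately show ?thesis by (simp only:)
      qed
      have yl: "y * L \<le> c * L" if "r0 \<le> c" for c using y that L by (intro mult_right_mono) auto
      have y2: "y\<^sup>2 \<le> y" using y r0_le(1) by (simp add: power2_eq_square mult_left_le)
      show ?case
      proof (intro allI impI)
        fix x assume sx: "sbm n x (\<alpha> * ln (real n) / real n) (\<beta> * ln (real n) / real n)"
        interpret S: sbm n x p q using sx by (simp add: p_def q_def L_def)
        have rec: "recoverable n x p q (k / 4) C a" if ty: "S.typical K1 K2 w D (\<epsilon> * L) n a" for a
        proof -
          have gaps: "n * (p - q) / 2 > 4 * w" "n * q > 4 * w"
            unfolding np wy using y r0_le(3,4) pos ab L by (auto intro!: mult_strict_right_mono simp: mult.assoc[symmetric])
          have "planted n x (S.W a) (n * (p + q) / 2) (n * (p - q) / 2) w"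
          proof (rule S.typical_imp_planted[OF ty w_eq])
            show "w > 0" using y L by (simp add: wy)
            show "R \<ge> 1" using L by (simp add: R_def ge_one_powr_ge_zero)
          qed (use gaps in \<open>auto simp: D_def\<close>)
          then obtain u1 u2 l1 l2 where pe: "planted_eigen n x (S.W a) (n * (p + q) / 2) (n * (p - q) / 2) w u1 u2 l1 l2"
            using planted.eigen_exists by blast
          then interpret P: planted_eigen n x "S.W a" "n * (p + q) / 2" "n * (p - q) / 2" w u1 u2 l1 l2 .
          have bw: "16 * w \<le> b1 * L" "16 * w \<le> \<beta> * L" using yl[OF r0_le(4)] yl[OF r0_le(3)] by (simp_all add: wy)
          have bL: "b1 * L > 0" "\<beta> * L > 0" using pos ab L by auto
          have l2: "l2 \<ge> b1 * L / 2" "l2 \<le> b1 * L + w" using P.l2_bounds bw(1) bL unfolding np by linarith+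
          have 1: "w / l2 \<le> ln n powr (- 1/20)"
          proof -
            have "w / l2 \<le> w / (b1 * L / 2)" using l2 bL y L by (intro divide_left_mono) (auto simp: wy)
            also have "\<dots> = 2 * w / (b1 * L)" by simp
            also have "\<dots> \<le> ln n powr (- 1/20)" using elim(6) by (simp add: w_def b1_def L_def)
            finally show ?thesis .
          qed
          have 2: "3 + 2 * ((2 * w + l2) / (l1 - l2)) \<le> C"
          proof -
            have "a1 * L - b1 * L = \<beta> * L" by (simp add: a1_def b1_def field_simps)
            then have "l1 - l2 \<ge> \<beta> * L / 2" using P.l1_ge l2(2) bw(2) bL(2) unfolding np by linarith
            moreover have "2 * w + l2 \<le> 2 * (b1 * L)" using l2 bw by simp
            ultimately have "(2 * w + l2) / (l1 - l2) \<le> 2 * (b1 * L) / (\<beta> * L / 2)"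
              using bL by (intro frac_le) auto
            also have "\<dots> = 2 * (\<alpha> - \<beta>) / \<beta>" using L by (simp add: b1_def)
            finally have "(2 * w + l2) / (l1 - l2) \<le> 2 * (\<alpha> - \<beta>) / \<beta>" .
            moreover have "4 * (\<alpha> - \<beta>) / \<beta> = 2 * (2 * (\<alpha> - \<beta>) / \<beta>)" by simp
            ultimately show ?thesis using C(2) by linarith
          qed
          have 3: "\<exists>\<sigma>. (\<sigma> = 1 \<or> \<sigma> = -1) \<and> (\<forall>i<n. \<sigma> * (x i * u2 i) \<ge> k / 4 / sqrt n)"
          proof (rule S.typical_entry[OF ty pe])
            show "K1 \<ge> 1" using pos L mult_mono[of 1 C1 1 L] by (simp add: K1_def)
            show "4 * sqrt K1 \<le> K2" using elim(3) by (simp add: K1_def K2_def L_def)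
            show "2 * w + sqrt K1 \<le> K2" using elim(4) by (simp add: K1_def K2_def L_def w_def)
            show "K2 \<le> n * (p - q) / 2 / 4" unfolding np using mult_right_mono[OF \<eta>(3), of L] L by (simp add: K2_def)
            show "16 * w \<le> n * (p - q) / 2" unfolding np by (rule bw)
            show "w \<le> \<epsilon> * L" using yl[OF r0_le(2)] \<epsilon> L mult_pos_pos[of \<epsilon> L] by (simp add: wy)
            have by2: "\<beta> / 2 \<le> \<beta> - y" using y r0_le(3) by simp
            show "8 * (n * (p + q) / 2) * w\<^sup>2 \<le> n * (p - q) / 2 * (n * q - w)\<^sup>2"
            proof -
              have "y \<le> b1 * \<beta>\<^sup>2 / (32 * a1)" using y r0_le(6) by simp
              then have "32 * a1 * y \<le> b1 * \<beta>\<^sup>2" using pos by (simp add: pos_le_divide_eq mult_ac)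
              moreover have "32 * a1 * y\<^sup>2 \<le> 32 * a1 * y" using y2 pos by simp
              ultimately have "8 * a1 * y\<^sup>2 \<le> b1 * (\<beta> / 2)\<^sup>2" by (simp add: power_divide)
              also have "\<dots> \<le> b1 * (\<beta> - y)\<^sup>2" using by2 pos ab by (intro mult_left_mono power_mono) auto
              finally have f1: "8 * a1 * y\<^sup>2 * L ^ 3 \<le> b1 * (\<beta> - y)\<^sup>2 * L ^ 3" using L by (intro mult_right_mono) auto
              have f2: "8 * (a1 * L) * (y * L)\<^sup>2 = 8 * a1 * y\<^sup>2 * L ^ 3" "b1 * L * (\<beta> * L - y * L)\<^sup>2 = b1 * (\<beta> - y)\<^sup>2 * L ^ 3"
                by (simp_all add: power2_eq_square power3_eq_cube algebra_simps)
              show ?thesis unfolding np wy f2 by (rule f1)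
            qed
            show "k \<le> (\<epsilon> * L - w) / (2 * (n * (p - q) / 2)) - 8 * K1 * K2 / (n * (p - q) / 2)\<^sup>2
               - 2 * (n * (p + q) / 2) * w / (n * (p - q) / 2 * (n * q - w)) * (1 + 4 * K1 / (n * (p - q) / 2))
               - 4 * sqrt n * (1 / 2) ^ (n + 2)"
            proof -
              have e1: "(\<epsilon> * L - w) / (2 * (n * (p - q) / 2)) \<ge> \<epsilon> / (2 * b1) - \<epsilon> / (16 * b1)"
              proof -
                have "(\<epsilon> * L - w) / (2 * (n * (p - q) / 2)) = (\<epsilon> - y) / (2 * b1)"
                  unfolding np wy using L pos by (simp add: field_simps)
                also have "\<dots> \<ge> (\<epsilon> - \<epsilon> / 8) / (2 * b1)" using y r0_le(2) pos by (intro divide_right_mono) auto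
                finally show ?thesis by (simp add: diff_divide_distrib)
              qed
              have e2: "8 * K1 * K2 / (n * (p - q) / 2)\<^sup>2 \<le> \<epsilon> / (16 * b1)"
              proof -
                have "8 * K1 * K2 / (n * (p - q) / 2)\<^sup>2 = 8 * C1 * \<eta> / b1\<^sup>2"
                  unfolding np K1_def K2_def using L pos by (simp add: field_simps power2_eq_square)
                also have "\<dots> \<le> 8 * C1 * (\<epsilon> * b1 / (128 * C1)) / b1\<^sup>2"
                  using \<eta>(4) pos by (intro divide_right_mono mult_left_mono) auto
                also have "\<dots> = \<epsilon> / (16 * b1)" using pos by (simp add: power2_eq_square)
                finally show ?thesis .
              qed
              have e3: "2 * (n * (p + q) / 2) * w / (n * (p - q) / 2 * (n * q - w)) * (1 + 4 * K1 / (n * (p - q) / 2)) \<le> \<epsilon> / (16 * b1)"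
              proof -
                define Z where "Z = 1 + 4 * C1 / b1"
                have Z: "Z > 0" using pos by (simp add: Z_def add_pos_pos)
                have "2 * (n * (p + q) / 2) * w / (n * (p - q) / 2 * (n * q - w)) * (1 + 4 * K1 / (n * (p - q) / 2)) = 2 * a1 * y / (b1 * (\<beta> - y)) * Z"
                proof -
                  have "2 * (a1 * L) * (y * L) / (b1 * L * (\<beta> * L - y * L)) = (2 * a1 * y) * (L * L) / ((b1 * (\<beta> - y)) * (L * L))"
                    by (simp add: algebra_simps)
                  also have "\<dots> = 2 * a1 * y / (b1 * (\<beta> - y))" using L by simp
                  finally have "2 * (a1 * L) * (y * L) / (b1 * L * (\<beta> * L - y * L)) = 2 * a1 * y / (b1 * (\<beta> - y))" .
                  moreover have "4 * (C1 * L) / (b1 * L) = 4 * C1 / b1" using L by simp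
                  ultimately show ?thesis unfolding np wy K1_def Z_def by simp
                qed
                also have "\<dots> \<le> 2 * a1 * (\<epsilon> * \<beta> / (64 * a1 * Z)) / (b1 * (\<beta> / 2)) * Z"
                  using y r0_le(5) by2 pos ab Z \<epsilon>
                  by (intro mult_right_mono frac_le mult_left_mono)
                    (auto simp: Z_def intro!: divide_nonneg_nonneg mult_nonneg_nonneg add_nonneg_nonneg)
                also have "\<dots> = \<epsilon> / (16 * b1)" using pos ab Z by (simp add: field_simps)
                finally show ?thesis .
              qed
              have g: "kk \<le> X1 - X2 - X3 - X4" if "X1 \<ge> Y1 - Y2" "X2 \<le> Y2" "X3 \<le> Y2" "X4 \<le> Y2" "kk = Y1 - Y2 - Y2 - Y2 - Y2"
                for kk X1 X2 X3 X4 Y1 Y2 :: real using that by linarith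
              have keq: "k = \<epsilon> / (2 * b1) - \<epsilon> / (16 * b1) - \<epsilon> / (16 * b1) - \<epsilon> / (16 * b1) - \<epsilon> / (16 * b1)"
                using pos by (simp add: k_def field_simps)
              show ?thesis by (rule g[OF e1 e2 e3 elim(8) keq])
            qed
          qed (rule k)
          have 4: "\<forall>i<n. (\<Sum>j<n. of_bool (a (mm i j))) \<le> C * ln n"
          proof (intro allI impI)
            fix i assume i: "i < n"
            have "(\<Sum>j<n. of_bool (a (mm i j)) :: real) \<le> (\<Sum>j<n. \<bar>S.W a i j\<bar> + p)"
            proof (intro sum_mono)
              fix j
              have "of_bool (a (mm i j)) = S.W a i j + S.pr (mm i j)" by (simp add: S.W_def)
              then show "of_bool (a (mm i j)) \<le> \<bar>S.W a i j\<bar> + p"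
                using S.pr_bounds(3)[of "mm i j"] abs_ge_self[of "S.W a i j"] by linarith
            qed
            also have "\<dots> \<le> K1 + n * p" using ty i by (simp add: sum.distrib S.typical_def)
            also have "\<dots> = (C1 + \<alpha>) * L" unfolding np K1_def by (simp add: algebra_simps)
            also have "\<dots> \<le> C * L" using C L by (intro mult_right_mono) auto
            finally show "(\<Sum>j<n. of_bool (a (mm i j)) :: real) \<le> C * ln n" by (simp add: L_def)
          qed
          show ?thesis unfolding recoverable_def using pe 1 2 3 4 by blast
        qed
        have "measure_pmf.prob S.mu {a. \<not> recoverable n x p q (k / 4) C a} \<le> measure_pmf.prob S.mu {a. \<not> S.typical K1 K2 w D (\<epsilon> * L) n a}"
          using rec by (intro prob_pmf_mono) auto
        also have "\<dots> \<le> n * exp (- (K1 - 2 * (n * p)) + 2 * exp 2 * (n * p)) + 2 / n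
           + 4 * real n * (real n + 1) * exp (- (r * K2 / 6) + r\<^sup>2 * exp (2 * r) * (n * p) * (w / K2)\<^sup>2)
           + n * exp (\<theta> * (\<epsilon> * L) + n / 2 * (p * (exp (- \<theta>) - 1) + q * (exp \<theta> - 1)))"
        proof (rule S.typical_prob)
          show "D > 0" using L by (simp add: D_def)
          show "24 * K1 / D\<^sup>2 \<le> 1/4" using elim(1) by (simp add: K1_def D_def L_def)
          show "12 * (24 * K1 / D\<^sup>2) * (n * p) \<le> D" unfolding np using elim(2) by (simp add: K1_def D_def L_def)
          show "K1 \<ge> K2" using \<eta> L by (simp add: K1_def K2_def)
          show "K2 > 0" using \<eta> L by (simp add: K2_def)
          show w0: "0 \<le> w" using y L by (simp add: wy)
          have "2 * w + sqrt K1 \<le> K2" using elim(4) by (simp add: K1_def K2_def L_def w_def)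
          moreover have "sqrt K1 \<ge> 0" using pos L by (simp add: K1_def)
          ultimately show "w \<le> K2" using w0 by linarith
        qed (use \<theta> r in auto)
        also have "\<dots> \<le> err n"
        proof -
          have "exp (- (K1 - 2 * (n * p)) + 2 * exp 2 * (n * p)) \<le> exp (- (3 * L))"
          proof -
            have "exp (2::real) = exp 1 * exp 1" by (simp add: exp_add[symmetric])
            also have "\<dots> \<le> 3 * 3" using exp_le by (intro mult_mono) auto
            finally have "exp 2 * (\<alpha> * L) \<le> 9 * (\<alpha> * L)" using pos L by (intro mult_right_mono) auto
            then show ?thesis unfolding np K1_def C1_def by (simp add: algebra_simps)
          qed
          moreover have "exp (- (r * K2 / 6) + r\<^sup>2 * exp (2 * r) * (n * p) * (w / K2)\<^sup>2) \<le> exp (- (5/2 * L))"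
          proof -
            have "r * K2 / 6 = 3 * L" using \<eta> by (simp add: r_def K2_def)
            moreover have "r\<^sup>2 * exp (2 * r) * (n * p) * (w / K2)\<^sup>2 \<le> L / 2"
            proof -
              have "y \<le> \<eta>\<^sup>2 / (2 * r\<^sup>2 * exp (2 * r) * \<alpha>)" using y r0_le(7) by simp
              then have "y * (2 * r\<^sup>2 * exp (2 * r) * \<alpha>) \<le> \<eta>\<^sup>2" using r pos by (simp add: pos_le_divide_eq)
              moreover have "y\<^sup>2 * (2 * r\<^sup>2 * exp (2 * r) * \<alpha>) \<le> y * (2 * r\<^sup>2 * exp (2 * r) * \<alpha>)"
                using y2 r pos by (intro mult_right_mono) auto
              ultimately have "2 * r\<^sup>2 * exp (2 * r) * \<alpha> * y\<^sup>2 / \<eta>\<^sup>2 \<le> 1" using \<eta> by (simp add: mult_ac)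
              then have "2 * r\<^sup>2 * exp (2 * r) * \<alpha> * y\<^sup>2 / \<eta>\<^sup>2 * (L / 2) \<le> 1 * (L / 2)" using L by (intro mult_right_mono) auto
              moreover have "w / K2 = y / \<eta>" unfolding wy K2_def using L by simp
              ultimately show ?thesis unfolding np by (simp add: power_divide mult_ac)
            qed
            ultimately show ?thesis by simp
          qed
          \<comment> \<open>At this \<open>\<theta>\<close> the Chernoff exponent is
            \<open>- (1 + \<Delta>) * L\<close>. The union over vertices uses up the 1, and the
            margin \<open>\<epsilon>\<close> half of \<open>\<Delta>\<close>.\<close>
          moreover have "n * exp (\<theta> * (\<epsilon> * L) + n / 2 * (p * (exp (- \<theta>) - 1) + q * (exp \<theta> - 1))) \<le> exp (- (\<Delta> / 2 * L))"
          proof -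
            have e: "exp \<theta> = sqrt (\<alpha> / \<beta>)"
            proof -
              have "exp \<theta> * exp \<theta> = \<alpha> / \<beta>" using ab by (simp add: \<theta>_def exp_add[symmetric])
              then show ?thesis by (metis exp_ge_zero real_sqrt_abs2 abs_of_nonneg)
            qed
            have t1: "\<beta> * exp \<theta> = sqrt \<alpha> * sqrt \<beta>" unfolding e using ab
              by (simp add: real_sqrt_divide field_simps)
            have t2: "\<alpha> * exp (- \<theta>) = sqrt \<alpha> * sqrt \<beta>" unfolding exp_minus e using ab
              by (simp add: real_sqrt_divide field_simps)
            have t3: "n / 2 * (p * (exp (- \<theta>) - 1) + q * (exp \<theta> - 1)) = L / 2 * (\<alpha> * exp (- \<theta>) + \<beta> * exp \<theta> - \<alpha> - \<beta>)"
              using n0 by (simp add: p_def q_def field_simps)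
            have sq: "(sqrt \<alpha> - sqrt \<beta>)\<^sup>2 = \<alpha> + \<beta> - 2 * (sqrt \<alpha> * sqrt \<beta>)"
              using ab by (simp add: power2_diff)
            have d: "sqrt \<alpha> * sqrt \<beta> = (\<alpha> + \<beta>) / 2 - (1 + \<Delta>)" unfolding \<Delta>_def sq by (simp add: field_simps)
            have t4: "\<theta> * (\<epsilon> * L) = \<Delta> / 2 * L" using \<theta> by (simp add: \<epsilon>_def)
            have "\<Delta> / 2 * L + L / 2 * ((\<alpha> + \<beta>) / 2 - (1 + \<Delta>) + ((\<alpha> + \<beta>) / 2 - (1 + \<Delta>)) - \<alpha> - \<beta>) = - ((1 + \<Delta> / 2) * L)"
              by (simp add: field_simps)
            then have "\<theta> * (\<epsilon> * L) + n / 2 * (p * (exp (- \<theta>) - 1) + q * (exp \<theta> - 1)) = - ((1 + \<Delta> / 2) * L)"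
              unfolding t4 t3 t1 t2 d .
            moreover have "n * exp (- ((1 + \<Delta> / 2) * L)) = exp (- (\<Delta> / 2 * L))"
            proof -
              have "real n = exp L" using n0 by (simp add: L_def)
              then have "n * exp (- ((1 + \<Delta> / 2) * L)) = exp (L + - ((1 + \<Delta> / 2) * L))" unfolding exp_add by simp
              also have "L + - ((1 + \<Delta> / 2) * L) = - (\<Delta> / 2 * L)" by (simp add: algebra_simps)
              finally show ?thesis .
            qed
            ultimately show ?thesis by (simp only: order.refl)
          qed
          ultimately show ?thesis
            unfolding err_def L_def[symmetric] by (intro add_mono mult_left_mono) auto
        qed
        finally show "measure_pmf.prob (sbm.mu n x (\<alpha> * ln (real n) / real n) (\<beta> * ln (real n) / real n))
          {a. \<not> recoverable n x (\<alpha> * ln (real n) / real n) (\<beta> * ln (real n) / real n) (k / 4) C a} \<le> err n"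
          by (simp add: p_def q_def L_def)
      qed
    qed
  qed
  ultimately show thesis using k C that[of "k / 4" C err] by simp
qed

section \<open>Gaussian initialisation\<close>

abbreviation gaussian :: "real measure" where "gaussian \<equiv> density lborel std_normal_density"

lemma prob_space_gaussian: "prob_space gaussian"
  by (rule prob_space_normal_density) simp

lemma std_normal_density_le_1: "std_normal_density t \<le> 1"
proof -
  have "1 / sqrt (2 * pi) \<le> 1" using pi_ge_two by (simp add: divide_le_eq)
  moreover have "exp (- t\<^sup>2 / 2) \<le> 1" by simp
  ultimately have "1 / sqrt (2 * pi) * exp (- t\<^sup>2 / 2) \<le> 1 * 1" by (intro mult_mono) auto
  then show ?thesis by (simp add: normal_density_def)
qed

text \<open>The density is at most 1, so the probability is at most the length of the
  interval.\<close>

lemma gaussian_interval: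
  assumes "\<bar>c\<bar> \<ge> \<kappa>" "\<kappa> > 0" "\<delta> \<ge> 0"
  shows "emeasure gaussian {t. \<bar>c * t + r\<bar> \<le> \<delta>} \<le> ennreal (2 * \<delta> / \<kappa>)"
proof -
  have c: "\<bar>c\<bar> > 0" using assms by linarith
  have eq: "{t. \<bar>c * t + r\<bar> \<le> \<delta>} = {- r / c - \<delta> / \<bar>c\<bar> .. - r / c + \<delta> / \<bar>c\<bar>}"
  proof -
    have "\<bar>c * t + r\<bar> \<le> \<delta> \<longleftrightarrow> \<bar>t - (- r / c)\<bar> \<le> \<delta> / \<bar>c\<bar>" for t
    proof -
      have "c * t + r = c * (t - (- r / c))" using c by (simp add: field_simps)
      then have "\<bar>c * t + r\<bar> = \<bar>c\<bar> * \<bar>t - (- r / c)\<bar>" by (simp add: abs_mult)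
      then show ?thesis using c by (simp add: pos_le_divide_eq mult.commute)
    qed
    moreover have "\<bar>t - A\<bar> \<le> B \<longleftrightarrow> A - B \<le> t \<and> t \<le> A + B" for t A B :: real by arith
    ultimately show ?thesis unfolding set_eq_iff mem_Collect_eq atLeastAtMost_iff by (simp only: simp_thms)
  qed
  have "emeasure gaussian {t. \<bar>c * t + r\<bar> \<le> \<delta>} = (\<integral>\<^sup>+t. ennreal (std_normal_density t) * indicator {t. \<bar>c * t + r\<bar> \<le> \<delta>} t \<partial>lborel)"
    unfolding eq by (subst emeasure_density) auto
  also have "\<dots> \<le> (\<integral>\<^sup>+t. indicator {t. \<bar>c * t + r\<bar> \<le> \<delta>} t \<partial>lborel)"
    using std_normal_density_le_1 by (intro nn_integral_mono) (auto simp: indicator_def ennreal_le_1)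
  also have "\<dots> = emeasure lborel {t. \<bar>c * t + r\<bar> \<le> \<delta>}" unfolding eq by simp
  also have "\<dots> = ennreal (2 * \<delta> / \<bar>c\<bar>)" unfolding eq using assms by (simp add: divide_nonneg_nonneg)
  also have "\<dots> \<le> ennreal (2 * \<delta> / \<kappa>)" using assms c by (intro ennreal_leI divide_left_mono) auto
  finally show ?thesis .
qed

lemma gaussian_tail:
  assumes "M > 0" shows "emeasure gaussian {t. \<bar>t\<bar> > M} \<le> ennreal (1 / M\<^sup>2)"
proof -
  have mom: "has_bochner_integral lborel (\<lambda>x. std_normal_density x * x ^ 2) 1"
    using std_normal_moment_even[of 1] by simp
  have "emeasure gaussian {t. \<bar>t\<bar> > M} = (\<integral>\<^sup>+t. ennreal (std_normal_density t) * indicator {t. \<bar>t\<bar> > M} t \<partial>lborel)"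
    by (subst emeasure_density) auto
  also have "\<dots> \<le> (\<integral>\<^sup>+t. ennreal (1 / M\<^sup>2) * ennreal (std_normal_density t * t ^ 2) \<partial>lborel)"
  proof (intro nn_integral_mono)
    fix t :: real
    have "M\<^sup>2 \<le> t\<^sup>2" if "\<bar>t\<bar> > M" using that assms abs_le_square_iff[of M t] by simp
    then have "std_normal_density t * 1 \<le> std_normal_density t * (t ^ 2 / M\<^sup>2)" if "\<bar>t\<bar> > M"
      using that assms by (intro mult_left_mono) auto
    then show "ennreal (std_normal_density t) * indicator {t. \<bar>t\<bar> > M} t \<le> ennreal (1 / M\<^sup>2) * ennreal (std_normal_density t * t ^ 2)"
      by (auto simp: indicator_def ennreal_mult[symmetric] intro!: ennreal_leI)
  qed
  also have "\<dots> = ennreal (1 / M\<^sup>2) * (\<integral>\<^sup>+t. ennreal (std_normal_density t * t ^ 2) \<partial>lborel)"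
    by (rule nn_integral_cmult) auto
  also have "(\<integral>\<^sup>+t. ennreal (std_normal_density t * t ^ 2) \<partial>lborel) = ennreal 1"
    using mom by (intro nn_integral_eq_integral[THEN trans]) (auto simp: has_bochner_integral_iff)
  finally show ?thesis by simp
qed

text \<open>Fubini in the single coordinate \<open>e\<close>: a bound on every section bounds the
  whole.\<close>

lemma PiM_gaussian_slice:
  assumes I: "finite I" "e \<in> I" and S: "S \<in> sets (Pi\<^sub>M I (\<lambda>_. gaussian))"
    and slice: "\<And>y. emeasure gaussian {t. y(e := t) \<in> S} \<le> b"
  shows "emeasure (Pi\<^sub>M I (\<lambda>_. gaussian)) S \<le> b"
proof -
  interpret prob_space gaussian by (rule prob_space_gaussian)
  interpret product_prob_space "\<lambda>_. gaussian" UNIV ..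
  define J where "J = I - {e}"
  have IJ: "I = insert e J" "e \<notin> J" "finite J" using I by (auto simp: J_def)
  interpret J: prob_space "Pi\<^sub>M J (\<lambda>_. gaussian)" by (intro prob_space_PiM prob_space_gaussian)
  have "emeasure (Pi\<^sub>M I (\<lambda>_. gaussian)) S = (\<integral>\<^sup>+y. indicator S y \<partial>Pi\<^sub>M (insert e J) (\<lambda>_. gaussian))"
    using S unfolding IJ(1) by simp
  also have "\<dots> = (\<integral>\<^sup>+y. (\<integral>\<^sup>+t. indicator S (y(e := t)) \<partial>gaussian) \<partial>Pi\<^sub>M J (\<lambda>_. gaussian))"
    using S IJ by (intro product_nn_integral_insert) auto
  also have "\<dots> \<le> (\<integral>\<^sup>+y. b \<partial>Pi\<^sub>M J (\<lambda>_. gaussian))"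
  proof (intro nn_integral_mono)
    fix y assume y: "y \<in> space (Pi\<^sub>M J (\<lambda>_. gaussian))"
    have "(\<lambda>t. y(e := t)) \<in> measurable gaussian (Pi\<^sub>M (insert e J) (\<lambda>_. gaussian))"
      using y IJ by (intro measurable_fun_upd[where J=J]) auto
    from measurable_sets[OF this] S have "(\<lambda>t. y(e := t)) -` S \<inter> space gaussian \<in> sets gaussian"
      unfolding IJ(1) by blast
    then have m: "{t. y(e := t) \<in> S} \<in> sets gaussian" by (simp add: vimage_def)
    have "(\<integral>\<^sup>+t. indicator S (y(e := t)) \<partial>gaussian) = (\<integral>\<^sup>+t. indicator {t. y(e := t) \<in> S} t \<partial>gaussian)"
      by (intro nn_integral_cong) (simp add: indicator_def)
    also have "\<dots> = emeasure gaussian {t. y(e := t) \<in> S}" using m by (rule nn_integral_indicator)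
    finally show "(\<integral>\<^sup>+t. indicator S (y(e := t)) \<partial>gaussian) \<le> b" using slice[of y] by simp
  qed
  also have "\<dots> = b" by (simp add: J.emeasure_space_1)
  finally show ?thesis .
qed

text \<open>In the coordinate \<open>e\<close> the expression is affine with slope at least
  \<open>\<kappa>\<close>, so it is rarely small. That slope and offset do not involve
  \<open>e\<close> is expressed by invariance under updates at \<open>e\<close>.\<close>

lemma PiM_gaussian_anticoncentration:
  assumes I: "finite I" "e \<in> I"
    and c: "c \<in> borel_measurable (Pi\<^sub>M I (\<lambda>_. gaussian))" "\<And>y t. c (y(e := t)) = c y"
    and r: "r \<in> borel_measurable (Pi\<^sub>M I (\<lambda>_. gaussian))" "\<And>y t. r (y(e := t)) = r y"
    and \<kappa>: "\<kappa> > 0" "\<delta> \<ge> 0"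
  shows "emeasure (Pi\<^sub>M I (\<lambda>_. gaussian)) {y \<in> space (Pi\<^sub>M I (\<lambda>_. gaussian)). \<bar>c y\<bar> \<ge> \<kappa> \<and> \<bar>c y * y e + r y\<bar> \<le> \<delta>} \<le> ennreal (2 * \<delta> / \<kappa>)"
proof (rule PiM_gaussian_slice[OF I])
  have [measurable]: "(\<lambda>y. y e) \<in> borel_measurable (Pi\<^sub>M I (\<lambda>_. gaussian))"
    using measurable_component_singleton[OF I(2), of "\<lambda>_. gaussian"] by simp
  note c(1)[measurable] r(1)[measurable]
  show "{y \<in> space (Pi\<^sub>M I (\<lambda>_. gaussian)). \<bar>c y\<bar> \<ge> \<kappa> \<and> \<bar>c y * y e + r y\<bar> \<le> \<delta>} \<in> sets (Pi\<^sub>M I (\<lambda>_. gaussian))"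
    by measurable
  fix y
  show "emeasure gaussian {t. y(e := t) \<in> {y \<in> space (Pi\<^sub>M I (\<lambda>_. gaussian)). \<bar>c y\<bar> \<ge> \<kappa> \<and> \<bar>c y * y e + r y\<bar> \<le> \<delta>}} \<le> ennreal (2 * \<delta> / \<kappa>)"
  proof (cases "\<bar>c y\<bar> \<ge> \<kappa>")
    case True
    have "emeasure gaussian {t. y(e := t) \<in> {y \<in> space (Pi\<^sub>M I (\<lambda>_. gaussian)). \<bar>c y\<bar> \<ge> \<kappa> \<and> \<bar>c y * y e + r y\<bar> \<le> \<delta>}}
      \<le> emeasure gaussian {t. \<bar>c y * t + r y\<bar> \<le> \<delta>}"
    proof (intro emeasure_mono)
      show "{t. \<bar>c y * t + r y\<bar> \<le> \<delta>} \<in> sets gaussian" by simp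
    qed (use c r in auto)
    also have "\<dots> \<le> ennreal (2 * \<delta> / \<kappa>)" using True \<kappa> by (rule gaussian_interval)
    finally show ?thesis .
  next
    case False
    then have "{t. y(e := t) \<in> {y \<in> space (Pi\<^sub>M I (\<lambda>_. gaussian)). \<bar>c y\<bar> \<ge> \<kappa> \<and> \<bar>c y * y e + r y\<bar> \<le> \<delta>}} = {}" using c by auto
    then show ?thesis by (simp only: emeasure_empty) simp
  qed
qed

text \<open>By Lagrange's identity the squares of the \<open>n^2\<close> minors sum to 2, so they
  cannot all be below \<open>1 / n^2\<close>.\<close>

lemma orthonormal_minor:
  assumes "ip n u1 u1 = 1" "ip n u2 u2 = 1" "ip n u1 u2 = 0" "n > 0"
  obtains i j where "i < n" "j < n" "\<bar>u1 i * u2 j - u2 i * u1 j\<bar> \<ge> 1 / n"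
proof -
  have "\<exists>i<n. \<exists>j<n. \<bar>u1 i * u2 j - u2 i * u1 j\<bar> \<ge> 1 / n"
  proof (rule ccontr)
    assume "\<not> ?thesis"
    then have small: "\<bar>u1 i * u2 j - u2 i * u1 j\<bar> < 1 / n" if "i < n" "j < n" for i j
      using that by (meson not_le)
    have "(\<Sum>i<n. \<Sum>j<n. (u1 i * u2 j - u2 i * u1 j)\<^sup>2)
      = (\<Sum>i<n. \<Sum>j<n. (u1 i * u1 i) * (u2 j * u2 j) + (u2 i * u2 i) * (u1 j * u1 j) - 2 * ((u1 i * u2 i) * (u1 j * u2 j)))"
      by (intro sum.cong refl) (simp add: power2_eq_square algebra_simps)
    also have "\<dots> = ip n u1 u1 * ip n u2 u2 + ip n u2 u2 * ip n u1 u1 - 2 * (ip n u1 u2 * ip n u1 u2)"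
      unfolding ip_def sum_product sum.distrib sum_subtractf sum_distrib_left[symmetric] ..
    finally have two: "(\<Sum>i<n. \<Sum>j<n. (u1 i * u2 j - u2 i * u1 j)\<^sup>2) = 2" using assms by simp
    have "(\<Sum>i<n. \<Sum>j<n. (u1 i * u2 j - u2 i * u1 j)\<^sup>2) \<le> (\<Sum>i<n. \<Sum>j<n. (1 / real n)\<^sup>2)"
    proof (intro sum_mono)
      fix i j assume "i \<in> {..<n}" "j \<in> {..<n}"
      then have "\<bar>u1 i * u2 j - u2 i * u1 j\<bar>\<^sup>2 \<le> (1 / real n)\<^sup>2" using small[of i j] by (intro power_mono) auto
      then show "(u1 i * u2 j - u2 i * u1 j)\<^sup>2 \<le> (1 / real n)\<^sup>2" by simp
    qed
    also have "\<dots> = 1" using assms(4) by (simp add: power2_eq_square)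
    finally show False using two by simp
  qed
  then show thesis using that by blast
qed

definition det2 :: "nat \<Rightarrow> (nat \<Rightarrow> real) \<Rightarrow> (nat \<Rightarrow> real) \<Rightarrow> (nat \<times> nat \<Rightarrow> real) \<Rightarrow> real" where
  "det2 n u1 u2 y = ip n u1 (\<lambda>k. y (k, 0)) * ip n u2 (\<lambda>k. y (k, 1)) - ip n u2 (\<lambda>k. y (k, 0)) * ip n u1 (\<lambda>k. y (k, 1))"

text \<open>The determinant is affine in \<open>y (j, 1)\<close>; its slope \<open>f\<close> is
  affine in \<open>y (i, 0)\<close>, with a fixed minor of size at least \<open>1 / n\<close> as
  slope. Two rounds of anticoncentration each lose a factor \<open>n\<close> and probability
  \<open>2 / n\<close>. The tails of the \<open>2 * n\<close> entries cost another
  \<open>2 / n\<close>.\<close>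

lemma gaussian_good_event:
  assumes u: "ip n u1 u1 = 1" "ip n u2 u2 = 1" "ip n u1 u2 = 0" and n: "n > 0"
  obtains H where "H \<in> sets (gaussian_entries n)" "emeasure (gaussian_entries n) H \<ge> ennreal (1 - 6 / n)"
    "\<And>y. y \<in> H \<Longrightarrow> \<bar>det2 n u1 u2 y\<bar> \<ge> 1 / real n ^ 3 \<and> (\<forall>k<n. \<forall>l<2. \<bar>y (k, l)\<bar> \<le> n)"
proof -
  define I where "I = {..<n} \<times> {..<2::nat}"
  define G where "G = Pi\<^sub>M I (\<lambda>_. gaussian)"
  have G: "gaussian_entries n = G" by (simp add: gaussian_entries_def G_def I_def)
  have finI: "finite I" by (simp add: I_def)
  interpret G: prob_space G unfolding G_def by (intro prob_space_PiM prob_space_gaussian)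
  obtain i j where ij: "i < n" "j < n" "\<bar>u1 i * u2 j - u2 i * u1 j\<bar> \<ge> 1 / n"
    using orthonormal_minor[OF u n] by blast
  have coord: "(\<lambda>y. y e) \<in> borel_measurable G" if "e \<in> I" for e
    using measurable_component_singleton[OF that, of "\<lambda>_. gaussian"] by (simp add: G_def)
  have ipm: "(\<lambda>y. ip n v (\<lambda>k. y (k, l))) \<in> borel_measurable G" if "l < 2" for v l
    unfolding ip_def using that by (intro borel_measurable_sum borel_measurable_times coord) (auto simp: I_def)
  have split: "ip n v f = v k * f k + ip n v (f(k := 0))" if "k < n" for v f k
  proof -
    have "ip n v f = (\<Sum>i<n. (if i = k then v k * f k else 0) + v i * (f(k := 0)) i)"
      unfolding ip_def by (intro sum.cong) auto
    also have "\<dots> = v k * f k + ip n v (f(k := 0))" using that by (simp add: sum.distrib ip_def)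
    finally show ?thesis .
  qed
  define f where "f y = ip n u1 (\<lambda>k. y (k, 0)) * u2 j - ip n u2 (\<lambda>k. y (k, 0)) * u1 j" for y :: "nat \<times> nat \<Rightarrow> real"
  define g where "g y = ip n u1 (\<lambda>k. y (k, 0)) * ip n u2 ((\<lambda>k. y (k, 1))(j := 0)) - ip n u2 (\<lambda>k. y (k, 0)) * ip n u1 ((\<lambda>k. y (k, 1))(j := 0))" for y :: "nat \<times> nat \<Rightarrow> real"
  define h where "h y = ip n u1 ((\<lambda>k. y (k, 0))(i := 0)) * u2 j - ip n u2 ((\<lambda>k. y (k, 0))(i := 0)) * u1 j" for y :: "nat \<times> nat \<Rightarrow> real"
  define c where "c = u1 i * u2 j - u2 i * u1 j"
  have det: "det2 n u1 u2 y = f y * y (j, 1) + g y" for y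
    unfolding det2_def f_def g_def using split[OF ij(2), of u2 "\<lambda>k. y (k, 1)"] split[OF ij(2), of u1 "\<lambda>k. y (k, 1)"]
    by (simp add: algebra_simps)
  have f: "f y = c * y (i, 0) + h y" for y
    unfolding f_def c_def h_def using split[OF ij(1), of u2 "\<lambda>k. y (k, 0)"] split[OF ij(1), of u1 "\<lambda>k. y (k, 0)"]
    by (simp add: algebra_simps)
  have fm: "f \<in> borel_measurable G" unfolding f_def using ipm by measurable
  have detm: "det2 n u1 u2 \<in> borel_measurable G" unfolding det2_def using ipm by measurable
  have gm: "g \<in> borel_measurable G"
  proof -
    have "g = (\<lambda>y. det2 n u1 u2 y - f y * y (j, 1))" using det by (simp add: fun_eq_iff)
    moreover have "(\<lambda>y. y (j, 1)) \<in> borel_measurable G" using ij by (intro coord) (simp add: I_def)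
    ultimately show ?thesis using detm fm by simp
  qed
  have hm: "h \<in> borel_measurable G"
  proof -
    have "h = (\<lambda>y. f y - c * y (i, 0))" using f by (simp add: fun_eq_iff)
    moreover have "(\<lambda>y. y (i, 0)) \<in> borel_measurable G" using ij by (intro coord) (simp add: I_def)
    ultimately show ?thesis using fm by simp
  qed
  have f_indep: "f (y((j, 1) := t)) = f y" for y t by (simp add: f_def)
  have g_indep: "g (y((j, 1) := t)) = g y" for y t
  proof -
    have "(\<lambda>k. (y((j, 1) := t)) (k, 1))(j := 0) = (\<lambda>k. y (k, 1))(j := 0)" by (auto simp: fun_eq_iff)
    then show ?thesis by (simp add: g_def)
  qed
  have h_indep: "h (y((i, 0) := t)) = h y" for y t
  proof -
    have "(\<lambda>k. (y((i, 0) := t)) (k, 0))(i := 0) = (\<lambda>k. y (k, 0))(i := 0)" by (auto simp: fun_eq_iff)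
    then show ?thesis by (simp add: h_def)
  qed
  define B1 where "B1 = {y \<in> space G. \<bar>c\<bar> \<ge> 1 / n \<and> \<bar>c * y (i, 0) + h y\<bar> \<le> 1 / real n ^ 2}"
  define B2 where "B2 = {y \<in> space G. \<bar>f y\<bar> \<ge> 1 / real n ^ 2 \<and> \<bar>f y * y (j, 1) + g y\<bar> \<le> 1 / real n ^ 3}"
  define B3 where "B3 e = {y \<in> space G. \<bar>y e\<bar> > n}" for e
  have n1: "real n > 0" using n by simp
  have B1: "emeasure G B1 \<le> ennreal (2 / n)"
  proof -
    have "emeasure G B1 \<le> ennreal (2 * (1 / real n ^ 2) / (1 / n))"
      unfolding B1_def G_def
      by (rule PiM_gaussian_anticoncentration[where c = "\<lambda>_. c" and r = h and e = "(i, 0)"])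
        (use finI ij n1 hm h_indep in \<open>auto simp: I_def G_def\<close>)
    then show ?thesis using n1 by (simp add: power2_eq_square)
  qed
  have B2: "emeasure G B2 \<le> ennreal (2 / n)"
  proof -
    have "emeasure G B2 \<le> ennreal (2 * (1 / real n ^ 3) / (1 / real n ^ 2))"
      unfolding B2_def G_def
      by (rule PiM_gaussian_anticoncentration[where c = f and r = g and e = "(j, 1)"])
        (use finI ij n1 gm fm f_indep g_indep in \<open>auto simp: I_def G_def\<close>)
    then show ?thesis using n1 by (simp add: power2_eq_square power3_eq_cube)
  qed
  have B3m: "B3 e \<in> sets G" if "e \<in> I" for e
    unfolding B3_def using coord[OF that] by measurable
  have B3: "emeasure G (B3 e) \<le> ennreal (1 / real n ^ 2)" if e: "e \<in> I" for e
    unfolding G_def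
  proof (rule PiM_gaussian_slice[OF finI e])
    show "B3 e \<in> sets (Pi\<^sub>M I (\<lambda>_. gaussian))" using B3m[OF e] by (simp add: G_def)
    fix y
    have "emeasure gaussian {t. y(e := t) \<in> B3 e} \<le> emeasure gaussian {t. \<bar>t\<bar> > real n}"
      by (intro emeasure_mono) (auto simp: B3_def)
    also have "\<dots> \<le> ennreal (1 / real n ^ 2)" using gaussian_tail[OF n1] by simp
    finally show "emeasure gaussian {t. y(e := t) \<in> B3 e} \<le> ennreal (1 / real n ^ 2)" .
  qed
  define Bad where "Bad = B1 \<union> B2 \<union> (\<Union>e\<in>I. B3 e)"
  have B12m: "B1 \<in> sets G" "B2 \<in> sets G"
  proof -
    have [measurable]: "(\<lambda>y. y (i, 0)) \<in> borel_measurable G" "(\<lambda>y. y (j, 1)) \<in> borel_measurable G"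
      using ij by (auto intro!: coord simp: I_def)
    note fm[measurable] gm[measurable] hm[measurable]
    show "B1 \<in> sets G" "B2 \<in> sets G" unfolding B1_def B2_def by measurable
  qed
  have Badm: "Bad \<in> sets G" unfolding Bad_def using B12m B3m finI by auto
  have "emeasure G Bad \<le> emeasure G (B1 \<union> B2) + emeasure G (\<Union>e\<in>I. B3 e)"
    unfolding Bad_def using B12m B3m finI by (intro emeasure_subadditive) auto
  also have "\<dots> \<le> (emeasure G B1 + emeasure G B2) + (\<Sum>e\<in>I. emeasure G (B3 e))"
    using B12m B3m finI by (intro add_mono emeasure_subadditive emeasure_subadditive_finite) auto
  also have "\<dots> \<le> (ennreal (2 / n) + ennreal (2 / n)) + (\<Sum>e\<in>I. ennreal (1 / real n ^ 2))"
    using B1 B2 B3 by (intro add_mono sum_mono) auto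
  also have "(\<Sum>e\<in>I. ennreal (1 / real n ^ 2)) = ennreal (2 / n)"
  proof -
    have "(\<Sum>e\<in>I. 1 / real n ^ 2) = 2 / n" using n1 by (simp add: I_def card_cartesian_product power2_eq_square)
    then show ?thesis by (subst sum_ennreal) auto
  qed
  also have "ennreal (2 / n) + ennreal (2 / n) + ennreal (2 / n) = ennreal (6 / n)"
    by (simp flip: ennreal_plus)
  finally have bad: "emeasure G Bad \<le> ennreal (6 / n)" .
  show thesis
  proof (rule that[of "space G - Bad"], unfold G)
    show "space G - Bad \<in> sets G" using Badm by auto
    have "measure G Bad \<le> 6 / n" using bad by (simp add: G.emeasure_eq_measure)
    then have "measure G (space G - Bad) \<ge> 1 - 6 / n" using G.prob_compl[OF Badm] by simp
    then show "emeasure G (space G - Bad) \<ge> ennreal (1 - 6 / n)" by (simp add: G.emeasure_eq_measure ennreal_leI)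
    fix y assume y: "y \<in> space G - Bad"
    then have "y \<notin> B1" "y \<in> space G" by (auto simp: Bad_def)
    then have "\<bar>f y\<bar> > 1 / real n ^ 2" using ij(3) by (simp add: B1_def f c_def)
    moreover have "y \<notin> B2" using y by (auto simp: Bad_def)
    ultimately have "\<bar>det2 n u1 u2 y\<bar> > 1 / real n ^ 3" using \<open>y \<in> space G\<close> by (simp add: B2_def det)
    moreover have "\<bar>y (k, l)\<bar> \<le> n" if "k < n" "l < 2" for k l
    proof -
      have "(k, l) \<in> I" using that by (simp add: I_def)
      then have "y \<notin> B3 (k, l)" using y by (auto simp: Bad_def)
      then show ?thesis using \<open>y \<in> space G\<close> by (simp add: B3_def)
    qed
    ultimately show "\<bar>det2 n u1 u2 y\<bar> \<ge> 1 / real n ^ 3 \<and> (\<forall>k<n. \<forall>l<2. \<bar>y (k, l)\<bar> \<le> n)" by simp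
  qed
qed

section \<open>Two-by-two matrices, projection and rounding\<close>

lemma scalar_prod_ip:
  "v \<in> carrier_vec n \<Longrightarrow> w \<in> carrier_vec n \<Longrightarrow> v \<bullet> w = ip n (\<lambda>i. v $ i) (\<lambda>i. w $ i)"
  by (auto simp: scalar_prod_def ip_def lessThan_atLeast0)

lemma mult_mat_vec_mv:
  "M \<in> carrier_mat n n \<Longrightarrow> v \<in> carrier_vec n \<Longrightarrow> i < n \<Longrightarrow> (M *\<^sub>v v) $ i = mv n (\<lambda>i j. M $$ (i, j)) (\<lambda>i. v $ i) i"
  by (auto simp: scalar_prod_def mv_def lessThan_atLeast0)

lemma sum_two: "(\<Sum>i\<in>{0..<2::nat}. f i) = f 0 + f 1"
  by (simp add: numeral_2_eq_2)

lemma scalar_prod_two: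
  "v \<in> carrier_vec 2 \<Longrightarrow> w \<in> carrier_vec 2 \<Longrightarrow> v \<bullet> w = v $ 0 * w $ 0 + v $ 1 * (w $ 1 :: real)"
  by (auto simp: scalar_prod_def sum_two)

lemma mult_mat_vec_two:
  assumes "M \<in> carrier_mat n 2" "v \<in> carrier_vec 2" "i < n"
  shows "(M *\<^sub>v v) $ i = M $$ (i, 0) * v $ 0 + M $$ (i, 1) * (v $ 1 :: real)"
  using assms by (auto simp: scalar_prod_def sum_two)

lemma vec_two_eq_iff:
  "v \<in> carrier_vec 2 \<Longrightarrow> w \<in> carrier_vec 2 \<Longrightarrow> v = w \<longleftrightarrow> v $ 0 = w $ 0 \<and> v $ 1 = w $ 1"
  by (auto simp: less_2_cases_iff intro!: eq_vecI)

text \<open>Since \<open>B - \<mu>\<close> has determinant zero and nonnegative trace, \<open>\<mu>\<close> is the smallest eigenvalue.\<close>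

lemma symmetric_two_min_eigenvalue:
  fixes B :: "real mat"
  assumes B: "B \<in> carrier_mat 2 2" and sym: "B $$ (0, 1) = B $$ (1, 0)"
  obtains \<mu> where "eigenvalue B \<mu>" "\<And>l. eigenvalue B l \<Longrightarrow> \<mu> \<le> l"
    "\<And>v. v \<in> carrier_vec 2 \<Longrightarrow> \<mu> * (v \<bullet> v) \<le> v \<bullet> (B *\<^sub>v v)"
proof -
  define a b d where "a = B $$ (0, 0)" and "b = B $$ (0, 1)" and "d = B $$ (1, 1)"
  define s where "s = sqrt ((a - d)\<^sup>2 + 4 * b\<^sup>2)"
  define \<mu> where "\<mu> = (a + d - s) / 2"
  have s: "s\<^sup>2 = (a - d)\<^sup>2 + 4 * b\<^sup>2" "s \<ge> 0" by (simp_all add: s_def)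
  have det: "(a - \<mu>) * (d - \<mu>) = b\<^sup>2"
    using s(1) by (simp add: \<mu>_def power2_eq_square field_simps)
  have sa: "\<bar>a - d\<bar> \<le> s" using s by (intro power2_le_imp_le[of "\<bar>a - d\<bar>"]) auto
  have tr: "a - \<mu> \<ge> 0" "d - \<mu> \<ge> 0" using sa by (auto simp: \<mu>_def)
  have B_vec: "(B *\<^sub>v v) $ 0 = a * v $ 0 + b * v $ 1" "(B *\<^sub>v v) $ 1 = b * v $ 0 + d * v $ 1" "B *\<^sub>v v \<in> carrier_vec 2"
    if "v \<in> carrier_vec 2" for v
    using B that sym mult_mat_vec_two[OF B that] by (auto simp: a_def b_def d_def)
  have quad: "\<mu> * (v \<bullet> v) \<le> v \<bullet> (B *\<^sub>v v)" if v: "v \<in> carrier_vec 2" for v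
  proof -
    define z1 z2 where "z1 = v $ 0" and "z2 = v $ 1"
    have "(a - \<mu>) * z1\<^sup>2 + 2 * b * z1 * z2 + (d - \<mu>) * z2\<^sup>2 \<ge> 0"
    proof (cases "a - \<mu> = 0")
      case True
      then have "b = 0" using det by simp
      then show ?thesis using True tr by simp
    next
      case False
      have "(a - \<mu>) * ((a - \<mu>) * z1\<^sup>2 + 2 * b * z1 * z2 + (d - \<mu>) * z2\<^sup>2)
        = ((a - \<mu>) * z1)\<^sup>2 + 2 * ((a - \<mu>) * z1) * (b * z2) + (a - \<mu>) * (d - \<mu>) * z2\<^sup>2"
        by (simp add: power2_eq_square algebra_simps)
      also have "\<dots> = ((a - \<mu>) * z1 + b * z2)\<^sup>2" unfolding det by (simp add: power2_sum power_mult_distrib)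
      finally have "(a - \<mu>) * ((a - \<mu>) * z1\<^sup>2 + 2 * b * z1 * z2 + (d - \<mu>) * z2\<^sup>2) = ((a - \<mu>) * z1 + b * z2)\<^sup>2" .
      then have "(a - \<mu>) * ((a - \<mu>) * z1\<^sup>2 + 2 * b * z1 * z2 + (d - \<mu>) * z2\<^sup>2) \<ge> 0" by simp
      then show ?thesis using False tr by (simp add: zero_le_mult_iff)
    qed
    then show ?thesis unfolding scalar_prod_two[OF v v] scalar_prod_two[OF v B_vec(3)[OF v]] B_vec(1,2)[OF v] z1_def z2_def
      by (simp add: power2_eq_square algebra_simps)
  qed
  have ev: "eigenvalue B \<mu>"
  proof -
    \<comment> \<open>Eigenvector \<open>(b, \<mu> - a)\<close>. For \<open>a = \<mu>\<close> it
      would vanish, since then \<open>b = 0\<close>, and the first unit vector takes its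
      place.\<close>
    define v where "v = vec 2 (\<lambda>i. if a - \<mu> = 0 then (if i = 0 then 1 else 0) else (if i = 0 then b else \<mu> - a))"
    have v: "v \<in> carrier_vec 2" by (simp add: v_def)
    have v01: "v $ 0 = (if a - \<mu> = 0 then 1 else b)" "v $ 1 = (if a - \<mu> = 0 then 0 else \<mu> - a)"
      by (auto simp: v_def)
    have "v \<noteq> 0\<^sub>v 2" using v01 by (auto simp: vec_two_eq_iff[OF v])
    moreover have "B *\<^sub>v v = \<mu> \<cdot>\<^sub>v v"
    proof -
      have "b = 0" if "a - \<mu> = 0" using det that by simp
      then show ?thesis
        using det by (subst vec_two_eq_iff) (use v in \<open>auto simp: B_vec v01 power2_eq_square algebra_simps simp del: One_nat_def\<close>)
    qed
    ultimately show ?thesis unfolding eigenvalue_def eigenvector_def using v B by auto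
  qed
  have le: "\<mu> \<le> l" if ev: "eigenvalue B l" for l
  proof -
    obtain v where v: "v \<in> carrier_vec 2" "v \<noteq> 0\<^sub>v 2" "B *\<^sub>v v = l \<cdot>\<^sub>v v"
      using ev B unfolding eigenvalue_def eigenvector_def by auto
    have "\<mu> * (v \<bullet> v) \<le> l * (v \<bullet> v)" using quad[OF v(1)] v by simp
    moreover have "v \<bullet> v > 0"
      using v(2) vec_two_eq_iff[OF v(1), of "0\<^sub>v 2"] unfolding scalar_prod_two[OF v(1) v(1)]
      by (auto simp: sum_squares_gt_zero_iff)
    ultimately show ?thesis by simp
  qed
  show thesis using that ev le quad by blast
qed

text \<open>Replaces the eigenvector by its variational property, the form in which it can be
  carried from the 2 x 2 problem to the subspace.\<close>

lemma unit_min_eigenvector_iff: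
  fixes B :: "real mat"
  assumes B: "B \<in> carrier_mat 2 2" and sym: "B $$ (0, 1) = B $$ (1, 0)"
  shows "\<exists>h. unit_min_eigenvector B h"
    and "unit_min_eigenvector B h \<Longrightarrow> h \<in> carrier_vec 2 \<and> h \<bullet> h = 1 \<and>
      (\<forall>v\<in>carrier_vec 2. (h \<bullet> (B *\<^sub>v h)) * (v \<bullet> v) \<le> v \<bullet> (B *\<^sub>v v))"
proof -
  obtain \<mu> where \<mu>: "eigenvalue B \<mu>" "\<And>l. eigenvalue B l \<Longrightarrow> \<mu> \<le> l"
    "\<And>v. v \<in> carrier_vec 2 \<Longrightarrow> \<mu> * (v \<bullet> v) \<le> v \<bullet> (B *\<^sub>v v)"
    using symmetric_two_min_eigenvalue[OF B sym] by blast
  have "finite {l. eigenvalue B l}" 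
    unfolding eigenvalue_root_char_poly[OF B] using degree_monic_char_poly[OF B] by (intro poly_roots_finite) auto
  then have Min: "Min {l. eigenvalue B l} = \<mu>" using \<mu> by (intro Min_eqI) auto
  obtain v where v: "v \<in> carrier_vec 2" "v \<noteq> 0\<^sub>v 2" "B *\<^sub>v v = \<mu> \<cdot>\<^sub>v v"
    using \<mu>(1) B unfolding eigenvalue_def eigenvector_def by auto
  have vv: "v \<bullet> v > 0"
    using v(2) vec_two_eq_iff[OF v(1), of "0\<^sub>v 2"] unfolding scalar_prod_two[OF v(1) v(1)]
    by (auto simp: sum_squares_gt_zero_iff)
  define c where "c = 1 / sqrt (v \<bullet> v)"
  have c: "c > 0" "c * c * (v \<bullet> v) = 1" using vv by (auto simp: c_def)
  have "eigenvector B (c \<cdot>\<^sub>v v) \<mu>"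
    unfolding eigenvector_def
  proof (intro conjI)
    have "(c \<cdot>\<^sub>v v) $ 0 \<noteq> 0 \<or> (c \<cdot>\<^sub>v v) $ 1 \<noteq> 0"
      using v c vec_two_eq_iff[OF v(1), of "0\<^sub>v 2"] by auto
    then show "c \<cdot>\<^sub>v v \<noteq> 0\<^sub>v (dim_row B)" using B by auto
    show "B *\<^sub>v (c \<cdot>\<^sub>v v) = \<mu> \<cdot>\<^sub>v (c \<cdot>\<^sub>v v)"
      using mult_mat_vec[OF B v(1)] v by (simp add: smult_smult_assoc mult.commute)
  qed (use v B in auto)
  moreover have "(c \<cdot>\<^sub>v v) \<bullet> (c \<cdot>\<^sub>v v) = 1" using c v by (simp add: mult.assoc)
  ultimately show "\<exists>h. unit_min_eigenvector B h" unfolding unit_min_eigenvector_def Min by blast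
  assume h: "unit_min_eigenvector B h"
  then have h': "h \<in> carrier_vec 2" "B *\<^sub>v h = \<mu> \<cdot>\<^sub>v h" "h \<bullet> h = 1"
    using B unfolding unit_min_eigenvector_def Min eigenvector_def by auto
  then have "h \<bullet> (B *\<^sub>v h) = \<mu>" by simp
  then show "h \<in> carrier_vec 2 \<and> h \<bullet> h = 1 \<and> (\<forall>v\<in>carrier_vec 2. (h \<bullet> (B *\<^sub>v h)) * (v \<bullet> v) \<le> v \<bullet> (B *\<^sub>v v))"
    using h' \<mu>(3) by simp
qed

section \<open>Nearest balanced sign vectors and thresholding\<close>

lemma sign_pattern_proj:
  assumes x: "x \<in> feasible n" and v: "v \<in> carrier_vec n" and pos: "\<And>i. i < n \<Longrightarrow> x $ i * v $ i > 0"
  shows "proj n v = {x}"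
proof -
  have dist: "(u - v) \<bullet> (u - v) = (\<Sum>i<n. (u $ i - v $ i)\<^sup>2)" if "u \<in> carrier_vec n" for u
    using that v by (auto simp: scalar_prod_def power2_eq_square lessThan_atLeast0 intro!: sum.cong)
  have fx: "x \<in> carrier_vec n" "\<And>i. i < n \<Longrightarrow> x $ i = 1 \<or> x $ i = -1" using x by (auto simp: feasible_def)
  have less: "(x - v) \<bullet> (x - v) < (u - v) \<bullet> (u - v)" if u: "u \<in> feasible n" "u \<noteq> x" for u
  proof -
    have fu: "u \<in> carrier_vec n" "\<And>i. i < n \<Longrightarrow> u $ i = 1 \<or> u $ i = -1" using u by (auto simp: feasible_def)
    obtain j where j: "j < n" "u $ j \<noteq> x $ j" using u(2) fu fx by (metis carrier_vecD eq_vecI)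
    have le: "(x $ i - v $ i)\<^sup>2 \<le> (u $ i - v $ i)\<^sup>2 \<and> (u $ i \<noteq> x $ i \<longrightarrow> (x $ i - v $ i)\<^sup>2 < (u $ i - v $ i)\<^sup>2)" if i: "i < n" for i
      using fx(2)[OF i] fu(2)[OF i] pos[OF i] by (auto simp: power2_eq_square algebra_simps)
    show ?thesis unfolding dist[OF fx(1)] dist[OF fu(1)]
      by (rule sum_strict_mono_ex1) (use le j in auto)
  qed
  show ?thesis unfolding proj_def
  proof (rule equalityI; rule subsetI)
    fix u assume "u \<in> {u. is_arg_min (\<lambda>u. (u - v) \<bullet> (u - v)) (\<lambda>u. u \<in> feasible n) u}"
    then have "u \<in> feasible n" "\<not> (x - v) \<bullet> (x - v) < (u - v) \<bullet> (u - v)" using x by (auto simp: is_arg_min_def)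
    then show "u \<in> {x}" using less by auto
  next
    fix u assume "u \<in> {x}"
    then show "u \<in> {u. is_arg_min (\<lambda>u. (u - v) \<bullet> (u - v)) (\<lambda>u. u \<in> feasible n) u}"
      using x less by (auto simp: is_arg_min_def) (metis less_asym)
  qed
qed

lemma feasible_uminus: "x \<in> feasible n \<Longrightarrow> - x \<in> feasible n"
  by (auto simp: feasible_def scalar_prod_def sum_negf)

lemma feasible_card:
  assumes x: "x \<in> feasible n"
  shows "2 * card {i. i < n \<and> x $ i = 1} = n"
proof -
  have xn: "x \<in> carrier_vec n" "\<And>i. i < n \<Longrightarrow> x $ i = 1 \<or> x $ i = -1" "(\<Sum>i<n. x $ i) = 0"
    using x by (auto simp: feasible_def scalar_prod_def lessThan_atLeast0)
  have "(\<Sum>i<n. x $ i) = (\<Sum>i<n. 2 * (of_bool (x $ i = 1) :: real) - 1)"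
    using xn(2) by (intro sum.cong refl) auto
  also have "\<dots> = 2 * (\<Sum>i<n. of_bool (x $ i = 1) :: real) - real n"
    unfolding sum_subtractf sum_distrib_left by simp
  also have "(\<Sum>i<n. of_bool (x $ i = 1) :: real) = card {i. i < n \<and> x $ i = 1}"
    by (simp add: of_bool_def sum.If_cases lessThan_def Int_def)
  finally show ?thesis using xn(3) by linarith
qed

text \<open>Sorting puts the \<open>k\<close> positive entries last, so the \<open>k\<close>-th
  largest entry is the least positive one.\<close>

lemma sorted_threshold:
  fixes xs :: "real list"
  assumes "length (filter (\<lambda>z. z > 0) xs) = k" "k \<ge> 1"
  shows "rev (sort xs) ! (k - 1) \<in> set xs" "rev (sort xs) ! (k - 1) > 0"
    "\<And>z. z \<in> set xs \<Longrightarrow> z > 0 \<Longrightarrow> rev (sort xs) ! (k - 1) \<le> z"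
proof -
  define P N where "P = sort (filter (\<lambda>z. z > 0) xs)" and "N = sort (filter (\<lambda>z. \<not> z > 0) xs)"
  have "sort xs = N @ P"
  proof (rule properties_for_sort)
    show "mset (N @ P) = mset xs" by (simp add: N_def P_def multiset_partition[symmetric] add.commute)
    show "sorted (N @ P)" by (auto simp: sorted_append N_def P_def)
  qed
  moreover have lP: "length P = k" using assms by (simp add: P_def)
  moreover have P0: "P \<noteq> []" using lP assms(2) by auto
  ultimately have eq: "rev (sort xs) ! (k - 1) = hd P"
    using assms(2) by (simp add: nth_append rev_nth hd_conv_nth)
  have in_P: "set P = {z \<in> set xs. z > 0}" by (auto simp: P_def)
  have "hd P \<in> set P" using P0 by simp
  then show "rev (sort xs) ! (k - 1) \<in> set xs" "rev (sort xs) ! (k - 1) > 0" unfolding eq in_P by auto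
  have "sorted P" by (simp add: P_def)
  then have "hd P \<le> z" if "z \<in> set P" for z using that P0 by (cases P) auto
  then show "rev (sort xs) ! (k - 1) \<le> z" if "z \<in> set xs" "z > 0" for z using that unfolding eq in_P by auto
qed

text \<open>Exactly half of the entries are positive, so \<open>\<tau>\<close> is the least positive
  entry, and being positive means being at or above it. All ties are positive and the quota has room
  for each, so tie-breaking never rejects one.\<close>

lemma threshold_rounding:
  assumes x: "x \<in> feasible n" and v: "v \<in> carrier_vec n" and pos: "\<And>i. i < n \<Longrightarrow> x $ i * v $ i > 0"
    and n: "n > 0"
  defines "\<tau> \<equiv> kth_largest (n div 2) v"
  shows "vec n (\<lambda>i. if v $ i > \<tau> \<or> v $ i = \<tau> \<and> card {j. j < i \<and> v $ j = \<tau>} < n div 2 - card {i. i < n \<and> v $ i > \<tau>} then 1 else -1) = x"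
proof -
  have xn: "x \<in> carrier_vec n" "\<And>i. i < n \<Longrightarrow> x $ i = 1 \<or> x $ i = -1" using x by (auto simp: feasible_def)
  have sgn: "x $ i = (if v $ i > 0 then 1 else -1)" if "i < n" for i
    using xn(2)[OF that] pos[OF that] by auto
  have half: "card {i. i < n \<and> v $ i > 0} = n div 2"
  proof -
    have "x $ i = 1 \<longleftrightarrow> v $ i > 0" if "i < n" for i using sgn[OF that] by simp
    then have "{i. i < n \<and> v $ i > 0} = {i. i < n \<and> x $ i = 1}" by blast
    then show ?thesis using feasible_card[OF x] by simp
  qed
  have "n div 2 = card {i. i < n \<and> x $ i = 1}" using feasible_card[OF x] by linarith
  then have n2: "n div 2 \<ge> 1" using feasible_card[OF x] n by linarith
  have lv: "list_of_vec v = map (\<lambda>i. v $ i) [0..<n]" using v by (auto simp: list_eq_iff_nth_eq list_of_vec_index)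
  have len: "length (filter (\<lambda>z. z > 0) (list_of_vec v)) = n div 2"
  proof -
    have "length (filter (\<lambda>z. z > 0) (list_of_vec v)) = length (filter (\<lambda>i. v $ i > 0) [0..<n])"
      unfolding lv by (simp add: filter_map o_def)
    also have "\<dots> = card {i. i < n \<and> v $ i > 0}"
      by (subst distinct_card[symmetric]) (auto intro!: arg_cong[of _ _ card])
    finally show ?thesis using half by simp
  qed
  have st: "set (list_of_vec v) = {v $ i |i. i < n}" unfolding lv by auto
  have \<tau>0: "\<tau> > 0" and \<tau>le: "\<tau> \<le> v $ i" if "i < n" "v $ i > 0" for i
    using sorted_threshold[OF len n2] that unfolding \<tau>_def kth_largest_def st by auto
  have \<tau>0: "\<tau> > 0" using sorted_threshold(2)[OF len n2] unfolding \<tau>_def kth_largest_def .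
  \<comment> \<open>Entry \<open>i\<close> is positive but counted in neither set, whence the strict
    inequality.\<close>
  have tie: "card {j. j < i \<and> v $ j = \<tau>} < n div 2 - card {i. i < n \<and> v $ i > \<tau>}" if i: "i < n" "v $ i = \<tau>" for i
  proof -
    have fin: "finite {j. j < i \<and> v $ j = \<tau>}" "finite {i. i < n \<and> v $ i > \<tau>}" by auto
    have "card {j. j < i \<and> v $ j = \<tau>} + card {i. i < n \<and> v $ i > \<tau>} = card ({j. j < i \<and> v $ j = \<tau>} \<union> {i. i < n \<and> v $ i > \<tau>})"
      using fin by (intro card_Un_disjoint[symmetric]) auto
    also have "\<dots> < card {i. i < n \<and> v $ i > 0}"
    proof (rule psubset_card_mono)
      show "{j. j < i \<and> v $ j = \<tau>} \<union> {i. i < n \<and> v $ i > \<tau>} \<subset> {i. i < n \<and> v $ i > 0}"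
        using i \<tau>0 by auto
    qed simp
    finally show ?thesis using half by linarith
  qed
  show ?thesis
  proof (rule eq_vecI)
    fix i assume "i < dim_vec x"
    then have i: "i < n" using xn by simp
    have "(v $ i > \<tau> \<or> v $ i = \<tau> \<and> card {j. j < i \<and> v $ j = \<tau>} < n div 2 - card {i. i < n \<and> v $ i > \<tau>}) \<longleftrightarrow> v $ i > 0"
      using tie[OF i] \<tau>le[OF i] \<tau>0 by fastforce
    then show "vec n (\<lambda>i. if v $ i > \<tau> \<or> v $ i = \<tau> \<and> card {j. j < i \<and> v $ j = \<tau>} < n div 2 - card {i. i < n \<and> v $ i > \<tau>} then 1 else -1) $ i = x $ i"
      using i sgn[OF i] by simp
  qed (use xn in simp)
qed

section \<open>Inverse square roots and QR decompositions\<close>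

lemma mat_two_eqI:
  assumes "A \<in> carrier_mat 2 2" "B \<in> carrier_mat 2 2"
    "A $$ (0, 0) = B $$ (0, 0)" "A $$ (0, 1) = B $$ (0, 1)" "A $$ (1, 0) = B $$ (1, 0)" "A $$ (1, 1) = B $$ (1, 1)"
  shows "A = B"
  using assms by (intro eq_matI) (auto simp: less_2_cases_iff)

lemma mat_mult_two:
  assumes "A \<in> carrier_mat n 2" "B \<in> carrier_mat 2 m" "i < n" "j < m"
  shows "(A * B) $$ (i, j) = A $$ (i, 0) * B $$ (0, j) + A $$ (i, 1) * (B $$ (1, j) :: real)"
  using assms by (auto simp: scalar_prod_def sum_two)

definition sym2 :: "real \<Rightarrow> real \<Rightarrow> real \<Rightarrow> real mat" where
  "sym2 a b d = mat 2 2 (\<lambda>(i, j). if i = j then (if i = 0 then a else d) else b)"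

lemma sym2_carrier: "sym2 a b d \<in> carrier_mat 2 2"
  by (simp add: sym2_def)

lemma sym2_entries: "sym2 a b d $$ (0, 0) = a" "sym2 a b d $$ (0, 1) = b" "sym2 a b d $$ (1, 0) = b" "sym2 a b d $$ (1, 1) = d"
  by (simp_all add: sym2_def)

lemma sym2_transpose: "(sym2 a b d)\<^sup>T = sym2 a b d"
  by (intro eq_matI) (auto simp: sym2_def)

text \<open>The square of a positive definite \<open>S\<close> determines \<open>det S\<close>; then
  \<open>tr S\<close> by \<open>(tr S)^2 = tr (S^2) + 2 * det S\<close>; then \<open>S\<close>
  itself by Cayley-Hamilton, as \<open>tr S * S = S^2 + det S\<close>.\<close>

lemma positive_root_unique:
  fixes e f g e' f' g' :: real
  assumes "e > 0" "g > 0" "e * g - f\<^sup>2 > 0" "e' > 0" "g' > 0" "e' * g' - f'\<^sup>2 > 0"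
    and eq: "e * e + f * f = e' * e' + f' * f'" "e * f + f * g = e' * f' + f' * g'" "f * f + g * g = f' * f' + g' * g'"
  shows "e = e' \<and> f = f' \<and> g = g'"
proof -
  define \<delta> where "\<delta> = e * g - f\<^sup>2"
  have "\<delta>\<^sup>2 = (e * e + f * f) * (f * f + g * g) - (e * f + f * g)\<^sup>2"
    by (simp add: \<delta>_def power2_eq_square algebra_simps)
  also have "\<dots> = (e' * g' - f'\<^sup>2)\<^sup>2" unfolding eq by (simp add: power2_eq_square algebra_simps)
  finally have \<delta>: "\<delta> = e' * g' - f'\<^sup>2" using assms(3,6) unfolding \<delta>_def[symmetric] by (simp add: power2_eq_iff_nonneg)
  have "(e + g)\<^sup>2 = (e * e + f * f) + (f * f + g * g) + 2 * \<delta>" by (simp add: \<delta>_def power2_eq_square algebra_simps)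
  also have "\<dots> = (e' + g')\<^sup>2" unfolding eq \<delta> by (simp add: power2_eq_square algebra_simps)
  finally have t: "e + g = e' + g'" using assms by (simp add: power2_eq_iff_nonneg)
  have t0: "e + g > 0" using assms by simp
  have "f * (e + g) = e * f + f * g" by (simp add: algebra_simps)
  also have "\<dots> = f' * (e' + g')" unfolding eq(2) by (simp add: algebra_simps)
  finally have "f * (e + g) = f' * (e + g)" unfolding t .
  then have f: "f = f'" using t0 by simp
  have "e * (e + g) = e * e + f * f + \<delta>" by (simp add: \<delta>_def power2_eq_square algebra_simps)
  also have "\<dots> = e' * (e' + g')" unfolding eq(1) \<delta> by (simp add: power2_eq_square algebra_simps)
  finally have "e * (e + g) = e' * (e + g)" unfolding t .
  then have e: "e = e'" using t0 by simp
  then show ?thesis using f t by simp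
qed

text \<open>If \<open>s\<^sup>2 = det G\<close> and \<open>t\<^sup>2 = tr G + 2 s\<close>, then \<open>(G + s) / t\<close> is the square root of \<open>G\<close> by
  Cayley-Hamilton; below is its inverse.\<close>

lemma inv_sqrt_two:
  fixes G :: "real mat"
  assumes G: "G \<in> carrier_mat 2 2" and sym: "G $$ (0, 1) = G $$ (1, 0)"
    and pd: "G $$ (0, 0) > 0" "G $$ (0, 0) * G $$ (1, 1) - (G $$ (0, 1))\<^sup>2 > 0"
  shows "inv_sqrt G \<in> carrier_mat 2 2 \<and> inv_sqrt G * (inv_sqrt G * G) = 1\<^sub>m 2"
proof -
  define a b d where "a = G $$ (0, 0)" and "b = G $$ (0, 1)" and "d = G $$ (1, 1)"
  define s where "s = sqrt (a * d - b\<^sup>2)"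
  have s: "s > 0" "s * s = a * d - b * b" using pd by (auto simp: s_def a_def b_def d_def power2_eq_square)
  have a0: "a > 0" using pd by (simp add: a_def)
  have "a * d > 0" using s by (smt (verit) mult_pos_pos zero_le_square)
  then have d0: "d > 0" using a0 by (simp add: zero_less_mult_iff)
  define t where "t = sqrt (a + d + 2 * s)"
  have t: "t > 0" "t * t = a + d + 2 * s" using s a0 d0 by (auto simp: t_def)
  have Gs: "G = sym2 a b d" using G sym by (intro mat_two_eqI) (auto simp: sym2_carrier sym2_entries a_def b_def d_def simp del: One_nat_def)
  define S0 where "S0 = sym2 ((d + s) / (t * s)) (- b / (t * s)) ((a + s) / (t * s))"
  define P where "P S \<longleftrightarrow> S \<in> carrier_mat (dim_row G) (dim_row G) \<and> S\<^sup>T = S \<and>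
     (\<forall>v \<in> carrier_vec (dim_row G). v \<noteq> 0\<^sub>v (dim_row G) \<longrightarrow> v \<bullet> (S *\<^sub>v v) > 0) \<and> inverts_mat (S * S) G" for S
  have P_form: "\<exists>e f g. S = sym2 e f g \<and> e > 0 \<and> g > 0 \<and> e * g - f\<^sup>2 > 0" if "P S" for S
  proof -
    have S: "S \<in> carrier_mat 2 2" "S\<^sup>T = S" and pos: "\<And>v. v \<in> carrier_vec 2 \<Longrightarrow> v \<noteq> 0\<^sub>v 2 \<Longrightarrow> v \<bullet> (S *\<^sub>v v) > 0"
      using that G by (auto simp: P_def)
    define e f g where "e = S $$ (0, 0)" and "f = S $$ (0, 1)" and "g = S $$ (1, 1)"
    have "S $$ (1, 0) = S\<^sup>T $$ (0, 1)" using S(1) by simp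
    then have S10: "S $$ (1, 0) = f" using S(2) by (simp add: f_def)
    have q: "v \<bullet> (S *\<^sub>v v) = e * (v $ 0)\<^sup>2 + 2 * f * v $ 0 * v $ 1 + g * (v $ 1)\<^sup>2" if v: "v \<in> carrier_vec 2" for v
    proof -
      have "S *\<^sub>v v \<in> carrier_vec 2" using S(1) v by simp
      then show ?thesis unfolding scalar_prod_two[OF v \<open>S *\<^sub>v v \<in> carrier_vec 2\<close>]
        using mult_mat_vec_two[OF S(1) v, of 0] mult_mat_vec_two[OF S(1) v, of 1] S10
        by (simp add: e_def f_def g_def power2_eq_square algebra_simps del: One_nat_def)
    qed
    have vv: "vec 2 w \<in> carrier_vec 2" "vec 2 w $ 0 = w 0" "vec 2 w $ 1 = w 1" for w :: "nat \<Rightarrow> real" by auto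
    have qp: "e * (w 0)\<^sup>2 + 2 * f * w 0 * w 1 + g * (w 1)\<^sup>2 > 0" if "w 0 \<noteq> 0 \<or> w 1 \<noteq> 0" for w :: "nat \<Rightarrow> real"
    proof -
      have "vec 2 w \<noteq> 0\<^sub>v 2" using that vec_two_eq_iff[OF vv(1), of "0\<^sub>v 2" w] by auto
      from pos[OF vv(1) this] show ?thesis unfolding q[OF vv(1)] vv(2,3) .
    qed
    have e: "e > 0" using qp[of "\<lambda>i. if i = 0 then 1 else 0"] by simp
    have g: "g > 0" using qp[of "\<lambda>i. if i = 0 then 0 else 1"] by simp
    \<comment> \<open>The vector \<open>(f, - e)\<close> turns positivity of the form into
      positivity of the determinant.\<close>
    have "e * f\<^sup>2 + 2 * f * f * (- e) + g * (- e)\<^sup>2 > 0" using qp[of "\<lambda>i. if i = 0 then f else - e"] e by simp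
    then have "e * (e * g - f\<^sup>2) > 0" by (simp add: power2_eq_square algebra_simps)
    then have "e * g - f\<^sup>2 > 0" using e by (simp add: zero_less_mult_iff)
    moreover have "S = sym2 e f g" using S S10 by (intro mat_two_eqI) (auto simp: sym2_carrier sym2_entries e_def f_def g_def simp del: One_nat_def)
    ultimately show ?thesis using e g by blast
  qed
  have SG: "S * (S * G) = (S * S) * G" if "S \<in> carrier_mat 2 2" for S using that G by (simp add: assoc_mult_mat)
  have inv: "(S * S) * G = 1\<^sub>m 2" if "P S" for S
    using that G by (auto simp: P_def inverts_mat_def)
  have S0c: "S0 \<in> carrier_mat 2 2" by (simp add: S0_def sym2_carrier)
  define z where "z = t * s"
  have z: "z > 0" using t s by (simp add: z_def)
  have S0e: "S0 $$ (0, 0) = (d + s) / z" "S0 $$ (0, 1) = - b / z" "S0 $$ (1, 0) = - b / z" "S0 $$ (1, 1) = (a + s) / z"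
    by (simp_all only: S0_def sym2_entries z_def)
  have PS0: "P S0"
    unfolding P_def
  proof (intro conjI ballI impI)
    show "S0 \<in> carrier_mat (dim_row G) (dim_row G)" using S0c G by simp
    show "S0\<^sup>T = S0" unfolding S0_def by (rule sym2_transpose)
    fix v :: "real vec" assume v: "v \<in> carrier_vec (dim_row G)" "v \<noteq> 0\<^sub>v (dim_row G)"
    then have v2: "v \<in> carrier_vec 2" "v $ 0 \<noteq> 0 \<or> v $ 1 \<noteq> 0" using G vec_two_eq_iff[of v "0\<^sub>v 2"] by auto
    define p q where "p = v $ 0" and "q = v $ 1"
    have "S0 *\<^sub>v v \<in> carrier_vec 2" using S0c v2 by simp
    moreover have "(S0 *\<^sub>v v) $ 0 = S0 $$ (0, 0) * p + S0 $$ (0, 1) * q" "(S0 *\<^sub>v v) $ 1 = S0 $$ (1, 0) * p + S0 $$ (1, 1) * q"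
      unfolding p_def q_def by (rule mult_mat_vec_two[OF S0c v2(1)], simp)+
    ultimately have "v \<bullet> (S0 *\<^sub>v v) = p * ((d + s) / z * p + - b / z * q) + q * (- b / z * p + (a + s) / z * q)"
      unfolding S0e using scalar_prod_two[OF v2(1)] by (simp only: p_def q_def)
    also have "\<dots> = ((d + s) * p\<^sup>2 - 2 * b * p * q + (a + s) * q\<^sup>2) / z"
      using z by (simp add: power2_eq_square field_simps)
    finally have eq: "v \<bullet> (S0 *\<^sub>v v) = ((d + s) * p\<^sup>2 - 2 * b * p * q + (a + s) * q\<^sup>2) / z" .
    have "d * (d * p\<^sup>2 - 2 * b * p * q + a * q\<^sup>2) = (d * p - b * q)\<^sup>2 + (a * d - b * b) * q\<^sup>2"
      by (simp add: power2_eq_square algebra_simps)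
    also have "\<dots> \<ge> 0" unfolding s(2)[symmetric] by simp
    finally have "d * p\<^sup>2 - 2 * b * p * q + a * q\<^sup>2 \<ge> 0" using d0 by (simp add: zero_le_mult_iff)
    moreover have "s * (p\<^sup>2 + q\<^sup>2) > 0" using s v2(2) by (simp add: p_def q_def sum_power2_gt_zero_iff)
    ultimately have "(d + s) * p\<^sup>2 - 2 * b * p * q + (a + s) * q\<^sup>2 > 0" by (simp add: algebra_simps)
    then show "v \<bullet> (S0 *\<^sub>v v) > 0" unfolding eq using z by simp
  next
    have z: "t * s * (t * s) > 0" using t s by simp
    have SS: "S0 * S0 \<in> carrier_mat 2 2" using S0c by simp
    have gen: "u / z * (w / z) + u' / z * (w' / z) = (u * w + u' * w') / (z * z)" for u w u' w'
      by (simp add: add_divide_distrib)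
    have E: "(d + s) * (d + s) + - b * - b = t * t * d" "(d + s) * - b + - b * (a + s) = t * t * - b"
      "- b * (d + s) + (a + s) * - b = t * t * - b" "- b * - b + (a + s) * (a + s) = t * t * a"
      unfolding t(2) using s(2) by (simp_all add: algebra_simps)
    have div: "t * t * w / (z * z) = w / (s * s)" for w using t(1) s(1) by (simp add: z_def)
    have prods: "(d + s) / z * ((d + s) / z) + - b / z * (- b / z) = t * t * d / (z * z)"
      "(d + s) / z * (- b / z) + - b / z * ((a + s) / z) = t * t * (- b) / (z * z)"
      "- b / z * ((d + s) / z) + (a + s) / z * (- b / z) = t * t * (- b) / (z * z)"
      "- b / z * (- b / z) + (a + s) / z * ((a + s) / z) = t * t * a / (z * z)"
      unfolding gen E by (rule refl)+
    have S2: "S0 * S0 = sym2 (d / (s * s)) (- b / (s * s)) (a / (s * s))"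
      by (rule mat_two_eqI[OF SS sym2_carrier]; subst mat_mult_two[OF S0c S0c];
        (simp only: S0e sym2_entries prods div)?)
    have "(S0 * S0) * G = 1\<^sub>m 2"
    proof (rule mat_two_eqI)
      show "S0 * S0 * G \<in> carrier_mat 2 2" using SS G by simp
      show "(S0 * S0 * G) $$ (0, 0) = 1\<^sub>m 2 $$ (0, 0)" "(S0 * S0 * G) $$ (0, 1) = 1\<^sub>m 2 $$ (0, 1)"
        "(S0 * S0 * G) $$ (1, 0) = 1\<^sub>m 2 $$ (1, 0)" "(S0 * S0 * G) $$ (1, 1) = 1\<^sub>m 2 $$ (1, 1)"
        unfolding S2 Gs using s
        by (simp_all add: mat_mult_two[OF sym2_carrier sym2_carrier] sym2_entries field_simps del: One_nat_def)
    qed simp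
    then show "inverts_mat (S0 * S0) G" using S0c by (simp add: inverts_mat_def)
  qed
  \<comment> \<open>Both candidates square to the inverse of \<open>G\<close>, so uniqueness of the
    positive root applies.\<close>
  have uniq: "S = S0" if PS: "P S" for S
  proof -
    obtain e f g where S: "S = sym2 e f g" "e > 0" "g > 0" "e * g - f\<^sup>2 > 0" using P_form[OF PS] by blast
    obtain e' f' g' where S': "S0 = sym2 e' f' g'" "e' > 0" "g' > 0" "e' * g' - f'\<^sup>2 > 0" using P_form[OF PS0] by blast
    have Sc: "S \<in> carrier_mat 2 2" by (simp add: S sym2_carrier)
    have c: "S * S \<in> carrier_mat 2 2" "S0 * S0 \<in> carrier_mat 2 2" using Sc S0c by auto
    have GI: "G * (S0 * S0) = 1\<^sub>m 2" using inv[OF PS0] mat_mult_left_right_inverse[OF c(2) G] by simp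
    have "S * S = S * S * (G * (S0 * S0))" unfolding GI by (rule right_mult_one_mat[OF c(1), symmetric])
    also have "\<dots> = (S * S * G) * (S0 * S0)" using c G by (simp add: assoc_mult_mat)
    also have "\<dots> = S0 * S0" unfolding inv[OF PS] by (rule left_mult_one_mat[OF c(2)])
    finally have eq: "S * S = S0 * S0" .
    have "e * e + f * f = e' * e' + f' * f'" "e * f + f * g = e' * f' + f' * g'" "f * f + g * g = f' * f' + g' * g'"
      using arg_cong[OF eq, of "\<lambda>M. M $$ (0, 0)"] arg_cong[OF eq, of "\<lambda>M. M $$ (0, 1)"] arg_cong[OF eq, of "\<lambda>M. M $$ (1, 1)"]
      unfolding S(1) S'(1) by (simp_all add: mat_mult_two[OF sym2_carrier sym2_carrier] sym2_entries del: One_nat_def)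
    then show ?thesis using positive_root_unique[of e g f e' g' f'] S S' by simp
  qed
  have PI: "P (inv_sqrt G)" unfolding inv_sqrt_def P_def[symmetric] using PS0 uniq by (rule theI)
  then have c: "inv_sqrt G \<in> carrier_mat 2 2" using G by (simp add: P_def)
  then show ?thesis using inv[OF PI] SG[OF c] by simp
qed

text \<open>Gram-Schmidt on the two columns; injectivity keeps the pivots \<open>r11\<close> and
  \<open>r22\<close> positive.\<close>

lemma qr_exists:
  fixes W :: "real mat"
  assumes W: "W \<in> carrier_mat n 2" and full: "\<And>v. v \<in> carrier_vec 2 \<Longrightarrow> v \<noteq> 0\<^sub>v 2 \<Longrightarrow> W *\<^sub>v v \<noteq> 0\<^sub>v n"
  shows "\<exists>Q R. is_qr W Q R"
proof -
  define c1 c2 where "c1 = (\<lambda>i. W $$ (i, 0))" and "c2 = (\<lambda>i. W $$ (i, 1))"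
  have indep: "\<exists>i<n. \<alpha> * c1 i + \<beta> * c2 i \<noteq> 0" if "\<alpha> \<noteq> 0 \<or> \<beta> \<noteq> 0" for \<alpha> \<beta>
  proof (rule ccontr)
    assume neg: "\<not> ?thesis"
    define v where "v = vec 2 (\<lambda>i. if i = 0 then \<alpha> else \<beta>)"
    have v: "v \<in> carrier_vec 2" "v $ 0 = \<alpha>" "v $ 1 = \<beta>" by (auto simp: v_def)
    have "v \<noteq> 0\<^sub>v 2" using vec_two_eq_iff[OF v(1), of "0\<^sub>v 2"] v that by auto
    moreover have "W *\<^sub>v v = 0\<^sub>v n"
    proof (rule eq_vecI)
      fix i assume "i < dim_vec (0\<^sub>v n :: real vec)"
      then have i: "i < n" by simp
      have "(W *\<^sub>v v) $ i = W $$ (i, 0) * v $ 0 + W $$ (i, 1) * v $ 1" by (rule mult_mat_vec_two[OF W v(1) i])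
      then show "(W *\<^sub>v v) $ i = 0\<^sub>v n $ i" using neg i v by (simp add: c1_def c2_def mult.commute del: One_nat_def index_mult_mat_vec)
    qed (use W in simp)
    ultimately show False using full[OF v(1)] by blast
  qed
  define r11 where "r11 = nrm n c1"
  have nz: "ip n f f > 0" if "\<exists>i<n. f i \<noteq> 0" for f
    using that ip_self_eq_0[of n f] ip_self_nonneg[of n f] by (metis less_eq_real_def)
  have r11: "r11 > 0" using nz[of c1] indep[of 1 0] by (simp add: r11_def nrm_def)
  define q1 where "q1 = (\<lambda>i. (1 / r11) * c1 i)"
  define r12 where "r12 = ip n q1 c2"
  define e where "e = (\<lambda>i. c2 i - r12 * q1 i)"
  define r22 where "r22 = nrm n e"
  have r22: "r22 > 0"
  proof -
    have "e i = (- r12 / r11) * c1 i + 1 * c2 i" for i by (simp add: e_def q1_def)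
    then have "\<exists>i<n. e i \<noteq> 0" using indep[of "- r12 / r11" 1] by simp
    then show ?thesis using nz[of e] by (simp add: r22_def nrm_def)
  qed
  define q2 where "q2 = (\<lambda>i. (1 / r22) * e i)"
  have q11: "ip n q1 q1 = 1" 
  proof -
    have "ip n c1 c1 = r11 * r11" by (simp add: r11_def nrm_power2[symmetric] power2_eq_square)
    then show ?thesis unfolding q1_def ip_linear using r11 by simp
  qed
  have q12: "ip n q1 q2 = 0" unfolding q2_def ip_linear e_def using q11 by (simp add: r12_def)
  have q22: "ip n q2 q2 = 1" 
  proof -
    have "ip n e e = r22 * r22" by (simp add: r22_def nrm_power2[symmetric] power2_eq_square)
    then show ?thesis unfolding q2_def ip_linear using r22 by simp
  qed
  define Q where "Q = mat n 2 (\<lambda>(i, j). if j = 0 then q1 i else q2 i)"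
  define R where "R = mat 2 2 (\<lambda>(i, j). if i = 0 then (if j = 0 then r11 else r12) else (if j = 0 then 0 else r22))"
  have QR: "Q \<in> carrier_mat n 2" "R \<in> carrier_mat 2 2" by (auto simp: Q_def R_def)
  have ent: "Q $$ (i, 0) = q1 i" "Q $$ (i, 1) = q2 i" if "i < n" for i using that by (auto simp: Q_def)
  have entR: "R $$ (0, 0) = r11" "R $$ (0, 1) = r12" "R $$ (1, 0) = 0" "R $$ (1, 1) = r22" by (auto simp: R_def)
  have "W = Q * R"
  proof (rule eq_matI)
    fix i j assume "i < dim_row (Q * R)" "j < dim_col (Q * R)"
    then have ij: "i < n" "j < 2" using QR by auto
    then consider "j = 0" | "j = 1" by linarith
    then show "W $$ (i, j) = (Q * R) $$ (i, j)"
      unfolding mat_mult_two[OF QR ij] ent[OF ij(1)]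
      by cases (use r11 r22 in \<open>simp_all add: entR q1_def q2_def e_def c1_def c2_def del: One_nat_def\<close>)
  qed (use W QR in auto)
  moreover have "Q\<^sup>T * Q = 1\<^sub>m 2"
  proof -
    have "(Q\<^sup>T * Q) $$ (i, j) = ip n (\<lambda>k. Q $$ (k, i)) (\<lambda>k. Q $$ (k, j))" if "i < 2" "j < 2" for i j
      using that QR(1) by (auto simp: scalar_prod_def ip_def lessThan_atLeast0 intro!: sum.cong)
    moreover have "ip n (\<lambda>k. Q $$ (k, 0)) f = ip n q1 f" "ip n (\<lambda>k. Q $$ (k, 1)) f = ip n q2 f"
      "ip n f (\<lambda>k. Q $$ (k, 0)) = ip n f q1" "ip n f (\<lambda>k. Q $$ (k, 1)) = ip n f q2" for f
      using ent by (auto intro!: ip_cong)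
    ultimately show ?thesis using QR q11 q12 q22 ip_commute[of n q2 q1]
      by (intro mat_two_eqI) (auto simp del: One_nat_def index_mult_mat index_transpose_mat)
  qed
  moreover have "upper_triangular R" using entR by (auto simp: upper_triangular_def R_def)
  ultimately show ?thesis unfolding is_qr_def using W QR by auto
qed

section \<open>Orthogonal iterations\<close>

definition power_iterate :: "real mat \<Rightarrow> real mat \<Rightarrow> nat \<Rightarrow> real mat" where
  "power_iterate A Y k = ((\<lambda>X. A * X) ^^ k) Y"

lemma power_iterate_simps: "power_iterate A Y 0 = Y" "power_iterate A Y (Suc k) = A * power_iterate A Y k"
  by (simp_all add: power_iterate_def)

lemma power_iterate_carrier:
  "A \<in> carrier_mat n n \<Longrightarrow> Y \<in> carrier_mat n 2 \<Longrightarrow> power_iterate A Y k \<in> carrier_mat n 2"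
  by (induction k) (auto simp: power_iterate_simps)

lemma power_iterate_apply:
  assumes A: "A \<in> carrier_mat n n" and Y: "Y \<in> carrier_mat n 2" and c: "c \<in> carrier_vec 2" and i: "i < n"
  shows "(power_iterate A Y k *\<^sub>v c) $ i = (mv n (\<lambda>i j. A $$ (i, j)) ^^ k) (\<lambda>i. c $ 0 * Y $$ (i, 0) + c $ 1 * Y $$ (i, 1)) i"
  using i
proof (induction k arbitrary: i)
  case 0
  have "(Y *\<^sub>v c) $ i = Y $$ (i, 0) * c $ 0 + Y $$ (i, 1) * c $ 1" by (rule mult_mat_vec_two[OF Y c 0])
  then show ?case by (simp only: power_iterate_simps funpow_0 mult.commute)
next
  case (Suc k)
  have X: "power_iterate A Y k \<in> carrier_mat n 2" by (rule power_iterate_carrier[OF A Y])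
  have "power_iterate A Y (Suc k) *\<^sub>v c = A *\<^sub>v (power_iterate A Y k *\<^sub>v c)"
    unfolding power_iterate_simps by (rule assoc_mult_mat_vec[OF A X c])
  also have "\<dots> $ i = mv n (\<lambda>i j. A $$ (i, j)) (\<lambda>i. (power_iterate A Y k *\<^sub>v c) $ i) i"
    using X c Suc.prems by (intro mult_mat_vec_mv[OF A]) auto
  also have "mv n (\<lambda>i j. A $$ (i, j)) (\<lambda>i. (power_iterate A Y k *\<^sub>v c) $ i)
    = mv n (\<lambda>i j. A $$ (i, j)) ((mv n (\<lambda>i j. A $$ (i, j)) ^^ k) (\<lambda>i. c $ 0 * Y $$ (i, 0) + c $ 1 * Y $$ (i, 1)))"
    by (rule mv_cong) (rule Suc.IH)
  finally show ?case by (simp only: funpow.simps o_apply)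
qed

text \<open>By \<open>inj\<close> no power step loses rank. This makes the initial inverse square
  root meaningful and provides a QR decomposition at every step, so that runs exist.\<close>

locale orthogonal_setup =
  fixes n :: nat and A Y :: "real mat"
  assumes A: "A \<in> carrier_mat n n" and A_sym: "A\<^sup>T = A" and Y: "Y \<in> carrier_mat n 2"
    and inj: "\<And>k c. c \<in> carrier_vec 2 \<Longrightarrow> c \<noteq> 0\<^sub>v 2 \<Longrightarrow> power_iterate A Y k *\<^sub>v c \<noteq> 0\<^sub>v n"
begin

lemma P_carrier: "power_iterate A Y k \<in> carrier_mat n 2"
  by (rule power_iterate_carrier[OF A Y])

lemma gram_pos:
  defines "G \<equiv> Y\<^sup>T * Y"
  shows "G \<in> carrier_mat 2 2" "G $$ (0, 1) = G $$ (1, 0)" "G $$ (0, 0) > 0" "G $$ (0, 0) * G $$ (1, 1) - (G $$ (0, 1))\<^sup>2 > 0"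
proof -
  define y1 y2 where "y1 = (\<lambda>i. Y $$ (i, 0))" and "y2 = (\<lambda>i. Y $$ (i, 1))"
  show G: "G \<in> carrier_mat 2 2" using Y by (simp add: G_def)
  have ent: "G $$ (i, j) = ip n (\<lambda>k. Y $$ (k, i)) (\<lambda>k. Y $$ (k, j))" if "i < 2" "j < 2" for i j
    using that Y by (auto simp: G_def scalar_prod_def ip_def lessThan_atLeast0 intro!: sum.cong)
  have e: "G $$ (0, 0) = ip n y1 y1" "G $$ (0, 1) = ip n y1 y2" "G $$ (1, 0) = ip n y1 y2" "G $$ (1, 1) = ip n y2 y2"
    by (simp_all add: ent y1_def y2_def ip_commute[of n "\<lambda>k. Y $$ (k, Suc 0)" "\<lambda>k. Y $$ (k, 0)"])
  show "G $$ (0, 1) = G $$ (1, 0)" by (simp only: e)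
  have pos: "ip n f f > 0" if f: "\<And>i. i < n \<Longrightarrow> f i = \<alpha> * y1 i + \<beta> * y2 i" and nz: "\<alpha> \<noteq> 0 \<or> \<beta> \<noteq> 0" for f \<alpha> \<beta>
  proof (rule ccontr)
    assume "\<not> ip n f f > 0"
    then have "ip n f f = 0" using ip_self_nonneg[of n f] by linarith
    then have f0: "\<forall>i<n. f i = 0" by (simp add: ip_self_eq_0)
    define v where "v = vec 2 (\<lambda>i. if i = 0 then \<alpha> else \<beta>)"
    have v: "v \<in> carrier_vec 2" "v $ 0 = \<alpha>" "v $ 1 = \<beta>" by (auto simp: v_def)
    have "v \<noteq> 0\<^sub>v 2" using vec_two_eq_iff[OF v(1), of "0\<^sub>v 2"] v nz by auto
    from inj[OF v(1) this, of 0] have "Y *\<^sub>v v \<noteq> 0\<^sub>v n" by (simp add: power_iterate_simps)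
    moreover have "Y *\<^sub>v v = 0\<^sub>v n"
    proof (rule eq_vecI)
      fix i assume "i < dim_vec (0\<^sub>v n :: real vec)"
      then have i: "i < n" by simp
      have "(Y *\<^sub>v v) $ i = Y $$ (i, 0) * v $ 0 + Y $$ (i, 1) * v $ 1" by (rule mult_mat_vec_two[OF Y v(1) i])
      also have "\<dots> = f i" unfolding f[OF i] v y1_def y2_def by (simp add: mult.commute)
      finally show "(Y *\<^sub>v v) $ i = 0\<^sub>v n $ i" using f0 i by simp
    qed (use Y in simp)
    ultimately show False by blast
  qed
  have p1: "ip n y1 y1 > 0" by (rule pos[of _ 1 0]) auto
  then show "G $$ (0, 0) > 0" by (simp only: e)
  \<comment> \<open>The residual of \<open>y2\<close> against \<open>y1\<close>, scaled by
    \<open>ip n y1 y1\<close>: its squared norm is \<open>ip n y1 y1\<close> times the Gram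
    determinant.\<close>
  have "ip n (\<lambda>i. ip n y1 y1 * y2 i - ip n y1 y2 * y1 i) (\<lambda>i. ip n y1 y1 * y2 i - ip n y1 y2 * y1 i) > 0"
    by (rule pos[of _ "- ip n y1 y2" "ip n y1 y1"]) (use p1 in auto)
  then have "ip n y1 y1 * (ip n y1 y1 * ip n y2 y2 - (ip n y1 y2)\<^sup>2) > 0"
    unfolding ip_linear by (simp add: ip_commute[of n y2 y1] power2_eq_square algebra_simps)
  then show "G $$ (0, 0) * G $$ (1, 1) - (G $$ (0, 1))\<^sup>2 > 0" unfolding e using p1 by (simp add: zero_less_mult_iff)
qed

text \<open>Whatever QR factors are chosen, the triangular factors only accumulate in
  \<open>T\<close> on the right. This is how the freedom of the algorithm leaves the
  analysis.\<close>

lemma iterates_factor: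
  assumes "orthogonal_iterates A Y N Q" "k \<le> N"
  shows "Q k \<in> carrier_mat n 2 \<and> (\<exists>T\<in>carrier_mat 2 2. power_iterate A Y k = Q k * T)"
  using assms(2)
proof (induction k)
  case 0
  define S where "S = inv_sqrt (Y\<^sup>T * Y)"
  have S: "S \<in> carrier_mat 2 2" "S * (S * (Y\<^sup>T * Y)) = 1\<^sub>m 2" using inv_sqrt_two[OF gram_pos] by (auto simp: S_def)
  have Q0: "Q 0 = Y * S" using assms(1) by (simp add: orthogonal_iterates_def S_def)
  have T: "S * (Y\<^sup>T * Y) \<in> carrier_mat 2 2" using S Y by simp
  have "Q 0 * (S * (Y\<^sup>T * Y)) = Y * (S * (S * (Y\<^sup>T * Y)))" unfolding Q0 by (rule assoc_mult_mat[OF Y S(1) T])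
  also have "\<dots> = Y" unfolding S(2) by (rule right_mult_one_mat[OF Y])
  finally have "power_iterate A Y 0 = Q 0 * (S * (Y\<^sup>T * Y))" by (simp add: power_iterate_simps)
  moreover have "Q 0 \<in> carrier_mat n 2" unfolding Q0 using Y S(1) by (rule mult_carrier_mat)
  ultimately show ?case using T by blast
next
  case (Suc k)
  then obtain T where T: "Q k \<in> carrier_mat n 2" "T \<in> carrier_mat 2 2" "power_iterate A Y k = Q k * T" by auto
  have "Suc k \<in> {1..N}" using Suc.prems by simp
  then obtain R where "is_qr (A * Q (Suc k - 1)) (Q (Suc k)) R" using assms(1) unfolding orthogonal_iterates_def by blast
  then have R: "is_qr (A * Q k) (Q (Suc k)) R" by simp
  have Q': "Q (Suc k) \<in> carrier_mat n 2" "R \<in> carrier_mat 2 2" "A * Q k = Q (Suc k) * R"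
    using R T(1) A by (auto simp: is_qr_def)
  have "power_iterate A Y (Suc k) = (A * Q k) * T"
    unfolding power_iterate_simps T(3) by (rule assoc_mult_mat[OF A T(1,2), symmetric])
  also have "\<dots> = Q (Suc k) * (R * T)" unfolding Q'(3) by (rule assoc_mult_mat[OF Q'(1,2) T(2)])
  finally show ?case using Q' T by auto
qed

text \<open>The power iterate is injective, so \<open>T\<close> is invertible and \<open>Q\<close>
  has the same range as the power iterate.\<close>

lemma factor_surj:
  assumes Q: "Q \<in> carrier_mat n 2" and T: "T \<in> carrier_mat 2 2" "power_iterate A Y k = Q * T" and v: "v \<in> carrier_vec 2"
  obtains c where "c \<in> carrier_vec 2" "T *\<^sub>v c = v" "Q *\<^sub>v v = power_iterate A Y k *\<^sub>v c"
proof -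
  have "det T \<noteq> 0"
  proof
    assume "det T = 0"
    then obtain c where c: "c \<in> carrier_vec 2" "c \<noteq> 0\<^sub>v 2" "T *\<^sub>v c = 0\<^sub>v 2" using det_0_iff_vec_prod_zero[OF T(1)] by blast
    have "power_iterate A Y k *\<^sub>v c = Q *\<^sub>v (T *\<^sub>v c)" unfolding T(2) by (rule assoc_mult_mat_vec[OF Q T(1) c(1)])
    also have "\<dots> = 0\<^sub>v n" unfolding c(3) using Q by auto
    finally show False using inj[OF c(1,2)] by blast
  qed
  then have "T \<in> Units (ring_mat TYPE(real) 2 undefined)" by (rule det_non_zero_imp_unit[OF T(1)])
  then obtain T' where T': "T' \<in> carrier_mat 2 2" "T * T' = 1\<^sub>m 2" unfolding Units_def by (auto simp: ring_mat_def)
  define c where "c = T' *\<^sub>v v"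
  have c: "c \<in> carrier_vec 2" using T' v by (simp add: c_def)
  have Tc: "T *\<^sub>v c = v" unfolding c_def using assoc_mult_mat_vec[OF T(1) T'(1) v] T'(2) v by simp
  have "power_iterate A Y k *\<^sub>v c = Q *\<^sub>v (T *\<^sub>v c)" unfolding T(2) by (rule assoc_mult_mat_vec[OF Q T(1) c])
  then show thesis using that[OF c Tc] Tc by simp
qed

lemma iterates_exist: "\<exists>Q. orthogonal_iterates A Y N Q"
proof (induction N)
  case 0
  show ?case by (intro exI[of _ "\<lambda>_. Y * inv_sqrt (Y\<^sup>T * Y)"]) (simp add: orthogonal_iterates_def)
next
  case (Suc N)
  then obtain Q where Q: "orthogonal_iterates A Y N Q" by blast
  obtain T where T: "Q N \<in> carrier_mat n 2" "T \<in> carrier_mat 2 2" "power_iterate A Y N = Q N * T"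
    using iterates_factor[OF Q order.refl] by blast
  have AQ: "A * Q N \<in> carrier_mat n 2" using A T by simp
  have "\<exists>Q' R. is_qr (A * Q N) Q' R"
  proof (rule qr_exists[OF AQ])
    fix v :: "real vec" assume v: "v \<in> carrier_vec 2" "v \<noteq> 0\<^sub>v 2"
    obtain c where c: "c \<in> carrier_vec 2" "T *\<^sub>v c = v" "Q N *\<^sub>v v = power_iterate A Y N *\<^sub>v c"
      by (rule factor_surj[OF T v(1)])
    have "c \<noteq> 0\<^sub>v 2" using c(2) v T by auto
    then have "power_iterate A Y (Suc N) *\<^sub>v c \<noteq> 0\<^sub>v n" by (rule inj[OF c(1)])
    moreover have "power_iterate A Y (Suc N) *\<^sub>v c = A *\<^sub>v (Q N *\<^sub>v v)"
      unfolding power_iterate_simps c(3) by (rule assoc_mult_mat_vec[OF A P_carrier c(1)])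
    ultimately show "A * Q N *\<^sub>v v \<noteq> 0\<^sub>v n" using assoc_mult_mat_vec[OF A T(1) v(1)] by simp
  qed
  then obtain Q' R where "is_qr (A * Q N) Q' R" by blast
  then have "orthogonal_iterates A Y (Suc N) (Q(Suc N := Q'))"
    using Q unfolding orthogonal_iterates_def by (auto simp: le_Suc_eq)
  then show ?case by blast
qed

lemma compressed:
  assumes Q: "Q \<in> carrier_mat n 2" and orth: "Q\<^sup>T * Q = 1\<^sub>m 2"
  shows "Q\<^sup>T * A * Q \<in> carrier_mat 2 2" "(Q\<^sup>T * A * Q) $$ (0, 1) = (Q\<^sup>T * A * Q) $$ (1, 0)"
    "g \<in> carrier_vec 2 \<Longrightarrow> (Q *\<^sub>v g) \<bullet> (Q *\<^sub>v g) = g \<bullet> g"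
    "g \<in> carrier_vec 2 \<Longrightarrow> (Q *\<^sub>v g) \<bullet> (A *\<^sub>v (Q *\<^sub>v g)) = g \<bullet> ((Q\<^sup>T * A * Q) *\<^sub>v g)"
proof -
  have QT: "Q\<^sup>T \<in> carrier_mat 2 n" using Q by simp
  have QTA: "Q\<^sup>T * A \<in> carrier_mat 2 n" using QT A by simp
  show B: "Q\<^sup>T * A * Q \<in> carrier_mat 2 2" using QTA Q by simp
  have "(Q\<^sup>T * A * Q)\<^sup>T = Q\<^sup>T * (Q\<^sup>T * A)\<^sup>T" by (rule transpose_mult[OF QTA Q])
  also have "(Q\<^sup>T * A)\<^sup>T = A\<^sup>T * Q\<^sup>T\<^sup>T" by (rule transpose_mult[OF QT A])
  also have "\<dots> = A * Q" by (simp add: A_sym)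
  also have "Q\<^sup>T * (A * Q) = Q\<^sup>T * A * Q" by (rule assoc_mult_mat[OF QT A Q, symmetric])
  finally have BT: "(Q\<^sup>T * A * Q)\<^sup>T = Q\<^sup>T * A * Q" .
  have "(Q\<^sup>T * A * Q)\<^sup>T $$ (0, 1) = (Q\<^sup>T * A * Q) $$ (1, 0)" using B by (intro index_transpose_mat) auto
  then show "(Q\<^sup>T * A * Q) $$ (0, 1) = (Q\<^sup>T * A * Q) $$ (1, 0)" unfolding BT .
  have tr: "(Q *\<^sub>v g) \<bullet> z = g \<bullet> (Q\<^sup>T *\<^sub>v z)" if "g \<in> carrier_vec 2" "z \<in> carrier_vec n" for g z
  proof -
    have "(Q\<^sup>T *\<^sub>v z) \<bullet> g = z \<bullet> (Q *\<^sub>v g)" by (rule transpose_vec_mult_scalar[OF Q that])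
    moreover have "(Q\<^sup>T *\<^sub>v z) \<bullet> g = g \<bullet> (Q\<^sup>T *\<^sub>v z)" by (rule comm_scalar_prod[of _ 2]) (use QT that in auto)
    moreover have "z \<bullet> (Q *\<^sub>v g) = (Q *\<^sub>v g) \<bullet> z" by (rule comm_scalar_prod[of _ n]) (use Q that in auto)
    ultimately show ?thesis by simp
  qed
  assume g: "g \<in> carrier_vec 2"
  have Qg: "Q *\<^sub>v g \<in> carrier_vec n" using Q g by simp
  have "Q\<^sup>T *\<^sub>v (Q *\<^sub>v g) = g" using assoc_mult_mat_vec[OF QT Q g] orth g by simp
  then show "(Q *\<^sub>v g) \<bullet> (Q *\<^sub>v g) = g \<bullet> g" using tr[OF g Qg] by simp
  have AQg: "A *\<^sub>v (Q *\<^sub>v g) \<in> carrier_vec n" using A Qg by simp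
  have "Q\<^sup>T *\<^sub>v (A *\<^sub>v (Q *\<^sub>v g)) = (Q\<^sup>T * A * Q) *\<^sub>v g"
    unfolding assoc_mult_mat_vec[OF QTA Q g] by (rule assoc_mult_mat_vec[OF QT A Qg, symmetric])
  then show "(Q *\<^sub>v g) \<bullet> (A *\<^sub>v (Q *\<^sub>v g)) = g \<bullet> ((Q\<^sup>T * A * Q) *\<^sub>v g)" using tr[OF g AQg] by simp
qed

text \<open>Read off the last QR step, whence \<open>N >= 1\<close>.\<close>

lemma iterates_orthonormal:
  assumes Q: "orthogonal_iterates A Y N Q" and N: "N \<ge> 1"
  shows "(Q N)\<^sup>T * Q N = 1\<^sub>m 2"
proof -
  have "N \<in> {1..N}" using N by simp
  then obtain R where R: "is_qr (A * Q (N - 1)) (Q N) R" using Q unfolding orthogonal_iterates_def by blast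
  have "Q (N - 1) \<in> carrier_mat n 2" using iterates_factor[OF Q, of "N - 1"] by simp
  then show ?thesis using R A by (simp add: is_qr_def)
qed

lemma extraction:
  assumes Q: "orthogonal_iterates A Y N Q" and N: "N \<ge> 1"
  shows "\<exists>h. unit_min_eigenvector ((Q N)\<^sup>T * A * Q N) h"
proof -
  have "Q N \<in> carrier_mat n 2" using iterates_factor[OF Q order.refl] by blast
  then show ?thesis using iterates_orthonormal[OF Q N] by (intro unit_min_eigenvector_iff compressed)
qed

lemma spectral_vector_exists: "N \<ge> 1 \<Longrightarrow> \<exists>v. spectral_vector A Y N v"
  using iterates_exist[of N] extraction[of N] unfolding spectral_vector_def by blast

text \<open>Minimality in the 2 x 2 problem is carried to the range of the power iterate:
  \<open>Q N\<close> preserves norms and quadratic forms, and \<open>T\<close> matches the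
  coefficients. The chosen QR factors no longer occur in the conclusion.\<close>

lemma spectral_vector_min:
  assumes v: "spectral_vector A Y N v" and N: "N \<ge> 1"
  obtains c where "c \<in> carrier_vec 2" "v = power_iterate A Y N *\<^sub>v c" "v \<bullet> v = 1"
    "\<And>d. d \<in> carrier_vec 2 \<Longrightarrow> (v \<bullet> (A *\<^sub>v v)) * ((power_iterate A Y N *\<^sub>v d) \<bullet> (power_iterate A Y N *\<^sub>v d))
      \<le> (power_iterate A Y N *\<^sub>v d) \<bullet> (A *\<^sub>v (power_iterate A Y N *\<^sub>v d))"
proof -
  obtain Q h where Q: "orthogonal_iterates A Y N Q" and h: "unit_min_eigenvector ((Q N)\<^sup>T * A * Q N) h" and vQ: "v = Q N *\<^sub>v h"
    using v unfolding spectral_vector_def by blast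
  obtain T where T: "Q N \<in> carrier_mat n 2" "T \<in> carrier_mat 2 2" "power_iterate A Y N = Q N * T"
    using iterates_factor[OF Q order.refl] by blast
  note orth = iterates_orthonormal[OF Q N]
  note comp = compressed[OF T(1) orth]
  have hm: "h \<in> carrier_vec 2" "h \<bullet> h = 1"
    "\<And>g. g \<in> carrier_vec 2 \<Longrightarrow> (h \<bullet> (((Q N)\<^sup>T * A * Q N) *\<^sub>v h)) * (g \<bullet> g) \<le> g \<bullet> (((Q N)\<^sup>T * A * Q N) *\<^sub>v g)"
    using unit_min_eigenvector_iff(2)[OF comp(1,2) h] by auto
  obtain c where c: "c \<in> carrier_vec 2" "T *\<^sub>v c = h" "Q N *\<^sub>v h = power_iterate A Y N *\<^sub>v c"
    by (rule factor_surj[OF T hm(1)])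
  show thesis
  proof (rule that[OF c(1)])
    show "v = power_iterate A Y N *\<^sub>v c" using vQ c(3) by simp
    show "v \<bullet> v = 1" unfolding vQ comp(3)[OF hm(1)] by (rule hm(2))
    fix d :: "real vec" assume d: "d \<in> carrier_vec 2"
    have Td: "T *\<^sub>v d \<in> carrier_vec 2" using T d by simp
    have P: "power_iterate A Y N *\<^sub>v d = Q N *\<^sub>v (T *\<^sub>v d)" unfolding T(3) by (rule assoc_mult_mat_vec[OF T(1,2) d])
    show "(v \<bullet> (A *\<^sub>v v)) * ((power_iterate A Y N *\<^sub>v d) \<bullet> (power_iterate A Y N *\<^sub>v d))
      \<le> (power_iterate A Y N *\<^sub>v d) \<bullet> (A *\<^sub>v (power_iterate A Y N *\<^sub>v d))"
      unfolding P vQ comp(3)[OF Td] comp(4)[OF Td] comp(4)[OF hm(1)] by (rule hm(3)[OF Td])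
  qed
qed

end

section \<open>Results and costs of the timed implementation\<close>

lemma andthen_iff: "(y, t) \<in> m \<rhd> f \<longleftrightarrow> (\<exists>x s r. (x, s) \<in> m \<and> (y, r) \<in> f x \<and> t = s + r)"
  by (auto simp: andthen_def)

lemma iteration_impl_iff:
  "(Q', t) \<in> iteration_impl \<kappa> n A Q \<longleftrightarrow>
    (\<exists>R s r. is_qr (A * Q) Q' R \<and> s \<le> 2 * (\<kappa> * (nnz A + n)) \<and> r \<le> \<kappa> * n \<and> t = s + r)"
  by (auto simp: iteration_impl_def andthen_iff sparse_mult_def subroutine_def charge_def)

lemma iterations_impl_sound:
  assumes "(Q', t) \<in> iterations_impl \<kappa> n A k Q0"
  shows "\<exists>Q. Q 0 = Q0 \<and> Q k = Q' \<and> (\<forall>j\<in>{1..k}. \<exists>R. is_qr (A * Q (j - 1)) (Q j) R) \<and>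
    t \<le> k * (2 * (\<kappa> * (nnz A + n)) + \<kappa> * n)"
  using assms
proof (induction k arbitrary: Q' t)
  case 0
  then show ?case by (intro exI[of _ "\<lambda>_. Q0"]) (auto simp: charge_def)
next
  case (Suc k)
  from Suc.prems obtain Q1 s r where 1: "(Q1, s) \<in> iterations_impl \<kappa> n A k Q0" "(Q', r) \<in> iteration_impl \<kappa> n A Q1" "t = s + r"
    by (auto simp: andthen_iff)
  obtain Q where Q: "Q 0 = Q0" "Q k = Q1" "\<forall>j\<in>{1..k}. \<exists>R. is_qr (A * Q (j - 1)) (Q j) R"
    "s \<le> k * (2 * (\<kappa> * (nnz A + n)) + \<kappa> * n)" using Suc.IH[OF 1(1)] by blast
  obtain R where R: "is_qr (A * Q1) Q' R" "r \<le> 2 * (\<kappa> * (nnz A + n)) + \<kappa> * n" using 1(2) by (auto simp: iteration_impl_iff)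
  have "\<forall>j\<in>{1..Suc k}. \<exists>R. is_qr (A * (Q(Suc k := Q')) (j - 1)) ((Q(Suc k := Q')) j) R"
  proof
    fix j assume "j \<in> {1..Suc k}"
    then consider "j = Suc k" | "j \<in> {1..k}" by fastforce
    then show "\<exists>R. is_qr (A * (Q(Suc k := Q')) (j - 1)) ((Q(Suc k := Q')) j) R"
    proof cases
      case 1 then show ?thesis using R(1) Q(2) by auto
    next
      case 2
      then have "j - 1 \<noteq> Suc k" "j \<noteq> Suc k" by auto
      then show ?thesis using Q(3) 2 by simp
    qed
  qed
  then show ?case using Q R 1(3) by (intro exI[of _ "Q(Suc k := Q')"]) auto
qed

lemma iterations_impl_complete:
  assumes "\<forall>j\<in>{1..k}. \<exists>R. is_qr (A * Q (j - 1)) (Q j) R"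
  shows "\<exists>t. (Q k, t) \<in> iterations_impl \<kappa> n A k (Q 0)"
  using assms
proof (induction k)
  case 0
  then show ?case by (auto simp: charge_def)
next
  case (Suc k)
  then obtain t where t: "(Q k, t) \<in> iterations_impl \<kappa> n A k (Q 0)" by auto
  have "Suc k \<in> {1..Suc k}" by simp
  then obtain R where "is_qr (A * Q (Suc k - 1)) (Q (Suc k)) R" using Suc.prems by blast
  then have "(Q (Suc k), 0) \<in> iteration_impl \<kappa> n A (Q k)" by (auto simp: iteration_impl_iff)
  then show ?case using t by (auto simp: andthen_iff)
qed

definition rounding :: "nat \<Rightarrow> real vec \<Rightarrow> real vec" where
  "rounding n v = vec n (\<lambda>i. if v $ i > kth_largest (n div 2) v \<or> v $ i = kth_largest (n div 2) v \<and>
     card {j. j < i \<and> v $ j = kth_largest (n div 2) v} < n div 2 - card {i. i < n \<and> v $ i > kth_largest (n div 2) v} then 1 else -1)"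

lemma projection_impl_iff:
  "(u, t) \<in> projection_impl \<kappa> n v \<longleftrightarrow> u = rounding n v \<and> (\<exists>s \<le> \<kappa> * n. t = s + (2 * n + (4 * n + 1)))"
  unfolding projection_impl_def andthen_iff subroutine_def charge_def rounding_def by auto

lemma initial_impl_iff:
  "(Q0, t) \<in> initial_impl \<kappa> n Y \<longleftrightarrow> Q0 = Y * inv_sqrt (Y\<^sup>T * Y) \<and> (\<exists>s \<le> \<kappa>. t = 8 * n + (s + 6 * n))"
  unfolding initial_impl_def andthen_iff subroutine_def charge_def by auto

lemma extraction_impl_iff:
  "(v, t) \<in> extraction_impl \<kappa> n A Q \<longleftrightarrow> (\<exists>h. unit_min_eigenvector (Q\<^sup>T * (A * Q)) h \<and> v = Q *\<^sub>v h \<and>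
    (\<exists>s r. s \<le> 2 * (\<kappa> * (nnz A + n)) \<and> r \<le> \<kappa> \<and> t = s + (8 * n + (r + 3 * n))))"
  (is "?l = ?r")
proof
  assume ?l
  then obtain W s B s2 h r s3 where "(W, s) \<in> sparse_mult \<kappa> n A Q" "(B, s2) \<in> charge (8 * n) (Q\<^sup>T * W)"
    "(h, r) \<in> subroutine \<kappa> (unit_min_eigenvector B)" "(v, s3) \<in> charge (3 * n) (Q *\<^sub>v h)" "t = s + (s2 + (r + s3))"
    unfolding extraction_impl_def andthen_iff by blast
  then have "unit_min_eigenvector (Q\<^sup>T * (A * Q)) h" "v = Q *\<^sub>v h"
    "s \<le> 2 * (\<kappa> * (nnz A + n))" "r \<le> \<kappa>" "t = s + (8 * n + (r + 3 * n))"
    by (simp_all add: sparse_mult_def subroutine_def charge_def)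
  then show ?r by blast
next
  assume ?r
  then obtain h s r where h: "unit_min_eigenvector (Q\<^sup>T * (A * Q)) h" "v = Q *\<^sub>v h"
    "s \<le> 2 * (\<kappa> * (nnz A + n))" "r \<le> \<kappa>" "t = s + (8 * n + (r + 3 * n))" by blast
  have "(A * Q, s) \<in> sparse_mult \<kappa> n A Q" "(Q\<^sup>T * (A * Q), 8 * n) \<in> charge (8 * n) (Q\<^sup>T * (A * Q))"
    "(h, r) \<in> subroutine \<kappa> (unit_min_eigenvector (Q\<^sup>T * (A * Q)))" "(v, 3 * n) \<in> charge (3 * n) (Q *\<^sub>v h)"
    using h by (simp_all add: sparse_mult_def subroutine_def charge_def)
  then show ?l unfolding extraction_impl_def andthen_iff h(5) by blast
qed

context orthogonal_setup
begin

lemma compression_assoc: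
  assumes "orthogonal_iterates A Y N Q"
  shows "(Q N)\<^sup>T * (A * Q N) = (Q N)\<^sup>T * A * Q N"
  using iterates_factor[OF assms order.refl] A by (intro assoc_mult_mat[symmetric]) auto

text \<open>The product in the extraction and the selection in the projection cost as much as one
  more iteration, whence \<open>N + 1\<close>. The linear charges \<open>14 * n\<close>,
  \<open>11 * n\<close> and \<open>6 * n\<close> add up to \<open>31 * n\<close>.\<close>

lemma spectral_impl_sound:
  assumes "(u, t) \<in> spectral_impl \<kappa> n A Y N"
  shows "\<exists>v. spectral_vector A Y N v \<and> u = rounding n v \<and>
    t \<le> (N + 1) * (2 * (\<kappa> * (nnz A + n)) + \<kappa> * n) + 31 * n + 2 * \<kappa> + 1"
proof -
  obtain Q0 Qn v t1 t2 t3 t4 where *: "(Q0, t1) \<in> initial_impl \<kappa> n Y" "(Qn, t2) \<in> iterations_impl \<kappa> n A N Q0"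
    "(v, t3) \<in> extraction_impl \<kappa> n A Qn" "(u, t4) \<in> projection_impl \<kappa> n v" "t = t1 + t2 + t3 + t4"
    using assms unfolding spectral_impl_def andthen_iff by blast
  obtain Q where Q: "Q 0 = Q0" "Q N = Qn" "\<forall>j\<in>{1..N}. \<exists>R. is_qr (A * Q (j - 1)) (Q j) R"
    "t2 \<le> N * (2 * (\<kappa> * (nnz A + n)) + \<kappa> * n)" using iterations_impl_sound[OF *(2)] by blast
  have it: "orthogonal_iterates A Y N Q" unfolding orthogonal_iterates_def using Q *(1) by (simp add: initial_impl_iff)
  have "spectral_vector A Y N v"
    using *(3) it compression_assoc[OF it] unfolding spectral_vector_def extraction_impl_iff Q(2)[symmetric] by metis
  moreover have "u = rounding n v" using *(4) by (simp add: projection_impl_iff)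
  moreover have "t1 \<le> 14 * n + \<kappa>" using *(1) by (auto simp: initial_impl_iff)
  moreover have "t3 \<le> 2 * (\<kappa> * (nnz A + n)) + 11 * n + \<kappa>" using *(3) by (auto simp: extraction_impl_iff)
  moreover have "t4 \<le> \<kappa> * n + 6 * n + 1" using *(4) by (auto simp: projection_impl_iff)
  moreover have "(N + 1) * (2 * (\<kappa> * (nnz A + n)) + \<kappa> * n) = N * (2 * (\<kappa> * (nnz A + n)) + \<kappa> * n) + (2 * (\<kappa> * (nnz A + n)) + \<kappa> * n)" by simp
  ultimately show ?thesis using Q(4) *(5) by (intro exI[of _ v] conjI) linarith+
qed

text \<open>Keeps the statement about all runs from being vacuous. Subroutines are taken at cost 0,
  which their upper bounds allow.\<close>

lemma spectral_impl_nonempty: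
  assumes N: "N \<ge> 1" shows "spectral_impl \<kappa> n A Y N \<noteq> {}"
proof -
  obtain Q where Q: "orthogonal_iterates A Y N Q" using iterates_exist by blast
  obtain h where h: "unit_min_eigenvector ((Q N)\<^sup>T * (A * Q N)) h" using extraction[OF Q N] compression_assoc[OF Q] by auto
  have 1: "(Q 0, 8 * n + (0 + 6 * n)) \<in> initial_impl \<kappa> n Y" using Q unfolding initial_impl_iff orthogonal_iterates_def by blast
  obtain t where 2: "(Q N, t) \<in> iterations_impl \<kappa> n A N (Q 0)" using iterations_impl_complete Q unfolding orthogonal_iterates_def by blast
  have 3: "(Q N *\<^sub>v h, 0 + (8 * n + (0 + 3 * n))) \<in> extraction_impl \<kappa> n A (Q N)" unfolding extraction_impl_iff using h by blast
  have 4: "(rounding n (Q N *\<^sub>v h), 0 + (2 * n + (4 * n + 1))) \<in> projection_impl \<kappa> n (Q N *\<^sub>v h)" unfolding projection_impl_iff by blast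
  have 5: "(Q N, 8 * n + (0 + 6 * n) + t) \<in> initial_impl \<kappa> n Y \<rhd> iterations_impl \<kappa> n A N"
    unfolding andthen_iff using 1 2 by blast
  then have "(Q N *\<^sub>v h, 8 * n + (0 + 6 * n) + t + (0 + (8 * n + (0 + 3 * n))))
      \<in> initial_impl \<kappa> n Y \<rhd> iterations_impl \<kappa> n A N \<rhd> extraction_impl \<kappa> n A"
    using 3 unfolding andthen_iff[of "Q N *\<^sub>v h"] by blast
  then have "\<exists>s. (rounding n (Q N *\<^sub>v h), s) \<in> spectral_impl \<kappa> n A Y N"
    using 4 unfolding spectral_impl_def andthen_iff[of "rounding n (Q N *\<^sub>v h)"] by blast
  then show ?thesis by blast
qed

end

section \<open>Transfer to matrices and to the adjacency matrix\<close>

lemma mv_pow_cong_matrix: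
  assumes "\<And>i j. i < n \<Longrightarrow> j < n \<Longrightarrow> M i j = M' i j" "i < n"
  shows "(mv n M ^^ k) f i = (mv n M' ^^ k) f i"
  using assms(2)
proof (induction k arbitrary: i)
  case (Suc k)
  have "mv n M ((mv n M ^^ k) f) = mv n M ((mv n M' ^^ k) f)" by (rule mv_cong) (rule Suc.IH)
  moreover have "mv n M ((mv n M' ^^ k) f) i = mv n M' ((mv n M' ^^ k) f) i"
    unfolding mv_def using assms(1) Suc.prems by (intro sum.cong) auto
  ultimately show ?case by simp
qed simp

locale planted_iteration =
  iterated_subspace n x W a b w u1 u2 l1 l2 "\<lambda>i. Y $$ (i, 0)" "\<lambda>i. Y $$ (i, 1)" M \<delta> N
  for n x W a b w u1 u2 l1 l2 and Y :: "real mat" and M \<delta> N +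
  fixes B :: "real mat"
  assumes B: "B \<in> carrier_mat n n" and B_A: "\<And>i j. i < n \<Longrightarrow> j < n \<Longrightarrow> B $$ (i, j) = A i j"
    and Y: "Y \<in> carrier_mat n 2"
begin

lemma power_iterate_V:
  assumes c: "c \<in> carrier_vec 2" and i: "i < n"
  shows "(power_iterate B Y N *\<^sub>v c) $ i = V (c $ 0) (c $ 1) i"
  unfolding power_iterate_apply[OF B Y c i] V_def by (rule mv_pow_cong_matrix[OF _ i]) (rule B_A)

lemma orthogonal: "orthogonal_setup n B Y"
proof
  show "B \<in> carrier_mat n n" "Y \<in> carrier_mat n 2" by (rule B, rule Y)
  show "B\<^sup>T = B"
  proof (rule eq_matI)
    fix i j assume "i < dim_row B" "j < dim_col B"
    then have ij: "i < n" "j < n" using B by auto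
    have "B\<^sup>T $$ (i, j) = B $$ (j, i)" using ij B by (intro index_transpose_mat) auto
    also have "\<dots> = B $$ (i, j)" unfolding B_A[OF ij] B_A[OF ij(2,1)] using W_sym ij by (simp add: A_def sym_def)
    finally show "B\<^sup>T $$ (i, j) = B $$ (i, j)" .
  qed (use B in auto)
  fix k and c :: "real vec" assume c: "c \<in> carrier_vec 2" "c \<noteq> 0\<^sub>v 2"
  \<comment> \<open>The number of iterations is a locale parameter, so instantiating it at every
    \<open>k\<close> gives injectivity of all powers.\<close>
  interpret K: planted_iteration n x W a b w u1 u2 l1 l2 Y M \<delta> k B
    by (intro planted_iteration.intro planted_iteration_axioms.intro iterated_subspace_axioms B B_A Y)
  have "c $ 0 \<noteq> 0 \<or> c $ 1 \<noteq> 0" using vec_two_eq_iff[OF c(1), of "0\<^sub>v 2"] c(2) by auto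
  then have pos: "ip n (K.V (c $ 0) (c $ 1)) (K.V (c $ 0) (c $ 1)) > 0" by (rule K.V_nonzero)
  show "power_iterate B Y k *\<^sub>v c \<noteq> 0\<^sub>v n"
  proof
    assume 0: "power_iterate B Y k *\<^sub>v c = 0\<^sub>v n"
    have "K.V (c $ 0) (c $ 1) i = 0" if "i < n" for i
      using K.power_iterate_V[OF c(1) that] that unfolding 0 by simp
    then have "ip n (K.V (c $ 0) (c $ 1)) (K.V (c $ 0) (c $ 1)) = 0" by (simp add: ip_def)
    then show False using pos by simp
  qed
qed

text \<open>The entrywise Ritz error is below the lower bound \<open>\<theta>\<close> for the
  entries of \<open>u2\<close>, so signs are inherited. The sign \<open>\<rho>\<close> of the Ritz
  vector and the sign \<open>\<sigma>\<close> of \<open>u2\<close> multiply to the undetermined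
  global sign.\<close>

lemma spectral_vector_signs:
  assumes v: "spectral_vector B Y N v" and N: "N \<ge> 1"
    and eps: "\<epsilon> \<le> 1" "\<epsilon> * (3 + 2 * ((2 * w + l2) / (l1 - l2))) < \<theta>"
    and \<sigma>: "\<sigma> = 1 \<or> \<sigma> = -1" "\<And>i. i < n \<Longrightarrow> \<sigma> * (x i * u2 i) \<ge> \<theta>"
  shows "v \<in> carrier_vec n \<and> (\<exists>s. (s = 1 \<or> s = -1) \<and> (\<forall>i<n. s * x i * v $ i > 0))"
proof -
  interpret S: orthogonal_setup n B Y by (rule orthogonal)
  let ?P = "power_iterate B Y N"
  obtain c where c: "c \<in> carrier_vec 2" "v = ?P *\<^sub>v c" "v \<bullet> v = 1"
    and min: "\<And>d. d \<in> carrier_vec 2 \<Longrightarrow> (v \<bullet> (B *\<^sub>v v)) * ((?P *\<^sub>v d) \<bullet> (?P *\<^sub>v d)) \<le> (?P *\<^sub>v d) \<bullet> (B *\<^sub>v (?P *\<^sub>v d))"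
    by (rule S.spectral_vector_min[OF v N]) blast
  have Pd: "?P *\<^sub>v d \<in> carrier_vec n" if "d \<in> carrier_vec 2" for d using S.P_carrier[of N] that by (rule mult_mat_vec_carrier)
  have e1: "(?P *\<^sub>v d) \<bullet> (?P *\<^sub>v d) = ip n (V (d $ 0) (d $ 1)) (V (d $ 0) (d $ 1))" if d: "d \<in> carrier_vec 2" for d
    unfolding scalar_prod_ip[OF Pd[OF d] Pd[OF d]] by (intro ip_cong power_iterate_V[OF d])
  have e2: "(?P *\<^sub>v d) \<bullet> (B *\<^sub>v (?P *\<^sub>v d)) = ip n (V (d $ 0) (d $ 1)) (mv n A (V (d $ 0) (d $ 1)))" if d: "d \<in> carrier_vec 2" for d
  proof -
    have "B *\<^sub>v (?P *\<^sub>v d) \<in> carrier_vec n" using B Pd[OF d] by simp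
    then have "(?P *\<^sub>v d) \<bullet> (B *\<^sub>v (?P *\<^sub>v d)) = ip n (\<lambda>i. (?P *\<^sub>v d) $ i) (\<lambda>i. (B *\<^sub>v (?P *\<^sub>v d)) $ i)"
      by (rule scalar_prod_ip[OF Pd[OF d]])
    also have "\<dots> = ip n (V (d $ 0) (d $ 1)) (mv n A (V (d $ 0) (d $ 1)))"
    proof (rule ip_cong)
      fix i assume i: "i < n"
      show "(?P *\<^sub>v d) $ i = V (d $ 0) (d $ 1) i" by (rule power_iterate_V[OF d i])
      have "(B *\<^sub>v (?P *\<^sub>v d)) $ i = mv n (\<lambda>i j. B $$ (i, j)) (\<lambda>i. (?P *\<^sub>v d) $ i) i"
        by (rule mult_mat_vec_mv[OF B Pd[OF d] i])
      also have "\<dots> = mv n A (V (d $ 0) (d $ 1)) i"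
        unfolding mv_def by (intro sum.cong refl arg_cong2[where f="(*)"] B_A i power_iterate_V[OF d]) auto
      finally show "(B *\<^sub>v (?P *\<^sub>v d)) $ i = mv n A (V (d $ 0) (d $ 1)) i" .
    qed
    finally show ?thesis .
  qed
  have unit: "ip n (V (c $ 0) (c $ 1)) (V (c $ 0) (c $ 1)) = 1" using c(3) unfolding c(2) e1[OF c(1)] .
  have min': "ip n (V (c $ 0) (c $ 1)) (mv n A (V (c $ 0) (c $ 1))) * ip n (V d1 d2) (V d1 d2) \<le> ip n (V d1 d2) (mv n A (V d1 d2))" for d1 d2
  proof -
    define d where "d = vec 2 (\<lambda>i. if i = 0 then d1 else d2)"
    have d: "d \<in> carrier_vec 2" "d $ 0 = d1" "d $ 1 = d2" by (auto simp: d_def)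
    show ?thesis using min[OF d(1)] unfolding c(2) e1[OF d(1)] e2[OF d(1)] e2[OF c(1)] d(2,3) .
  qed
  obtain \<rho> :: real where \<rho>: "\<rho> = 1 \<or> \<rho> = -1"
    "\<And>i. i < n \<Longrightarrow> \<bar>V (c $ 0) (c $ 1) i - \<rho> * u2 i\<bar> \<le> \<epsilon> * (3 + 2 * ((2 * w + l2) / (l1 - l2)))"
    by (rule ritz_vector[OF unit eps(1) min']) blast
  have "\<sigma> * \<rho> * x i * v $ i > 0" if i: "i < n" for i
  proof -
    have "\<bar>v $ i - \<rho> * u2 i\<bar> < \<theta>" using \<rho>(2)[OF i] eps(2) unfolding c(2) power_iterate_V[OF c(1) i] by linarith
    then show ?thesis using \<rho>(1) \<sigma>(1) \<sigma>(2)[OF i] x_pm[OF i] by auto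
  qed
  moreover have "\<sigma> * \<rho> = 1 \<or> \<sigma> * \<rho> = -1" using \<rho>(1) \<sigma>(1) by auto
  ultimately show ?thesis using Pd[OF c(1)] unfolding c(2) by blast
qed

end

lemma nrm_le_of_bound:
  assumes "\<And>i. i < n \<Longrightarrow> \<bar>f i\<bar> \<le> real n"
  shows "nrm n f \<le> (real n)\<^sup>2"
proof -
  have "(nrm n f)\<^sup>2 \<le> (\<Sum>i<n. (real n)\<^sup>2)" unfolding nrm_power2 ip_def
    using assms by (intro sum_mono) (metis lessThan_iff abs_le_square_iff abs_of_nat power2_eq_square)
  also have "\<dots> \<le> ((real n)\<^sup>2)\<^sup>2"
    by (cases "n = 0") (simp_all add: power2_eq_square)
  finally show ?thesis by (rule power2_le_imp_le) simp
qed

lemma sbm_pmf_eq_mu: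
  assumes "sbm n (\<lambda>i. x $ i) p q"
  shows "sbm_pmf n p q x = sbm.mu n (\<lambda>i. x $ i) p q"
proof -
  interpret sbm n "\<lambda>i. x $ i" p q by (rule assms)
  show ?thesis unfolding sbm_pmf_def mu_def E_def pr_def by (auto intro!: arg_cong[where f="Pi_pmf _ _"] ext simp: case_prod_beta)
qed

lemma nnz_adjacency:
  "real (nnz (adjacency n a)) = (\<Sum>i<n. \<Sum>j<n. of_bool (a (mm i j)))"
proof -
  have "{(i, j). i < dim_row (adjacency n a) \<and> j < dim_col (adjacency n a) \<and> adjacency n a $$ (i, j) \<noteq> 0}
    = {e \<in> {..<n} \<times> {..<n}. a (mm (fst e) (snd e))}"
    by (auto simp: adjacency_def mm_def)
  then have "real (nnz (adjacency n a)) = (\<Sum>e\<in>{..<n} \<times> {..<n}. of_bool (a (mm (fst e) (snd e))))"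
    by (simp add: nnz_def sum_of_bool_eq Int_def)
  also have "\<dots> = (\<Sum>i<n. \<Sum>j<n. of_bool (a (mm i j)))"
    unfolding sum.cartesian_product case_prod_beta ..
  finally show ?thesis .
qed

section \<open>Recovery with high probability\<close>

text \<open>Common source of both claims: full rank for the existence of runs, signs for the
  rounding, sparsity for the running time.\<close>

definition recovers :: "nat \<Rightarrow> nat \<Rightarrow> real \<Rightarrow> real vec \<Rightarrow> (nat \<times> nat \<Rightarrow> bool) \<Rightarrow> (nat \<times> nat \<Rightarrow> real) \<Rightarrow> bool" where
  "recovers n N C x a y \<longleftrightarrow> orthogonal_setup n (adjacency n a) (gaussian_mat n y) \<and>
     (\<forall>v. spectral_vector (adjacency n a) (gaussian_mat n y) N v \<longrightarrow>
       v \<in> carrier_vec n \<and> (\<exists>s. (s = 1 \<or> s = -1) \<and> (\<forall>i<n. s * x $ i * v $ i > 0))) \<and>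
     real (nnz (adjacency n a)) \<le> C * ln n * n"

text \<open>The factor \<open>4 * n^7\<close> is \<open>4 * M^2 / \<delta>\<close> with
  \<open>M = n^2\<close>, from entries of size at most \<open>n\<close>, and
  \<open>\<delta> = 1 / n^3\<close>, from the determinant. The event \<open>H\<close> depends on
  \<open>a\<close> through the eigenvectors.\<close>

lemma recoverable_recovers:
  assumes sbm: "sbm n (\<lambda>i. x $ i) p q" and rec: "recoverable n (\<lambda>i. x $ i) p q k C a" and N: "N \<ge> 1"
    and small: "4 * real n ^ 7 * (ln n powr (- 1/20)) ^ N \<le> 1" "4 * real n ^ 7 * (ln n powr (- 1/20)) ^ N * C < k / sqrt n"
    and C: "C > 0"
  shows "\<exists>H \<in> sets (gaussian_entries n). emeasure (gaussian_entries n) H \<ge> ennreal (1 - 6 / n) \<and>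
    (\<forall>y\<in>H. recovers n N C x a y)"
proof -
  interpret S: sbm n "\<lambda>i. x $ i" p q by (rule sbm)
  let ?x = "\<lambda>i. x $ i" and ?a = "n * (p + q) / 2" and ?b = "n * (p - q) / 2"
  obtain u1 u2 l1 l2 w \<sigma> where pe: "planted_eigen n ?x (S.W a) ?a ?b w u1 u2 l1 l2"
    and wl: "w / l2 \<le> ln n powr (- 1/20)" and K: "3 + 2 * ((2 * w + l2) / (l1 - l2)) \<le> C"
    and \<sigma>: "\<sigma> = 1 \<or> \<sigma> = -1" "\<And>i. i < n \<Longrightarrow> \<sigma> * (x $ i * u2 i) \<ge> k / sqrt n"
    and deg: "\<And>i. i < n \<Longrightarrow> (\<Sum>j<n. of_bool (a (mm i j))) \<le> C * ln n"
    using rec unfolding recoverable_def by blast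
  interpret P: planted_eigen n ?x "S.W a" ?a ?b w u1 u2 l1 l2 by (rule pe)
  have n: "n > 0" by (rule P.n_pos)
  obtain H where H: "H \<in> sets (gaussian_entries n)" "emeasure (gaussian_entries n) H \<ge> ennreal (1 - 6 / n)"
    and det: "\<And>y. y \<in> H \<Longrightarrow> \<bar>det2 n u1 u2 y\<bar> \<ge> 1 / real n ^ 3 \<and> (\<forall>k<n. \<forall>l<2. \<bar>y (k, l)\<bar> \<le> real n)"
    by (rule gaussian_good_event[OF P.u_unit P.u_orth n]) blast
  have wl0: "0 \<le> w / l2" using P.w_pos P.l2_bounds P.b_gt by simp
  have "recovers n N C x a y" if y: "y \<in> H" for y
  proof -
    let ?Y = "gaussian_mat n y"
    have Y: "?Y $$ (i, 0) = y (i, 0)" "?Y $$ (i, 1) = y (i, 1)" if "i < n" for i using that by (auto simp: gaussian_mat_def)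
    have nY: "nrm n (\<lambda>i. ?Y $$ (i, 0)) \<le> (real n)\<^sup>2" "nrm n (\<lambda>i. ?Y $$ (i, 1)) \<le> (real n)\<^sup>2"
      using det[OF y] by (auto intro!: nrm_le_of_bound simp: gaussian_mat_def)
    have ipY: "ip n u (\<lambda>i. ?Y $$ (i, 0)) = ip n u (\<lambda>k. y (k, 0))" "ip n u (\<lambda>i. ?Y $$ (i, 1)) = ip n u (\<lambda>k. y (k, 1))" for u
      by (rule ip_cong; (simp only: Y)?)+
    have dY: "\<bar>ip n u1 (\<lambda>i. ?Y $$ (i, 0)) * ip n u2 (\<lambda>i. ?Y $$ (i, 1)) - ip n u2 (\<lambda>i. ?Y $$ (i, 0)) * ip n u1 (\<lambda>i. ?Y $$ (i, 1))\<bar> \<ge> 1 / real n ^ 3"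
      using det[OF y] unfolding ipY det2_def by blast
    have B: "adjacency n a \<in> carrier_mat n n" and Yc: "?Y \<in> carrier_mat n 2" by (simp_all add: adjacency_def gaussian_mat_def)
    have BA: "adjacency n a $$ (i, j) = P.A i j" if ij: "i < n" "j < n" for i j
    proof -
      have "P.A i j = of_bool (a (mm i j))" unfolding P.A_def S.W_eq[OF ij] using n by (simp add: field_simps)
      then show ?thesis using ij by (simp add: adjacency_def mm_def)
    qed
    have d0: "1 / real n ^ 3 > 0" using n by simp
    interpret I: planted_iteration n ?x "S.W a" ?a ?b w u1 u2 l1 l2 ?Y "(real n)\<^sup>2" "1 / real n ^ 3" N "adjacency n a"
      by (rule planted_iteration.intro[OF iterated_subspace.intro[OF pe iterated_subspace_axioms.intro[OF nY d0 dY]]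
        planted_iteration_axioms.intro[OF B BA Yc]])
    have \<epsilon>: "I.\<epsilon> \<le> 4 * real n ^ 7 * (ln n powr (- 1/20)) ^ N" "0 \<le> I.\<epsilon>"
    proof -
      have "I.\<epsilon> = 4 * real n ^ 7 * (w / l2) ^ N" unfolding I.\<epsilon>_def using n by (simp add: power_mult[symmetric] power_add[symmetric])
      moreover have "(w / l2) ^ N \<le> (ln n powr (- 1/20)) ^ N" using wl wl0 by (rule power_mono)
      ultimately show "I.\<epsilon> \<le> 4 * real n ^ 7 * (ln n powr (- 1/20)) ^ N" "0 \<le> I.\<epsilon>"
        using wl0 by (auto intro!: mult_left_mono)
    qed
    have "I.\<epsilon> * (3 + 2 * ((2 * w + l2) / (l1 - l2))) \<le> I.\<epsilon> * C" using K \<epsilon>(2) by (rule mult_left_mono)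
    also have "\<dots> \<le> 4 * real n ^ 7 * (ln n powr (- 1/20)) ^ N * C" using \<epsilon>(1) C by (intro mult_right_mono) auto
    also have "\<dots> < k / sqrt n" by (rule small(2))
    finally have "I.\<epsilon> * (3 + 2 * ((2 * w + l2) / (l1 - l2))) < k / sqrt n" .
    moreover have "I.\<epsilon> \<le> 1" using \<epsilon>(1) small(1) by linarith
    ultimately have "v \<in> carrier_vec n \<and> (\<exists>s. (s = 1 \<or> s = -1) \<and> (\<forall>i<n. s * x $ i * v $ i > 0))"
      if "spectral_vector (adjacency n a) ?Y N v" for v
      using I.spectral_vector_signs[OF that N _ _ \<sigma>] by blast
    moreover have "real (nnz (adjacency n a)) \<le> (\<Sum>i<n. C * ln n)"
      unfolding nnz_adjacency using deg by (intro sum_mono) simp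
    ultimately show ?thesis using I.orthogonal unfolding recovers_def by (auto simp: mult_ac)
  qed
  then show ?thesis using H by blast
qed

text \<open>The sets \<open>h a\<close> are chosen graph by graph, with no regularity in
  \<open>a\<close>. Only finitely many graphs have positive probability, so the union of the
  rectangles over these is measurable.\<close>

lemma joint_law_event:
  assumes R: "measure_pmf.prob (sbm_pmf n p q x) (- R) \<le> e" and \<delta>: "0 \<le> \<delta>"
    and H: "\<And>a. a \<in> R \<Longrightarrow> \<exists>H \<in> sets (gaussian_entries n). emeasure (gaussian_entries n) H \<ge> ennreal (1 - \<delta>) \<and> (\<forall>y\<in>H. P (a, y))"
  shows "\<exists>E \<in> sets (joint_law n p q x). (\<forall>\<omega>\<in>E. P \<omega>) \<and> 1 - e - \<delta> \<le> measure (joint_law n p q x) E"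
proof -
  let ?M = "sbm_pmf n p q x" and ?G = "gaussian_entries n"
  interpret G: prob_space ?G unfolding gaussian_entries_def by (intro prob_space_PiM prob_space_gaussian)
  interpret J: pair_prob_space "measure_pmf ?M" ?G ..
  obtain h where h: "\<And>a. a \<in> R \<Longrightarrow> h a \<in> sets ?G" "\<And>a. a \<in> R \<Longrightarrow> emeasure ?G (h a) \<ge> ennreal (1 - \<delta>)"
    "\<And>a y. a \<in> R \<Longrightarrow> y \<in> h a \<Longrightarrow> P (a, y)" using H by metis
  have hm: "1 - \<delta> \<le> measure ?G (h a)" if "a \<in> R" for a
    using h(2)[OF that] measure_nonneg[of ?G "h a"] unfolding G.emeasure_eq_measure ennreal_le_iff2 by linarith
  define D where "D = R \<inter> set_pmf ?M"
  have finE: "finite {(i, j). i \<le> j \<and> j < n}" by (rule finite_subset[of _ "{..<n} \<times> {..<n}"]) auto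
  have "finite (PiE_dflt {(i, j). i \<le> j \<and> j < n} False (\<lambda>_. UNIV :: bool set))" using finE by (intro finite_PiE_dflt) auto
  moreover have "set_pmf ?M \<subseteq> PiE_dflt {(i, j). i \<le> j \<and> j < n} False (\<lambda>_. UNIV)"
    unfolding sbm_pmf_def set_Pi_pmf[OF finE] by (auto simp: PiE_dflt_def)
  ultimately have D: "finite D" unfolding D_def by (meson finite_Int finite_subset)
  define E where "E = (\<Union>a\<in>D. {a} \<times> h a)"
  have sets: "{a} \<times> h a \<in> sets (joint_law n p q x)" if "a \<in> D" for a
    unfolding joint_law_def using h(1)[of a] that by (intro pair_measureI) (auto simp: D_def)
  have E: "E \<in> sets (joint_law n p q x)" unfolding E_def using D sets by (intro sets.finite_UN) auto
  have m: "measure (joint_law n p q x) ({a} \<times> h a) = pmf ?M a * measure ?G (h a)" if "a \<in> D" for a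
    unfolding joint_law_def measure_def using h(1)[of a] that
    by (subst G.emeasure_pair_measure_Times) (auto simp: D_def enn2real_mult emeasure_pmf_single)
  have "measure (joint_law n p q x) E = (\<Sum>a\<in>D. measure (joint_law n p q x) ({a} \<times> h a))"
    unfolding E_def
  proof (rule measure_finite_Union[OF D])
    show "(\<lambda>a. {a} \<times> h a) ` D \<subseteq> sets (joint_law n p q x)" using sets by blast
    show "disjoint_family_on (\<lambda>a. {a} \<times> h a) D" unfolding disjoint_family_on_def by blast
    show "emeasure (joint_law n p q x) ({a} \<times> h a) \<noteq> \<infinity>" for a
      unfolding joint_law_def J.P.emeasure_eq_measure by simp
  qed
  also have "\<dots> = (\<Sum>a\<in>D. pmf ?M a * measure ?G (h a))" by (intro sum.cong refl m)
  also have "\<dots> \<ge> (\<Sum>a\<in>D. pmf ?M a * (1 - \<delta>))"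
    using hm by (intro sum_mono mult_left_mono) (auto simp: D_def)
  also have "(\<Sum>a\<in>D. pmf ?M a * (1 - \<delta>)) = measure ?M D * (1 - \<delta>)"
    by (simp add: measure_measure_pmf_finite[OF D] sum_distrib_right)
  finally have ge: "measure ?M D * (1 - \<delta>) \<le> measure (joint_law n p q x) E" .
  have "measure ?M D = measure ?M R" unfolding D_def by (rule measure_Int_set_pmf)
  also have "\<dots> = 1 - measure ?M (- R)" using measure_pmf.prob_compl[of "- R" ?M] by (simp add: Compl_eq_Diff_UNIV[symmetric])
  finally have "1 - e \<le> measure ?M D" using R by simp
  moreover have "measure ?M D * \<delta> \<le> 1 * \<delta>" using \<delta> by (intro mult_right_mono) simp_all
  ultimately have "1 - e - \<delta> \<le> measure ?M D * (1 - \<delta>)" by (simp add: algebra_simps)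
  then have "1 - e - \<delta> \<le> measure (joint_law n p q x) E" using ge by linarith
  moreover have "\<forall>\<omega>\<in>E. P \<omega>" using h(3) by (auto simp: E_def D_def)
  ultimately show ?thesis using E by blast
qed

lemma prob_space_joint_law: "prob_space (joint_law n p q x)"
proof -
  interpret G: prob_space "gaussian_entries n" unfolding gaussian_entries_def by (intro prob_space_PiM prob_space_gaussian)
  interpret J: pair_prob_space "measure_pmf (sbm_pmf n p q x)" "gaussian_entries n" ..
  show ?thesis unfolding joint_law_def by (rule J.P.prob_space_axioms)
qed

lemma whp_evenI:
  assumes ev: "\<forall>\<^sub>F n in sequentially. even n \<longrightarrow> (\<exists>E \<in> sets (M n). (\<forall>\<omega>\<in>E. P n \<omega>) \<and> 1 - e n \<le> measure (M n) E)"
    and e: "e \<longlonglongrightarrow> 0" and M: "\<And>n. prob_space (M n)"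
  shows "whp_even M P"
proof -
  let ?good = "\<lambda>n E. E \<in> sets (M n) \<and> (\<forall>\<omega>\<in>E. P n \<omega>) \<and> 1 - e n \<le> measure (M n) E"
  \<comment> \<open>Where no good event exists the empty one is used; only the limit
    matters.\<close>
  define E where "E n = (if \<exists>E. ?good n E then SOME E. ?good n E else {})" for n
  have E: "?good n (E n)" if "\<exists>E. ?good n E" for n
    using someI_ex[OF that] that by (simp add: E_def)
  have "E n \<in> sets (M n) \<and> (\<forall>\<omega>\<in>E n. P n \<omega>)" for n
    using E[of n] by (cases "\<exists>E. ?good n E") (auto simp: E_def)
  moreover have "((\<lambda>n. measure (M n) (E n)) \<longlongrightarrow> 1) (inf sequentially (principal {n. even n}))"
  proof (rule tendsto_sandwich)
    have "(\<lambda>n. 1 - e n) \<longlonglongrightarrow> 1 - 0" by (intro tendsto_intros e)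
    then show "((\<lambda>n. 1 - e n) \<longlongrightarrow> 1) (inf sequentially (principal {n. even n}))"
      by (auto intro: tendsto_mono[OF inf_le1])
    show "\<forall>\<^sub>F n in inf sequentially (principal {n. even n}). 1 - e n \<le> measure (M n) (E n)"
      unfolding eventually_inf_principal using ev by eventually_elim (use E in blast)
    show "\<forall>\<^sub>F n in inf sequentially (principal {n. even n}). measure (M n) (E n) \<le> 1"
      by (intro always_eventually allI prob_space.prob_le_1 M)
  qed simp
  ultimately show ?thesis unfolding whp_even_def by blast
qed

lemma whp_even_mono:
  assumes P: "whp_even M P" and ev: "\<forall>\<^sub>F n in sequentially. even n \<longrightarrow> (\<forall>\<omega>. P n \<omega> \<longrightarrow> Q n \<omega>)"
  shows "whp_even M Q"
proof -
  obtain E where E: "\<And>n. even n \<Longrightarrow> E n \<in> sets (M n) \<and> (\<forall>\<omega>\<in>E n. P n \<omega>)"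
    and lim: "((\<lambda>n. measure (M n) (E n)) \<longlongrightarrow> 1) (inf sequentially (principal {n. even n}))"
    using P unfolding whp_even_def by blast
  define E' where "E' n = (if \<forall>\<omega>. P n \<omega> \<longrightarrow> Q n \<omega> then E n else {})" for n
  have "\<forall>\<^sub>F n in inf sequentially (principal {n. even n}). measure (M n) (E n) = measure (M n) (E' n)"
    unfolding eventually_inf_principal using ev by eventually_elim (auto simp: E'_def)
  then have "((\<lambda>n. measure (M n) (E' n)) \<longlongrightarrow> 1) (inf sequentially (principal {n. even n}))"
    by (rule Lim_transform_eventually[OF lim])
  moreover have "even n \<longrightarrow> E' n \<in> sets (M n) \<and> (\<forall>\<omega>\<in>E' n. Q n \<omega>)" for n using E[of n] by (auto simp: E'_def)
  ultimately show ?thesis unfolding whp_even_def by blast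
qed

text \<open>The 200 brings the contraction down to \<open>n powr (- 10)\<close>, which beats the
  losses \<open>n^7\<close> and \<open>sqrt n\<close>. The maximum secures a QR step for small
  \<open>n\<close> as well.\<close>

definition iteration_count :: "nat \<Rightarrow> nat" where
  "iteration_count n = max 1 (nat \<lceil>200 * (ln (real n) / ln (ln (real n)))\<rceil>)"

lemma iteration_count_ge_1: "iteration_count n \<ge> 1"
  by (simp add: iteration_count_def)

text \<open>Rounding up adds at most 1, hence at most one more copy of the ratio.\<close>

lemma iteration_count_le:
  assumes "1 \<le> ln (real n) / ln (ln (real n))"
  shows "real (iteration_count n) \<le> 201 * (ln (real n) / ln (ln (real n)))"
  using assms by (simp add: iteration_count_def) linarith

lemma log_ratio_ge_1: "\<forall>\<^sub>F n in sequentially. 1 \<le> ln (real n) / ln (ln (real n))"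
  by real_asymp

lemma iteration_count_bigo: "(\<lambda>n. real (iteration_count n)) \<in> O(\<lambda>n. ln (real n) / ln (ln (real n)))"
proof (rule bigoI[of _ 201])
  show "\<forall>\<^sub>F n in sequentially. norm (real (iteration_count n)) \<le> 201 * norm (ln (real n) / ln (ln (real n)))"
    using log_ratio_ge_1 by eventually_elim (use iteration_count_le in \<open>simp only: real_norm_def abs_of_nonneg\<close>)
qed

lemma contraction_power_le:
  assumes "ln (real n) > 1"
  shows "(ln n powr (- 1/20)) ^ iteration_count n \<le> real n powr (- 10)"
proof -
  define L where "L = ln (real n)"
  define m where "m = iteration_count n"
  have L: "L > 1" "ln L > 0" using assms by (auto simp: L_def)
  have n: "real n > 0" using assms by (cases "n = 0") auto
  have "real m \<ge> 200 * (L / ln L)" unfolding m_def iteration_count_def L_def by linarith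
  then have "real m * ln L \<ge> 200 * L" using L by (simp add: field_simps)
  then have "exp (- (real m * ln L / 20)) \<le> exp (- (10 * L))" by simp
  also have "exp (- (10 * L)) = real n powr (- 10)" using n by (simp add: powr_def L_def)
  also have "exp (- (real m * ln L / 20)) = exp (ln L * (- 1/20)) ^ m" by (simp add: exp_of_nat_mult[symmetric] field_simps)
  also have "exp (ln L * (- 1/20)) = L powr (- 1/20)" using L by (simp add: powr_def mult.commute)
  finally show ?thesis unfolding L_def m_def .
qed

lemma whp_recovers:
  fixes \<alpha> \<beta> :: real
  assumes ab: "\<alpha> > \<beta>" "\<beta> > 0" and thr: "sqrt \<alpha> - sqrt \<beta> > sqrt 2"
  obtains C where "C > 0" "\<And>xs. (\<forall>n. even n \<longrightarrow> xs n \<in> feasible n) \<Longrightarrow>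
    whp_even (\<lambda>n. joint_law n (\<alpha> * ln (real n) / real n) (\<beta> * ln (real n) / real n) (xs n))
      (\<lambda>n (a, y). recovers n (iteration_count n) C (xs n) a y)"
proof -
  let ?p = "\<lambda>n. \<alpha> * ln (real n) / real n" and ?q = "\<lambda>n. \<beta> * ln (real n) / real n"
  obtain k C err where k: "k > 0" and C: "C > 0" and err: "err \<longlonglongrightarrow> 0"
    and rec: "\<forall>\<^sub>F n in sequentially. \<forall>x. sbm n x (?p n) (?q n) \<longrightarrow>
      measure_pmf.prob (sbm.mu n x (?p n) (?q n)) {a. \<not> recoverable n x (?p n) (?q n) k C a} \<le> err n"
    by (rule sbm_recoverable[OF ab thr]) blast
  show thesis
  proof (rule that[OF C])
    fix xs :: "nat \<Rightarrow> real vec" assume xs: "\<forall>n. even n \<longrightarrow> xs n \<in> feasible n"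
    have p1: "\<forall>\<^sub>F n in sequentially. ?p n \<le> 1" using ab by real_asymp
    have small1: "\<forall>\<^sub>F n in sequentially. 4 * real n ^ 7 * real n powr (- 10) \<le> 1" by real_asymp
    have small2: "\<forall>\<^sub>F n in sequentially. 4 * real n ^ 7 * real n powr (- 10) * C < k / sqrt (real n)" using k C by real_asymp
    have ln1: "\<forall>\<^sub>F n in sequentially. 1 < ln (real n)" by real_asymp
    have n2: "\<forall>\<^sub>F n in sequentially. 2 \<le> n" by (rule eventually_ge_at_top)
    have "\<forall>\<^sub>F n in sequentially. even n \<longrightarrow> (\<exists>E \<in> sets (joint_law n (?p n) (?q n) (xs n)).
      (\<forall>\<omega>\<in>E. (\<lambda>(a, y). recovers n (iteration_count n) C (xs n) a y) \<omega>) \<and>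
      1 - (err n + 6 / real n) \<le> measure (joint_law n (?p n) (?q n) (xs n)) E)"
      using rec p1 small1 small2 ln1 n2
    proof eventually_elim
      case (elim n)
      show ?case
      proof
        assume "even n"
        then have x: "xs n \<in> feasible n" using xs by blast
        have sbm: "sbm n (\<lambda>i. xs n $ i) (?p n) (?q n)"
        proof
          show "2 \<le> n" "?p n \<le> 1" by (fact elim)+
          show "0 < ?q n" using ab elim by simp
          show "?q n \<le> ?p n" using ab elim by (intro divide_right_mono mult_right_mono) auto
          show "xs n $ i = 1 \<or> xs n $ i = -1" if "i < n" for i using x that by (auto simp: feasible_def)
          show "(\<Sum>i<n. xs n $ i) = 0" using x by (auto simp: feasible_def scalar_prod_def lessThan_atLeast0)
        qed
        define R where "R = {a. recoverable n (\<lambda>i. xs n $ i) (?p n) (?q n) k C a}"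
        have R: "measure_pmf.prob (sbm_pmf n (?p n) (?q n) (xs n)) (- R) \<le> err n"
          using elim(1) sbm unfolding sbm_pmf_eq_mu[OF sbm] R_def Collect_neg_eq[symmetric] by blast
        have pow: "4 * real n ^ 7 * (ln n powr (- 1/20)) ^ iteration_count n \<le> 4 * real n ^ 7 * real n powr (- 10)"
          using contraction_power_le[OF elim(5)] by (intro mult_left_mono) auto
        then have s1: "4 * real n ^ 7 * (ln n powr (- 1/20)) ^ iteration_count n \<le> 1" using elim(3) by linarith
        have s2: "4 * real n ^ 7 * (ln n powr (- 1/20)) ^ iteration_count n * C < k / sqrt n"
          using mult_right_mono[OF pow, of C] C elim(4) by linarith
        have "\<exists>E \<in> sets (joint_law n (?p n) (?q n) (xs n)).
          (\<forall>\<omega>\<in>E. (\<lambda>(a, y). recovers n (iteration_count n) C (xs n) a y) \<omega>) \<and>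
          1 - err n - 6 / real n \<le> measure (joint_law n (?p n) (?q n) (xs n)) E"
        proof (rule joint_law_event[OF R])
          fix a assume "a \<in> R"
          then have "recoverable n (\<lambda>i. xs n $ i) (?p n) (?q n) k C a" by (simp add: R_def)
          from recoverable_recovers[OF sbm this iteration_count_ge_1 s1 s2 C]
          show "\<exists>H \<in> sets (gaussian_entries n). emeasure (gaussian_entries n) H \<ge> ennreal (1 - 6 / real n) \<and>
            (\<forall>y\<in>H. (\<lambda>(a, y). recovers n (iteration_count n) C (xs n) a y) (a, y))" by simp
        qed simp
        then show "\<exists>E \<in> sets (joint_law n (?p n) (?q n) (xs n)).
          (\<forall>\<omega>\<in>E. (\<lambda>(a, y). recovers n (iteration_count n) C (xs n) a y) \<omega>) \<and>
          1 - (err n + 6 / real n) \<le> measure (joint_law n (?p n) (?q n) (xs n)) E"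
          by (simp only: diff_diff_eq)
      qed
    qed
    moreover have "(\<lambda>n. err n + 6 / real n) \<longlonglongrightarrow> 0"
    proof -
      have "(\<lambda>n. 6 / real n) \<longlonglongrightarrow> 0" by real_asymp
      from tendsto_add[OF err this] show ?thesis by simp
    qed
    ultimately show "whp_even (\<lambda>n. joint_law n (?p n) (?q n) (xs n))
      (\<lambda>n (a, y). recovers n (iteration_count n) C (xs n) a y)"
      using prob_space_joint_law by (rule whp_evenI)
  qed
qed

lemma sign_vector_cases:
  assumes x: "x \<in> feasible n" and s: "s = 1 \<or> s = (-1 :: real)" "\<forall>i<n. s * x $ i * v $ i > 0"
  obtains u where "u \<in> feasible n" "u = x \<or> u = - x" "\<And>i. i < n \<Longrightarrow> u $ i * v $ i > 0"
  using s(1)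
proof
  assume "s = 1"
  then show thesis using that[of x] x s(2) by simp
next
  assume "s = -1"
  moreover have "dim_vec x = n" using x by (auto simp: feasible_def)
  ultimately show thesis using that[of "- x"] feasible_uminus[OF x] s(2) by simp
qed

lemma recovers_proj:
  assumes rec: "recovers n N C x a y" and x: "x \<in> feasible n" and N: "N \<ge> 1"
  shows "(\<exists>v. spectral_vector (adjacency n a) (gaussian_mat n y) N v) \<and>
    (\<forall>v. spectral_vector (adjacency n a) (gaussian_mat n y) N v \<longrightarrow> proj n v = {x} \<or> proj n v = {- x})"
proof -
  interpret orthogonal_setup n "adjacency n a" "gaussian_mat n y" using rec by (simp add: recovers_def)
  have "proj n v = {x} \<or> proj n v = {- x}" if v: "spectral_vector (adjacency n a) (gaussian_mat n y) N v" for v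
  proof -
    obtain s where s: "v \<in> carrier_vec n" "s = 1 \<or> s = -1" "\<forall>i<n. s * x $ i * v $ i > 0"
      using rec v unfolding recovers_def by blast
    obtain u where "u \<in> feasible n" "u = x \<or> u = - x" "\<And>i. i < n \<Longrightarrow> u $ i * v $ i > 0"
      by (rule sign_vector_cases[OF x s(2,3)]) blast
    then show ?thesis using sign_pattern_proj[of u n v] s(1) by blast
  qed
  then show ?thesis using spectral_vector_exists[OF N] by blast
qed

lemma recovers_spectral_impl:
  assumes rec: "recovers n N C x a y" and x: "x \<in> feasible n" and N: "N \<ge> 1" and n: "n > 0"
    and u: "(u, t) \<in> spectral_impl \<kappa> n (adjacency n a) (gaussian_mat n y) N"
  shows "u = x \<or> u = - x"
    "real t \<le> (real N + 1) * (2 * (real \<kappa> * (C * ln n * real n + real n)) + real \<kappa> * real n) + 31 * real n + 2 * real \<kappa> + 1"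
proof -
  interpret orthogonal_setup n "adjacency n a" "gaussian_mat n y" using rec by (simp add: recovers_def)
  obtain v where v: "spectral_vector (adjacency n a) (gaussian_mat n y) N v" "u = rounding n v"
    and t: "t \<le> (N + 1) * (2 * (\<kappa> * (nnz (adjacency n a) + n)) + \<kappa> * n) + 31 * n + 2 * \<kappa> + 1"
    using spectral_impl_sound[OF u] by blast
  obtain s where s: "v \<in> carrier_vec n" "s = 1 \<or> s = -1" "\<forall>i<n. s * x $ i * v $ i > 0"
    using rec v unfolding recovers_def by blast
  obtain z where z: "z \<in> feasible n" "z = x \<or> z = - x" "\<And>i. i < n \<Longrightarrow> z $ i * v $ i > 0"
    by (rule sign_vector_cases[OF x s(2,3)]) blast
  have "rounding n v = z" unfolding rounding_def by (rule threshold_rounding[OF z(1) s(1) z(3) n])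
  then show "u = x \<or> u = - x" using z(2) unfolding v(2) by simp
  have nnz: "real (nnz (adjacency n a)) \<le> C * ln n * n" using rec by (simp add: recovers_def)
  have "real t \<le> real ((N + 1) * (2 * (\<kappa> * (nnz (adjacency n a) + n)) + \<kappa> * n) + 31 * n + 2 * \<kappa> + 1)"
    using t by (simp only: of_nat_le_iff)
  also have "\<dots> = (real N + 1) * (2 * (real \<kappa> * (real (nnz (adjacency n a)) + real n)) + real \<kappa> * real n) + 31 * real n + 2 * real \<kappa> + 1"
    by (simp only: of_nat_add of_nat_mult of_nat_1 of_nat_numeral)
  also have "\<dots> \<le> (real N + 1) * (2 * (real \<kappa> * (C * ln n * real n + real n)) + real \<kappa> * real n) + 31 * real n + 2 * real \<kappa> + 1"
    using nnz by (intro add_right_mono mult_left_mono) auto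
  finally show "real t \<le> (real N + 1) * (2 * (real \<kappa> * (C * ln n * real n + real n)) + real \<kappa> * real n) + 31 * real n + 2 * real \<kappa> + 1" .
qed

text \<open>With \<open>r = ln n / ln (ln n)\<close>, every term is at most a multiple of
  \<open>n * L * r\<close>; 202 is 201 plus the extra round of
  \<open>spectral_impl_sound\<close>.\<close>

lemma running_time_le:
  fixes \<kappa> n :: nat and N C L r :: real
  assumes C: "C > 0" and L: "L \<ge> 1" and r: "r \<ge> 1" and N: "0 \<le> N" "N \<le> 201 * r" and n: "n > 0"
  shows "(N + 1) * (2 * (real \<kappa> * (C * L * real n + real n)) + real \<kappa> * real n) + 31 * real n + 2 * real \<kappa> + 1
    \<le> (202 * (2 * real \<kappa> * C + 3 * real \<kappa>) + 32 + 2 * real \<kappa>) * (real n * L * r)"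
proof -
  have n1: "real n \<ge> 1" using n by simp
  have Ln: "real n \<le> real n * L" using n1 L mult_left_mono[of 1 L "real n"] by simp
  have nLr: "real n * L \<le> real n * L * r" using r L mult_left_mono[of 1 r "real n * L"] by simp
  have "\<kappa> * real n \<le> \<kappa> * (n * L)" using Ln by (intro mult_left_mono) auto
  then have "2 * (\<kappa> * (C * L * n + n)) + \<kappa> * n \<le> (2 * \<kappa> * C + 3 * \<kappa>) * (n * L)"
    by (simp add: algebra_simps)
  then have "(N + 1) * (2 * (\<kappa> * (C * L * n + n)) + \<kappa> * n) \<le> (202 * r) * ((2 * \<kappa> * C + 3 * \<kappa>) * (n * L))"
    using N r C L by (intro mult_mono) auto
  moreover have "31 * real n + 1 \<le> 32 * (n * L * r)" using n1 Ln nLr by linarith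
  moreover have "2 * real \<kappa> * 1 \<le> 2 * real \<kappa> * (n * L * r)" using n1 Ln nLr by (intro mult_left_mono) linarith+
  ultimately show ?thesis by (simp add: algebra_simps)
qed

theorem mainTheorem4:
  fixes \<alpha> \<beta> :: real and p q :: "nat \<Rightarrow> real"
  assumes "\<alpha> > \<beta>" and "\<beta> > 0" and "sqrt \<alpha> - sqrt \<beta> > sqrt 2"
    and "p = (\<lambda>n. \<alpha> * ln (real n) / real n)" and "q = (\<lambda>n. \<beta> * ln (real n) / real n)"
  shows "\<exists>N :: nat \<Rightarrow> nat.
    (\<forall>n. N n \<ge> 1) \<and>
    (\<lambda>n. real (N n)) \<in> O(\<lambda>n. ln (real n) / ln (ln (real n))) \<and>
    (\<forall>xs. (\<forall>n. even n \<longrightarrow> xs n \<in> feasible n) \<longrightarrow>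
      whp_even (\<lambda>n. joint_law n (p n) (q n) (xs n)) (\<lambda>n (a, y).
        (\<exists>v. spectral_vector (adjacency n a) (gaussian_mat n y) (N n) v) \<and>
        (\<forall>v. spectral_vector (adjacency n a) (gaussian_mat n y) (N n) v \<longrightarrow>
          proj n v = {xs n} \<or> proj n v = {- xs n}))) \<and>
    (\<forall>\<kappa>. \<exists>C :: real. \<forall>xs. (\<forall>n. even n \<longrightarrow> xs n \<in> feasible n) \<longrightarrow>
      whp_even (\<lambda>n. joint_law n (p n) (q n) (xs n)) (\<lambda>n (a, y).
        spectral_impl \<kappa> n (adjacency n a) (gaussian_mat n y) (N n) \<noteq> {} \<and>
        (\<forall>(x, t) \<in> spectral_impl \<kappa> n (adjacency n a) (gaussian_mat n y) (N n).
          (x = xs n \<or> x = - xs n) \<and>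
          real t \<le> C * (real n * (ln (real n))\<^sup>2 / ln (ln (real n))))))"
proof -
  \<comment> \<open>Both claims follow from this one event, with a constant independent of the
    labels; \<open>\<kappa>\<close> only enters the final time bound.\<close>
  obtain C where C: "C > 0" and whp: "\<And>xs. (\<forall>n. even n \<longrightarrow> xs n \<in> feasible n) \<Longrightarrow>
    whp_even (\<lambda>n. joint_law n (p n) (q n) (xs n)) (\<lambda>n (a, y). recovers n (iteration_count n) C (xs n) a y)"
    unfolding assms(4,5) by (rule whp_recovers[OF assms(1-3)]) blast
  show ?thesis
  proof (intro exI[of _ iteration_count] conjI)
    show "\<forall>n. 1 \<le> iteration_count n" using iteration_count_ge_1 by blast
    show "(\<lambda>n. real (iteration_count n)) \<in> O(\<lambda>n. ln (real n) / ln (ln (real n)))" by (rule iteration_count_bigo)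
    show "\<forall>xs. (\<forall>n. even n \<longrightarrow> xs n \<in> feasible n) \<longrightarrow>
      whp_even (\<lambda>n. joint_law n (p n) (q n) (xs n)) (\<lambda>n (a, y).
        (\<exists>v. spectral_vector (adjacency n a) (gaussian_mat n y) (iteration_count n) v) \<and>
        (\<forall>v. spectral_vector (adjacency n a) (gaussian_mat n y) (iteration_count n) v \<longrightarrow>
          proj n v = {xs n} \<or> proj n v = {- xs n}))"
    proof (intro allI impI)
      fix xs :: "nat \<Rightarrow> real vec" assume xs: "\<forall>n. even n \<longrightarrow> xs n \<in> feasible n"
      show "whp_even (\<lambda>n. joint_law n (p n) (q n) (xs n)) (\<lambda>n (a, y).
        (\<exists>v. spectral_vector (adjacency n a) (gaussian_mat n y) (iteration_count n) v) \<and>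
        (\<forall>v. spectral_vector (adjacency n a) (gaussian_mat n y) (iteration_count n) v \<longrightarrow>
          proj n v = {xs n} \<or> proj n v = {- xs n}))"
      proof (rule whp_even_mono[OF whp[OF xs] always_eventually], intro allI impI)
        fix n \<omega> assume "even n"
          and \<omega>: "(\<lambda>(a, y). recovers n (iteration_count n) C (xs n) a y) \<omega>"
        then have x: "xs n \<in> feasible n" using xs by blast
        obtain a y where ay: "\<omega> = (a, y)" by (cases \<omega>)
        show "(\<lambda>(a, y). (\<exists>v. spectral_vector (adjacency n a) (gaussian_mat n y) (iteration_count n) v) \<and>
          (\<forall>v. spectral_vector (adjacency n a) (gaussian_mat n y) (iteration_count n) v \<longrightarrow>
            proj n v = {xs n} \<or> proj n v = {- xs n})) \<omega>"
          using \<omega> recovers_proj[OF _ x iteration_count_ge_1] unfolding ay prod.case by blast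
      qed
    qed
    show "\<forall>\<kappa>. \<exists>C :: real. \<forall>xs. (\<forall>n. even n \<longrightarrow> xs n \<in> feasible n) \<longrightarrow>
      whp_even (\<lambda>n. joint_law n (p n) (q n) (xs n)) (\<lambda>n (a, y).
        spectral_impl \<kappa> n (adjacency n a) (gaussian_mat n y) (iteration_count n) \<noteq> {} \<and>
        (\<forall>(x, t) \<in> spectral_impl \<kappa> n (adjacency n a) (gaussian_mat n y) (iteration_count n).
          (x = xs n \<or> x = - xs n) \<and>
          real t \<le> C * (real n * (ln (real n))\<^sup>2 / ln (ln (real n)))))"
    proof
      fix \<kappa> :: nat
      define K where "K = 202 * (2 * real \<kappa> * C + 3 * real \<kappa>) + 32 + 2 * real \<kappa>"
      show "\<exists>C :: real. \<forall>xs. (\<forall>n. even n \<longrightarrow> xs n \<in> feasible n) \<longrightarrow>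
        whp_even (\<lambda>n. joint_law n (p n) (q n) (xs n)) (\<lambda>n (a, y).
          spectral_impl \<kappa> n (adjacency n a) (gaussian_mat n y) (iteration_count n) \<noteq> {} \<and>
          (\<forall>(x, t) \<in> spectral_impl \<kappa> n (adjacency n a) (gaussian_mat n y) (iteration_count n).
            (x = xs n \<or> x = - xs n) \<and>
            real t \<le> C * (real n * (ln (real n))\<^sup>2 / ln (ln (real n)))))"
      proof (rule exI[of _ K], intro allI impI)
        fix xs :: "nat \<Rightarrow> real vec" assume xs: "\<forall>n. even n \<longrightarrow> xs n \<in> feasible n"
        have "\<forall>\<^sub>F n in sequentially. 1 \<le> ln (real n)" by real_asymp
        then have ev: "\<forall>\<^sub>F n in sequentially. even n \<longrightarrow> (\<forall>\<omega>. (\<lambda>(a, y). recovers n (iteration_count n) C (xs n) a y) \<omega> \<longrightarrow>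
          (\<lambda>(a, y). spectral_impl \<kappa> n (adjacency n a) (gaussian_mat n y) (iteration_count n) \<noteq> {} \<and>
          (\<forall>(x, t) \<in> spectral_impl \<kappa> n (adjacency n a) (gaussian_mat n y) (iteration_count n).
            (x = xs n \<or> x = - xs n) \<and>
            real t \<le> K * (real n * (ln (real n))\<^sup>2 / ln (ln (real n))))) \<omega>)"
          using log_ratio_ge_1 eventually_gt_at_top[of 0]
        proof (eventually_elim, intro allI impI)
          fix n :: nat and \<omega>
          assume L: "1 \<le> ln (real n)" and r: "1 \<le> ln (real n) / ln (ln (real n))" and n: "n > 0" and "even n"
            and \<omega>: "(\<lambda>(a, y). recovers n (iteration_count n) C (xs n) a y) \<omega>"
          then have x: "xs n \<in> feasible n" using xs by blast
          obtain a y where ay: "\<omega> = (a, y)" by (cases \<omega>)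
          have rec: "recovers n (iteration_count n) C (xs n) a y" using \<omega> unfolding ay prod.case .
          interpret orthogonal_setup n "adjacency n a" "gaussian_mat n y" using rec by (simp add: recovers_def)
          have time: "(real (iteration_count n) + 1) * (2 * (real \<kappa> * (C * ln n * real n + real n)) + real \<kappa> * real n) + 31 * real n + 2 * real \<kappa> + 1
            \<le> K * (real n * ln n * (ln n / ln (ln n)))"
            unfolding K_def by (rule running_time_le[OF C L r _ iteration_count_le[OF r] n]) simp
          have "(u = xs n \<or> u = - xs n) \<and> real t \<le> K * (real n * (ln (real n))\<^sup>2 / ln (ln (real n)))"
            if u: "(u, t) \<in> spectral_impl \<kappa> n (adjacency n a) (gaussian_mat n y) (iteration_count n)" for u t
            using recovers_spectral_impl[OF rec x iteration_count_ge_1 n u] time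
            by (auto simp: power2_eq_square mult.assoc)
          then show "(\<lambda>(a, y). spectral_impl \<kappa> n (adjacency n a) (gaussian_mat n y) (iteration_count n) \<noteq> {} \<and>
            (\<forall>(x, t) \<in> spectral_impl \<kappa> n (adjacency n a) (gaussian_mat n y) (iteration_count n).
              (x = xs n \<or> x = - xs n) \<and>
              real t \<le> K * (real n * (ln (real n))\<^sup>2 / ln (ln (real n))))) \<omega>"
            using spectral_impl_nonempty[OF iteration_count_ge_1] unfolding ay prod.case by blast
        qed
        show "whp_even (\<lambda>n. joint_law n (p n) (q n) (xs n)) (\<lambda>n (a, y).
          spectral_impl \<kappa> n (adjacency n a) (gaussian_mat n y) (iteration_count n) \<noteq> {} \<and>
          (\<forall>(x, t) \<in> spectral_impl \<kappa> n (adjacency n a) (gaussian_mat n y) (iteration_count n).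
            (x = xs n \<or> x = - xs n) \<and>
            real t \<le> K * (real n * (ln (real n))\<^sup>2 / ln (ln (real n)))))"
          by (rule whp_even_mono[OF whp[OF xs] ev])
      qed
    qed
  qed
qed

end
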